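(* Let $\Lambda=\mathbb{Z}+\mathbb{Z}\tau$ with $\mathrm{Im}(\tau)>0$ and $T=\mathbb{C}/\Lambda$. Let $S=\{0,-z_0,z_0\}\subset T$, where $\pm z_0$ are zeros of $z\mapsto\wp_\Lambda(2z)$ (the zero set of $\wp_\Lambda(2z)$ in $T$ being $D_2\cdot\{z_0,-z_0\}$). Then Holod's algebra $\mathcal{H}_\tau$ is the automorphic Lie algebra based on $\mathfrak{sl}(2,\mathbb{C})$, with respect to the actions $\rho$ and $\sigma$, on $T$ punctured at $D_2\cdot S$: $$\mathcal{H}_\tau=\mathfrak{A}(\tau,\{0,\pm z_0\}).$$ A normal form of $\mathcal{H}_\tau$ is given by $$\mathcal{H}_\tau=\mathbb{C}[\wp_{\frac12\Lambda},(\wp_{\frac12\Lambda})^{-1},\wp_{\frac12\Lambda}']\langle H,E,F\rangle,$$ where $H=\mathrm{Ad}(\Omega)h$, $E=\mathrm{Ad}(\Omega)e$ and $F=\mathrm{Ad}(\Omega)f$. For $\tau=\mathrm{i}$, we have $\mathcal{H}_{\mathrm i}\cong\mathcal{E}_{k,\nu^\pm}$ as Lie algebras, where $\mathcal{E}_{k,\nu^\pm}$ is Uglov's algebra with $k=\tfrac1{\sqrt2}$, $\nu^+=0$, $\nu^-=\tfrac{1+\mathrm i}{4}$.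
   Context: Theta functions: for $a,b\in\mathbb R$, $\theta_{a,b}(z|\tau)=\sum_{m\in\mathbb Z}\exp\{\pi \mathrm i\tau(m+a)^2+2\pi \mathrm i(m+a)(z+b)\}$; $\theta_1=-\theta_{\frac12,\frac12}$, $\theta_2=\theta_{\frac12,0}$, $\theta_3=\theta_{0,0}$, $\theta_4=\theta_{0,\frac12}$. $\wp_L$ is the Weierstrass function of a lattice $L$. For $i=1,2,3$, $\mu_i(z)=\frac{\theta_1'(0|\tau)}{\theta_{i+1}(0|\tau)}\frac{\theta_{i+1}(2z|\tau)}{\theta_1(2z|\tau)}$. $D_2=\langle t_1,t_2\rangle\cong C_2\times C_2$ acts on $T$ via $\sigma(t_1)z=z+\frac12$, $\sigma(t_2)z=z+\frac\tau2$ and on $\mathfrak{sl}(2,\mathbb C)$ via $\rho(t_1)=\mathrm{Ad}\begin{pmatrix}1&0\\0&-1\end{pmatrix}$, $\rho(t_2)=\mathrm{Ad}\begin{pmatrix}0&1\\1&0\end{pmatrix}$, $\mathrm{Ad}(g)X=gXg^{-1}$. For finite nonempty $S\subset T$, $\mathcal{O}_{T\setminus D_2\cdot S}$ is the ring of meromorphic functions on $T$ holomorphic outside $D_2\cdot S$, with $\tilde\sigma(\gamma)f=f\circ\sigma(\gamma^{-1})$, and $\mathfrak{A}(\tau,S)=(\mathfrak{sl}(2,\mathbb{C})\otimes_{\mathbb C}\mathcal{O}_{T\setminus D_2\cdot S})^{\rho\otimes\tilde\sigma(D_2)}$ is the fixed-point Lie subalgebra for the diagonal action, with bracket $[A\otimes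 f,B\otimes g]=[A,B]\otimes fg$. $h=\begin{pmatrix}1&0\\0&-1\end{pmatrix}$, $e=\begin{pmatrix}0&1\\0&0\end{pmatrix}$, $f=\begin{pmatrix}0&0\\1&0\end{pmatrix}$. "Normal form" $R\langle H,E,F\rangle$, where $R=\mathcal{O}_{T\setminus D_2\cdot S}^{\tilde\sigma(D_2)}$, means that the algebra is the free $R$-module with basis $H,E,F$ and $[H,E]=2E$, $[H,F]=-2F$, $[E,F]=H$ ($R$-bilinear bracket). The matrix $\Omega$ is $$\Omega(z)=\begin{pmatrix}\psi_-(z)\theta_2(2z|2\tau)&\theta_3(2z|2\tau)\\ \psi_+(z)\theta_3(2z|2\tau)&\theta_2(2z|2\tau)\end{pmatrix},\qquad \psi_\pm(z)=\pm\frac{\theta_4^2(0|\tau)}{\theta_3(0|\tau)}\frac{\theta_3(2z|\tau)}{\theta_1(2z|\tau)}-\frac{\theta_3^2(0|\tau)}{\theta_4(0|\tau)}\frac{\theta_4(2z|\tau)}{\theta_1(2z|\tau)}.$$ Holod's algebra: let $v_1=\frac12\begin{pmatrix}\mathrm i&0\\0&-\mathrm i\end{pmatrix}$, $v_2=\frac12\begin{pmatrix}0&1\\-1&0\end{pmatrix}$, $v_3=\frac12\begin{pmatrix}0&\mathrm i\\\mathrm i&0\end{pmatrix}$. $\mathcal{H}_\tau$ is the complex Lie algebra of $\mathfrak{sl}(2,\mathbb C)$-valued meromorphic functions on $T$ (pointwise bracket) with $\mathbb{C}$-basis $$X_i^{2n+2}(z)=\wp_\Lambda(2z)^n\mu_j(z)\mu_k(z)v_i,\qquad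 X_i^{2m+1}(z)=\wp_\Lambda(2z)^m\mu_i(z)v_i,\qquad m,n\in\mathbb{Z},$$ with $(i,j,k)$ running over the cyclic permutations of $(1,2,3)$. Note $\wp_\Lambda(2z)=\frac14\wp_{\frac12\Lambda}(z)$. (Equivalently, it is Holod's algebra $\mathcal{H}_{r_1,r_2,r_3}$ on the curve $\lambda_i^2-\lambda_j^2=r_j-r_i$, with $\lambda_i=\mu_i$.) Uglov's algebra $\mathcal{E}_{k,\nu^\pm}$, for $k=\theta_2^2(0|\tau)/\theta_3^2(0|\tau)$ and $\nu^\pm\in T$ with $\nu^+-\nu^-\notin D_2\cdot\{0\}$, is the complex Lie algebra generated by $x_i^\pm$ ($i=1,2,3$) subject to $$[x_i^\pm,[x_j^\pm,x_k^\pm]]=0,\quad [x_i^\pm,[x_i^\pm,x_k^\pm]]-[x_j^\pm,[x_j^\pm,x_k^\pm]]=J_{ij}x_k^\pm,\quad [x_i^+,x_i^-]=0,$$ $$[x_i^\pm,x_j^\mp]=\sqrt{-1}\,\big(w_i(\nu^\mp-\nu^\pm)x_k^\mp-w_j(\nu^\mp-\nu^\pm)x_k^\pm\big),$$ for every cyclic permutation $(i,j,k)$ of $(1,2,3)$, where $J_{12}=k^2$, $J_{23}=1-k^2$, $J_{31}=-1$, and $w_1=\frac1{\mathrm{sn}}$, $w_2=\frac{\mathrm{dn}}{\mathrm{sn}}$, $w_3=\frac{\mathrm{cn}}{\mathrm{sn}}$ are formed from the Jacobi elliptic functions of modulus $k$, with $z\in\mathbb{C}/(\mathbb{Z}+\mathbb{Z}\tau)$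 corresponding to the Jacobi argument $u=2\pi\theta_3^2(0|\tau)z$. For $\tau=\mathrm i$ one has $k=1/\sqrt2$. *)

theory Defs
  imports
    "HOL-Complex_Analysis.Complex_Analysis"
    "HOL-Library.Function_Algebras"
    "HOL-Library.Product_Plus"
    "HOL-Library.Z2"
begin

section \<open>Theta, Weierstrass and Jacobi functions\<close>

definition period_lattice :: "complex \<Rightarrow> complex set" where
  "period_lattice \<tau> = {of_int m + of_int n * \<tau> | m n :: int. True}"

definition half_lattice :: "complex \<Rightarrow> complex set" where
  "half_lattice \<tau> = (\<lambda>\<omega>. \<omega> / 2) ` period_lattice \<tau>"

text \<open>The value at a point of \<open>L\<close> is meaningless; whenever a function built from \<open>weierstrass_p\<close>
  is regarded as a meromorphic function, its value there is corrected by \<open>remove_sings\<close>.\<close>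

definition weierstrass_p :: "complex set \<Rightarrow> complex \<Rightarrow> complex" where
  "weierstrass_p L z = 1 / z^2 + (\<Sum>\<^sub>\<infinity>\<omega>\<in>L - {0}. 1 / (z - \<omega>)^2 - 1 / \<omega>^2)"

definition theta :: "real \<Rightarrow> real \<Rightarrow> complex \<Rightarrow> complex \<Rightarrow> complex" where
  "theta a b z \<tau> = (\<Sum>\<^sub>\<infinity>m::int.
     exp (of_real pi * \<i> * \<tau> * (of_int m + of_real a)^2
          + 2 * of_real pi * \<i> * (of_int m + of_real a) * (z + of_real b)))"

definition theta1 :: "complex \<Rightarrow> complex \<Rightarrow> complex" where "theta1 z \<tau> = - theta (1/2) (1/2) z \<tau>"
definition theta2 :: "complex \<Rightarrow> complex \<Rightarrow> complex" where "theta2 z \<tau> = theta (1/2) 0 z \<tau>"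
definition theta3 :: "complex \<Rightarrow> complex \<Rightarrow> complex" where "theta3 z \<tau> = theta 0 0 z \<tau>"
definition theta4 :: "complex \<Rightarrow> complex \<Rightarrow> complex" where "theta4 z \<tau> = theta 0 (1/2) z \<tau>"

datatype idx = I1 | I2 | I3

definition cyclic_triples :: "(idx \<times> idx \<times> idx) set" where
  "cyclic_triples = {(I1, I2, I3), (I2, I3, I1), (I3, I1, I2)}"

fun theta_succ :: "idx \<Rightarrow> complex \<Rightarrow> complex \<Rightarrow> complex" where
  "theta_succ I1 = theta2"
| "theta_succ I2 = theta3"
| "theta_succ I3 = theta4"

definition mu :: "complex \<Rightarrow> idx \<Rightarrow> complex \<Rightarrow> complex" where
  "mu \<tau> i z = deriv (\<lambda>w. theta1 w \<tau>) 0 / theta_succ i 0 \<tau>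
               * (theta_succ i (2 * z) \<tau> / theta1 (2 * z) \<tau>)"

text \<open>The Jacobi functions of modulus \<open>jacobi_modulus \<tau>\<close>, as the usual theta quotients in the
  Jacobi argument \<open>u\<close>. The classical theta argument is \<open>u / theta3 0 \<tau> ^ 2\<close>; it is divided by \<open>pi\<close>
  since the theta functions above are normalised to have period 1 up to sign.\<close>

definition jacobi_modulus :: "complex \<Rightarrow> complex" where
  "jacobi_modulus \<tau> = theta2 0 \<tau> ^ 2 / theta3 0 \<tau> ^ 2"

definition theta_arg :: "complex \<Rightarrow> complex \<Rightarrow> complex" where
  "theta_arg \<tau> u = u / (of_real pi * theta3 0 \<tau> ^ 2)"

definition jacobi_sn :: "complex \<Rightarrow> complex \<Rightarrow> complex" where
  "jacobi_sn \<tau> u = theta3 0 \<tau> / theta2 0 \<tau> * (theta1 (theta_arg \<tau> u) \<tau> / theta4 (theta_arg \<tau> u) \<tau>)"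

definition jacobi_cn :: "complex \<Rightarrow> complex \<Rightarrow> complex" where
  "jacobi_cn \<tau> u = theta4 0 \<tau> / theta2 0 \<tau> * (theta2 (theta_arg \<tau> u) \<tau> / theta4 (theta_arg \<tau> u) \<tau>)"

definition jacobi_dn :: "complex \<Rightarrow> complex \<Rightarrow> complex" where
  "jacobi_dn \<tau> u = theta4 0 \<tau> / theta3 0 \<tau> * (theta3 (theta_arg \<tau> u) \<tau> / theta4 (theta_arg \<tau> u) \<tau>)"


section \<open>Complex Lie algebras\<close>

record 'a lie_alg =
  lie_carrier :: "'a set"
  lie_zero :: 'a
  lie_add :: "'a \<Rightarrow> 'a \<Rightarrow> 'a"
  lie_smul :: "complex \<Rightarrow> 'a \<Rightarrow> 'a"
  lie_br :: "'a \<Rightarrow> 'a \<Rightarrow> 'a"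

definition complex_lie_algebra :: "('a, 'b) lie_alg_scheme \<Rightarrow> bool" where
  "complex_lie_algebra L \<longleftrightarrow>
     lie_zero L \<in> lie_carrier L \<and>
     (\<forall>x\<in>lie_carrier L. \<forall>y\<in>lie_carrier L. \<forall>z\<in>lie_carrier L. \<forall>a b.
        lie_add L x y \<in> lie_carrier L \<and>
        lie_smul L a x \<in> lie_carrier L \<and>
        lie_br L x y \<in> lie_carrier L \<and>
        lie_add L (lie_add L x y) z = lie_add L x (lie_add L y z) \<and>
        lie_add L x y = lie_add L y x \<and>
        lie_add L (lie_zero L) x = x \<and>
        lie_add L x (lie_smul L (-1) x) = lie_zero L \<and>
        lie_smul L a (lie_add L x y) = lie_add L (lie_smul L a x) (lie_smul L a y) \<and>
        lie_smul L (a + b) x = lie_add L (lie_smul L a x) (lie_smul L b x) \<and>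
        lie_smul L (a * b) x = lie_smul L a (lie_smul L b x) \<and>
        lie_smul L 1 x = x \<and>
        lie_br L (lie_add L x y) z = lie_add L (lie_br L x z) (lie_br L y z) \<and>
        lie_br L x (lie_add L y z) = lie_add L (lie_br L x y) (lie_br L x z) \<and>
        lie_br L (lie_smul L a x) y = lie_smul L a (lie_br L x y) \<and>
        lie_br L x (lie_smul L a y) = lie_smul L a (lie_br L x y) \<and>
        lie_br L x x = lie_zero L \<and>
        lie_add L (lie_add L (lie_br L x (lie_br L y z)) (lie_br L y (lie_br L z x)))
                  (lie_br L z (lie_br L x y)) = lie_zero L)"

definition lie_isomorphic :: "('a, 'c) lie_alg_scheme \<Rightarrow> ('b, 'd) lie_alg_scheme \<Rightarrow> bool" where
  "lie_isomorphic L M \<longleftrightarrow>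
     complex_lie_algebra L \<and> complex_lie_algebra M \<and>
     (\<exists>\<phi>. bij_betw \<phi> (lie_carrier L) (lie_carrier M) \<and>
        (\<forall>x\<in>lie_carrier L. \<forall>y\<in>lie_carrier L. \<phi> (lie_add L x y) = lie_add M (\<phi> x) (\<phi> y)) \<and>
        (\<forall>a. \<forall>x\<in>lie_carrier L. \<phi> (lie_smul L a x) = lie_smul M a (\<phi> x)) \<and>
        (\<forall>x\<in>lie_carrier L. \<forall>y\<in>lie_carrier L. \<phi> (lie_br L x y) = lie_br M (\<phi> x) (\<phi> y)))"


subsection \<open>Presentations by generators and relations\<close>

datatype 'g lie_term =
    Gen 'g
  | TZero
  | TAdd "'g lie_term" "'g lie_term"
  | TSmul complex "'g lie_term"
  | TBr "'g lie_term" "'g lie_term"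

text \<open>The least congruence that contains the relations and makes the quotient a complex Lie
  algebra.\<close>

inductive lie_cong :: "('g lie_term \<times> 'g lie_term) set \<Rightarrow> 'g lie_term \<Rightarrow> 'g lie_term \<Rightarrow> bool"
  for rels where
  rel: "(s, t) \<in> rels \<Longrightarrow> lie_cong rels s t"
| refl: "lie_cong rels s s"
| sym: "lie_cong rels s t \<Longrightarrow> lie_cong rels t s"
| trans: "lie_cong rels s t \<Longrightarrow> lie_cong rels t u \<Longrightarrow> lie_cong rels s u"
| cong_add: "lie_cong rels s s' \<Longrightarrow> lie_cong rels t t' \<Longrightarrow> lie_cong rels (TAdd s t) (TAdd s' t')"
| cong_smul: "lie_cong rels s s' \<Longrightarrow> lie_cong rels (TSmul a s) (TSmul a s')"
| cong_br: "lie_cong rels s s' \<Longrightarrow> lie_cong rels t t' \<Longrightarrow> lie_cong rels (TBr s t) (TBr s' t')"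
| add_assoc: "lie_cong rels (TAdd (TAdd s t) u) (TAdd s (TAdd t u))"
| add_commute: "lie_cong rels (TAdd s t) (TAdd t s)"
| add_zero: "lie_cong rels (TAdd TZero s) s"
| add_inverse: "lie_cong rels (TAdd s (TSmul (-1) s)) TZero"
| smul_add: "lie_cong rels (TSmul a (TAdd s t)) (TAdd (TSmul a s) (TSmul a t))"
| add_smul: "lie_cong rels (TSmul (a + b) s) (TAdd (TSmul a s) (TSmul b s))"
| smul_smul: "lie_cong rels (TSmul (a * b) s) (TSmul a (TSmul b s))"
| one_smul: "lie_cong rels (TSmul 1 s) s"
| br_add_left: "lie_cong rels (TBr (TAdd s t) u) (TAdd (TBr s u) (TBr t u))"
| br_add_right: "lie_cong rels (TBr s (TAdd t u)) (TAdd (TBr s t) (TBr s u))"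
| br_smul_left: "lie_cong rels (TBr (TSmul a s) t) (TSmul a (TBr s t))"
| br_smul_right: "lie_cong rels (TBr s (TSmul a t)) (TSmul a (TBr s t))"
| br_self: "lie_cong rels (TBr s s) TZero"
| jacobi: "lie_cong rels
    (TAdd (TAdd (TBr s (TBr t u)) (TBr t (TBr u s))) (TBr u (TBr s t))) TZero"

definition lie_class :: "('g lie_term \<times> 'g lie_term) set \<Rightarrow> 'g lie_term \<Rightarrow> 'g lie_term set" where
  "lie_class rels s = {t. lie_cong rels s t}"

definition presented_lie :: "('g lie_term \<times> 'g lie_term) set \<Rightarrow> 'g lie_term set lie_alg" where
  "presented_lie rels = \<lparr>
     lie_carrier = range (lie_class rels),
     lie_zero = lie_class rels TZero,
     lie_add = (\<lambda>A B. \<Union>s\<in>A. \<Union>t\<in>B. lie_class rels (TAdd s t)),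
     lie_smul = (\<lambda>a A. \<Union>s\<in>A. lie_class rels (TSmul a s)),
     lie_br = (\<lambda>A B. \<Union>s\<in>A. \<Union>t\<in>B. lie_class rels (TBr s t)) \<rparr>"


section \<open>Meromorphic functions on the torus\<close>

text \<open>A function on the torus is a function on \<open>\<complex>\<close> invariant under translation by \<open>period_lattice \<tau>\<close>,
  and points of the torus are given by representatives in \<open>\<complex>\<close>. A meromorphic function is represented
  by its normal form (\<open>nicely_meromorphic_on\<close>: removable singularities are removed and
  the value at a pole is 0), so that equality of meromorphic functions is equality. The operations
  on meromorphic functions are therefore the pointwise ones followed by \<open>remove_sings\<close>.\<close>

type_synonym cmat = "complex^2^2"

definition mat2 :: "complex \<Rightarrow> complex \<Rightarrow> complex \<Rightarrow> complex \<Rightarrow> cmat" where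
  "mat2 a b c d = vector [vector [a, b], vector [c, d]]"

definition smult_mat :: "complex \<Rightarrow> cmat \<Rightarrow> cmat" where
  "smult_mat c A = (\<chi> i j. c * A $ i $ j)"

definition Ad :: "cmat \<Rightarrow> cmat \<Rightarrow> cmat" where
  "Ad g X = g ** X ** matrix_inv g"

definition remove_sings_mat :: "(complex \<Rightarrow> cmat) \<Rightarrow> complex \<Rightarrow> cmat" where
  "remove_sings_mat X = (\<lambda>z. \<chi> i j. remove_sings (\<lambda>w. X w $ i $ j) z)"

text \<open>The Lie algebra of matrix-valued meromorphic functions with underlying set \<open>V\<close>.\<close>

definition mero_lie :: "(complex \<Rightarrow> cmat) set \<Rightarrow> (complex \<Rightarrow> cmat) lie_alg" where
  "mero_lie V = \<lparr>
     lie_carrier = V,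
     lie_zero = (\<lambda>z. 0),
     lie_add = (\<lambda>X Y. remove_sings_mat (\<lambda>z. X z + Y z)),
     lie_smul = (\<lambda>c X. remove_sings_mat (\<lambda>z. smult_mat c (X z))),
     lie_br = (\<lambda>X Y. remove_sings_mat (\<lambda>z. X z ** Y z - Y z ** X z)) \<rparr>"

definition torus_meromorphic :: "complex \<Rightarrow> (complex \<Rightarrow> complex) set" where
  "torus_meromorphic \<tau> =
     {f. f nicely_meromorphic_on UNIV \<and> (\<forall>\<omega>\<in>period_lattice \<tau>. \<forall>z. f (z + \<omega>) = f z)}"

text \<open>The group \<open>D\<^sub>2 = C\<^sub>2 \<times> C\<^sub>2\<close> is written additively, with \<open>t\<^sub>1 = (1, 0)\<close> and \<open>t\<^sub>2 = (0, 1)\<close>. The map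
  \<open>sigma \<tau> \<gamma>\<close> is a lift to \<open>\<complex>\<close> of the action on the torus.\<close>

type_synonym D2 = "bit \<times> bit"

fun sigma :: "complex \<Rightarrow> D2 \<Rightarrow> complex \<Rightarrow> complex" where
  "sigma \<tau> (a, b) z = z + (if a = 1 then 1/2 else 0) + (if b = 1 then \<tau>/2 else 0)"

fun rho :: "D2 \<Rightarrow> cmat \<Rightarrow> cmat" where
  "rho (a, b) X =
     (if a = 1 then Ad (mat2 1 0 0 (-1)) else id) ((if b = 1 then Ad (mat2 0 1 1 0) else id) X)"

text \<open>The preimage in \<open>\<complex>\<close> of the union of the orbits of the points in \<open>S\<close>.\<close>

definition D2_orbit :: "complex \<Rightarrow> complex set \<Rightarrow> complex set" where
  "D2_orbit \<tau> S = {sigma \<tau> \<gamma> s + \<omega> | \<gamma> s \<omega>. s \<in> S \<and> \<omega> \<in> period_lattice \<tau>}"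

definition punctured_ring :: "complex \<Rightarrow> complex set \<Rightarrow> (complex \<Rightarrow> complex) set" where
  "punctured_ring \<tau> S = {f \<in> torus_meromorphic \<tau>. f holomorphic_on - D2_orbit \<tau> S}"

definition invariant_ring :: "complex \<Rightarrow> complex set \<Rightarrow> (complex \<Rightarrow> complex) set" where
  "invariant_ring \<tau> S = {f \<in> punctured_ring \<tau> S. \<forall>\<gamma>. f \<circ> sigma \<tau> (- \<gamma>) = f}"


section \<open>The automorphic Lie algebra\<close>

text \<open>The tensor product of \<open>\<ss>\<ll>(2,\<complex>)\<close> with the ring of functions is identified with the traceless matrices
  having entries in that ring.\<close>

definition automorphic_lie :: "complex \<Rightarrow> complex set \<Rightarrow> (complex \<Rightarrow> cmat) lie_alg" where
  "automorphic_lie \<tau> S = mero_lie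
     {X. (\<forall>z. trace (X z) = 0) \<and>
         (\<forall>i j. (\<lambda>z. X z $ i $ j) \<in> punctured_ring \<tau> S) \<and>
         (\<forall>\<gamma>. (\<lambda>z. rho \<gamma> (X (sigma \<tau> (- \<gamma>) z))) = X)}"

definition sl2_h :: cmat where "sl2_h = mat2 1 0 0 (-1)"
definition sl2_e :: cmat where "sl2_e = mat2 0 1 0 0"
definition sl2_f :: cmat where "sl2_f = mat2 0 0 1 0"


section \<open>Holod's algebra\<close>

fun holod_v :: "idx \<Rightarrow> cmat" where
  "holod_v I1 = smult_mat (1/2) (mat2 \<i> 0 0 (-\<i>))"
| "holod_v I2 = smult_mat (1/2) (mat2 0 1 (-1) 0)"
| "holod_v I3 = smult_mat (1/2) (mat2 0 \<i> \<i> 0)"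

text \<open>In \<open>holod_even \<tau> (i, j, k) n\<close> and \<open>holod_odd \<tau> i m\<close> the functions are the generators of degree
  \<open>2 n + 2\<close> and \<open>2 m + 1\<close>, not yet in normal form.\<close>

fun holod_even :: "complex \<Rightarrow> idx \<times> idx \<times> idx \<Rightarrow> int \<Rightarrow> complex \<Rightarrow> cmat" where
  "holod_even \<tau> (i, j, k) n z =
     smult_mat (weierstrass_p (period_lattice \<tau>) (2 * z) powi n * mu \<tau> j z * mu \<tau> k z) (holod_v i)"

definition holod_odd :: "complex \<Rightarrow> idx \<Rightarrow> int \<Rightarrow> complex \<Rightarrow> cmat" where
  "holod_odd \<tau> i m z =
     smult_mat (weierstrass_p (period_lattice \<tau>) (2 * z) powi m * mu \<tau> i z) (holod_v i)"

definition smult_fun :: "complex \<Rightarrow> (complex \<Rightarrow> cmat) \<Rightarrow> complex \<Rightarrow> cmat" where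
  "smult_fun c X = (\<lambda>z. smult_mat c (X z))"

lemma module_smult_fun: "module smult_fun"
  by unfold_locales
    (simp_all add: smult_fun_def smult_mat_def fun_eq_iff vec_eq_iff algebra_simps)

definition holod_algebra :: "complex \<Rightarrow> (complex \<Rightarrow> cmat) lie_alg" where
  "holod_algebra \<tau> = mero_lie (remove_sings_mat `
     module.span smult_fun
       ({holod_even \<tau> t n | t n. t \<in> cyclic_triples} \<union> {holod_odd \<tau> i m | i m. True}))"


section \<open>Normal forms\<close>

text \<open>The \<open>\<complex>\<close>-algebra of functions generated by \<open>G\<close>, with pointwise operations.\<close>

inductive_set adjoin :: "(complex \<Rightarrow> complex) set \<Rightarrow> (complex \<Rightarrow> complex) set" for G where
  const: "(\<lambda>z. c) \<in> adjoin G"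
| gen: "g \<in> G \<Longrightarrow> g \<in> adjoin G"
| add: "f \<in> adjoin G \<Longrightarrow> g \<in> adjoin G \<Longrightarrow> (\<lambda>z. f z + g z) \<in> adjoin G"
| mult: "f \<in> adjoin G \<Longrightarrow> g \<in> adjoin G \<Longrightarrow> (\<lambda>z. f z * g z) \<in> adjoin G"

text \<open>The ring \<open>\<complex>[\<wp>, \<wp>\<^sup>-\<^sup>1, \<wp>']\<close> for the lattice \<open>L\<close>, as a ring of meromorphic functions.\<close>

definition wp_ring :: "complex set \<Rightarrow> (complex \<Rightarrow> complex) set" where
  "wp_ring L = remove_sings `
     adjoin {weierstrass_p L, (\<lambda>z. inverse (weierstrass_p L z)), deriv (weierstrass_p L)}"

definition ring_smul :: "(complex \<Rightarrow> complex) \<Rightarrow> (complex \<Rightarrow> cmat) \<Rightarrow> complex \<Rightarrow> cmat" where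
  "ring_smul r X = remove_sings_mat (\<lambda>z. smult_mat (r z) (X z))"

text \<open>\<open>normal_form R L H E F\<close>: the Lie algebra \<open>L\<close> of meromorphic functions is \<open>R\<langle>H, E, F\<rangle>\<close>.\<close>

definition normal_form ::
  "(complex \<Rightarrow> complex) set \<Rightarrow> (complex \<Rightarrow> cmat) lie_alg \<Rightarrow>
   (complex \<Rightarrow> cmat) \<Rightarrow> (complex \<Rightarrow> cmat) \<Rightarrow> (complex \<Rightarrow> cmat) \<Rightarrow> bool" where
  "normal_form R L H E F \<longleftrightarrow>
     complex_lie_algebra L \<and>
     (\<forall>r\<in>R. \<forall>X\<in>lie_carrier L. ring_smul r X \<in> lie_carrier L) \<and>
     (\<forall>r\<in>R. \<forall>X\<in>lie_carrier L. \<forall>Y\<in>lie_carrier L.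
        lie_br L (ring_smul r X) Y = ring_smul r (lie_br L X Y) \<and>
        lie_br L X (ring_smul r Y) = ring_smul r (lie_br L X Y)) \<and>
     H \<in> lie_carrier L \<and> E \<in> lie_carrier L \<and> F \<in> lie_carrier L \<and>
     (\<forall>X\<in>lie_carrier L. \<exists>!t. t \<in> R \<times> R \<times> R \<and>
        (case t of (a, b, c) \<Rightarrow>
           X = lie_add L (lie_add L (ring_smul a H) (ring_smul b E)) (ring_smul c F))) \<and>
     lie_br L H E = lie_smul L 2 E \<and>
     lie_br L H F = lie_smul L (-2) F \<and>
     lie_br L E F = H"

text \<open>\<open>psi_coeff \<tau> 1\<close> and \<open>psi_coeff \<tau> (-1)\<close> are \<open>\<psi>\<^sub>+\<close> and \<open>\<psi>\<^sub>-\<close>.\<close>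

definition psi_coeff :: "complex \<Rightarrow> complex \<Rightarrow> complex \<Rightarrow> complex" where
  "psi_coeff \<tau> s z =
     s * (theta4 0 \<tau> ^ 2 / theta3 0 \<tau>) * (theta3 (2 * z) \<tau> / theta1 (2 * z) \<tau>)
     - (theta3 0 \<tau> ^ 2 / theta4 0 \<tau>) * (theta4 (2 * z) \<tau> / theta1 (2 * z) \<tau>)"

definition Omega :: "complex \<Rightarrow> complex \<Rightarrow> cmat" where
  "Omega \<tau> z = mat2
     (psi_coeff \<tau> (-1) z * theta2 (2 * z) (2 * \<tau>))  (theta3 (2 * z) (2 * \<tau>))
     (psi_coeff \<tau> 1 z * theta3 (2 * z) (2 * \<tau>))     (theta2 (2 * z) (2 * \<tau>))"

definition Ad_Omega :: "complex \<Rightarrow> cmat \<Rightarrow> complex \<Rightarrow> cmat" where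
  "Ad_Omega \<tau> X = remove_sings_mat (\<lambda>z. Ad (Omega \<tau> z) X)"


section \<open>Uglov's algebra\<close>

text \<open>The functions \<open>1/sn\<close>, \<open>dn/sn\<close>, \<open>cn/sn\<close> of the point \<open>z\<close> of the torus, whose Jacobi argument is
  \<open>2 * pi * theta3 0 \<tau> ^ 2 * z\<close>. The quotients extend over the common poles of \<open>sn\<close>, \<open>cn\<close>, \<open>dn\<close>.\<close>

definition jacobi_arg :: "complex \<Rightarrow> complex \<Rightarrow> complex" where
  "jacobi_arg \<tau> z = 2 * of_real pi * theta3 0 \<tau> ^ 2 * z"

fun uglov_w :: "complex \<Rightarrow> idx \<Rightarrow> complex \<Rightarrow> complex" where
  "uglov_w \<tau> I1 = remove_sings (\<lambda>z. 1 / jacobi_sn \<tau> (jacobi_arg \<tau> z))"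
| "uglov_w \<tau> I2 = remove_sings (\<lambda>z. jacobi_dn \<tau> (jacobi_arg \<tau> z) / jacobi_sn \<tau> (jacobi_arg \<tau> z))"
| "uglov_w \<tau> I3 = remove_sings (\<lambda>z. jacobi_cn \<tau> (jacobi_arg \<tau> z) / jacobi_sn \<tau> (jacobi_arg \<tau> z))"

text \<open>Only \<open>J\<^sub>1\<^sub>2\<close>, \<open>J\<^sub>2\<^sub>3\<close> and \<open>J\<^sub>3\<^sub>1\<close> occur; the last equation is a dummy.\<close>

fun uglov_J :: "complex \<Rightarrow> idx \<Rightarrow> idx \<Rightarrow> complex" where
  "uglov_J k I1 I2 = k^2"
| "uglov_J k I2 I3 = 1 - k^2"
| "uglov_J k I3 I1 = -1"
| "uglov_J k _ _ = 0"

datatype pm = Plus | Minus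

fun opp :: "pm \<Rightarrow> pm" where
  "opp Plus = Minus"
| "opp Minus = Plus"

abbreviation uglov_x :: "pm \<Rightarrow> idx \<Rightarrow> (pm \<times> idx) lie_term" where
  "uglov_x s i \<equiv> Gen (s, i)"

abbreviation TDiff :: "'g lie_term \<Rightarrow> 'g lie_term \<Rightarrow> 'g lie_term" where
  "TDiff s t \<equiv> TAdd s (TSmul (-1) t)"

definition uglov_rels :: "complex \<Rightarrow> (pm \<Rightarrow> complex) \<Rightarrow> ((pm \<times> idx) lie_term \<times> (pm \<times> idx) lie_term) set" where
  "uglov_rels \<tau> \<nu> =
     {(TBr (uglov_x s i) (TBr (uglov_x s j) (uglov_x s k)), TZero)
        | s i j k. (i, j, k) \<in> cyclic_triples} \<union>
     {(TDiff (TBr (uglov_x s i) (TBr (uglov_x s i) (uglov_x s k)))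
             (TBr (uglov_x s j) (TBr (uglov_x s j) (uglov_x s k))),
       TSmul (uglov_J (jacobi_modulus \<tau>) i j) (uglov_x s k))
        | s i j k. (i, j, k) \<in> cyclic_triples} \<union>
     {(TBr (uglov_x Plus i) (uglov_x Minus i), TZero) | i. True} \<union>
     {(TBr (uglov_x s i) (uglov_x (opp s) j),
       TSmul \<i> (TDiff (TSmul (uglov_w \<tau> i (\<nu> (opp s) - \<nu> s)) (uglov_x (opp s) k))
                      (TSmul (uglov_w \<tau> j (\<nu> (opp s) - \<nu> s)) (uglov_x s k))))
        | s i j k. (i, j, k) \<in> cyclic_triples}"

text \<open>The modulus is \<open>jacobi_modulus \<tau>\<close>. The definition is meant for \<open>\<nu>\<^sup>+ - \<nu>\<^sup>-\<close> outside
  \<open>D2_orbit \<tau> {0}\<close>, the set of poles of \<open>uglov_w \<tau> i\<close>.\<close>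

definition uglov_algebra :: "complex \<Rightarrow> complex \<Rightarrow> complex \<Rightarrow> (pm \<times> idx) lie_term set lie_alg" where
  "uglov_algebra \<tau> \<nu>p \<nu>m = presented_lie (uglov_rels \<tau> (\<lambda>s. case s of Plus \<Rightarrow> \<nu>p | Minus \<Rightarrow> \<nu>m))"

end

theory Submission
  imports Defs
begin

text \<open>In the basis \<open>holod_v\<close>, an element of the automorphic algebra is a triple of meromorphic functions that
  translations by \<open>1/2\<close> and \<open>\<tau>/2\<close> multiply by the same signs as \<open>mu \<tau> I1\<close>, \<open>mu \<tau> I2\<close>, \<open>mu \<tau> I3\<close>. By Liouville's
  theorem such a function vanishes if it has no poles and a nontrivial sign, so it is a linear combination
  of any family of functions with the same signs that realises each pole order once; the functions
  occurring in Holod's basis form such a family. The normal form holds because the entries of the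
  conjugated matrices lie in the ring and conjugation preserves the invariant form, which computes
  coordinates.

  Uglov's generators act as the multiples of \<open>mu \<tau> i (z - \<nu>) v\<^sub>i\<close> for \<open>\<nu> = \<nu>\<^sup>+, \<nu>\<^sup>-\<close>: the relations are the
  identities between the squares of the \<open>mu\<close>s and their addition theorem. The relations imply that the
  iterated brackets \<open>[x\<^sub>j, [x\<^sub>k, \<dots>]]\<close> of generators of one sign span the algebra, and
  their images have each pole order at \<open>\<nu>\<^sup>+\<close> or \<open>\<nu>\<^sup>-\<close> once, so they are a basis.
  For \<open>\<tau> = \<i>\<close>, multiplication by \<open>\<i>\<close> preserves the lattice and changes the sign of \<open>\<wp>\<close>, which puts a zero of
  \<open>\<wp>\<close> at \<open>(1 + \<i>)/4\<close>, and exchanges \<open>mu \<tau> I1\<close> and \<open>mu \<tau> I3\<close>, which determines the modulus.\<close>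

section \<open>Orders of poles\<close>

text \<open>Translations by \<open>1/2\<close> and \<open>\<tau>/2\<close> generate
  \<open>half_lattice \<tau>\<close>, so D_2-orbits on the torus are cosets of it, and invariant
  functions are elliptic for this finer lattice. The trivial sign is exceptional: constants have no
  pole and no function has a single simple pole, so the pole orders 0, 2, 3, ... occur, against 1,
  2, 3, ... for the other signs. Excluding the simple pole and locating the zeros of theta1 and of
  \<open>wp z - wp v\<close> rest on Liouville's theorem and product identities: auxiliary functions
  are built whose poles cancel, in place of contour integrals and zero counting. For Uglov's algebra
  the presentation itself gives no linear independence. The relations yield a spanning family, the
  pole orders of its image yield independence, and together they determine the kernel of the
  evaluation map. Uglov's generators have poles over two orbits, Holod's functions over three; the
  two sets agree for \<open>\<tau> = \<i>\<close> because twice \<open>(1 + \<i>)/4\<close> lies in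
  the half lattice, so that \<open>z0\<close> and \<open>- z0\<close> share an orbit.\<close>

definition pole_le :: "nat \<Rightarrow> complex \<Rightarrow> (complex \<Rightarrow> complex) \<Rightarrow> bool" where
  "pole_le n a f \<longleftrightarrow> (\<exists>c. ((\<lambda>z. (z - a) ^ n * f z) \<longlongrightarrow> c) (at a))"

lemma pole_leI: "((\<lambda>z. (z - a) ^ n * f z) \<longlongrightarrow> c) (at a) \<Longrightarrow> pole_le n a f"
  by (auto simp: pole_le_def)

lemma pole_le_cong:
  assumes "eventually (\<lambda>z. f z = g z) (at a)"
  shows "pole_le n a f \<longleftrightarrow> pole_le n a g"
proof -
  have "((\<lambda>z. (z - a) ^ n * f z) \<longlongrightarrow> c) (at a) \<longleftrightarrow> ((\<lambda>z. (z - a) ^ n * g z) \<longlongrightarrow> c) (at a)" for c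
    by (intro tendsto_cong) (use assms in \<open>auto elim: eventually_mono\<close>)
  thus ?thesis by (auto simp: pole_le_def)
qed

lemma pole_le_add: "pole_le n a f \<Longrightarrow> pole_le n a g \<Longrightarrow> pole_le n a (\<lambda>z. f z + g z)"
  unfolding pole_le_def by (auto simp: ring_distribs intro: tendsto_add)

lemma pole_le_cmult: "pole_le n a f \<Longrightarrow> pole_le n a (\<lambda>z. c * f z)"
  unfolding pole_le_def by (auto simp: mult.left_commute[of _ c] intro: tendsto_mult_left)

lemma pole_le_diff: "pole_le n a f \<Longrightarrow> pole_le n a g \<Longrightarrow> pole_le n a (\<lambda>z. f z - g z)"
  using pole_le_add[of n a f "\<lambda>z. -1 * g z"] pole_le_cmult[of n a g "-1"] by simp

lemma pole_le_sum: "(\<And>i. i \<in> A \<Longrightarrow> pole_le n a (f i)) \<Longrightarrow> pole_le n a (\<lambda>z. \<Sum>i\<in>A. f i z)"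
proof (induction A rule: infinite_finite_induct)
  case (insert x F)
  thus ?case by (auto intro!: pole_le_add)
qed (auto simp: pole_le_def)

lemma tendsto_pole_Suc:
  fixes f :: "complex \<Rightarrow> complex"
  assumes "((\<lambda>z. (z - a) ^ n * f z) \<longlongrightarrow> c) (at a)"
  shows "((\<lambda>z. (z - a) ^ Suc n * f z) \<longlongrightarrow> 0) (at a)"
proof -
  have "((\<lambda>z. (z - a) * ((z - a) ^ n * f z)) \<longlongrightarrow> (a - a) * c) (at a)"
    by (rule tendsto_mult[OF _ assms]) (intro tendsto_intros)
  thus ?thesis by (simp add: mult_ac)
qed

lemma pole_le_Suc: "pole_le n a f \<Longrightarrow> pole_le (Suc n) a f"
  unfolding pole_le_def using tendsto_pole_Suc by blast

lemma pole_le_mono: "pole_le n a f \<Longrightarrow> n \<le> m \<Longrightarrow> pole_le m a f"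
  by (induction m) (auto simp: le_Suc_eq intro: pole_le_Suc)

lemma pole_le_analytic: "f analytic_on {a} \<Longrightarrow> pole_le n a f"
  by (rule pole_le_mono[of 0])
    (auto simp: pole_le_def intro: analytic_at_imp_isCont[unfolded isCont_def])

lemma pole_le_shift: "pole_le n a (\<lambda>z. f (z + c)) \<longleftrightarrow> pole_le n (a + c) f"
proof -
  have "at (a + c) = filtermap (\<lambda>z. z + c) (at a)"
    using filtermap_at_shift[of "-c" a] by (simp add: algebra_simps)
  thus ?thesis
    unfolding pole_le_def by (simp add: filterlim_filtermap algebra_simps)
qed

text \<open>At a pole the exponent is minus the subdegree of the Laurent series; multiplying by that
  power leaves no negative exponents.\<close>

lemma meromorphic_pole_le:
  assumes "f meromorphic_on {a}"
  obtains n where "pole_le n a f"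
proof -
  have iso: "isolated_singularity_at f a" and ne: "not_essential f a"
    using assms by (auto simp: meromorphic_at_iff)
  from ne consider c where "f \<midarrow>a\<rightarrow> c" | "is_pole f a" unfolding not_essential_def by auto
  thus ?thesis
  proof cases
    case 1
    thus ?thesis using that[of 0] by (auto simp: pole_le_def)
  next
    case 2
    from zorder_exist_pole[of f UNIV a] 2 iso
    obtain F where F: "(\<lambda>w. f (a + w)) has_laurent_expansion F"
      using assms unfolding meromorphic_on_def by blast
    define n where "n = nat (- fls_subdegree F)"
    have "(\<lambda>w. w ^ n * f (a + w)) has_laurent_expansion (fls_X ^ n * F)"
      by (intro laurent_expansion_intros F)
    moreover have "fls_subdegree (fls_X ^ n * F) \<ge> 0"
      by (cases "F = 0") (auto simp: n_def fls_subdegree_mult fls_subdegree_pow)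
    ultimately have "(\<lambda>w. w ^ n * f (a + w)) \<midarrow>0\<rightarrow> fls_nth (fls_X ^ n * F) 0"
      by (rule has_laurent_expansion_imp_tendsto_0)
    hence "((\<lambda>z. (z - a) ^ n * f z) \<longlongrightarrow> fls_nth (fls_X ^ n * F) 0) (at a)"
      by (simp add: at_to_0'[of a] filterlim_filtermap add_ac)
    thus ?thesis using that pole_leI by blast
  qed
qed

text \<open>Multiplying by \<open>(z - a) ^ Suc n\<close> leaves an analytic function with value 0
  at \<open>a\<close>. Its difference quotient at \<open>a\<close> is
  \<open>(z - a) ^ n * f z\<close>, which converges to the derivative. Cancellations of leading
  coefficients are exploited through this lemma.\<close>

lemma pole_le_reduce:
  assumes mero: "f meromorphic_on {a}" and lim: "((\<lambda>z. (z - a) ^ Suc n * f z) \<longlongrightarrow> 0) (at a)"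
  shows "pole_le n a f"
proof -
  define k where "k = (\<lambda>z. (z - a) ^ Suc n * f z)"
  have km: "k meromorphic_on {a}" unfolding k_def using mero
    by (intro meromorphic_intros analytic_on_imp_meromorphic_on[of "\<lambda>z. z - a"] analytic_intros)
  define r where "r = remove_sings k"
  have ra: "r analytic_on {a}" unfolding r_def
    using km lim by (intro remove_sings_analytic_at[of _ _ 0]) (auto simp: k_def meromorphic_at_iff)
  have r0: "r a = 0" unfolding r_def using lim by (intro remove_sings_eqI) (auto simp: k_def)
  have ev: "eventually (\<lambda>z. r z = k z) (at a)" unfolding r_def
    using km by (intro eventually_remove_sings_eq_at) (auto simp: meromorphic_at_iff)
  have "(r has_field_derivative deriv r a) (at a)"
    using ra analytic_on_imp_differentiable_at DERIV_deriv_iff_field_differentiable by blast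
  hence "((\<lambda>z. (r z - r a) / (z - a)) \<longlongrightarrow> deriv r a) (at a)"
    by (simp add: has_field_derivative_iff)
  moreover have "eventually (\<lambda>z. (r z - r a) / (z - a) = (z - a) ^ n * f z) (at a)"
    using ev eventually_neq_at_within[of a a]
    by eventually_elim (auto simp: r0 k_def field_simps)
  ultimately have "((\<lambda>z. (z - a) ^ n * f z) \<longlongrightarrow> deriv r a) (at a)"
    using tendsto_cong by fast
  thus ?thesis by (rule pole_leI)
qed

text \<open>The zero supplies a factor \<open>z - a\<close>: the quotient
  \<open>g z / (z - a)\<close> tends to \<open>deriv g a\<close>, which may itself be 0.\<close>

lemma pole_le_mult_zero:
  assumes "pole_le (Suc n) a f" and g: "g analytic_on {a}" "g a = 0"
  shows "pole_le n a (\<lambda>z. f z * g z)"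
proof -
  obtain c where c: "((\<lambda>z. (z - a) ^ Suc n * f z) \<longlongrightarrow> c) (at a)"
    using assms(1) by (auto simp: pole_le_def)
  have "(g has_field_derivative deriv g a) (at a)"
    using g analytic_on_imp_differentiable_at DERIV_deriv_iff_field_differentiable by blast
  hence "((\<lambda>z. g z / (z - a)) \<longlongrightarrow> deriv g a) (at a)"
    by (simp add: has_field_derivative_iff g)
  from tendsto_mult[OF c this]
  have "((\<lambda>z. (z - a) ^ Suc n * f z * (g z / (z - a))) \<longlongrightarrow> c * deriv g a) (at a)" .
  moreover have "eventually (\<lambda>z. (z - a) ^ Suc n * f z * (g z / (z - a)) = (z - a) ^ n * (f z * g z)) (at a)"
    using eventually_neq_at_within[of a a]
    by eventually_elim (auto simp: field_simps)
  ultimately have "((\<lambda>z. (z - a) ^ n * (f z * g z)) \<longlongrightarrow> c * deriv g a) (at a)"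
    using tendsto_cong by fast
  thus ?thesis by (rule pole_leI)
qed

text \<open>Leading terms are removed from order \<open>k + m\<close> downwards, \<open>g n\<close>
  being of order exactly \<open>n\<close>. The floor \<open>k\<close> is 0 for a nontrivial sign and
  1 for the trivial sign, where order 1 is not realised.\<close>

lemma pole_reduction:
  assumes "f meromorphic_on {a}" "pole_le (k + m) a f"
    and "\<And>n. k < n \<Longrightarrow> g n meromorphic_on {a}"
    and "\<And>n. k < n \<Longrightarrow> \<exists>d. d \<noteq> 0 \<and> ((\<lambda>z. (z - a) ^ n * g n z) \<longlongrightarrow> d) (at a)"
  shows "\<exists>c. pole_le k a (\<lambda>z. f z - (\<Sum>n\<in>{k<..k+m}. c n * g n z))"
  using assms(1,2)
proof (induction m arbitrary: f)
  case 0
  thus ?case by simp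
next
  case (Suc m)
  let ?n = "Suc (k + m)"
  obtain e where e: "((\<lambda>z. (z - a) ^ ?n * f z) \<longlongrightarrow> e) (at a)"
    using Suc.prems(2) by (auto simp: pole_le_def)
  obtain d where d: "d \<noteq> 0" "((\<lambda>z. (z - a) ^ ?n * g ?n z) \<longlongrightarrow> d) (at a)"
    using assms(4)[of ?n] by auto
  define f' where "f' = (\<lambda>z. f z - e / d * g ?n z)"
  have m': "f' meromorphic_on {a}" unfolding f'_def
    by (intro meromorphic_intros Suc.prems assms(3)) auto
  have "((\<lambda>z. (z - a) ^ ?n * f z - e / d * ((z - a) ^ ?n * g ?n z)) \<longlongrightarrow> e - e / d * d) (at a)"
    by (intro tendsto_intros e d)
  hence "((\<lambda>z. (z - a) ^ ?n * f' z) \<longlongrightarrow> 0) (at a)"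
    using d(1) by (simp add: f'_def algebra_simps)
  hence "pole_le (k + m) a f'" by (intro pole_le_reduce m')
  from Suc.IH[OF m' this] obtain c where
    c: "pole_le k a (\<lambda>z. f' z - (\<Sum>n\<in>{k<..k+m}. c n * g n z))" by blast
  have eq: "{k<..k + Suc m} = insert ?n {k<..k+m}" by auto
  have "f' z - (\<Sum>n\<in>{k<..k+m}. c n * g n z)
      = f z - (\<Sum>n\<in>{k<..k + Suc m}. (c(?n := e / d)) n * g n z)" for z
  proof -
    have "(\<Sum>n\<in>{k<..k+m}. (c(?n := e / d)) n * g n z) = (\<Sum>n\<in>{k<..k+m}. c n * g n z)"
      by (intro sum.cong) auto
    thus ?thesis unfolding eq by (subst sum.insert) (auto simp: f'_def)
  qed
  with c show ?case by auto
qed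

lemma eventually_not_in_sparse: "D sparse_in UNIV \<Longrightarrow> eventually (\<lambda>z. z \<notin> D) (at (a::complex))"
  by (auto simp: sparse_in_open islimpt_conv_frequently_at frequently_def)

text \<open>In normal form the value at a point is determined by a punctured neighbourhood: it is
  the limit, or 0 at a pole. Equality off a sparse set therefore suffices.\<close>

lemma nicely_meromorphic_eqI:
  assumes "f nicely_meromorphic_on UNIV" "g nicely_meromorphic_on UNIV" "D sparse_in UNIV"
    and "\<And>z. z \<notin> D \<Longrightarrow> f z = g z"
  shows "f = g"
proof
  fix a
  have ev: "eventually (\<lambda>z. f z = g z) (at a)"
    using eventually_not_in_sparse[OF assms(3)] by eventually_elim (rule assms(4))
  have "remove_sings f a = remove_sings g a" by (rule remove_sings_cong[OF ev HOL.refl])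
  moreover have "remove_sings h a = h a" if "h nicely_meromorphic_on UNIV" for h
    using that unfolding nicely_meromorphic_on_def by (metis UNIV_I remove_sings_at_pole remove_sings_eqI)
  ultimately show "f a = g a" using assms by simp
qed

section \<open>The half lattice\<close>

text \<open>The codomain of \<open>\<phi>\<close> is arbitrary, so the lemma also applies to norms
  and to predicates such as having a pole of bounded order.\<close>

lemma int_period:
  assumes "\<And>z::complex. \<phi> (z + p) = \<phi> z"
  shows "\<phi> (z + of_int n * p) = \<phi> z"
proof -
  have nat: "\<phi> (w + of_nat k * p) = \<phi> w" for w and k :: nat
  proof (induction k)
    case (Suc k)
    have "\<phi> (w + of_nat (Suc k) * p) = \<phi> ((w + of_nat k * p) + p)" by (simp add: algebra_simps)
    with Suc assms show ?case by simp
  qed simp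
  show ?thesis
  proof (cases "n \<ge> 0")
    case True
    thus ?thesis using nat[of z "nat n"] by (simp add: of_nat_nat)
  next
    case False
    hence "n = - int (nat (- n))" by simp
    then obtain k where n: "n = - int k" by blast
    show ?thesis using nat[of "z + of_int n * p" k] unfolding n by simp
  qed
qed

locale torus =
  fixes \<tau> :: complex
  assumes Im_pos: "Im \<tau> > 0"
begin

abbreviation H :: "complex set" where "H \<equiv> half_lattice \<tau>"

lemma H_iff: "z \<in> H \<longleftrightarrow> (\<exists>m n :: int. z = (of_int m + of_int n * \<tau>) / 2)"
  unfolding half_lattice_def period_lattice_def image_def by blast

lemma H_iff_lattice: "z \<in> H \<longleftrightarrow> 2 * z \<in> period_lattice \<tau>"
  unfolding H_iff period_lattice_def mem_Collect_eq
  by (intro ex_cong1) (simp add: field_simps)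

lemma H_0 [simp]: "0 \<in> H"
  unfolding H_iff by (intro exI[of _ 0]) auto

lemma H_add: "a \<in> H \<Longrightarrow> b \<in> H \<Longrightarrow> a + b \<in> H"
  unfolding H_iff
proof clarify
  fix m n m' n' :: int
  show "\<exists>ma na. (of_int m + of_int n * \<tau>) / 2 + (of_int m' + of_int n' * \<tau>) / 2 = (of_int ma + of_int na * \<tau>) / 2"
    by (intro exI[of _ "m + m'"] exI[of _ "n + n'"]) (simp add: field_simps)
qed

lemma H_uminus [simp]: "- a \<in> H \<longleftrightarrow> a \<in> H"
proof -
  have *: "- a \<in> H" if "a \<in> H" for a
    using that unfolding H_iff
  proof clarify
    fix m n :: int
    show "\<exists>ma na. - ((of_int m + of_int n * \<tau>) / 2) = (of_int ma + of_int na * \<tau>) / 2"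
      by (intro exI[of _ "- m"] exI[of _ "- n"]) (simp add: field_simps)
  qed
  show ?thesis using *[of a] *[of "- a"] by auto
qed

lemma H_diff: "a \<in> H \<Longrightarrow> b \<in> H \<Longrightarrow> a - b \<in> H"
  using H_add[of a "- b"] by simp

lemma H_add_iff: "h \<in> H \<Longrightarrow> z + h \<in> H \<longleftrightarrow> z \<in> H"
  using H_add[of z h] H_diff[of "z + h" h] by auto

lemma H_diff_commute: "a - b \<in> H \<longleftrightarrow> b - a \<in> H"
  using H_uminus[of "a - b"] by simp

lemma half_H [simp]: "1/2 \<in> H" and tau_H [simp]: "\<tau>/2 \<in> H"
  unfolding H_iff by (intro exI[of _ 1] exI[of _ 0], simp) (intro exI[of _ 0] exI[of _ 1], simp)

lemma tau_coords_eq: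
  fixes a b c d :: real
  assumes "of_real a + of_real b * \<tau> = of_real c + of_real d * \<tau>"
  shows "a = c \<and> b = d"
proof -
  have "b * Im \<tau> = d * Im \<tau>" using arg_cong[OF assms, of Im] by simp
  hence "b = d" using Im_pos by simp
  with assms show ?thesis by simp
qed

lemma H_coords: "(of_real x + of_real y * \<tau>) / 2 \<in> H \<longleftrightarrow> x \<in> \<int> \<and> y \<in> \<int>"
proof
  assume "(of_real x + of_real y * \<tau>) / 2 \<in> H"
  then obtain m n :: int where "of_real x + of_real y * \<tau> = of_real (of_int m) + of_real (of_int n) * \<tau>"
    unfolding H_iff by (metis divide_cancel_right of_real_of_int_eq zero_neq_numeral)
  from tau_coords_eq[OF this] show "x \<in> \<int> \<and> y \<in> \<int>" by auto
next
  assume "x \<in> \<int> \<and> y \<in> \<int>"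
  thus "(of_real x + of_real y * \<tau>) / 2 \<in> H"
    unfolding H_iff by (metis Ints_cases of_real_of_int_eq)
qed

lemma quarter_notin_Ints: "1/2 \<notin> (\<int> :: real set)"
proof
  assume "1/2 \<in> (\<int> :: real set)"
  then obtain n :: int where "1/2 = real_of_int n" by (auto elim: Ints_cases)
  hence "real_of_int 1 = real_of_int (2 * n)" by simp
  hence "1 = 2 * n" by linarith
  thus False by presburger
qed

text \<open>Modulo \<open>H\<close> these are the three points of order two. Odd
  \<open>H\<close>-periodic functions that are holomorphic there vanish at them, and they are the
  zeros of theta2, theta4 and theta3 at \<open>2 * z\<close>.\<close>

lemma quarter_notin_H: "1/4 \<notin> H" "\<tau>/4 \<notin> H" "(1 + \<tau>)/4 \<notin> H"
  using H_coords[of "1/2" 0] H_coords[of 0 "1/2"] H_coords[of "1/2" "1/2"] quarter_notin_Ints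
  by (simp_all add: field_simps)

text \<open>The imaginary part of \<open>m + n * \<tau>\<close> bounds \<open>n\<close>, and the
  triangle inequality then bounds \<open>m\<close>. Both the discreteness of \<open>H\<close> and
  the convergence of the lattice sums follow from this bound.\<close>

lemma H_norm_bound:
  obtains C where "C > 0" "\<And>m n :: int. real_of_int (\<bar>m\<bar> + \<bar>n\<bar>) \<le> C * norm ((of_int m + of_int n * \<tau>) / 2)"
proof
  \<comment> \<open>The factor 2 undoes the halving; the summands
    \<open>1 + norm \<tau> / Im \<tau>\<close> come from \<open>m\<close>, and
    \<open>1 / Im \<tau>\<close> from \<open>n\<close>.\<close>
  define C where "C = 2 * (1 + norm \<tau> / Im \<tau> + 1 / Im \<tau>)"
  show "C > 0" using Im_pos by (auto simp: C_def intro!: add_pos_nonneg)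
  fix m n :: int
  define w where "w = of_int m + of_int n * \<tau>"
  have "\<bar>of_int n\<bar> * Im \<tau> = \<bar>Im w\<bar>" using Im_pos by (simp add: w_def abs_mult)
  also have "\<dots> \<le> norm w" by (rule abs_Im_le_cmod)
  finally have n: "\<bar>of_int n\<bar> \<le> norm w / Im \<tau>" using Im_pos by (simp add: field_simps)
  have "\<bar>of_int m\<bar> = norm (w - of_int n * \<tau>)" by (simp add: w_def)
  also have "\<dots> \<le> norm w + \<bar>of_int n\<bar> * norm \<tau>"
    by (rule order.trans[OF norm_triangle_ineq4]) (simp add: norm_mult)
  also have "\<dots> \<le> norm w + norm w / Im \<tau> * norm \<tau>"
    by (intro add_left_mono mult_right_mono n) auto
  finally have "real_of_int (\<bar>m\<bar> + \<bar>n\<bar>) \<le> norm w + norm w / Im \<tau> * norm \<tau> + norm w / Im \<tau>"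
    using n by simp
  also have "\<dots> = C * (norm w / 2)" using Im_pos by (simp add: C_def field_simps)
  finally show "real_of_int (\<bar>m\<bar> + \<bar>n\<bar>) \<le> C * norm ((of_int m + of_int n * \<tau>) / 2)"
    by (simp add: w_def norm_divide)
qed

lemma finite_H_ball: "finite (H \<inter> cball 0 r)"
proof -
  obtain C where C: "C > 0" "\<And>m n :: int. real_of_int (\<bar>m\<bar> + \<bar>n\<bar>) \<le> C * norm ((of_int m + of_int n * \<tau>) / 2)"
    using H_norm_bound by blast
  define N where "N = \<lceil>C * r\<rceil>"
  have "H \<inter> cball 0 r \<subseteq> (\<lambda>(m, n). (of_int m + of_int n * \<tau>) / 2) ` ({-N..N} \<times> {-N..N})"
  proof
    fix z assume z: "z \<in> H \<inter> cball 0 r"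
    then obtain m n :: int where mn: "z = (of_int m + of_int n * \<tau>) / 2" by (auto simp: H_iff)
    have "real_of_int (\<bar>m\<bar> + \<bar>n\<bar>) \<le> C * norm z" unfolding mn by (rule C(2))
    also have "\<dots> \<le> C * r" using z C(1) by simp
    also have "\<dots> \<le> real_of_int N" unfolding N_def by linarith
    finally have "\<bar>m\<bar> + \<bar>n\<bar> \<le> N" by linarith
    hence "m \<in> {-N..N}" "n \<in> {-N..N}" by auto
    thus "z \<in> (\<lambda>(m, n). (of_int m + of_int n * \<tau>) / 2) ` ({-N..N} \<times> {-N..N})"
      unfolding mn by (intro image_eqI[of _ _ "(m, n)"]) auto
  qed
  thus ?thesis by (rule finite_subset) auto
qed

lemma H_sparse: "H sparse_in UNIV"
  unfolding sparse_in_open[OF open_UNIV]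
proof
  fix y :: complex
  have "finite (H \<inter> cball 0 (norm y + 1))" by (rule finite_H_ball)
  moreover have "H \<inter> ball y 1 \<subseteq> H \<inter> cball 0 (norm y + 1)"
  proof clarsimp
    fix z assume "dist y z < 1"
    thus "norm z \<le> norm y + 1" using norm_triangle_ineq[of y "z - y"] by (simp add: dist_norm norm_minus_commute)
  qed
  ultimately have "finite (H \<inter> ball y 1)" using finite_subset by blast
  thus "\<not> y islimpt H" unfolding islimpt_eq_infinite_ball by force
qed

lemma H_period:
  assumes "\<And>z. \<phi> (z + 1/2) = \<phi> z" "\<And>z. \<phi> (z + \<tau>/2) = \<phi> z" "h \<in> H"
  shows "\<phi> (z + h) = \<phi> z"
proof -
  obtain m n :: int where h: "h = (of_int m + of_int n * \<tau>) / 2" using assms(3) by (auto simp: H_iff)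
  have "\<phi> (z + h) = \<phi> ((z + of_int m * (1/2)) + of_int n * (\<tau>/2))" by (simp add: h field_simps)
  thus ?thesis using int_period[of \<phi> "\<tau>/2" _ n] int_period[of \<phi> "1/2" _ m] assms by simp
qed

text \<open>Integer parts of the real coordinates over \<open>1/2\<close> and
  \<open>\<tau>/2\<close> are subtracted. Every class modulo \<open>H\<close> thus has a
  representative in one compact disc.\<close>

lemma H_reduce: obtains h where "h \<in> H" "norm (z + h) \<le> 1 + norm \<tau>"
proof -
  define y where "y = 2 * Im z / Im \<tau>"
  define x where "x = 2 * Re z - y * Re \<tau>"
  have z: "z = (of_real x + of_real y * \<tau>) / 2"
    using Im_pos by (simp add: complex_eq_iff x_def y_def)
  define h where "h = - (of_int \<lfloor>x\<rfloor> + of_int \<lfloor>y\<rfloor> * \<tau>) / 2"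
  have "h \<in> H" unfolding h_def H_iff
    by (intro exI[of _ "- \<lfloor>x\<rfloor>"] exI[of _ "- \<lfloor>y\<rfloor>"]) (simp add: field_simps)
  moreover have "z + h = (of_real (frac x) + of_real (frac y) * \<tau>) / 2"
    by (simp add: z h_def frac_def field_simps)
  hence "norm (z + h) \<le> (norm (of_real (frac x) :: complex) + norm (of_real (frac y) * \<tau>)) / 2"
    by (metis norm_divide norm_numeral norm_triangle_ineq divide_right_mono zero_le_numeral)
  moreover have "\<dots> \<le> 1 + norm \<tau>"
  proof -
    have "frac y * norm \<tau> \<le> 1 * norm \<tau>" by (intro mult_right_mono) (auto simp: frac_lt_1 less_imp_le)
    moreover have "frac x \<le> 1" by (simp add: frac_lt_1 less_imp_le)
    moreover have "frac x \<ge> 0" "frac y \<ge> 0" by auto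
    ultimately have "frac x + frac y * norm \<tau> \<le> 2 + norm \<tau> * 2"
      using norm_ge_zero[of \<tau>] by linarith
    thus ?thesis by (simp add: norm_mult)
  qed
  ultimately show ?thesis using that order.trans by meson
qed

section \<open>Elliptic functions with multipliers\<close>

definition polar_set :: "complex set \<Rightarrow> bool" where
  "polar_set D \<longleftrightarrow> D sparse_in UNIV \<and> (\<forall>z. \<forall>h\<in>H. z + h \<in> D \<longleftrightarrow> z \<in> D)"

text \<open>All conditions are imposed off \<open>D\<close>, since the value at a pole carries no
  information. The class is then closed under pointwise operations, with multipliers multiplying
  along with the functions.\<close>

definition ell :: "complex set \<Rightarrow> complex \<Rightarrow> complex \<Rightarrow> (complex \<Rightarrow> complex) \<Rightarrow> bool" where
  "ell D s1 s2 f \<longleftrightarrow> f meromorphic_on UNIV \<and> f holomorphic_on - D \<and>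
     (\<forall>z. z \<notin> D \<longrightarrow> f (z + 1/2) = s1 * f z \<and> f (z + \<tau>/2) = s2 * f z)"

definition pts :: "complex set \<Rightarrow> complex set" where
  "pts A = (\<Union>a\<in>A. {z. z - a \<in> H})"

lemma H_eq_pts: "H = pts {0}" by (auto simp: pts_def)

lemma in_pts: "z \<in> pts A \<longleftrightarrow> (\<exists>a\<in>A. z - a \<in> H)" by (auto simp: pts_def)

lemma sparse_translate: "{z. z - a \<in> H} sparse_in UNIV"
proof -
  have "\<not> y islimpt {z. z - a \<in> H}" for y
  proof -
    have "eventually (\<lambda>z. z \<notin> H) (at (y - a))" using H_sparse by (rule eventually_not_in_sparse)
    hence "eventually (\<lambda>z. z - a \<notin> H) (at y)"
      unfolding filtermap_at_shift[of a y, symmetric] eventually_filtermap .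
    thus ?thesis by (simp add: islimpt_iff_eventually)
  qed
  thus ?thesis by (simp add: sparse_in_open)
qed

lemma polar_pts: "finite A \<Longrightarrow> polar_set (pts A)"
proof -
  assume "finite A"
  hence "pts A sparse_in UNIV" unfolding pts_def by (intro sparse_in_UN_finite sparse_translate)
  moreover have "z + h \<in> pts A \<longleftrightarrow> z \<in> pts A" if "h \<in> H" for z h
    using that H_add_iff[of h "z - _"] by (simp add: in_pts add_diff_eq diff_add_eq)
  ultimately show ?thesis by (auto simp: polar_set_def)
qed

lemma polar_H [simp]: "polar_set H" using polar_pts[of "{0}"] by (simp add: H_eq_pts)

lemma polar_sparse: "polar_set D \<Longrightarrow> D sparse_in UNIV" by (simp add: polar_set_def)

lemma polar_open: "polar_set D \<Longrightarrow> open (- D)"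
  using open_diff_sparse_pts[OF open_UNIV polar_sparse] by (simp add: Compl_eq_Diff_UNIV)

lemma polar_shift: "polar_set D \<Longrightarrow> h \<in> H \<Longrightarrow> z + h \<in> D \<longleftrightarrow> z \<in> D" by (auto simp: polar_set_def)

lemma polar_half [simp]: "polar_set D \<Longrightarrow> z + 1/2 \<in> D \<longleftrightarrow> z \<in> D" "polar_set D \<Longrightarrow> z + \<tau>/2 \<in> D \<longleftrightarrow> z \<in> D"
  using polar_shift[OF _ half_H] polar_shift[OF _ tau_H] by blast+

lemma ell_mero: "ell D s1 s2 f \<Longrightarrow> f meromorphic_on A"
  by (meson ell_def meromorphic_on_subset subset_UNIV)

lemma ell_analytic: "ell D s1 s2 f \<Longrightarrow> polar_set D \<Longrightarrow> z \<notin> D \<Longrightarrow> f analytic_on {z}"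
  by (metis ComplI analytic_on_open analytic_on_subset ell_def empty_subsetI insert_subset polar_open)

lemma ell_half: "ell D s1 s2 f \<Longrightarrow> z \<notin> D \<Longrightarrow> f (z + 1/2) = s1 * f z"
  and ell_tau: "ell D s1 s2 f \<Longrightarrow> z \<notin> D \<Longrightarrow> f (z + \<tau>/2) = s2 * f z"
  by (auto simp: ell_def)

lemma ell_mono: "ell D s1 s2 f \<Longrightarrow> D \<subseteq> D' \<Longrightarrow> ell D' s1 s2 f"
  unfolding ell_def using holomorphic_on_subset by (smt (verit) Compl_anti_mono subsetD)

lemma ell_cong:
  assumes "ell D s1 s2 f" "polar_set D" "\<And>z. z \<notin> D \<Longrightarrow> f z = g z"
  shows "ell D s1 s2 g"
proof -
  have "eventually (\<lambda>z. f z = g z) (at a)" for a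
    using eventually_not_in_sparse[OF polar_sparse[OF assms(2)]]
    by eventually_elim (rule assms(3))
  hence "g meromorphic_on UNIV"
    using assms(1) meromorphic_on_cong[of UNIV f g UNIV] by (auto simp: ell_def)
  moreover have "g holomorphic_on - D"
    using assms(1) holomorphic_cong[of "- D" "- D" f g] assms(3) by (auto simp: ell_def)
  ultimately show ?thesis using assms by (auto simp: ell_def polar_half)
qed

lemma ell_const: "ell D 1 1 (\<lambda>z. c)"
  by (auto simp: ell_def)

lemma ell_add: "ell D s1 s2 f \<Longrightarrow> ell D s1 s2 g \<Longrightarrow> ell D s1 s2 (\<lambda>z. f z + g z)"
  by (auto simp: ell_def algebra_simps intro!: meromorphic_intros holomorphic_intros)

lemma ell_mult: "ell D s1 s2 f \<Longrightarrow> ell D t1 t2 g \<Longrightarrow> ell D (s1 * t1) (s2 * t2) (\<lambda>z. f z * g z)"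
  by (auto simp: ell_def algebra_simps intro!: meromorphic_intros holomorphic_intros)

lemma ell_cmult: "ell D s1 s2 f \<Longrightarrow> ell D s1 s2 (\<lambda>z. c * f z)"
  using ell_mult[OF ell_const] by simp

lemma ell_diff: "ell D s1 s2 f \<Longrightarrow> ell D s1 s2 g \<Longrightarrow> ell D s1 s2 (\<lambda>z. f z - g z)"
  using ell_add[OF _ ell_cmult[of D s1 s2 g "-1"], of f] by simp

lemma ell_zero: "ell D s1 s2 (\<lambda>z. 0)"
  by (auto simp: ell_def)

lemma ell_sum: "(\<And>i. i \<in> A \<Longrightarrow> ell D s1 s2 (f i)) \<Longrightarrow> ell D s1 s2 (\<lambda>z. \<Sum>i\<in>A. f i z)"
  by (induction A rule: infinite_finite_induct) (auto intro: ell_add ell_zero)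

lemma ell_power: "ell D s1 s2 f \<Longrightarrow> ell D (s1 ^ n) (s2 ^ n) (\<lambda>z. f z ^ n)"
  by (auto simp: ell_def algebra_simps intro!: meromorphic_intros holomorphic_intros)

lemma ell_inverse: "ell D s1 s2 f \<Longrightarrow> (\<And>z. z \<notin> D \<Longrightarrow> f z \<noteq> 0) \<Longrightarrow>
    ell D (inverse s1) (inverse s2) (\<lambda>z. inverse (f z))"
  by (auto simp: ell_def algebra_simps intro!: meromorphic_intros holomorphic_intros)

lemma ell_translate:
  assumes "ell D s1 s2 f"
  shows "ell {z. z + c \<in> D} s1 s2 (\<lambda>z. f (z + c))"
proof -
  have "(\<lambda>z. f (z + c)) meromorphic_on UNIV"
    by (rule meromorphic_on_compose[of f UNIV "\<lambda>z. z + c"])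
       (use assms in \<open>auto simp: ell_def intro!: analytic_intros\<close>)
  moreover have "(f \<circ> (\<lambda>z. z + c)) holomorphic_on - {z. z + c \<in> D}"
    by (rule holomorphic_on_compose_gen[of _ _ _ "- D"])
       (use assms in \<open>auto simp: ell_def intro!: holomorphic_intros\<close>)
  moreover have "f (z + 1/2 + c) = s1 * f (z + c)" "f (z + \<tau>/2 + c) = s2 * f (z + c)" if "z + c \<notin> D" for z
    using ell_half[OF assms that] ell_tau[OF assms that] by (simp_all add: add_ac)
  ultimately show ?thesis unfolding ell_def by (auto simp: o_def)
qed

text \<open>Reflection replaces each multiplier by its inverse, and a sign is its own
  inverse.\<close>

lemma ell_reflect:
  assumes "ell D s1 s2 f" "s1 * s1 = 1" "s2 * s2 = 1" "polar_set D"
  shows "ell {z. - z \<in> D} s1 s2 (\<lambda>z. f (- z))"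
proof -
  have "(\<lambda>z. f (- z)) meromorphic_on UNIV"
    by (rule meromorphic_on_compose[of f UNIV "\<lambda>z. - z"])
       (use assms in \<open>auto simp: ell_def intro!: analytic_intros\<close>)
  moreover have "(f \<circ> (\<lambda>z. - z)) holomorphic_on - {z. - z \<in> D}"
    by (rule holomorphic_on_compose_gen[of _ _ _ "- D"])
       (use assms in \<open>auto simp: ell_def intro!: holomorphic_intros\<close>)
  moreover have "f (- (z + 1/2)) = s1 * f (- z)" "f (- (z + \<tau>/2)) = s2 * f (- z)" if "- z \<notin> D" for z
  proof -
    have "- z - 1/2 \<notin> D" "- z - \<tau>/2 \<notin> D"
      using that polar_shift[OF assms(4), of "- (1/2)" "- z"] polar_shift[OF assms(4), of "- (\<tau>/2)" "- z"]
      by (simp_all del: divide_minus_left)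
    from ell_half[OF assms(1) this(1)] ell_tau[OF assms(1) this(2)]
    have "f (- z) = s1 * f (- z - 1/2)" "f (- z) = s2 * f (- z - \<tau>/2)" by simp_all
    hence "s1 * f (- z) = s1 * s1 * f (- z - 1/2)" "s2 * f (- z) = s2 * s2 * f (- z - \<tau>/2)"
      by simp_all
    thus "f (- (z + 1/2)) = s1 * f (- z)" "f (- (z + \<tau>/2)) = s2 * f (- z)"
      using assms(2,3) by simp_all
  qed
  ultimately show ?thesis unfolding ell_def by (auto simp: o_def)
qed

text \<open>At points of \<open>D - D'\<close> the singularity is removable. The translation rules,
  known off \<open>D\<close>, extend to these points by continuity because \<open>D\<close> is
  sparse.\<close>

lemma ell_extend:
  assumes "ell D s1 s2 f" "polar_set D" "polar_set D'" "D' \<subseteq> D" "\<And>a. a \<in> D - D' \<Longrightarrow> pole_le 0 a f"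
  shows "ell D' s1 s2 (remove_sings f)" "\<And>z. z \<notin> D \<Longrightarrow> remove_sings f z = f z"
    "\<And>a. eventually (\<lambda>z. remove_sings f z = f z) (at a)"
proof -
  let ?g = "remove_sings f"
  show eq: "?g z = f z" if "z \<notin> D" for z
    using ell_analytic[OF assms(1,2) that] by simp
  show ev: "eventually (\<lambda>z. ?g z = f z) (at a)" for a
    using eventually_not_in_sparse[OF polar_sparse[OF assms(2)]] by eventually_elim (rule eq)
  have an: "?g analytic_on {a}" if "a \<notin> D'" for a
  proof (cases "a \<in> D")
    case True
    then obtain c where "f \<midarrow>a\<rightarrow> c" using assms(5)[of a] \<open>a \<notin> D'\<close> by (auto simp: pole_le_def)
    thus ?thesis using ell_mero[OF assms(1), of "{a}"]
      by (intro remove_sings_analytic_at) (auto simp: meromorphic_at_iff)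
  next
    case False
    thus ?thesis by (intro remove_sings_analytic_on ell_analytic[OF assms(1,2)])
  qed
  have hol: "?g holomorphic_on - D'"
    using an by (metis Compl_iff analytic_imp_holomorphic analytic_on_analytic_at)
  have per: "?g (z + p) = s * ?g z"
    if z: "z \<notin> D'" and p: "p \<in> H" and f: "\<And>z. z \<notin> D \<Longrightarrow> f (z + p) = s * f z" for z p s
  proof -
    have "z + p \<notin> D'" using z p assms(3) by (simp add: polar_shift)
    hence "isCont ?g (z + p)" "isCont ?g z" using an z analytic_at_imp_isCont by blast+
    hence "((\<lambda>w. ?g (w + p)) \<longlongrightarrow> ?g (z + p)) (at z)" "((\<lambda>w. s * ?g w) \<longlongrightarrow> s * ?g z) (at z)"
      by (auto simp: isCont_def LIM_offset intro!: tendsto_intros isCont_tendsto_compose[of "z + p" ?g])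
    moreover have "eventually (\<lambda>w. ?g (w + p) = s * ?g w) (at z)"
      using eventually_not_in_sparse[OF polar_sparse[OF assms(2)]]
    proof eventually_elim
      case (elim w)
      thus ?case using f[of w] eq[of w] eq[of "w + p"] p assms(2) by (simp add: polar_shift)
    qed
    ultimately show ?thesis using tendsto_cong tendsto_unique trivial_limit_at by metis
  qed
  show "ell D' s1 s2 ?g" unfolding ell_def
    using remove_sings_meromorphic[OF ell_mero[OF assms(1)]] hol per[OF _ half_H ell_half[OF assms(1)]]
      per[OF _ tau_H ell_tau[OF assms(1)]] by blast
qed

section \<open>Liouville's theorem for functions with multipliers\<close>

lemma polar_empty: "polar_set {}" by (simp add: polar_set_def)

text \<open>Multipliers of norm 1 make the norm of the function periodic under \<open>H\<close>, so
  once the singularities are removed its bound on a compact disc holds on the whole plane.\<close>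

lemma ell_Liouville:
  assumes "ell D s1 s2 f" "polar_set D" "\<And>a. a \<in> D \<Longrightarrow> pole_le 0 a f" "norm s1 = 1" "norm s2 = 1"
  obtains c where "\<And>z. z \<notin> D \<Longrightarrow> f z = c"
proof -
  let ?g = "remove_sings f"
  have g: "ell {} s1 s2 ?g" "\<And>z. z \<notin> D \<Longrightarrow> ?g z = f z"
    using ell_extend[OF assms(1,2) polar_empty] assms(3) by auto
  have per: "norm (?g (z + h)) = norm (?g z)" if "h \<in> H" for z h
    by (rule H_period[of "\<lambda>z. norm (?g z)", OF _ _ that])
       (use assms(4,5) in \<open>simp_all only: ell_half[OF g(1)] ell_tau[OF g(1)] norm_mult empty_iff not_False_eq_True mult_1\<close>)
  have hol: "?g holomorphic_on UNIV" using g(1) by (simp add: ell_def)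
  hence "bounded (?g ` cball 0 (1 + norm \<tau>))"
    by (intro compact_imp_bounded compact_continuous_image holomorphic_on_imp_continuous_on
          holomorphic_on_subset[OF hol]) auto
  then obtain B where B: "\<And>z. norm z \<le> 1 + norm \<tau> \<Longrightarrow> norm (?g z) \<le> B"
    unfolding bounded_iff by (metis imageI mem_cball_0)
  have "norm (?g z) \<le> B" for z
  proof -
    obtain h where "h \<in> H" "norm (z + h) \<le> 1 + norm \<tau>" by (rule H_reduce)
    with B[of "z + h"] per[of h z] show ?thesis by simp
  qed
  hence "bounded (range ?g)" by (auto simp: bounded_iff)
  from Liouville_theorem[OF hol this] obtain c where "\<And>z. ?g z = c" by (auto simp: constant_on_def)
  with g(2) that show ?thesis by metis
qed

text \<open>The constant from Liouville's theorem satisfies \<open>c = s1 * c\<close> and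
  \<open>c = s2 * c\<close>.\<close>

lemma ell_Liouville_0:
  assumes "ell D s1 s2 f" "polar_set D" "\<And>a. a \<in> D \<Longrightarrow> pole_le 0 a f" "norm s1 = 1" "norm s2 = 1"
    and "s1 \<noteq> 1 \<or> s2 \<noteq> 1" and "z \<notin> D"
  shows "f z = 0"
proof -
  obtain c where c: "\<And>z. z \<notin> D \<Longrightarrow> f z = c" using ell_Liouville[OF assms(1-5)] by blast
  have "c = s1 * c" "c = s2 * c"
    using c[of z] c[of "z + 1/2"] c[of "z + \<tau>/2"] ell_half[OF assms(1,7)] ell_tau[OF assms(1,7)]
      polar_half[OF assms(2), of z] assms(7) by auto
  thus ?thesis using assms(6,7) c by auto
qed

text \<open>The period argument is applied to the predicate \<open>pole_le n a f\<close> in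
  \<open>a\<close>, since translation multiplies \<open>f\<close> by a nonzero factor. Pole orders
  then need checking at one point of each orbit only.\<close>

lemma ell_pole_le_shift:
  assumes "ell D s1 s2 f" "polar_set D" "h \<in> H" "s1 \<noteq> 0" "s2 \<noteq> 0"
  shows "pole_le n (a + h) f \<longleftrightarrow> pole_le n a f"
proof -
  have *: "pole_le n (a + p) f \<longleftrightarrow> pole_le n a f"
    if "s \<noteq> 0" "\<And>z. z \<notin> D \<Longrightarrow> f (z + p) = s * f z" for a p s
  proof -
    have "pole_le n (a + p) f \<longleftrightarrow> pole_le n a (\<lambda>z. f (z + p))" by (simp add: pole_le_shift)
    also have "\<dots> \<longleftrightarrow> pole_le n a (\<lambda>z. s * f z)"
      by (rule pole_le_cong, rule eventually_mono[OF eventually_not_in_sparse[OF polar_sparse[OF assms(2)]]])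
         (rule that(2))
    also have "\<dots> \<longleftrightarrow> pole_le n a f"
      using pole_le_cmult[of n a f s] pole_le_cmult[of n a "\<lambda>z. s * f z" "inverse s"] that(1) by (auto simp: field_simps)
    finally show ?thesis .
  qed
  show ?thesis
    by (rule H_period[of "\<lambda>a. pole_le n a f", OF _ _ assms(3)])
       (rule *[OF assms(4) ell_half[OF assms(1)]] *[OF assms(5) ell_tau[OF assms(1)]], assumption)+
qed

lemma ell_pole_le_pts:
  assumes "ell D s1 s2 f" "polar_set D" "s1 \<noteq> 0" "s2 \<noteq> 0" "a \<in> pts A" "\<And>a. a \<in> A \<Longrightarrow> pole_le n a f"
  shows "pole_le n a f"
proof -
  obtain b where b: "b \<in> A" "a - b \<in> H" using assms(5) by (auto simp: in_pts)
  thus ?thesis using ell_pole_le_shift[OF assms(1,2) b(2) assms(3,4), of n b] assms(6)[OF b(1)] by simp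
qed

text \<open>The accumulation point \<open>a\<close> may lie in \<open>D\<close>, so the identity
  theorem is applied to the normal form of \<open>f\<close> on the whole plane.\<close>

lemma ell_eq_0:
  assumes "ell D s1 s2 f" "polar_set D" "frequently (\<lambda>z. f z = 0) (at a)" "z \<notin> D"
  shows "f z = 0"
proof -
  have nm: "remove_sings f nicely_meromorphic_on UNIV"
    by (intro remove_sings_nicely_meromorphic ell_mero[OF assms(1)])
  have eq: "remove_sings f z = f z" if "z \<notin> D" for z using ell_analytic[OF assms(1,2) that] by simp
  have ev: "eventually (\<lambda>z. remove_sings f z = f z) (at a)"
    using eventually_not_in_sparse[OF polar_sparse[OF assms(2)]] by eventually_elim (rule eq)
  have "frequently (\<lambda>z. remove_sings f z = 0) (at a)"
    using frequently_eventually_frequently[OF assms(3) ev] by (rule frequently_elim1) auto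
  from frequently_eq_meromorphic_imp_constant[OF this nm open_UNIV connected_UNIV UNIV_I, of z]
  show ?thesis using eq[OF assms(4)] by simp
qed

lemma ell_mult_eq_0:
  assumes "ell D s1 s2 f" "ell D t1 t2 g" "polar_set D" "\<And>z. z \<notin> D \<Longrightarrow> f z * g z = 0"
  shows "(\<forall>z. z \<notin> D \<longrightarrow> f z = 0) \<or> (\<forall>z. z \<notin> D \<longrightarrow> g z = 0)"
proof (cases "frequently (\<lambda>z. f z = 0) (at 0)")
  case True
  thus ?thesis using ell_eq_0[OF assms(1,3)] by blast
next
  case False
  hence "eventually (\<lambda>z. f z \<noteq> 0) (at 0)" by (simp add: frequently_def)
  with eventually_not_in_sparse[OF polar_sparse[OF assms(3)]]
  have "eventually (\<lambda>z. g z = 0) (at 0)" by eventually_elim (use assms(4) in auto)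
  hence "frequently (\<lambda>z. g z = 0) (at 0)" by (intro eventually_frequently) auto
  thus ?thesis using ell_eq_0[OF assms(2,3)] by blast
qed

text \<open>Up to a constant, \<open>f\<close> is an odd function \<open>g\<close>, which vanishes at the points of order two. As its only
  pole is simple, \<open>g z * g (z + 1/4)\<close> has no pole, hence is constant and vanishes with \<open>g\<close> at \<open>\<tau>/4\<close>.\<close>

lemma ell_simple_pole:
  assumes f: "ell H 1 1 f" and p: "pole_le 1 0 f"
  obtains c where "\<And>z. z \<notin> H \<Longrightarrow> f z = c"
proof -
  have Hm: "{z. - z \<in> H} = H" by auto
  have fr: "ell H 1 1 (\<lambda>z. f (- z))" using ell_reflect[OF f _ _ polar_H] by (simp add: Hm)
  obtain r where r: "((\<lambda>z. (z - 0) ^ 1 * f z) \<longlongrightarrow> r) (at 0)" using p by (auto simp: pole_le_def)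
  have flt: "filterlim uminus (at (0::complex)) (at 0)"
    by (rule filterlim_atI) (auto intro!: tendsto_eq_intros simp: eventually_at_filter)
  have "((\<lambda>z. - z * f (- z)) \<longlongrightarrow> r) (at 0)"
    using filterlim_compose[OF r flt] by simp
  \<comment> \<open>The residues of \<open>f z\<close> and \<open>f (- z)\<close> at 0 are opposite,
    so the sum has no pole and is a constant \<open>k\<close>; subtracting \<open>k / 2\<close>
    makes \<open>f\<close> odd.\<close>
  from tendsto_diff[OF r this] have "((\<lambda>z. (z - 0) ^ Suc 0 * (f z + f (- z))) \<longlongrightarrow> 0) (at 0)"
    by (simp add: algebra_simps)
  hence p0: "pole_le 0 0 (\<lambda>z. f z + f (- z))"
    by (intro pole_le_reduce ell_mero[OF ell_add[OF f fr]])
  have "pole_le 0 a (\<lambda>z. f z + f (- z))" if "a \<in> H" for a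
    by (rule ell_pole_le_pts[OF ell_add[OF f fr], of _ "{0}"])
       (use that p0 in \<open>auto simp flip: H_eq_pts\<close>)
  then obtain k where k: "\<And>z. z \<notin> H \<Longrightarrow> f z + f (- z) = k"
    using ell_Liouville[OF ell_add[OF f fr]] by auto
  define g where "g = (\<lambda>z. f z - k / 2)"
  have g: "ell H 1 1 g" unfolding g_def by (intro ell_diff f ell_const)
  have odd: "g (- z) = - g z" if "z \<notin> H" for z using k[OF that, symmetric] by (simp add: g_def field_simps)
  have gp: "pole_le 1 0 g" unfolding g_def by (intro pole_le_diff p pole_le_analytic) auto
  have per: "g (z + h) = g z" if "z \<notin> H" "h = 1/2 \<or> h = \<tau>/2" for z h
    using that(2) ell_half[OF g that(1)] ell_tau[OF g that(1)]
    by (elim disjE) (simp_all only: mult_1)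
  have g1: "g (1/4) = 0"
    using odd[of "1/4"] per[of "-1/4" "1/2"] quarter_notin_H by simp
  have g2: "g (\<tau>/4) = 0"
    using odd[of "\<tau>/4"] per[of "-\<tau>/4" "\<tau>/2"] quarter_notin_H by (simp add: field_simps)
  define D where "D = H \<union> {z. z + 1/4 \<in> H}"
  have D: "D = pts {0, -1/4}" by (auto simp: D_def pts_def)
  have pD: "polar_set D" unfolding D by (rule polar_pts) simp
  have gs: "ell {z. z + 1/4 \<in> H} 1 1 (\<lambda>z. g (z + 1/4))" by (rule ell_translate[OF g])
  define q where "q = (\<lambda>z. g z * g (z + 1/4))"
  have q: "ell D 1 1 q" unfolding q_def
    using ell_mult[OF ell_mono[OF g, of D] ell_mono[OF gs, of D]] by (auto simp: D_def)
  have an: "g analytic_on {1/4}" "g analytic_on {-1/4}" using quarter_notin_H by (auto intro: ell_analytic[OF g])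
  have "pole_le 0 0 q" unfolding q_def
  proof (rule pole_le_mult_zero)
    show "pole_le (Suc 0) 0 g" using gp by simp
    have "(g \<circ> (\<lambda>z. z + 1/4)) analytic_on {0}"
      by (intro analytic_on_compose) (use an in \<open>auto intro!: analytic_intros\<close>)
    thus "(\<lambda>z. g (z + 1/4)) analytic_on {0}" by (simp add: o_def)
  qed (use g1 in auto)
  hence q0: "\<And>a. a \<in> {0, -1/4} \<Longrightarrow> pole_le 0 a q" if "pole_le 0 (-1/4) q"
    using that by blast
  have q1: "pole_le 0 (-1/4) q"
  proof -
    have "pole_le 0 (-1/4) (\<lambda>z. g (z + 1/4) * g z)"
    proof (rule pole_le_mult_zero)
      show "pole_le (Suc 0) (-1/4) (\<lambda>z. g (z + 1/4))" using gp pole_le_shift[of 1 "-1/4" g "1/4"] by simp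
      show "g (-1/4) = 0" using odd[of "1/4"] g1 quarter_notin_H by simp
    qed (use an in auto)
    thus ?thesis by (simp add: q_def mult.commute)
  qed
  have "pole_le 0 a q" if "a \<in> D" for a
    by (rule ell_pole_le_pts[OF q pD, of a "{0, -1/4}"]) (use that q0 q1 in \<open>auto simp: D\<close>)
  then obtain c where c: "\<And>z. z \<notin> D \<Longrightarrow> q z = c" using ell_Liouville[OF q pD] by auto
  have "\<tau>/4 \<notin> D" using quarter_notin_H by (auto simp: D_def add_divide_distrib add.commute)
  hence "c = 0" using c[of "\<tau>/4"] g2 by (simp add: q_def)
  hence "g z * g (z + 1/4) = 0" if "z \<notin> D" for z using c[OF that] by (simp add: q_def)
  from ell_mult_eq_0[OF ell_mono[OF g, of D] ell_mono[OF gs, of D] pD this]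
  consider "\<forall>z. z \<notin> D \<longrightarrow> g z = 0" | "\<forall>z. z \<notin> D \<longrightarrow> g (z + 1/4) = 0" by (auto simp: D_def)
  hence "g z = 0" if "z \<notin> H" for z
  proof cases
    case 1
    have "eventually (\<lambda>z. g z = 0) (at 0)"
      by (rule eventually_mono[OF eventually_not_in_sparse[OF polar_sparse[OF pD]]]) (use 1 in blast)
    hence "frequently (\<lambda>z. g z = 0) (at 0)" by (intro eventually_frequently) auto
    thus ?thesis using ell_eq_0[OF g polar_H _ that] by blast
  next
    case 2
    have ev: "eventually (\<lambda>z. g (z + 1/4) = 0) (at (-1/4))"
      by (rule eventually_mono[OF eventually_not_in_sparse[OF polar_sparse[OF pD]]]) (use 2 in blast)
    have "at 0 = filtermap (\<lambda>z. z + 1/4) (at (-1/4 :: complex))"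
      using filtermap_at_shift[of "-1/4" "-1/4 :: complex"] by simp
    with ev have "eventually (\<lambda>z. g z = 0) (at 0)" by (simp add: eventually_filtermap)
    hence "frequently (\<lambda>z. g z = 0) (at 0)" by (intro eventually_frequently) auto
    thus ?thesis using ell_eq_0[OF g polar_H _ that] by blast
  qed
  thus ?thesis using that[of "k / 2"] by (simp add: g_def)
qed

end

section \<open>The Weierstrass function of the half lattice\<close>

lemma summable_on_int:
  fixes g :: "nat \<Rightarrow> real"
  assumes "summable g" "\<And>n. g n \<ge> 0"
  shows "(\<lambda>m::int. g (nat \<bar>m\<bar>)) summable_on UNIV"
proof -
  have g: "g summable_on A" for A
    using norm_summable_imp_summable_on[of g] assms summable_on_subset_banach by force
  have "(\<lambda>m::int. g (nat \<bar>m\<bar>)) summable_on range int"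
    using g by (subst summable_on_reindex) (auto simp: o_def)
  moreover have "(\<lambda>m::int. g (nat \<bar>m\<bar>)) summable_on (\<lambda>n. - int n) ` {1..}"
    using g by (subst summable_on_reindex) (auto simp: o_def inj_on_def)
  ultimately have "(\<lambda>m::int. g (nat \<bar>m\<bar>)) summable_on (range int \<union> (\<lambda>n. - int n) ` {1..})"
    by (intro summable_on_Un_disjoint) auto
  moreover have "range int \<union> (\<lambda>n. - int n) ` {1..} = UNIV"
  proof -
    have "m \<in> range int \<union> (\<lambda>n. - int n) ` {1..}" for m
    proof (cases "m \<ge> 0")
      case True
      hence "m = int (nat m)" by simp
      thus ?thesis by blast
    next
      case False
      hence "m = - int (nat (- m))" "nat (- m) \<in> {1..}" by auto
      thus ?thesis by blast
    qed
    thus ?thesis by blast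
  qed
  ultimately show ?thesis by simp
qed

lemma summable_on_int_product:
  fixes f g :: "int \<Rightarrow> real"
  assumes "f summable_on UNIV" "g summable_on UNIV" "\<And>n. f n \<ge> 0" "\<And>n. g n \<ge> 0"
  shows "(\<lambda>(m, n). f m * g n) summable_on UNIV"
proof -
  have "(\<lambda>(m, n). f m * g n) summable_on Sigma UNIV (\<lambda>_. UNIV)"
  proof (rule summable_on_SigmaI)
    show "((\<lambda>y. case (x, y) of (m, n) \<Rightarrow> f m * g n) has_sum f x * infsum g UNIV) UNIV" for x
      using has_sum_cmult_right[OF has_sum_infsum[OF assms(2)], of "f x"] by simp
    show "(\<lambda>x. f x * infsum g UNIV) summable_on UNIV"
      by (intro summable_on_cmult_left assms)
  qed (use assms in auto)
  thus ?thesis by simp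
qed

lemma has_sum_diff:
  fixes f g :: "'a \<Rightarrow> complex"
  assumes "(f has_sum a) A" "(g has_sum b) A"
  shows "((\<lambda>x. f x - g x) has_sum (a - b)) A"
  using has_sum_add[of f A a "\<lambda>x. - g x" "- b"] assms by (simp add: has_sum_uminus)

text \<open>Weierstrass M-test: the partial sums converge uniformly on the closed disc, and a
  uniform limit of holomorphic functions is holomorphic inside.\<close>

lemma holomorphic_infsum:
  fixes f :: "'a \<Rightarrow> complex \<Rightarrow> complex"
  assumes "\<And>x. x \<in> X \<Longrightarrow> f x holomorphic_on UNIV' " "cball a r \<subseteq> UNIV'"
    and "\<And>x y. x \<in> X \<Longrightarrow> y \<in> cball a r \<Longrightarrow> norm (f x y) \<le> M x" "M summable_on X"
  shows "(\<lambda>y. \<Sum>\<^sub>\<infinity>x\<in>X. f x y) holomorphic_on ball a r"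
proof -
  have ul: "uniform_limit (cball a r) (\<lambda>X y. \<Sum>x\<in>X. f x y) (\<lambda>y. \<Sum>\<^sub>\<infinity>x\<in>X. f x y) (finite_subsets_at_top X)"
    by (rule Weierstrass_m_test_general[OF assms(3,4)])
  have hol: "(\<lambda>y. \<Sum>x\<in>Y. f x y) holomorphic_on cball a r" if "Y \<subseteq> X" for Y
    by (intro holomorphic_on_sum holomorphic_on_subset[OF assms(1) assms(2)]) (use that in auto)
  have ev: "eventually (\<lambda>Y. continuous_on (cball a r) (\<lambda>y. \<Sum>x\<in>Y. f x y) \<and>
      (\<lambda>y. \<Sum>x\<in>Y. f x y) holomorphic_on ball a r) (finite_subsets_at_top X)"
    by (rule eventually_finite_subsets_at_top_weakI)
       (use hol holomorphic_on_subset[OF hol ball_subset_cball] in \<open>auto intro: holomorphic_on_imp_continuous_on\<close>)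
  show ?thesis by (rule holomorphic_uniform_limit[OF ev ul]) auto
qed

text \<open>The difference is
  \<open>z * (2 * \<omega> - z) / ((z - \<omega>)^2 * \<omega>^2)\<close>. As \<open>norm z\<close>
  is at most half of \<open>norm \<omega>\<close>, the norm of \<open>2 * \<omega> - z\<close> is at
  most \<open>5/2 * norm \<omega>\<close> and that of \<open>z - \<omega>\<close> at least
  \<open>norm \<omega> / 2\<close>, whence \<open>10 = 5/2 * 4\<close>.\<close>

lemma wp_term_bound:
  fixes z \<omega> :: complex
  assumes "norm z \<le> r" "2 * r \<le> norm \<omega>" "r > 0"
  shows "norm (1 / (z - \<omega>)^2 - 1 / \<omega>^2) \<le> 10 * r / norm \<omega> ^ 3"
proof -
  have w: "norm \<omega> > 0" using assms by linarith
  have d: "norm (z - \<omega>) \<ge> norm \<omega> / 2"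
    using norm_triangle_ineq2[of \<omega> z] assms by (simp add: norm_minus_commute)
  hence d0: "z - \<omega> \<noteq> 0" using w by auto
  have "1 / (z - \<omega>)^2 - 1 / \<omega>^2 = z * (2 * \<omega> - z) / ((z - \<omega>)^2 * \<omega>^2)"
    using d0 w by (simp add: divide_simps) (simp add: power2_eq_square algebra_simps)
  hence "norm (1 / (z - \<omega>)^2 - 1 / \<omega>^2) = norm z * norm (2 * \<omega> - z) / (norm (z - \<omega>) ^ 2 * norm \<omega> ^ 2)"
    by (simp add: norm_divide norm_mult norm_power)
  also have "\<dots> \<le> r * (5 / 2 * norm \<omega>) / ((norm \<omega> / 2) ^ 2 * norm \<omega> ^ 2)"
  proof (rule frac_le)
    have "norm (2 * \<omega> - z) \<le> 2 * norm \<omega> + norm z"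
      using norm_triangle_ineq4[of "2 * \<omega>" z] by (simp add: norm_mult)
    hence "norm (2 * \<omega> - z) \<le> 5 / 2 * norm \<omega>" using assms by linarith
    thus "norm z * norm (2 * \<omega> - z) \<le> r * (5 / 2 * norm \<omega>)"
      using assms by (intro mult_mono) auto
    show "(norm \<omega> / 2) ^ 2 * norm \<omega> ^ 2 \<le> norm (z - \<omega>) ^ 2 * norm \<omega> ^ 2"
      using d w by (intro mult_right_mono power_mono) auto
  qed (use assms w in auto)
  also have "\<dots> = 10 * r / norm \<omega> ^ 3" using w by (simp add: field_simps power2_eq_square power3_eq_cube)
  finally show ?thesis .
qed

context torus
begin

text \<open>With \<open>s = \<bar>m\<bar> + \<bar>n\<bar>\<close> at least 1, the product
  \<open>(1 + \<bar>m\<bar>) * (1 + \<bar>n\<bar>)\<close> is at most \<open>3 * s^2\<close>. The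
  cube of \<open>1 / norm \<omega>\<close> is therefore dominated by a product of two series in
  \<open>m\<close> and \<open>n\<close> with exponent 3/2, which exceeds 1.\<close>

lemma H_cube_summable: "(\<lambda>\<omega>. 1 / norm \<omega> ^ 3) summable_on (H - {0})"
proof -
  obtain C where C: "C > 0" "\<And>m n :: int. real_of_int (\<bar>m\<bar> + \<bar>n\<bar>) \<le> C * norm ((of_int m + of_int n * \<tau>) / 2)"
    using H_norm_bound by blast
  define g where "g = (\<lambda>(m::int, n::int). (of_int m + of_int n * \<tau>) / 2)"
  have inj: "inj g"
  proof (rule injI)
    fix x y :: "int \<times> int" assume "g x = g y"
    hence "(of_int (fst x) + of_int (snd x) * \<tau>) / 2 = (of_int (fst y) + of_int (snd y) * \<tau>) / 2"
      unfolding g_def case_prod_unfold .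
    hence "of_int (fst x) + of_int (snd x) * \<tau> = of_int (fst y) + of_int (snd y) * \<tau>"
      by (metis divide_cancel_right zero_neq_numeral)
    thus "x = y"
      using tau_coords_eq[of "of_int (fst x)" "of_int (snd x)" "of_int (fst y)" "of_int (snd y)"]
      by (simp add: prod_eq_iff)
  qed
  have "z \<in> H \<longleftrightarrow> (\<exists>m n. z = g (m, n))" for z unfolding H_iff by (simp only: g_def prod.case)
  hence H: "H = range g" by auto
  have g0: "g (0, 0) = 0" by (simp add: g_def)
  have Hg: "H - {0} = g ` (UNIV - {(0, 0)})"
    unfolding H by (simp add: image_set_diff[OF inj] g0)
  define a where "a = (\<lambda>m::int. (1 + real (nat \<bar>m\<bar>)) powr (- 3 / 2))"
  have "summable (\<lambda>n. (real n) powr (- 3 / 2))" by (subst summable_real_powr_iff) auto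
  hence "summable (\<lambda>n. real (Suc n) powr (- 3 / 2))" by (subst summable_Suc_iff)
  hence "summable (\<lambda>n. (1 + real n) powr (- 3 / 2))" by (simp add: add.commute)
  hence a: "a summable_on UNIV" unfolding a_def by (rule summable_on_int) auto
  have "(\<lambda>(m, n). a m * a n) summable_on UNIV"
    by (rule summable_on_int_product[OF a a]) (auto simp: a_def)
  hence "(\<lambda>(m, n). C ^ 3 * 3 powr (3 / 2) * (a m * a n)) summable_on UNIV"
    using summable_on_cmult_right[of _ UNIV "C ^ 3 * 3 powr (3 / 2)"] by (simp add: case_prod_unfold)
  hence S: "(\<lambda>(m, n). C ^ 3 * 3 powr (3 / 2) * (a m * a n)) summable_on (UNIV - {(0, 0)})"
    using summable_on_subset_banach subset_UNIV by blast
  have "(\<lambda>\<omega>. 1 / norm \<omega> ^ 3) \<circ> g summable_on (UNIV - {(0, 0)})"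
  proof (rule summable_on_comparison_test[OF S])
    fix x :: "int \<times> int" assume "x \<in> UNIV - {(0, 0)}"
    then obtain m n where x: "x = (m, n)" and mn: "\<bar>m\<bar> + \<bar>n\<bar> \<ge> 1" by (cases x) auto
    define s where "s = real_of_int (\<bar>m\<bar> + \<bar>n\<bar>)"
    have s1: "s \<ge> 1" using mn unfolding s_def by linarith
    define P where "P = (1 + real (nat \<bar>m\<bar>)) * (1 + real (nat \<bar>n\<bar>))"
    have "P = 1 + s + \<bar>of_int m\<bar> * \<bar>of_int n\<bar>" by (simp add: P_def s_def algebra_simps)
    also have "\<bar>of_int m\<bar> * \<bar>of_int n\<bar> \<le> s * s" by (intro mult_mono) (auto simp: s_def)
    also have "1 + s + s * s \<le> 3 * s ^ 2"
    proof -
      have "s * 1 \<le> s * s" "1 * 1 \<le> s * s" using s1 by (intro mult_left_mono mult_mono; simp)+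
      thus ?thesis unfolding power2_eq_square by linarith
    qed
    finally have P: "P \<le> 3 * s ^ 2" by simp
    have P1: "P > 0" by (auto simp: P_def intro!: mult_pos_pos)
    have "P powr (3 / 2) \<le> (3 * s ^ 2) powr (3 / 2)" by (intro powr_mono2 P) (use P1 in auto)
    also have "\<dots> = 3 powr (3 / 2) * (s ^ 2) powr (3 / 2)"
      by (rule powr_mult)
    also have "(s ^ 2) powr (3 / 2) = (s powr 2) powr (3 / 2)" using s1 by simp
    also have "\<dots> = s powr 3" by (subst powr_powr) simp
    also have "\<dots> = s ^ 3" using s1 by simp
    finally have P2: "P powr (3 / 2) \<le> 3 powr (3 / 2) * s ^ 3" .
    have am: "a m * a n = 1 / P powr (3 / 2)"
      unfolding a_def P_def by (subst powr_mult[symmetric]) (auto simp: powr_minus_divide)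
    have sg: "s \<le> C * norm (g x)" using C(2)[of m n] by (simp add: x g_def s_def)
    have gpos: "norm (g x) > 0" using sg s1 C(1) by (smt (verit) mult_nonneg_nonpos zero_less_mult_pos norm_ge_zero)
    have "1 / norm (g x) ^ 3 \<le> C ^ 3 / s ^ 3"
    proof -
      have "s ^ 3 \<le> (C * norm (g x)) ^ 3" by (intro power_mono sg) (use s1 in auto)
      thus ?thesis using gpos s1 by (simp add: field_simps power_mult_distrib)
    qed
    also have "\<dots> \<le> C ^ 3 * 3 powr (3 / 2) / P powr (3 / 2)"
    proof -
      have "C ^ 3 * P powr (3 / 2) \<le> C ^ 3 * (3 powr (3 / 2) * s ^ 3)"
        using C(1) by (intro mult_left_mono P2) auto
      thus ?thesis using s1 P1 by (simp add: field_simps)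
    qed
    finally show "((\<lambda>\<omega>. 1 / norm \<omega> ^ 3) \<circ> g) x \<le> (case x of (m, n) \<Rightarrow> C ^ 3 * 3 powr (3 / 2) * (a m * a n))"
      by (simp add: x am)
  qed auto
  thus ?thesis unfolding Hg
    by (subst summable_on_reindex) (use inj inj_on_subset in blast, simp)
qed

section \<open>The regular part at 0, evenness and periods\<close>

definition wp_reg :: "complex \<Rightarrow> complex" where
  "wp_reg z = (\<Sum>\<^sub>\<infinity>\<omega>\<in>H - {0}. 1 / (z - \<omega>)^2 - 1 / \<omega>^2)"

abbreviation wp :: "complex \<Rightarrow> complex" where "wp \<equiv> weierstrass_p H"

lemma wp_eq: "wp z = 1 / z^2 + wp_reg z"
  by (simp add: weierstrass_p_def wp_reg_def)

lemma finite_H_near: "finite {\<omega> \<in> H - {0}. norm \<omega> < r}"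
  by (rule finite_subset[OF _ finite_H_ball[of r]]) auto

lemma tail_summable: "(\<lambda>\<omega>. 10 * r / norm \<omega> ^ 3) summable_on {\<omega> \<in> H - {0}. 2 * r \<le> norm \<omega>}"
proof -
  have "(\<lambda>\<omega>. 10 * r * (1 / norm \<omega> ^ 3)) summable_on (H - {0})"
    by (rule summable_on_cmult_right[OF H_cube_summable])
  hence "(\<lambda>\<omega>. 10 * r / norm \<omega> ^ 3) summable_on (H - {0})" by simp
  thus ?thesis by (rule summable_on_subset_banach) auto
qed

lemma wp_reg_summable: "(\<lambda>\<omega>. 1 / (z - \<omega>)^2 - 1 / \<omega>^2) summable_on (H - {0})"
proof -
  define r where "r = norm z + 1"
  have r: "r > 0" "norm z \<le> r" by (auto simp: r_def intro: add_nonneg_pos)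
  have "(\<lambda>\<omega>. norm (1 / (z - \<omega>)^2 - 1 / \<omega>^2)) summable_on {\<omega> \<in> H - {0}. 2 * r \<le> norm \<omega>}"
    by (rule Infinite_Sum.abs_summable_on_comparison_test'[OF tail_summable[of r]])
       (use wp_term_bound[of z r] r in auto)
  hence "(\<lambda>\<omega>. 1 / (z - \<omega>)^2 - 1 / \<omega>^2) summable_on {\<omega> \<in> H - {0}. 2 * r \<le> norm \<omega>}"
    by (rule abs_summable_summable)
  hence "(\<lambda>\<omega>. 1 / (z - \<omega>)^2 - 1 / \<omega>^2) summable_on
     ({\<omega> \<in> H - {0}. norm \<omega> < 2 * r} \<union> {\<omega> \<in> H - {0}. 2 * r \<le> norm \<omega>})"
    by (intro summable_on_Un_disjoint[OF summable_on_finite[OF finite_H_near]]) auto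
  also have "\<dots> = H - {0}" by auto
  finally show ?thesis .
qed

lemma H0_open: "open (- (H - {0}))"
  using open_diff_sparse_pts[OF open_UNIV sparse_in_subset2[OF H_sparse, of "H - {0}"]]
  by (simp add: Compl_eq_Diff_UNIV)

text \<open>On a given disc only finitely many terms can have poles; the remaining tail is dominated
  by the cubic series, uniformly on the disc.\<close>

lemma wp_reg_holomorphic: "wp_reg holomorphic_on - (H - {0})"
proof -
  have "wp_reg analytic_on {a}" if a: "a \<in> - (H - {0})" for a
  proof -
    define r where "r = norm a + 1"
    have r: "r > 0" "norm a < r" by (auto simp: r_def intro: add_nonneg_pos)
    define T where "T = {\<omega> \<in> H - {0}. 2 * r \<le> norm \<omega>}"
    define F where "F = {\<omega> \<in> H - {0}. norm \<omega> < 2 * r}"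
    have U: "H - {0} = F \<union> T" "F \<inter> T = {}" by (auto simp: F_def T_def)
    have finF: "finite F" unfolding F_def by (rule finite_H_near)
    define t where "t = (\<lambda>\<omega> z::complex. 1 / (z - \<omega>)^2 - 1 / \<omega>^2)"
    have split: "wp_reg z = (\<Sum>\<omega>\<in>F. t \<omega> z) + (\<Sum>\<^sub>\<infinity>\<omega>\<in>T. t \<omega> z)" for z
    proof -
      have "(\<lambda>\<omega>. t \<omega> z) summable_on T"
        using wp_reg_summable[of z] U(1) summable_on_subset_banach unfolding t_def by blast
      thus ?thesis
        using U(2) finF infsum_Un_disjoint[of "\<lambda>\<omega>. t \<omega> z" F T]
        unfolding wp_reg_def t_def U(1) by simp
    qed
    have "(\<lambda>z. \<Sum>\<^sub>\<infinity>\<omega>\<in>T. t \<omega> z) holomorphic_on ball 0 r"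
    proof (rule holomorphic_infsum[where UNIV' = "cball 0 r"])
      show "t \<omega> holomorphic_on cball 0 r" if "\<omega> \<in> T" for \<omega>
        unfolding t_def using that r by (auto simp: T_def intro!: holomorphic_intros)
      show "norm (t \<omega> z) \<le> 10 * r / norm \<omega> ^ 3" if "\<omega> \<in> T" "z \<in> cball 0 r" for \<omega> z
        unfolding t_def using that r by (intro wp_term_bound) (auto simp: T_def)
      show "(\<lambda>\<omega>. 10 * r / norm \<omega> ^ 3) summable_on T" unfolding T_def by (rule tail_summable)
    qed auto
    moreover have "(\<lambda>z. \<Sum>\<omega>\<in>F. t \<omega> z) holomorphic_on - (H - {0})"
      unfolding t_def by (intro holomorphic_intros) (auto simp: F_def)
    ultimately have "(\<lambda>z. (\<Sum>\<omega>\<in>F. t \<omega> z) + (\<Sum>\<^sub>\<infinity>\<omega>\<in>T. t \<omega> z)) holomorphic_on (ball 0 r \<inter> - (H - {0}))"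
      by (intro holomorphic_on_add) (auto elim: holomorphic_on_subset)
    hence "wp_reg holomorphic_on (ball 0 r \<inter> - (H - {0}))" by (simp add: split[abs_def])
    moreover have "open (ball 0 r \<inter> - (H - {0}))" using H0_open by blast
    moreover have "a \<in> ball 0 r \<inter> - (H - {0})" using a r by auto
    ultimately show ?thesis using analytic_at by blast
  qed
  thus ?thesis by (metis analytic_imp_holomorphic analytic_on_analytic_at)
qed

lemma wp_reg_analytic_0: "wp_reg analytic_on {0}"
  using wp_reg_holomorphic H0_open analytic_at by blast

lemma wp_even: "wp (- z) = wp z"
proof -
  have "wp_reg (- z) = wp_reg z"
    unfolding wp_reg_def
    by (rule infsum_reindex_bij_witness[where i = uminus and j = uminus])
       (auto simp: power2_eq_square algebra_simps)
  thus ?thesis by (simp add: wp_eq)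
qed

text \<open>In a difference of two values the correction \<open>1 / \<omega>^2\<close> cancels, and
  the pole term at 0 joins the others. The sum over all of \<open>H\<close> is then visibly
  invariant under translation.\<close>

lemma wp_diff_infsum:
  fixes z z' :: complex
  shows "wp z - wp z' = (\<Sum>\<^sub>\<infinity>\<omega>\<in>H. 1 / (z - \<omega>)^2 - 1 / (z' - \<omega>)^2)"
proof -
  have "wp_reg z - wp_reg z' = (\<Sum>\<^sub>\<infinity>\<omega>\<in>H - {0}. (1 / (z - \<omega>)^2 - 1 / \<omega>^2) - (1 / (z' - \<omega>)^2 - 1 / \<omega>^2))"
    using has_sum_diff[OF has_sum_infsum[OF wp_reg_summable[of z]] has_sum_infsum[OF wp_reg_summable[of z']]]
    unfolding wp_reg_def by (simp add: infsumI)
  also have "\<dots> = (\<Sum>\<^sub>\<infinity>\<omega>\<in>H - {0}. 1 / (z - \<omega>)^2 - 1 / (z' - \<omega>)^2)" by simp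
  finally have eq: "wp_reg z - wp_reg z' = (\<Sum>\<^sub>\<infinity>\<omega>\<in>H - {0}. 1 / (z - \<omega>)^2 - 1 / (z' - \<omega>)^2)" .
  have sm: "(\<lambda>\<omega>. 1 / (z - \<omega>)^2 - 1 / (z' - \<omega>)^2) summable_on (H - {0})"
    using has_sum_diff[OF has_sum_infsum[OF wp_reg_summable[of z]] has_sum_infsum[OF wp_reg_summable[of z']]]
    by (auto simp: summable_on_def)
  have "(\<Sum>\<^sub>\<infinity>\<omega>\<in>insert 0 (H - {0}). 1 / (z - \<omega>)^2 - 1 / (z' - \<omega>)^2) =
      (1 / (z - 0)^2 - 1 / (z' - 0)^2) + (\<Sum>\<^sub>\<infinity>\<omega>\<in>H - {0}. 1 / (z - \<omega>)^2 - 1 / (z' - \<omega>)^2)"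
    by (rule infsum_insert[OF sm]) simp
  thus ?thesis using eq by (simp add: wp_eq insert_absorb)
qed

lemma wp_diff_shift:
  assumes "h \<in> H"
  shows "wp (z + h) - wp (z' + h) = wp z - wp z'"
  unfolding wp_diff_infsum
  by (rule infsum_reindex_bij_witness[where i = "\<lambda>\<omega>. \<omega> + h" and j = "\<lambda>\<omega>. \<omega> - h"])
     (use assms in \<open>auto simp: H_add H_diff algebra_simps\<close>)

text \<open>The difference \<open>wp (z + h) - wp z\<close> does not depend on \<open>z\<close>. At
  \<open>z = - h / 2\<close> it is \<open>wp (h / 2) - wp (- h / 2)\<close>, which is 0 since
  \<open>wp\<close> is even.\<close>

lemma wp_half_periods: "wp (z + 1/2) = wp z" "wp (z + \<tau>/2) = wp z"
  using wp_diff_shift[OF half_H, of z "-1/4"] wp_diff_shift[OF tau_H, of z "-\<tau>/4"]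
    wp_even[of "1/4"] wp_even[of "\<tau>/4"] by (simp_all add: field_simps)

lemma wp_period: "h \<in> H \<Longrightarrow> wp (z + h) = wp z"
  by (rule H_period) (rule wp_half_periods, rule wp_half_periods)

lemma wp_meromorphic: "wp meromorphic_on UNIV"
proof (subst meromorphic_on_meromorphic_at, intro ballI)
  fix a :: complex
  have *: "wp meromorphic_on {a}" if "a \<in> - (H - {0})" for a
  proof -
    have "wp_reg meromorphic_on {a}"
      using wp_reg_holomorphic H0_open that by (intro analytic_on_imp_meromorphic_on) (use analytic_at in blast)
    hence "(\<lambda>z. 1 / z^2 + wp_reg z) meromorphic_on {a}" by (intro meromorphic_intros)
    thus ?thesis by (simp add: wp_eq[abs_def])
  qed
  show "wp meromorphic_on {a}"
  proof (cases "a \<in> H")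
    case True
    have "(\<lambda>z. wp (z - a)) meromorphic_on {a}"
      by (rule meromorphic_on_compose[of wp "{0}"]) (use * in \<open>auto intro!: analytic_intros\<close>)
    moreover have "wp (z - a) = wp z" for z using wp_period[of "- a" z] True by simp
    ultimately show ?thesis by simp
  qed (use * in auto)
qed

lemma wp_holomorphic: "wp holomorphic_on - H"
proof -
  have "(\<lambda>z. 1 / z^2 + wp_reg z) holomorphic_on - H"
    by (intro holomorphic_intros holomorphic_on_subset[OF wp_reg_holomorphic]) auto
  thus ?thesis by (simp add: wp_eq[abs_def])
qed

lemma wp_ell: "ell H 1 1 wp"
  using wp_meromorphic wp_holomorphic wp_half_periods by (simp add: ell_def)

lemma wp_lim: "((\<lambda>z. z ^ 2 * wp z) \<longlongrightarrow> 1) (at 0)"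
proof -
  have "((\<lambda>z. 1 + z ^ 2 * wp_reg z) \<longlongrightarrow> 1 + 0 ^ 2 * wp_reg 0) (at 0)"
    by (intro tendsto_intros analytic_at_imp_isCont[OF wp_reg_analytic_0, unfolded isCont_def])
  moreover have "eventually (\<lambda>z. 1 + z ^ 2 * wp_reg z = z ^ 2 * wp z) (at (0::complex))"
    using eventually_neq_at_within[of 0 0] by eventually_elim (simp add: wp_eq field_simps)
  ultimately show ?thesis using tendsto_cong by fastforce
qed

section \<open>The derivative and the values of the Weierstrass function\<close>

lemma ell_deriv:
  assumes f: "ell D s1 s2 f" and D: "polar_set D"
  shows "ell D s1 s2 (deriv f)"
proof -
  have "deriv f (z + p) = s * deriv f z"
    if z: "z \<notin> D" "z + p \<notin> D" and eq: "\<And>z. z \<notin> D \<Longrightarrow> f (z + p) = s * f z" for z p s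
  proof -
    have d: "(f has_field_derivative deriv f (z + p)) (at (z + p))" "(f has_field_derivative deriv f z) (at z)"
      using ell_analytic[OF f D z(1)] ell_analytic[OF f D z(2)] analytic_on_imp_differentiable_at
        DERIV_deriv_iff_field_differentiable by blast+
    have "((\<lambda>w. f (w + p)) has_field_derivative deriv f (z + p)) (at z)"
      using DERIV_shift[of f "deriv f (z + p)" z p] d(1) by simp
    moreover have "((\<lambda>w. s * f w) has_field_derivative s * deriv f z) (at z)"
      by (intro DERIV_cmult d)
    moreover have "eventually (\<lambda>w. f (w + p) = s * f w) (nhds z)"
      using eventually_nhds_in_open[OF polar_open[OF D], of z] z by (auto elim!: eventually_mono intro: eq)
    ultimately show ?thesis
      using DERIV_cong_ev[of z z "\<lambda>w. f (w + p)" "\<lambda>w. s * f w"] DERIV_unique[of "\<lambda>w. s * f w"] by metis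
  qed
  moreover have "deriv f meromorphic_on UNIV" by (intro meromorphic_intros ell_mero[OF f])
  moreover have "deriv f holomorphic_on - D"
    using f polar_open[OF D] by (intro holomorphic_deriv) (auto simp: ell_def)
  ultimately show ?thesis
    using ell_half[OF f] ell_tau[OF f] D unfolding ell_def by simp
qed

lemma ell_period:
  assumes "ell D 1 1 f" "polar_set D" "h \<in> H" "z \<notin> D"
  shows "f (z + h) = f z"
proof -
  have "(if z + h \<in> D then 0 else f (z + h)) = (if z \<in> D then 0 else f z)"
    by (rule H_period[of "\<lambda>z. if z \<in> D then 0 else f z"])
       (use assms ell_half[OF assms(1)] ell_tau[OF assms(1)] in auto)
  thus ?thesis using assms(2-4) by (simp add: polar_shift)
qed

lemma wp_deriv_ell: "ell H 1 1 (deriv wp)" by (rule ell_deriv[OF wp_ell polar_H])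

lemma wp_has_deriv: "z \<notin> H \<Longrightarrow> (wp has_field_derivative deriv wp z) (at z)"
  using ell_analytic[OF wp_ell polar_H] analytic_on_imp_differentiable_at
    DERIV_deriv_iff_field_differentiable by blast

lemma wp_deriv_odd:
  assumes "z \<notin> H"
  shows "deriv wp (- z) = - deriv wp z"
proof -
  have "((\<lambda>w. wp (- w)) has_field_derivative deriv wp (- z) * (- 1)) (at z)"
    by (rule DERIV_chain2[OF wp_has_deriv]) (use assms in \<open>auto intro!: derivative_eq_intros\<close>)
  hence "(wp has_field_derivative - deriv wp (- z)) (at z)" by (simp add: wp_even)
  from DERIV_unique[OF this wp_has_deriv[OF assms]] show ?thesis by (metis minus_minus)
qed

lemma wp_deriv_lim: "((\<lambda>z. z ^ 3 * deriv wp z) \<longlongrightarrow> - 2) (at 0)"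
proof -
  have an: "deriv wp_reg analytic_on {0}" by (intro analytic_deriv wp_reg_analytic_0)
  have "((\<lambda>z. - 2 + z ^ 3 * deriv wp_reg z) \<longlongrightarrow> - 2 + 0 ^ 3 * deriv wp_reg 0) (at 0)"
    by (intro tendsto_intros analytic_at_imp_isCont[OF an, unfolded isCont_def])
  moreover have "eventually (\<lambda>z. - 2 + z ^ 3 * deriv wp_reg z = z ^ 3 * deriv wp z) (at 0)"
    using eventually_not_in_sparse[OF H_sparse]
  proof eventually_elim
    case (elim z)
    hence z: "z \<noteq> 0" by auto
    have "(wp_reg has_field_derivative deriv wp_reg z) (at z)"
      using wp_reg_holomorphic H0_open elim by (intro holomorphic_derivI) auto
    hence "((\<lambda>z. 1 / z ^ 2 + wp_reg z) has_field_derivative (- 2 / z ^ 3 + deriv wp_reg z)) (at z)"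
      using z by (auto intro!: derivative_eq_intros simp: field_simps power2_eq_square power3_eq_cube)
    hence "deriv wp z = - 2 / z ^ 3 + deriv wp_reg z"
      by (intro DERIV_imp_deriv) (simp add: wp_eq[abs_def])
    thus ?case using z by (simp add: field_simps)
  qed
  ultimately show ?thesis using tendsto_cong by fastforce
qed

lemma wp_pole_le: "pole_le 2 a wp"
proof (cases "a \<in> H")
  case True
  have "pole_le 2 0 wp" using wp_lim by (intro pole_leI[of _ _ _ 1]) simp
  thus ?thesis using ell_pole_le_shift[OF wp_ell polar_H True, of 2 0] by simp
qed (intro pole_le_analytic ell_analytic[OF wp_ell polar_H])

text \<open>Otherwise \<open>wp\<close> would be constant off \<open>H\<close> by the identity
  theorem, contradicting its double pole at 0.\<close>

lemma wp_neq_ev: "eventually (\<lambda>z. wp z \<noteq> c) (at a)"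
proof (rule ccontr)
  assume "\<not> ?thesis"
  hence "frequently (\<lambda>z. wp z - c = 0) (at a)" by (simp add: frequently_def)
  from ell_eq_0[OF ell_diff[OF wp_ell ell_const] polar_H this]
  have "wp z = c" if "z \<notin> H" for z using that by simp
  hence "eventually (\<lambda>z. z ^ 2 * wp z = z ^ 2 * c) (at 0)"
    by (intro eventually_mono[OF eventually_not_in_sparse[OF H_sparse]]) simp
  hence "((\<lambda>z. z ^ 2 * c) \<longlongrightarrow> 1) (at 0)" using wp_lim tendsto_cong by fast
  moreover have "((\<lambda>z. z ^ 2 * c) \<longlongrightarrow> 0 ^ 2 * c) (at 0)" by (intro tendsto_intros)
  ultimately show False using tendsto_unique[of "at (0::complex)"] by fastforce
qed

text \<open>Replacing \<open>z\<close> by \<open>- z\<close> shows that the coefficient of order 2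
  equals its own negative.\<close>

lemma odd_pole_le:
  assumes "f meromorphic_on {0}" "pole_le 2 0 f" "eventually (\<lambda>z. f (- z) = - f z) (at 0)"
  shows "pole_le 1 0 f"
proof -
  obtain c where c: "((\<lambda>z. z ^ 2 * f z) \<longlongrightarrow> c) (at 0)" using assms(2) by (auto simp: pole_le_def)
  have flt: "filterlim uminus (at (0::complex)) (at 0)"
    by (rule filterlim_atI) (auto intro!: tendsto_eq_intros simp: eventually_at_filter)
  have "((\<lambda>z. z ^ 2 * f (- z)) \<longlongrightarrow> c) (at 0)" using filterlim_compose[OF c flt] by simp
  moreover have "eventually (\<lambda>z. z ^ 2 * f (- z) = - (z ^ 2 * f z)) (at 0)"
    using assms(3) by eventually_elim simp
  ultimately have "((\<lambda>z. - (z ^ 2 * f z)) \<longlongrightarrow> c) (at 0)" using tendsto_cong by fast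
  from tendsto_unique[OF _ this tendsto_minus[OF c]] have "c = 0" by simp
  with c show ?thesis using pole_le_reduce[OF assms(1), of 1] by (simp add: numeral_2_eq_2)
qed

text \<open>The double poles at \<open>v\<close> and \<open>- v\<close> are cancelled by the square.
  At 0 the coefficient of order 3 vanishes by the choice of the right-hand side and that of order 2
  by oddness, so the difference \<open>K\<close> of the two sides is constant, and being odd it is
  0. The identity takes the place of counting the zeros of \<open>wp z - wp v\<close>.\<close>

lemma wp_shift_identity:
  assumes v: "v \<notin> H" and z: "z \<notin> H" "z - v \<notin> H" "z + v \<notin> H"
  shows "(wp (z + v) - wp (z - v)) * (wp z - wp v)^2 = - deriv wp v * deriv wp z"
proof -
  define D where "D = pts {0, v, - v}"
  have D: "D = H \<union> {z. z - v \<in> H} \<union> {z. z + v \<in> H}" by (auto simp: D_def pts_def)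
  have pD: "polar_set D" unfolding D_def by (rule polar_pts) simp
  have HD: "H \<subseteq> D" by (auto simp: D)
  define K where "K = (\<lambda>z. (wp (z + v) - wp (z - v)) * (wp z - wp v)^2 + deriv wp v * deriv wp z)"
  have e1: "ell D 1 1 (\<lambda>z. wp (z + v))" "ell D 1 1 (\<lambda>z. wp (z - v))"
    using ell_mono[OF ell_translate[OF wp_ell, of v], of D] ell_mono[OF ell_translate[OF wp_ell, of "- v"], of D]
    by (auto simp: D)
  have "ell D (1 * 1 ^ 2) (1 * 1 ^ 2) (\<lambda>z. (wp (z + v) - wp (z - v)) * (wp z - wp v)^2)"
    by (intro ell_mult ell_diff e1 ell_power ell_const ell_mono[OF wp_ell HD])
  hence K: "ell D 1 1 K" unfolding K_def
    using ell_add[OF _ ell_cmult[OF ell_mono[OF wp_deriv_ell HD]]] by simp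
  have wpv: "wp (- v) = wp v" by (rule wp_even)
  have an: "(\<lambda>z. wp z - wp v) analytic_on {w}" "deriv wp analytic_on {w}" if "w = v \<or> w = - v" for w
    using that v by (auto intro!: analytic_intros ell_analytic[OF wp_ell] ell_analytic[OF wp_deriv_ell])
  have pole: "pole_le 0 w K" if w: "w = v \<or> w = - v" for w
  proof -
    have P: "pole_le (Suc (Suc 0)) w (\<lambda>z. wp (z + v) - wp (z - v))"
      using wp_pole_le pole_le_shift[of 2 w wp v] pole_le_shift[of 2 w wp "- v"]
      by (intro pole_le_diff) (auto simp: numeral_2_eq_2)
    have "pole_le 0 w (\<lambda>z. (wp (z + v) - wp (z - v)) * (wp z - wp v) * (wp z - wp v))"
      by (intro pole_le_mult_zero[OF pole_le_mult_zero[OF P]] an[OF w]) (use w wpv in auto)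
    thus ?thesis unfolding K_def
      by (intro pole_le_add pole_le_cmult pole_le_analytic[OF an(2)[OF w]])
         (simp add: power2_eq_square mult.assoc)
  qed
  \<comment> \<open>The difference quotient at 0 tends to \<open>2 * deriv wp v\<close> and
    \<open>z ^ 3 * deriv wp z\<close> tends to -2, so the two contributions cancel.\<close>
  have K3: "((\<lambda>z. (z - 0) ^ Suc 2 * K z) \<longlongrightarrow> 0) (at 0)"
  proof -
    have "((\<lambda>z. wp (z + v) - wp (z - v)) has_field_derivative (deriv wp v - deriv wp (- v))) (at 0)"
      using DERIV_shift[of wp "deriv wp v" 0 v] DERIV_shift[of wp "deriv wp (- v)" 0 "- v"]
        wp_has_deriv[of v] wp_has_deriv[of "- v"] v by (intro DERIV_diff) auto
    hence "((\<lambda>z. (wp (z + v) - wp (z - v)) / z) \<longlongrightarrow> 2 * deriv wp v) (at 0)"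
      using wp_deriv_odd[OF v] wpv by (simp add: has_field_derivative_iff)
    moreover have "((\<lambda>z. z^2 * (wp z - wp v)) \<longlongrightarrow> 1 - 0 ^ 2 * wp v) (at 0)"
      unfolding right_diff_distrib by (intro tendsto_intros wp_lim)
    ultimately have "((\<lambda>z. (wp (z + v) - wp (z - v)) / z * (z^2 * (wp z - wp v))^2 + deriv wp v * (z ^ 3 * deriv wp z))
       \<longlongrightarrow> 2 * deriv wp v * (1 - 0 ^ 2 * wp v)^2 + deriv wp v * - 2) (at 0)"
      by (intro tendsto_intros wp_deriv_lim)
    moreover have "eventually (\<lambda>z. (wp (z + v) - wp (z - v)) / z * (z^2 * (wp z - wp v))^2 + deriv wp v * (z ^ 3 * deriv wp z)
        = (z - 0) ^ Suc 2 * K z) (at 0)"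
      using eventually_neq_at_within[of 0 0]
      by eventually_elim (simp add: K_def field_simps power2_eq_square power3_eq_cube)
    ultimately show ?thesis using tendsto_cong by fastforce
  qed
  have odd: "K (- z) = - K z" if "z \<notin> H" for z
    using wp_even[of "z + v"] wp_even[of "z - v"] wp_even[of z] wp_deriv_odd[OF that]
    by (simp add: K_def) (simp add: algebra_simps)
  have "pole_le 2 0 K" by (rule pole_le_reduce[OF ell_mero[OF K] K3])
  moreover have "eventually (\<lambda>z. K (- z) = - K z) (at 0)"
    by (rule eventually_mono[OF eventually_not_in_sparse[OF H_sparse] odd])
  ultimately have P1: "pole_le 1 0 K"
    by (intro odd_pole_le ell_mero[OF K])
  have poleD: "pole_le 0 a K" if "a \<in> D - H" for a
  proof (rule ell_pole_le_pts[OF K pD, of a "{v, - v}"])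
    show "a \<in> pts {v, - v}" using that by (auto simp: D pts_def)
  qed (use pole in auto)
  have ext: "ell H 1 1 (remove_sings K)" "\<And>z. z \<notin> D \<Longrightarrow> remove_sings K z = K z"
    "\<And>a. eventually (\<lambda>z. remove_sings K z = K z) (at a)"
    using ell_extend[OF K pD polar_H HD] poleD by blast+
  have "pole_le 1 0 (remove_sings K)"
    using pole_le_cong[OF ext(3)] P1 by blast
  then obtain c where c: "\<And>z. z \<notin> H \<Longrightarrow> remove_sings K z = c"
    using ell_simple_pole[OF ext(1)] by blast
  have Kc: "K z = c" if "z \<notin> D" for z using c[of z] ext(2) that HD by auto
  have zD: "z \<notin> D" "- z \<notin> D" using z H_uminus[of "z + v"] H_uminus[of "z - v"] by (auto simp: D)
  have "c = - c" using Kc[OF zD(1)] Kc[OF zD(2)] odd[OF z(1)] by simp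
  hence "c = 0" by simp
  thus ?thesis using Kc[OF zD(1)] by (simp add: K_def eq_neg_iff_add_eq_0)
qed

text \<open>If the derivative vanishes at \<open>v\<close>, the shift identity makes
  \<open>wp (z + v)\<close> and \<open>wp (z - v)\<close> equal near \<open>v\<close>. The second
  has a pole at \<open>z = v\<close>, while the first is continuous there unless
  \<open>2 * v\<close> is in \<open>H\<close>.\<close>

lemma wp_deriv_zero:
  assumes v: "v \<notin> H" and "deriv wp v = 0"
  shows "2 * v \<in> H"
proof (rule ccontr)
  assume v2: "2 * v \<notin> H"
  have "eventually (\<lambda>z. z \<notin> pts {0, v, - v}) (at v)"
    by (intro eventually_not_in_sparse polar_sparse polar_pts) simp
  hence ev: "eventually (\<lambda>z. wp (z + v) = wp (z - v)) (at v)"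
    using wp_neq_ev[of "wp v" v]
  proof eventually_elim
    case (elim z)
    hence "z \<notin> H" "z - v \<notin> H" "z + v \<notin> H" by (auto simp: in_pts)
    from wp_shift_identity[OF v this] show ?case using elim(2) assms(2) by simp
  qed
  have "v + v \<notin> H" using v2 by (metis mult_2)
  hence "isCont wp (v + v)" by (intro analytic_at_imp_isCont ell_analytic[OF wp_ell polar_H])
  hence "((\<lambda>z. wp (z + v)) \<longlongrightarrow> wp (v + v)) (at v)"
    unfolding isCont_def using LIM_offset[of wp "wp (v + v)" "v + v" v] by simp
  hence "((\<lambda>z. wp (z - v)) \<longlongrightarrow> wp (v + v)) (at v)" using tendsto_cong[OF ev] by simp
  from LIM_offset[OF this, of v] have "(wp \<longlongrightarrow> wp (v + v)) (at 0)" by simp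
  hence "((\<lambda>z. z ^ 2 * wp z) \<longlongrightarrow> 0 ^ 2 * wp (v + v)) (at 0)" by (intro tendsto_intros)
  with wp_lim show False using tendsto_unique[of "at (0::complex)"] by fastforce
qed

lemma wp_deriv_zero_iff:
  assumes "v \<notin> H"
  shows "deriv wp v = 0 \<longleftrightarrow> 2 * v \<in> H"
proof
  assume "2 * v \<in> H"
  hence "deriv wp (- v + 2 * v) = deriv wp (- v)"
    using assms by (intro ell_period[OF wp_deriv_ell]) auto
  thus "deriv wp v = 0" using wp_deriv_odd[OF assms] by simp
qed (rule wp_deriv_zero[OF assms])

lemma pole_le_mult_double_zero:
  assumes "pole_le (Suc (Suc n)) a f" "f meromorphic_on {a}" "g analytic_on {a}" "g a = 0" "deriv g a = 0"
  shows "pole_le n a (\<lambda>z. f z * g z)"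
proof (rule pole_le_reduce)
  show "(\<lambda>z. f z * g z) meromorphic_on {a}"
    by (rule meromorphic_on_mult[OF assms(2) analytic_on_imp_meromorphic_on[OF assms(3)]])
  obtain c where c: "((\<lambda>z. (z - a) ^ Suc (Suc n) * f z) \<longlongrightarrow> c) (at a)"
    using assms(1) by (auto simp: pole_le_def)
  have "(g has_field_derivative deriv g a) (at a)"
    using assms(3) analytic_on_imp_differentiable_at DERIV_deriv_iff_field_differentiable by blast
  hence "((\<lambda>z. g z / (z - a)) \<longlongrightarrow> 0) (at a)"
    by (simp add: has_field_derivative_iff assms)
  from tendsto_mult[OF c this]
  have "((\<lambda>z. (z - a) ^ Suc (Suc n) * f z * (g z / (z - a))) \<longlongrightarrow> 0) (at a)" by simp
  moreover have "eventually (\<lambda>z. (z - a) ^ Suc (Suc n) * f z * (g z / (z - a)) = (z - a) ^ Suc n * (f z * g z)) (at a)"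
    using eventually_neq_at_within[of a a] by eventually_elim (auto simp: field_simps)
  ultimately show "((\<lambda>z. (z - a) ^ Suc n * (f z * g z)) \<longlongrightarrow> 0) (at a)"
    using tendsto_cong by fast
qed

text \<open>At a point \<open>v\<close> of order two, \<open>wp z - wp v\<close> has a double zero.
  In the product with its translate by \<open>v\<close> each double pole meets a double zero, so the
  product is constant; a further zero \<open>u\<close> would make it vanish identically.\<close>

lemma wp_neq_half_period:
  assumes v: "v \<notin> H" "2 * v \<in> H" and u: "u \<notin> H" "u - v \<notin> H"
  shows "wp u \<noteq> wp v"
proof
  assume eq: "wp u = wp v"
  define D where "D = pts {0, v}"
  have D: "D = H \<union> {z. z - v \<in> H}" by (auto simp: D_def pts_def)
  have pD: "polar_set D" unfolding D_def by (rule polar_pts) simp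
  have f: "ell D 1 1 (\<lambda>z. wp z - wp v)"
    by (intro ell_diff ell_const ell_mono[OF wp_ell]) (auto simp: D)
  have g: "ell D 1 1 (\<lambda>z. wp (z - v) - wp v)"
    using ell_mono[OF ell_translate[OF wp_ell, of "- v"], of D]
    by (intro ell_diff ell_const) (auto simp: D)
  have q: "ell D 1 1 (\<lambda>z. (wp z - wp v) * (wp (z - v) - wp v))" using ell_mult[OF f g] by simp
  have d0: "deriv wp v = 0" "deriv wp (- v) = 0"
    using wp_deriv_zero_iff[OF v(1)] v(2) wp_deriv_odd[OF v(1)] by auto
  have p0: "pole_le 0 0 (\<lambda>z. (wp z - wp v) * (wp (z - v) - wp v))"
  proof (rule pole_le_mult_double_zero)
    show "pole_le (Suc (Suc 0)) 0 (\<lambda>z. wp z - wp v)"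
      using wp_pole_le[of 0] by (intro pole_le_diff[OF _ pole_le_analytic]) (auto simp: numeral_2_eq_2)
    have "(wp has_field_derivative 0) (at (0 - v))" using wp_has_deriv[of "- v"] v(1) d0 by simp
    hence "((\<lambda>z. wp (z - v) - wp v) has_field_derivative 0) (at 0)"
      using DERIV_shift[of wp 0 0 "- v"] by (auto intro!: derivative_eq_intros)
    thus "deriv (\<lambda>z. wp (z - v) - wp v) 0 = 0" by (rule DERIV_imp_deriv)
    have "(wp \<circ> (\<lambda>z. z - v)) analytic_on {0}"
      by (intro analytic_on_compose) (use v in \<open>auto intro!: analytic_intros ell_analytic[OF wp_ell polar_H]\<close>)
    thus "(\<lambda>z. wp (z - v) - wp v) analytic_on {0}" by (intro analytic_intros) (simp add: o_def)
  qed (use wp_even[of v] in \<open>auto intro: ell_mero[OF f]\<close>)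
  have pv: "pole_le 0 v (\<lambda>z. (wp (z - v) - wp v) * (wp z - wp v))"
  proof (rule pole_le_mult_double_zero)
    have "pole_le 2 v (\<lambda>z. wp (z - v))" using wp_pole_le[of 0] pole_le_shift[of 2 v wp "- v"] by simp
    thus "pole_le (Suc (Suc 0)) v (\<lambda>z. wp (z - v) - wp v)"
      by (intro pole_le_diff[OF _ pole_le_analytic]) (auto simp: numeral_2_eq_2)
    show an: "(\<lambda>z. wp z - wp v) analytic_on {v}"
      by (intro analytic_intros ell_analytic[OF wp_ell polar_H] v)
    show "deriv (\<lambda>z. wp z - wp v) v = 0"
      by (rule DERIV_imp_deriv) (use wp_has_deriv[OF v(1)] d0 in \<open>auto intro!: derivative_eq_intros\<close>)
  qed (auto intro: ell_mero[OF g])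
  have "pole_le 0 a (\<lambda>z. (wp z - wp v) * (wp (z - v) - wp v))" if "a \<in> D" for a
    by (rule ell_pole_le_pts[OF q pD, of a "{0, v}"]) (use that p0 pv in \<open>auto simp: D_def mult.commute\<close>)
  then obtain c where c: "\<And>z. z \<notin> D \<Longrightarrow> (wp z - wp v) * (wp (z - v) - wp v) = c"
    using ell_Liouville[OF q pD] by auto
  have "c = 0" using c[of u] u eq by (auto simp: D)
  with c have "(\<forall>z. z \<notin> D \<longrightarrow> wp z - wp v = 0) \<or> (\<forall>z. z \<notin> D \<longrightarrow> wp (z - v) - wp v = 0)"
    by (intro ell_mult_eq_0[OF f g pD]) auto
  thus False
  proof
    assume *: "\<forall>z. z \<notin> D \<longrightarrow> wp z - wp v = 0"
    have "eventually (\<lambda>z. False) (at (0::complex))"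
      using wp_neq_ev[of "wp v" 0] eventually_not_in_sparse[OF polar_sparse[OF pD], of 0]
      by eventually_elim (use * in auto)
    thus False by simp
  next
    assume *: "\<forall>z. z \<notin> D \<longrightarrow> wp (z - v) - wp v = 0"
    have "at 0 = filtermap (\<lambda>z. z - v) (at v)" using filtermap_at_shift[of v v] by simp
    hence "eventually (\<lambda>z. wp (z - v) \<noteq> wp v) (at v)" using wp_neq_ev[of "wp v" 0] by (simp add: eventually_filtermap)
    hence "eventually (\<lambda>z. False) (at v)"
      using eventually_not_in_sparse[OF polar_sparse[OF pD], of v] by eventually_elim (use * in auto)
    thus False by simp
  qed
qed

text \<open>If neither \<open>u - v\<close> nor \<open>u + v\<close> is in \<open>H\<close>, the
  shift identity at \<open>z = u\<close> makes \<open>deriv wp\<close> vanish at \<open>u\<close> or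
  \<open>v\<close>. One of the points then has order two, and \<open>wp\<close> takes its value
  there at no other class.\<close>

lemma wp_eq_iff:
  assumes u: "u \<notin> H" and v: "v \<notin> H"
  shows "wp u = wp v \<longleftrightarrow> u - v \<in> H \<or> u + v \<in> H"
proof
  assume eq: "wp u = wp v"
  show "u - v \<in> H \<or> u + v \<in> H"
  proof (rule ccontr)
    assume *: "\<not> ?thesis"
    hence "deriv wp v * deriv wp u = 0" using wp_shift_identity[OF v u] eq by simp
    hence "2 * v \<in> H \<or> 2 * u \<in> H" using wp_deriv_zero u v by auto
    thus False
      using wp_neq_half_period[OF v _ u] wp_neq_half_period[OF u _ v] * eq H_diff_commute[of u v] by metis
  qed
next
  assume "u - v \<in> H \<or> u + v \<in> H"
  thus "wp u = wp v"
    using wp_period[of "u - v" v] wp_period[of "u + v" "- v"] wp_even[of v] by auto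
qed

section \<open>Comparison with the period lattice and with D_2-orbits\<close>

lemma wp_half_lattice: "wp z = 4 * weierstrass_p (period_lattice \<tau>) (2 * z)"
proof -
  have "wp_reg z = (\<Sum>\<^sub>\<infinity>\<omega>\<in>period_lattice \<tau> - {0}. 4 * (1 / (2 * z - \<omega>)^2 - 1 / \<omega>^2))"
    unfolding wp_reg_def
  proof (rule infsum_reindex_bij_witness[where i = "\<lambda>\<omega>. \<omega> / 2" and j = "\<lambda>\<omega>. 2 * \<omega>"])
    fix a assume "a \<in> H - {0}"
    have "(2 * z - 2 * a)^2 = 4 * (z - a)^2" by (simp add: power2_eq_square algebra_simps)
    thus "4 * (1 / (2 * z - 2 * a)^2 - 1 / (2 * a)^2) = 1 / (z - a)^2 - 1 / a^2"
      by (simp add: power_mult_distrib)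
  qed (auto simp: H_iff_lattice)
  also have "\<dots> = 4 * (\<Sum>\<^sub>\<infinity>\<omega>\<in>period_lattice \<tau> - {0}. 1 / (2 * z - \<omega>)^2 - 1 / \<omega>^2)"
    by (rule infsum_cmult_right')
  finally show ?thesis by (simp add: wp_eq weierstrass_p_def[of "period_lattice \<tau>"] power_mult_distrib)
qed

lemma D2_orbit_pts: "D2_orbit \<tau> S = pts S"
proof (intro subset_antisym subsetI)
  fix z assume "z \<in> D2_orbit \<tau> S"
  then obtain \<gamma> s m n where *: "s \<in> S" "z = sigma \<tau> \<gamma> s + (of_int m + of_int n * \<tau>)"
    by (auto simp: D2_orbit_def period_lattice_def)
  obtain a b where \<gamma>: "\<gamma> = (a, b)" by (cases \<gamma>)
  have "(of_int (2 * m) + of_int (2 * n) * \<tau>) / 2 \<in> H" unfolding H_iff by blast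
  moreover have "(of_int (2 * m) + of_int (2 * n) * \<tau>) / 2 = of_int m + of_int n * \<tau>" by (simp add: add_divide_distrib)
  ultimately have "of_int m + of_int n * \<tau> \<in> H" by metis
  hence "(if a = 1 then 1/2 else 0) + (if b = 1 then \<tau>/2 else 0) + (of_int m + of_int n * \<tau>) \<in> H"
    by (intro H_add[OF H_add]) auto
  moreover have "z - s = (if a = 1 then 1/2 else 0) + (if b = 1 then \<tau>/2 else 0) + (of_int m + of_int n * \<tau>)"
    by (simp add: * \<gamma>)
  ultimately show "z \<in> pts S" unfolding in_pts using *(1) by (intro bexI[of _ s]) (simp_all only:)
next
  fix z assume "z \<in> pts S"
  then obtain s m n where *: "s \<in> S" "z - s = (of_int m + of_int n * \<tau>) / 2"
    by (auto simp only: in_pts H_iff)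
  \<comment> \<open>The parities of \<open>m\<close> and \<open>n\<close> select the group element;
    the quotients by 2 give the remaining lattice vector.\<close>
  define a b :: bit where "a = (if even m then 0 else 1)" and "b = (if even n then 0 else 1)"
  have m: "of_int m = 2 * of_int (m div 2) + (if a = 1 then 1 else 0 :: complex)"
  proof -
    have "of_int m = 2 * of_int (m div 2) + (of_int (m mod 2) :: complex)"
      by (metis mult_div_mod_eq of_int_add of_int_mult of_int_numeral)
    thus ?thesis by (cases "even m") (simp_all add: a_def even_iff_mod_2_eq_zero odd_iff_mod_2_eq_one)
  qed
  have n: "of_int n = 2 * of_int (n div 2) + (if b = 1 then 1 else 0 :: complex)"
  proof -
    have "of_int n = 2 * of_int (n div 2) + (of_int (n mod 2) :: complex)"
      by (metis mult_div_mod_eq of_int_add of_int_mult of_int_numeral)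
    thus ?thesis by (cases "even n") (simp_all add: b_def even_iff_mod_2_eq_zero odd_iff_mod_2_eq_one)
  qed
  have "z = s + (z - s)" by simp
  also have "\<dots> = sigma \<tau> (a, b) s + (of_int (m div 2) + of_int (n div 2) * \<tau>)"
    unfolding *(2) by (subst m, subst n) (simp add: field_simps)
  finally show "z \<in> D2_orbit \<tau> S" unfolding D2_orbit_def period_lattice_def using *(1) by blast
qed

end

section \<open>Theta functions\<close>

definition theta_term :: "real \<Rightarrow> real \<Rightarrow> complex \<Rightarrow> complex \<Rightarrow> int \<Rightarrow> complex" where
  "theta_term a b z \<tau> m = exp (of_real pi * \<i> * \<tau> * (of_int m + of_real a)^2
          + 2 * of_real pi * \<i> * (of_int m + of_real a) * (z + of_real b))"

lemma theta_eq: "theta a b z \<tau> = (\<Sum>\<^sub>\<infinity>m. theta_term a b z \<tau> m)"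
  by (simp add: theta_def theta_term_def)

lemma summable_exp_int: "(\<lambda>m::int. exp (- real_of_int \<bar>m\<bar>)) summable_on UNIV"
proof -
  have "summable (\<lambda>n. exp (- 1 :: real) ^ n)" by (intro summable_geometric) simp
  hence "summable (\<lambda>n. exp (- real n))" by (simp add: exp_of_nat_mult[symmetric])
  from summable_on_int[OF this] show ?thesis by simp
qed

text \<open>Completing the square bounds \<open>- pi * t * x^2 + S * \<bar>x\<bar>\<close> by
  \<open>S^2 / (4 * pi * t)\<close>. The summand 1 in \<open>S = 2 * pi * R + 1\<close> reserves the
  factor \<open>exp (- \<bar>x\<bar>)\<close> that makes the bound summable in \<open>m\<close>,
  uniformly for bounded \<open>Im z\<close>.\<close>

lemma theta_term_bound:
  assumes "Im \<tau> > 0" "\<bar>Im z\<bar> \<le> R"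
  shows "norm (theta_term a b z \<tau> m)
    \<le> exp ((2 * pi * R + 1)^2 / (4 * pi * Im \<tau>) + \<bar>a\<bar>) * exp (- real_of_int \<bar>m\<bar>)"
proof -
  define x where "x = of_int m + a"
  define t where "t = Im \<tau>"
  define S where "S = 2 * pi * R + 1"
  have R: "R \<ge> 0" using assms(2) by linarith
  have t: "t > 0" using assms by (simp add: t_def)
  have cx: "of_int m + complex_of_real a = of_real x" by (simp add: x_def)
  have "norm (theta_term a b z \<tau> m) = exp (- (pi * t * x^2) - 2 * pi * x * Im z)"
    unfolding theta_term_def cx norm_exp_eq_Re
    by (simp add: t_def power2_eq_square algebra_simps)
  also have "- (pi * t * x^2) - 2 * pi * x * Im z \<le> S^2 / (4 * pi * t) - \<bar>x\<bar>"
  proof -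
    have "- (x * Im z) \<le> \<bar>x\<bar> * R"
    proof -
      have "- (x * Im z) \<le> \<bar>x * Im z\<bar>" by linarith
      also have "\<dots> \<le> \<bar>x\<bar> * R" unfolding abs_mult using assms(2) by (intro mult_left_mono) auto
      finally show ?thesis .
    qed
    hence 1: "- 2 * pi * x * Im z \<le> 2 * pi * R * \<bar>x\<bar>"
      using mult_left_mono[of "- (x * Im z)" "\<bar>x\<bar> * R" "2 * pi"] by (simp add: mult_ac)
    have "0 \<le> (2 * pi * t * \<bar>x\<bar> - S)^2" by simp
    also have "\<dots> = 4 * pi * t * (pi * t * x^2 - S * \<bar>x\<bar>) + S^2"
      by (simp add: power2_eq_square algebra_simps flip: abs_mult)
    finally have "- (pi * t * x^2) + S * \<bar>x\<bar> \<le> S^2 / (4 * pi * t)"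
      using t by (simp add: field_simps)
    with 1 show ?thesis by (simp add: S_def algebra_simps)
  qed
  also have "S^2 / (4 * pi * t) - \<bar>x\<bar> \<le> S^2 / (4 * pi * t) + \<bar>a\<bar> + (- real_of_int \<bar>m\<bar>)"
    by (simp add: x_def)
  finally have "norm (theta_term a b z \<tau> m) \<le> exp (S^2 / (4 * pi * t) + \<bar>a\<bar> + (- real_of_int \<bar>m\<bar>))"
    by simp
  thus ?thesis unfolding exp_add[of "_ + _"] S_def t_def .
qed

lemma theta_term_summable_norm:
  assumes "Im \<tau> > 0"
  shows "(\<lambda>m. norm (theta_term a b z \<tau> m)) summable_on UNIV"
  by (rule Infinite_Sum.abs_summable_on_comparison_test'[OF summable_on_cmult_right[OF summable_exp_int]
        theta_term_bound[OF assms order.refl]])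

lemma theta_term_summable: "Im \<tau> > 0 \<Longrightarrow> theta_term a b z \<tau> summable_on UNIV"
  using abs_summable_summable[OF theta_term_summable_norm] .

lemma theta_holomorphic:
  assumes "Im \<tau> > 0"
  shows "(\<lambda>z. theta a b z \<tau>) holomorphic_on A"
proof -
  have "(\<lambda>z. theta a b z \<tau>) analytic_on {w}" for w
  proof -
    define r where "r = norm w + 1"
    have "(\<lambda>z. \<Sum>\<^sub>\<infinity>m\<in>UNIV. theta_term a b z \<tau> m) holomorphic_on ball 0 r"
    proof (rule holomorphic_infsum[where UNIV' = UNIV])
      show "(\<lambda>z. theta_term a b z \<tau> m) holomorphic_on UNIV" for m
        unfolding theta_term_def by (intro holomorphic_intros)
      show "norm (theta_term a b z \<tau> m)
          \<le> exp ((2 * pi * r + 1)^2 / (4 * pi * Im \<tau>) + \<bar>a\<bar>) * exp (- real_of_int \<bar>m\<bar>)"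
        if "z \<in> cball 0 r" for m z
      proof (rule theta_term_bound[OF assms])
        show "\<bar>Im z\<bar> \<le> r" using abs_Im_le_cmod[of z] that by simp
      qed
      show "(\<lambda>m. exp ((2 * pi * r + 1)^2 / (4 * pi * Im \<tau>) + \<bar>a\<bar>) * exp (- real_of_int \<bar>m\<bar>)) summable_on UNIV"
        by (rule summable_on_cmult_right[OF summable_exp_int])
    qed auto
    moreover have "w \<in> ball 0 r" by (simp add: r_def)
    ultimately show ?thesis unfolding theta_eq using analytic_at open_ball by blast
  qed
  thus ?thesis by (meson analytic_imp_holomorphic analytic_on_analytic_at)
qed

lemma exp_eqI: "a = b + 2 * of_real pi * \<i> * of_int n \<Longrightarrow> exp a = exp (b :: complex)"
  using exp_integer_2pi[of "of_int n"] by (simp add: exp_add mult_ac)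

section \<open>Translations, characteristics and reflection\<close>

lemma theta_add_1: "theta a b (z + 1) \<tau> = exp (2 * of_real pi * \<i> * of_real a) * theta a b z \<tau>"
  unfolding theta_eq infsum_cmult_right'[symmetric] theta_term_def exp_add[symmetric]
proof (rule infsum_cong, goal_cases)
  case (1 m)
  show ?case by (rule exp_eqI[of _ _ m]) (simp add: algebra_simps)
qed

lemma theta_add_tau:
  "theta a b (z + \<tau>) \<tau> = exp (- of_real pi * \<i> * \<tau> - 2 * of_real pi * \<i> * (z + of_real b)) * theta a b z \<tau>"
  unfolding theta_eq infsum_cmult_right'[symmetric]
proof (rule infsum_reindex_bij_witness[where i = "\<lambda>m. m - 1" and j = "\<lambda>m. m + 1"])
  fix m :: int
  show "exp (- of_real pi * \<i> * \<tau> - 2 * of_real pi * \<i> * (z + of_real b)) * theta_term a b z \<tau> (m + 1)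
      = theta_term a b (z + \<tau>) \<tau> m"
    unfolding theta_term_def exp_add[symmetric]
    by (rule arg_cong[of _ _ exp]) (simp add: power2_eq_square algebra_simps)
qed auto

lemma theta_char_a: "theta (a + 1) b z \<tau> = theta a b z \<tau>"
  unfolding theta_eq
  by (rule infsum_reindex_bij_witness[where i = "\<lambda>m. m - 1" and j = "\<lambda>m. m + 1"])
     (auto simp: theta_term_def add_ac)

lemma theta_char_b: "theta a (b + 1) z \<tau> = exp (2 * of_real pi * \<i> * of_real a) * theta a b z \<tau>"
  using theta_add_1[of a b z \<tau>] by (simp add: theta_def add_ac)

lemma theta_minus: "theta a b (- z) \<tau> = theta (- a) (- b) z \<tau>"
  unfolding theta_eq
proof (rule infsum_reindex_bij_witness[where i = uminus and j = uminus])
  fix m :: int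
  show "theta_term (- a) (- b) z \<tau> (- m) = theta_term a b (- z) \<tau> m"
    unfolding theta_term_def
    by (rule arg_cong[of _ _ exp]) (simp add: power2_eq_square algebra_simps)
qed auto

lemma theta_shift:
  "theta a b z \<tau> = exp (of_real pi * \<i> * \<tau> * of_real a ^ 2 + 2 * of_real pi * \<i> * of_real a * (z + of_real b))
     * theta 0 0 (z + of_real a * \<tau> + of_real b) \<tau>"
  unfolding theta_eq infsum_cmult_right'[symmetric] theta_term_def exp_add[symmetric]
  by (intro infsum_cong arg_cong[of _ _ exp]) (simp add: power2_eq_square algebra_simps)

lemma infsum_mult_int:
  fixes f g :: "int \<Rightarrow> complex"
  assumes "(\<lambda>m. norm (f m)) summable_on UNIV" "(\<lambda>m. norm (g m)) summable_on UNIV"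
  shows "infsum f UNIV * infsum g UNIV = (\<Sum>\<^sub>\<infinity>(m, n)\<in>UNIV. f m * g n)"
    and "(\<lambda>(m, n). f m * g n) summable_on UNIV"
proof -
  have "(\<lambda>(m, n). norm (f m) * norm (g n)) summable_on UNIV"
    by (rule summable_on_int_product[OF assms]) auto
  hence "(\<lambda>p. norm (case p of (m, n) \<Rightarrow> f m * g n)) summable_on UNIV"
    by (simp add: case_prod_unfold norm_mult)
  thus s: "(\<lambda>(m, n). f m * g n) summable_on UNIV" by (rule abs_summable_summable)
  have "(\<Sum>\<^sub>\<infinity>(m, n)\<in>Sigma UNIV (\<lambda>_. UNIV). f m * g n) = (\<Sum>\<^sub>\<infinity>m. \<Sum>\<^sub>\<infinity>n. f m * g n)"
    by (rule infsum_Sigma'_banach[symmetric]) (use s in simp)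
  also have "\<dots> = (\<Sum>\<^sub>\<infinity>m. f m * infsum g UNIV)" by (simp add: infsum_cmult_right')
  also have "\<dots> = infsum f UNIV * infsum g UNIV" by (rule infsum_cmult_left')
  finally show "infsum f UNIV * infsum g UNIV = (\<Sum>\<^sub>\<infinity>(m, n)\<in>UNIV. f m * g n)" by simp
qed

text \<open>Summing over \<open>m + n\<close> and \<open>m - n\<close>, which have the same parity \<open>e\<close>, separates the two exponentials.\<close>

lemma theta_product:
  assumes "Im \<tau> > 0"
  shows "theta a b x \<tau> * theta a' b' y \<tau> =
    theta ((a + a') / 2) (b + b') (x + y) (2 * \<tau>) * theta ((a - a') / 2) (b - b') (x - y) (2 * \<tau>) +
    theta ((a + a' + 1) / 2) (b + b') (x + y) (2 * \<tau>) * theta ((a - a' + 1) / 2) (b - b') (x - y) (2 * \<tau>)"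
proof -
  have im2: "Im (2 * \<tau>) > 0" using assms by simp
  define F where "F = (\<lambda>(m, n). theta_term a b x \<tau> m * theta_term a' b' y \<tau> n)"
  define A where "A = (\<lambda>e::int. {(m::int, n::int). even (m + n + e)})"
  have FS: "F summable_on UNIV" and FI: "theta a b x \<tau> * theta a' b' y \<tau> = infsum F UNIV"
    unfolding F_def theta_eq
    by (rule infsum_mult_int; rule theta_term_summable_norm[OF assms])+
  have U: "UNIV = A 0 \<union> A 1" "A 0 \<inter> A 1 = {}" by (auto simp: A_def)
  have "infsum F UNIV = infsum F (A 0) + infsum F (A 1)"
    unfolding U(1) using summable_on_subset_banach[OF FS subset_UNIV] U(2)
    by (intro infsum_Un_disjoint) auto
  moreover have "infsum F (A e) = theta ((a + a' + of_int e) / 2) (b + b') (x + y) (2 * \<tau>)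
      * theta ((a - a' + of_int e) / 2) (b - b') (x - y) (2 * \<tau>)" for e
  proof -
    define G where "G = (\<lambda>(p, q). theta_term ((a + a' + of_int e) / 2) (b + b') (x + y) (2 * \<tau>) p *
       theta_term ((a - a' + of_int e) / 2) (b - b') (x - y) (2 * \<tau>) q)"
    have "infsum G UNIV = infsum F (A e)"
    proof (rule infsum_reindex_bij_witness[where j = "\<lambda>(p, q). (p + q + e, p - q)"
          and i = "\<lambda>(m, n). ((m + n - e) div 2, (m - n - e) div 2)"])
      show "(case (case pq of (p, q) \<Rightarrow> (p + q + e, p - q)) of (m, n) \<Rightarrow> ((m + n - e) div 2, (m - n - e) div 2)) = pq" for pq
        by (cases pq) simp
      show "(case (case mn of (m, n) \<Rightarrow> ((m + n - e) div 2, (m - n - e) div 2)) of (p, q) \<Rightarrow> (p + q + e, p - q)) = mn"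
        if "mn \<in> A e" for mn
      proof -
        obtain m n where mn: "mn = (m, n)" by (cases mn)
        have "even (m + n - e)" "even (m - n - e)" using that by (auto simp: mn A_def)
        then obtain k l where "m + n - e = 2 * k" "m - n - e = 2 * l" by (meson evenE)
        thus ?thesis by (simp add: mn)
      qed
      show "F (case pq of (p, q) \<Rightarrow> (p + q + e, p - q)) = G pq" for pq
      proof -
        obtain p q where pq: "pq = (p, q)" by (cases pq)
        show ?thesis
          unfolding pq F_def G_def prod.case theta_term_def exp_add[symmetric]
          by (rule arg_cong[of _ _ exp])
             (simp add: power2_eq_square field_simps)
      qed
    qed (auto simp: A_def)
    also have "infsum G UNIV = theta ((a + a' + of_int e) / 2) (b + b') (x + y) (2 * \<tau>)
      * theta ((a - a' + of_int e) / 2) (b - b') (x - y) (2 * \<tau>)"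
      unfolding G_def theta_eq
      by (rule infsum_mult_int(1)[symmetric]; rule theta_term_summable_norm[OF im2])
    finally show ?thesis by simp
  qed
  ultimately show ?thesis using FI by simp
qed

section \<open>Products of theta functions in terms of the doubled modulus\<close>

lemma theta_half_char: "theta a 1 z \<tau> = exp (2 * of_real pi * \<i> * of_real a) * theta a 0 z \<tau>"
  using theta_char_b[of a 0 z \<tau>] by simp

lemma exp_pi_i': "exp (of_real pi * \<i>) = -1" "exp (\<i> * of_real pi) = -1"
  using exp_pi_i by (simp_all add: mult.commute)

lemma theta33:
  assumes "Im \<tau> > 0"
  shows "theta3 x \<tau> * theta3 y \<tau> =
    theta3 (x + y) (2 * \<tau>) * theta3 (x - y) (2 * \<tau>) + theta2 (x + y) (2 * \<tau>) * theta2 (x - y) (2 * \<tau>)"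
  using theta_product[OF assms, of 0 0 x 0 0 y] by (simp add: theta3_def theta2_def)

lemma theta44:
  assumes "Im \<tau> > 0"
  shows "theta4 x \<tau> * theta4 y \<tau> =
    theta3 (x + y) (2 * \<tau>) * theta3 (x - y) (2 * \<tau>) - theta2 (x + y) (2 * \<tau>) * theta2 (x - y) (2 * \<tau>)"
  using theta_product[OF assms, of 0 "1/2" x 0 "1/2" y]
  by (simp add: theta3_def theta2_def theta4_def theta_half_char exp_pi_i')

lemma theta22:
  assumes "Im \<tau> > 0"
  shows "theta2 x \<tau> * theta2 y \<tau> =
    theta2 (x + y) (2 * \<tau>) * theta3 (x - y) (2 * \<tau>) + theta3 (x + y) (2 * \<tau>) * theta2 (x - y) (2 * \<tau>)"
  using theta_product[OF assms, of "1/2" 0 x "1/2" 0 y] theta_char_a[of 0 0]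
  by (simp add: theta3_def theta2_def)

lemma theta11:
  assumes "Im \<tau> > 0"
  shows "theta1 x \<tau> * theta1 y \<tau> =
    theta3 (x + y) (2 * \<tau>) * theta2 (x - y) (2 * \<tau>) - theta2 (x + y) (2 * \<tau>) * theta3 (x - y) (2 * \<tau>)"
  using theta_product[OF assms, of "1/2" "1/2" x "1/2" "1/2" y] theta_char_a[of 0 0]
    theta_char_a[of 0 1]
  by (simp add: theta3_def theta2_def theta1_def theta_half_char exp_pi_i')

lemma theta_even: "theta2 (- z) \<tau> = theta2 z \<tau>" "theta3 (- z) \<tau> = theta3 z \<tau>" "theta4 (- z) \<tau> = theta4 z \<tau>"
  and theta1_odd: "theta1 (- z) \<tau> = - theta1 z \<tau>"
  using theta_minus[of _ _ z \<tau>] theta_char_a[of "- 1/2" 0 z \<tau>] theta_char_a[of "- 1/2" "- 1/2" z \<tau>]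
    theta_char_b[of 0 "- 1/2" z \<tau>] theta_char_b[of "1/2" "- 1/2" z \<tau>]
  by (simp_all add: theta1_def theta2_def theta3_def theta4_def exp_pi_i')

lemma theta1_0 [simp]: "theta1 0 \<tau> = 0"
  using theta1_odd[of 0 \<tau>] by simp

lemma theta_add_1s:
  "theta1 (z + 1) \<tau> = - theta1 z \<tau>" "theta2 (z + 1) \<tau> = - theta2 z \<tau>"
  "theta3 (z + 1) \<tau> = theta3 z \<tau>" "theta4 (z + 1) \<tau> = theta4 z \<tau>"
  using theta_add_1[of _ _ z \<tau>]
  by (simp_all add: theta1_def theta2_def theta3_def theta4_def exp_pi_i')

text \<open>The factor of automorphy for \<open>\<tau>\<close>. Up to sign it is common to the four
  theta functions, so it cancels in their quotients.\<close>

definition theta_factor :: "complex \<Rightarrow> complex \<Rightarrow> complex" where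
  "theta_factor z \<tau> = exp (- of_real pi * \<i> * \<tau> - 2 * of_real pi * \<i> * z)"

lemma theta_factor_nz [simp]: "theta_factor z \<tau> \<noteq> 0" by (simp add: theta_factor_def)

lemma theta_add_taus:
  "theta1 (z + \<tau>) \<tau> = - (theta_factor z \<tau> * theta1 z \<tau>)" "theta2 (z + \<tau>) \<tau> = theta_factor z \<tau> * theta2 z \<tau>"
  "theta3 (z + \<tau>) \<tau> = theta_factor z \<tau> * theta3 z \<tau>" "theta4 (z + \<tau>) \<tau> = - (theta_factor z \<tau> * theta4 z \<tau>)"
proof -
  have "exp (- of_real pi * \<i> * \<tau> - 2 * of_real pi * \<i> * (z + of_real (1/2))) = - theta_factor z \<tau>"
    by (simp add: theta_factor_def algebra_simps exp_diff exp_add exp_pi_i')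
  thus "theta1 (z + \<tau>) \<tau> = - (theta_factor z \<tau> * theta1 z \<tau>)" "theta4 (z + \<tau>) \<tau> = - (theta_factor z \<tau> * theta4 z \<tau>)"
    using theta_add_tau[of _ "1/2" z \<tau>] by (simp_all add: theta1_def theta4_def)
  show "theta2 (z + \<tau>) \<tau> = theta_factor z \<tau> * theta2 z \<tau>" "theta3 (z + \<tau>) \<tau> = theta_factor z \<tau> * theta3 z \<tau>"
    using theta_add_tau[of _ 0 z \<tau>] by (simp_all add: theta2_def theta3_def theta_factor_def)
qed

lemma theta_shifts_zero:
  "theta4 z \<tau> = 0 \<longleftrightarrow> theta3 (z + 1/2) \<tau> = 0" "theta2 z \<tau> = 0 \<longleftrightarrow> theta3 (z + \<tau>/2) \<tau> = 0"
  "theta1 z \<tau> = 0 \<longleftrightarrow> theta3 (z + \<tau>/2 + 1/2) \<tau> = 0"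
  using theta_shift[of 0 "1/2" z \<tau>] theta_shift[of "1/2" 0 z \<tau>] theta_shift[of "1/2" "1/2" z \<tau>]
  by (simp_all add: theta1_def theta2_def theta3_def theta4_def)

lemma theta4_shift: "theta4 z \<tau> = theta3 (z + 1/2) \<tau>"
  using theta_shift[of 0 "1/2" z \<tau>] by (simp add: theta3_def theta4_def)

section \<open>Theta functions do not vanish identically\<close>

lemma theta3_large:
  obtains t0 where "\<And>\<tau>. Im \<tau> \<ge> t0 \<Longrightarrow> theta3 0 \<tau> \<noteq> 0"
proof -
  define S where "S = (\<Sum>\<^sub>\<infinity>m::int. exp (- real_of_int \<bar>m\<bar>))"
  have S0: "S \<ge> 0" unfolding S_def by (intro infsum_nonneg) auto
  \<comment> \<open>With \<open>Im \<tau>\<close> at least \<open>S + 2\<close> the terms of nonzero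
    index sum to at most \<open>exp (- (S + 1)) * S\<close>, which is below 1, so they cannot cancel
    the term 1 of index 0.\<close>
  define t0 where "t0 = 1 + S + 1"
  have "theta3 0 \<tau> \<noteq> 0" if t: "Im \<tau> \<ge> t0" for \<tau>
  proof
    assume z: "theta3 0 \<tau> = 0"
    have t1: "Im \<tau> \<ge> 1" "Im \<tau> > 0" using t S0 by (auto simp: t0_def)
    let ?f = "theta_term 0 0 0 \<tau>"
    have s: "?f summable_on UNIV" by (rule theta_term_summable[OF t1(2)])
    have ins: "infsum ?f (insert 0 (UNIV - {0})) = ?f 0 + infsum ?f (UNIV - {0})"
      by (rule infsum_insert) (use summable_on_subset_banach[OF s] in auto)
    have eq: "- 1 = infsum ?f (UNIV - {0})"
    proof -
      have "infsum ?f UNIV = 0" using z by (simp add: theta3_def theta_eq)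
      moreover have "?f 0 = 1" by (simp add: theta_term_def)
      moreover have "insert (0::int) (UNIV - {0}) = UNIV" by auto
      ultimately show ?thesis
        using ins by (simp add: add_eq_0_iff)
    qed
    have b: "norm (?f m) \<le> exp (- (Im \<tau> - 1)) * exp (- real_of_int \<bar>m\<bar>)" if m: "m \<in> UNIV - {0}" for m
    proof -
      have m1: "real_of_int \<bar>m\<bar> \<ge> 1" using m by (simp add: abs_if)
      have "norm (?f m) = exp (- (pi * Im \<tau> * (of_int m)^2))"
        by (simp add: theta_term_def norm_exp_eq_Re power2_eq_square algebra_simps)
      also have "- (pi * Im \<tau> * (of_int m)^2) \<le> - (Im \<tau> * real_of_int \<bar>m\<bar>)"
      proof -
        have "real_of_int \<bar>m\<bar> * 1 \<le> real_of_int \<bar>m\<bar> * real_of_int \<bar>m\<bar>" by (intro mult_left_mono m1) auto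
        hence "Im \<tau> * real_of_int \<bar>m\<bar> \<le> Im \<tau> * (of_int m)^2"
          using t1 by (intro mult_left_mono) (auto simp: power2_eq_square simp flip: abs_mult)
        also have "\<dots> = 1 * (Im \<tau> * (of_int m)^2)" by simp
        also have "\<dots> \<le> pi * (Im \<tau> * (of_int m)^2)"
          using t1 pi_gt3 by (intro mult_right_mono) auto
        finally show ?thesis by (simp add: mult_ac)
      qed
      also have "- (Im \<tau> * real_of_int \<bar>m\<bar>) \<le> - (Im \<tau> - 1) + - real_of_int \<bar>m\<bar>"
        using mult_mono[of "1" "real_of_int \<bar>m\<bar>" "Im \<tau> - 1" "Im \<tau> - 1"] m1 t1 by (simp add: algebra_simps)
      finally have "norm (?f m) \<le> exp (- (Im \<tau> - 1) + - real_of_int \<bar>m\<bar>)" by simp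
      thus ?thesis unfolding exp_add .
    qed
    have s2: "(\<lambda>m::int. exp (- real_of_int \<bar>m\<bar>)) summable_on (UNIV - {0})"
      by (rule summable_on_subset_banach[OF summable_exp_int]) auto
    have "norm (infsum ?f (UNIV - {0})) \<le> infsum (\<lambda>m. exp (- (Im \<tau> - 1)) * exp (- real_of_int \<bar>m\<bar>)) (UNIV - {0::int})"
      by (rule norm_infsum_le[OF has_sum_infsum has_sum_infsum b])
         (use summable_on_subset_banach[OF s] summable_on_cmult_right[OF s2] in auto)
    also have "\<dots> = exp (- (Im \<tau> - 1)) * infsum (\<lambda>m. exp (- real_of_int \<bar>m\<bar>)) (UNIV - {0::int})"
      by (rule infsum_cmult_right')
    also have "\<dots> \<le> exp (- (Im \<tau> - 1)) * S"
      unfolding S_def by (intro mult_left_mono infsum_mono_neutral s2 summable_exp_int) auto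
    also have "\<dots> \<le> exp (- (S + 1)) * S"
      using t S0 by (intro mult_right_mono) (auto simp: t0_def)
    also have "\<dots> < 1"
    proof -
      have "S < exp (S + 1)" using exp_ge_add_one_self[of "S + 1"] by linarith
      hence "exp (- (S + 1)) * S < exp (- (S + 1)) * exp (S + 1)" by (intro mult_strict_left_mono) auto
      thus ?thesis by (simp flip: exp_add)
    qed
    finally show False by (simp flip: eq)
  qed
  thus ?thesis using that by blast
qed

text \<open>If theta3 vanished identically for \<open>\<tau>\<close>, so would its translate theta4,
  and adding the two product formulas with \<open>y = 0\<close> would make the square of theta3 for
  \<open>2 * \<tau>\<close> vanish. Repeated doubling leads to large imaginary part.\<close>

lemma theta3_not_zero:
  assumes "Im \<tau> > 0"
  shows "\<exists>z. theta3 z \<tau> \<noteq> 0"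
proof -
  obtain t0 where t0: "\<And>\<tau>. Im \<tau> \<ge> t0 \<Longrightarrow> theta3 0 \<tau> \<noteq> 0" using theta3_large by blast
  have step: "\<exists>z. theta3 z \<tau> \<noteq> 0" if "\<exists>z. theta3 z (2 * \<tau>) \<noteq> 0" "Im \<tau> > 0" for \<tau>
  proof (rule ccontr)
    assume "\<not> ?thesis"
    hence "theta3 z \<tau> = 0" for z by blast
    hence z: "theta3 (z + 0) (2 * \<tau>) * theta3 (z - 0) (2 * \<tau>) + theta2 (z + 0) (2 * \<tau>) * theta2 (z - 0) (2 * \<tau>) = 0"
      "theta3 (z + 0) (2 * \<tau>) * theta3 (z - 0) (2 * \<tau>) - theta2 (z + 0) (2 * \<tau>) * theta2 (z - 0) (2 * \<tau>) = 0" for z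
      unfolding theta33[OF that(2), symmetric] theta44[OF that(2), symmetric] by (simp_all add: theta4_shift)
    have "theta3 z (2 * \<tau>) * theta3 z (2 * \<tau>) = 0" for z
      using z(1)[of z] z(2)[of z] by simp
    thus False using that(1) by simp
  qed
  have "\<exists>z. theta3 z \<sigma> \<noteq> 0" if "Im \<sigma> > 0" "2 ^ n * Im \<sigma> \<ge> t0" for n \<sigma>
    using that
  proof (induction n arbitrary: \<sigma>)
    case 0
    thus ?case using t0[of \<sigma>] by auto
  next
    case (Suc n)
    thus ?case using step[of \<sigma>] Suc.IH[of "2 * \<sigma>"] by (simp add: mult_ac)
  qed
  moreover obtain n where "2 ^ n * Im \<tau> \<ge> t0"
  proof -
    obtain n where "t0 / Im \<tau> < 2 ^ n" using real_arch_pow[of 2 "t0 / Im \<tau>"] by auto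
    thus ?thesis using that[of n] assms by (simp add: field_simps)
  qed
  ultimately show ?thesis using assms by blast
qed

lemma entire_mult_zero:
  assumes "f holomorphic_on UNIV" "g holomorphic_on UNIV" "\<And>z. f z * g z = (0::complex)"
  shows "(\<forall>z. f z = 0) \<or> (\<forall>z. g z = 0)"
proof (rule disjCI)
  assume "\<not> (\<forall>z. g z = 0)"
  then obtain z0 where z0: "g z0 \<noteq> 0" by blast
  have "open (g -` (- {0}))"
    using assms(2) holomorphic_on_imp_continuous_on by (intro open_vimage) auto
  moreover have "f z = 0" if "z \<in> g -` (- {0})" for z using assms(3)[of z] that by auto
  ultimately show "\<forall>z. f z = 0"
    using analytic_continuation_open[of "g -` (- {0})" UNIV f "\<lambda>_. 0"] z0 assms(1) by auto
qed

text \<open>The quotient has derivative 0 on a disc where \<open>g\<close> has no zero; the identity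
  theorem spreads the relation over the plane.\<close>

lemma entire_wronskian_zero:
  assumes f: "f holomorphic_on UNIV" and g: "g holomorphic_on UNIV"
    and eq: "\<And>z. deriv f z * g z = f z * deriv g z" and z0: "g z0 \<noteq> 0"
  obtains c where "\<And>z. f z = c * g z"
proof -
  have "open (g -` (- {0}))"
    using g holomorphic_on_imp_continuous_on by (intro open_vimage) auto
  then obtain r where r: "r > 0" "ball z0 r \<subseteq> g -` (- {0})"
    using z0 open_contains_ball by (metis ComplI singletonD vimageI2)
  have "((\<lambda>z. f z / g z) has_field_derivative 0) (at z within ball z0 r)" if "z \<in> ball z0 r" for z
  proof -
    have "g z \<noteq> 0" using r that by auto
    moreover have "(f has_field_derivative deriv f z) (at z)" "(g has_field_derivative deriv g z) (at z)"
      using f g by (auto intro: holomorphic_derivI)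
    ultimately have "((\<lambda>z. f z / g z) has_field_derivative (deriv f z * g z - f z * deriv g z) / (g z * g z)) (at z)"
      by (intro DERIV_divide)
    thus ?thesis using eq[of z] by (simp add: has_field_derivative_at_within)
  qed
  then obtain c where c: "\<And>z. z \<in> ball z0 r \<Longrightarrow> f z / g z = c"
    using has_field_derivative_zero_constant[of "ball z0 r" "\<lambda>z. f z / g z"] by auto
  have "f z = c * g z" if "z \<in> ball z0 r" for z
  proof -
    have "g z \<noteq> 0" using r that by auto
    thus ?thesis using c[OF that] by (simp add: field_simps)
  qed
  moreover have "(\<lambda>z. c * g z) holomorphic_on UNIV" by (intro holomorphic_intros g)
  ultimately have "f z = c * g z" for z
    using analytic_continuation_open[of "ball z0 r" UNIV f "\<lambda>z. c * g z"] r f connected_UNIV by auto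
  thus ?thesis using that by blast
qed

section \<open>Zeros of the theta functions\<close>

lemma exp_eq_1_int: "exp z = 1 \<Longrightarrow> \<exists>n::int. z = 2 * of_real pi * \<i> * of_int n"
proof -
  assume "exp z = 1"
  then obtain n :: int where "Re z = 0" "Im z = of_int (2 * n) * pi" unfolding exp_eq_1 by blast
  hence "z = 2 * of_real pi * \<i> * of_int n" by (simp add: complex_eq_iff)
  thus ?thesis by blast
qed

context torus
begin

lemma Im2: "Im (2 * \<tau>) > 0" using Im_pos by simp

lemma theta_hol:
  "(\<lambda>z. theta1 z \<tau>) holomorphic_on A" "(\<lambda>z. theta2 z \<tau>) holomorphic_on A"
  "(\<lambda>z. theta3 z \<tau>) holomorphic_on A" "(\<lambda>z. theta4 z \<tau>) holomorphic_on A"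
  "(\<lambda>z. theta2 z (2 * \<tau>)) holomorphic_on A" "(\<lambda>z. theta3 z (2 * \<tau>)) holomorphic_on A"
  using theta_holomorphic[OF Im_pos] theta_holomorphic[OF Im2]
  by (auto simp: theta1_def theta2_def theta3_def theta4_def intro!: holomorphic_intros)

lemma theta1_not_zero: "\<exists>z. theta1 z \<tau> \<noteq> 0"
proof -
  obtain z where "theta3 z \<tau> \<noteq> 0" using theta3_not_zero[OF Im_pos] by blast
  hence "theta1 (z - 1/2 - \<tau>/2) \<tau> \<noteq> 0" by (simp add: theta_shifts_zero)
  thus ?thesis by blast
qed

text \<open>If \<open>w\<close> is a zero, then \<open>g x = theta1 (x + w) / theta1 x\<close> has the property that \<open>g x * g y\<close> depends
  only on \<open>x + y\<close>. Hence the logarithmic derivative of \<open>g\<close> is constant.\<close>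

lemma theta1_zero_translation:
  assumes w: "theta1 w \<tau> = 0"
  obtains \<alpha> \<beta> where "\<beta> \<noteq> 0" "\<And>x. theta1 (x + w) \<tau> = \<beta> * exp (\<alpha> * x) * theta1 x \<tau>"
proof -
  define X Y t T where "X = (\<lambda>z. theta3 z (2 * \<tau>))" and "Y = (\<lambda>z. theta2 z (2 * \<tau>))"
    and "t = (\<lambda>z. theta1 z \<tau>)" and "T = (\<lambda>z. theta1 (z + w) \<tau>)"
  have hX: "X holomorphic_on UNIV" and ht: "t holomorphic_on UNIV" unfolding X_def t_def by (rule theta_hol)+
  have "(t \<circ> (\<lambda>z. z + w)) holomorphic_on UNIV"
    by (rule holomorphic_on_compose_gen[OF _ ht]) (auto intro!: holomorphic_intros)
  hence hT: "T holomorphic_on UNIV" by (simp add: T_def t_def o_def)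
  have tt: "t x * t y = X (x + y) * Y (x - y) - Y (x + y) * X (x - y)" for x y
    unfolding t_def X_def Y_def by (rule theta11[OF Im_pos])
  \<comment> \<open>The product formula at \<open>x = w\<close>, where its left-hand side
    vanishes.\<close>
  have k1: "X (s + 2 * w) * Y s = Y (s + 2 * w) * X s" for s
    using tt[of w "s + w"] w theta_even[of s "2 * \<tau>"] by (simp add: t_def X_def Y_def algebra_simps)
  have k2: "X (x + y) * (T x * T y) = X (x + y + 2 * w) * (t x * t y)" for x y
  proof -
    have TT: "T x * T y = X (x + y + 2 * w) * Y (x - y) - Y (x + y + 2 * w) * X (x - y)"
      using tt[of "x + w" "y + w"] by (simp add: T_def t_def algebra_simps)
    have "X (x + y) * (T x * T y) = X (x + y) * X (x + y + 2 * w) * Y (x - y)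
        - (Y (x + y + 2 * w) * X (x + y)) * X (x - y)"
      unfolding TT by (simp add: algebra_simps)
    also have "\<dots> = X (x + y + 2 * w) * (t x * t y)"
      unfolding k1[symmetric] tt by (simp add: algebra_simps)
    finally show ?thesis .
  qed
  have dt: "(t has_field_derivative deriv t z) (at z)" and dT: "(T has_field_derivative deriv T z) (at z)" for z
    using ht hT by (auto intro: holomorphic_derivI)
  \<comment> \<open>Differentiation along \<open>(x + h, y - h)\<close> keeps \<open>x + y\<close>
    fixed, so the factors \<open>X (x + y)\<close> and \<open>X (x + y + 2 * w)\<close> act as
    constants.\<close>
  have dprod: "((\<lambda>h. g (x + h) * g (y - h)) has_field_derivative (deriv g x * g y - g x * deriv g y)) (at 0)"
    if "\<And>z. (g has_field_derivative deriv g z) (at z)" for g :: "complex \<Rightarrow> complex" and x y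
  proof -
    have "((\<lambda>h. g (x + h)) has_field_derivative deriv g x * 1) (at 0)"
      by (rule DERIV_chain2[of g]) (use that[of x] in \<open>auto intro!: derivative_eq_intros\<close>)
    moreover have "((\<lambda>h. g (y - h)) has_field_derivative deriv g y * (-1)) (at 0)"
      by (rule DERIV_chain2[of g]) (use that[of y] in \<open>auto intro!: derivative_eq_intros\<close>)
    ultimately have "((\<lambda>h. g (x + h) * g (y - h)) has_field_derivative
        (deriv g x * 1 * g (y - 0) + deriv g y * (-1) * g (x + 0))) (at 0)" by (rule DERIV_mult)
    thus ?thesis by (simp add: algebra_simps)
  qed
  have k3: "X (x + y) * (deriv T x * T y - T x * deriv T y)
      = X (x + y + 2 * w) * (deriv t x * t y - t x * deriv t y)" for x y
  proof -
    have "((\<lambda>h. X (x + y) * (T (x + h) * T (y - h))) has_field_derivative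
        X (x + y) * (deriv T x * T y - T x * deriv T y)) (at 0)"
      by (intro DERIV_cmult dprod dT)
    moreover have "((\<lambda>h. X (x + y + 2 * w) * (t (x + h) * t (y - h))) has_field_derivative
        X (x + y + 2 * w) * (deriv t x * t y - t x * deriv t y)) (at 0)"
      by (intro DERIV_cmult dprod dt)
    moreover have "(\<lambda>h. X (x + y) * (T (x + h) * T (y - h))) = (\<lambda>h. X (x + y + 2 * w) * (t (x + h) * t (y - h)))"
    proof
      fix h
      show "X (x + y) * (T (x + h) * T (y - h)) = X (x + y + 2 * w) * (t (x + h) * t (y - h))"
        using k2[of "x + h" "y - h"] by simp
    qed
    ultimately show ?thesis using DERIV_unique by metis
  qed
  \<comment> \<open>With denominators cleared, \<open>G y x = 0\<close> says that the logarithmic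
    derivative of \<open>T / t\<close> takes the same value at \<open>x\<close> and
    \<open>y\<close>.\<close>
  define G where "G = (\<lambda>y x. (deriv T x * T y - T x * deriv T y) * (t x * t y)
      - (T x * T y) * (deriv t x * t y - t x * deriv t y))"
  have k4: "X (x + y) * G y x = 0" for x y
  proof -
    have "X (x + y) * G y x = (X (x + y) * (deriv T x * T y - T x * deriv T y)) * (t x * t y)
      - (X (x + y) * (T x * T y)) * (deriv t x * t y - t x * deriv t y)"
      by (simp add: G_def algebra_simps)
    also have "\<dots> = 0" unfolding k2 k3 by (simp add: algebra_simps)
    finally show ?thesis .
  qed
  obtain x1 where x1: "X x1 \<noteq> 0" using theta3_not_zero[OF Im2] by (auto simp: X_def)
  have k5: "G y x = 0" for y x
  proof -
    have "(X \<circ> (\<lambda>x. x + y)) holomorphic_on UNIV"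
      by (rule holomorphic_on_compose_gen[OF _ hX]) (auto intro!: holomorphic_intros)
    hence "(\<lambda>x. X (x + y)) holomorphic_on UNIV" by (simp add: o_def)
    moreover have "G y holomorphic_on UNIV" unfolding G_def by (intro holomorphic_intros ht hT) auto
    ultimately have "(\<forall>x. X (x + y) = 0) \<or> (\<forall>x. G y x = 0)" by (rule entire_mult_zero) (rule k4)
    moreover have "X (x1 - y + y) \<noteq> 0" using x1 by simp
    ultimately show ?thesis by blast
  qed
  obtain z1 where z1: "t z1 \<noteq> 0" using theta1_not_zero by (auto simp: t_def)
  obtain y0 where y0: "t y0 \<noteq> 0" "T y0 \<noteq> 0"
  proof -
    have "T (z1 - w) \<noteq> 0" using z1 by (simp add: T_def t_def)
    hence "\<not> ((\<forall>z. t z = 0) \<or> (\<forall>z. T z = 0))" using z1 by blast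
    hence "\<not> (\<forall>z. t z * T z = 0)" using entire_mult_zero[OF ht hT] by blast
    thus ?thesis using that by auto
  qed
  define \<alpha> where "\<alpha> = deriv T y0 / T y0 - deriv t y0 / t y0"
  have k6: "deriv T x * t x - T x * deriv t x = \<alpha> * (T x * t x)" for x
  proof -
    have "(deriv T x * t x - T x * deriv t x) * (T y0 * t y0) = (T x * t x) * (deriv T y0 * t y0 - T y0 * deriv t y0)"
      using k5[of y0 x] by (simp add: G_def algebra_simps)
    thus ?thesis using y0 by (simp add: \<alpha>_def field_simps)
  qed
  define K where "K = (\<lambda>x. T x * exp (- (\<alpha> * x)))"
  have hK: "K holomorphic_on UNIV" unfolding K_def by (intro holomorphic_intros hT)
  have dK: "deriv K x = (deriv T x - \<alpha> * T x) * exp (- (\<alpha> * x))" for x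
  proof (rule DERIV_imp_deriv)
    show "(K has_field_derivative (deriv T x - \<alpha> * T x) * exp (- (\<alpha> * x))) (at x)"
      unfolding K_def by (auto intro!: derivative_eq_intros dT simp: algebra_simps)
  qed
  have wr: "deriv K x * t x = K x * deriv t x" for x
  proof -
    have "deriv K x * t x - K x * deriv t x
       = (deriv T x * t x - T x * deriv t x - \<alpha> * (T x * t x)) * exp (- (\<alpha> * x))"
      unfolding dK by (simp add: K_def algebra_simps)
    thus ?thesis using k6[of x] by simp
  qed
  obtain \<beta> where \<beta>: "\<And>x. K x = \<beta> * t x" using entire_wronskian_zero[OF hK ht wr y0(1)] by blast
  have T: "T x = \<beta> * exp (\<alpha> * x) * t x" for x
  proof -
    have "T x = K x * exp (\<alpha> * x)" by (simp add: K_def mult.assoc flip: exp_add)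
    thus ?thesis by (simp add: \<beta> mult_ac)
  qed
  have "\<beta> \<noteq> 0" using T[of y0] y0 by auto
  thus ?thesis by (rule that[of \<beta> \<alpha>]) (use T in \<open>simp add: T_def t_def\<close>)
qed

text \<open>For a zero \<open>w\<close> the factor \<open>exp (\<alpha> * x)\<close> must be
  compatible with both translations. Translation by 1 gives \<open>exp \<alpha> = 1\<close>, so
  \<open>\<alpha> = 2 * pi * \<i> * n\<close>; translation by \<open>\<tau>\<close> then gives
  \<open>w = m - n * \<tau>\<close>.\<close>

lemma theta1_zero_iff: "theta1 w \<tau> = 0 \<longleftrightarrow> w \<in> period_lattice \<tau>"
proof
  assume "w \<in> period_lattice \<tau>"
  then obtain m n :: int where w: "w = of_int m + of_int n * \<tau>" by (auto simp: period_lattice_def)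
  have "(theta1 (0 + of_int m * 1 + of_int n * \<tau>) \<tau> = 0) \<longleftrightarrow> (theta1 (0 + of_int m * 1) \<tau> = 0)"
    by (rule int_period[of "\<lambda>z. theta1 z \<tau> = 0" \<tau>]) (simp add: theta_add_taus)
  also have "\<dots> \<longleftrightarrow> theta1 0 \<tau> = 0"
    by (rule int_period[of "\<lambda>z. theta1 z \<tau> = 0" 1]) (simp add: theta_add_1s)
  finally show "theta1 w \<tau> = 0" by (simp add: w)
next
  assume "theta1 w \<tau> = 0"
  then obtain \<alpha> \<beta> where ab: "\<beta> \<noteq> 0" "\<And>x. theta1 (x + w) \<tau> = \<beta> * exp (\<alpha> * x) * theta1 x \<tau>"
    using theta1_zero_translation by blast
  obtain x where x: "theta1 x \<tau> \<noteq> 0" using theta1_not_zero by blast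
  have "exp (\<alpha> * (x + 1)) = exp (\<alpha> * x)"
    using ab(2)[of "x + 1"] ab(2)[of x] theta_add_1s(1)[of "x + w" \<tau>] theta_add_1s(1)[of x \<tau>] x ab(1)
    by (simp add: add_ac)
  hence "exp \<alpha> = 1" by (simp add: ring_distribs exp_add)
  then obtain n :: int where n: "\<alpha> = 2 * of_real pi * \<i> * of_int n" using exp_eq_1_int by blast
  have "theta_factor (x + w) \<tau> = exp (\<alpha> * \<tau>) * theta_factor x \<tau>"
    using ab(2)[of "x + \<tau>"] ab(2)[of x] theta_add_taus(1)[of "x + w" \<tau>] theta_add_taus(1)[of x \<tau>] x ab(1)
    by (simp add: add_ac ring_distribs exp_add)
  moreover have "theta_factor (x + w) \<tau> = exp (- (2 * of_real pi * \<i> * w)) * theta_factor x \<tau>"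
    unfolding theta_factor_def exp_add[symmetric] by (rule arg_cong[of _ _ exp]) (simp add: algebra_simps)
  ultimately have "exp (\<alpha> * \<tau>) = exp (- (2 * of_real pi * \<i> * w))" by simp
  hence "exp (\<alpha> * \<tau> + 2 * of_real pi * \<i> * w) = 1" by (simp add: exp_add exp_minus)
  then obtain m :: int where "\<alpha> * \<tau> + 2 * of_real pi * \<i> * w = 2 * of_real pi * \<i> * of_int m"
    using exp_eq_1_int by blast
  hence "2 * of_real pi * \<i> * (of_int n * \<tau> + w) = 2 * of_real pi * \<i> * of_int m"
    by (simp add: n algebra_simps)
  hence "of_int n * \<tau> + w = of_int m" by simp
  hence "w = of_int m + of_int (- n) * \<tau>" by (simp add: algebra_simps)
  thus "w \<in> period_lattice \<tau>" unfolding period_lattice_def by blast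
qed

text \<open>If the derivative vanished, differentiating the product formula in the second argument
  at 0 would make the Wronskian of theta2 and theta3 for \<open>2 * \<tau>\<close> vanish. They
  would be proportional, and theta1 would vanish identically.\<close>

lemma theta1_deriv_nz: "deriv (\<lambda>z. theta1 z \<tau>) 0 \<noteq> 0"
proof
  assume D: "deriv (\<lambda>z. theta1 z \<tau>) 0 = 0"
  define X Y t where "X = (\<lambda>z. theta3 z (2 * \<tau>))" and "Y = (\<lambda>z. theta2 z (2 * \<tau>))"
    and "t = (\<lambda>z. theta1 z \<tau>)"
  have hX: "X holomorphic_on UNIV" and hY: "Y holomorphic_on UNIV" and ht: "t holomorphic_on UNIV"
    unfolding X_def Y_def t_def by (rule theta_hol)+
  have d: "(f has_field_derivative deriv f z) (at z)" if "f holomorphic_on UNIV" for f z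
    using that by (auto intro: holomorphic_derivI)
  have tt: "t x * t y = X (x + y) * Y (x - y) - Y (x + y) * X (x - y)" for x y
    unfolding t_def X_def Y_def by (rule theta11[OF Im_pos])
  have wr: "deriv Y x * X x = Y x * deriv X x" for x
  proof -
    have p: "((\<lambda>h. f (x + h)) has_field_derivative deriv f x) (at 0)" if "f holomorphic_on UNIV" for f
      using DERIV_shift[of f "deriv f x" 0 x] d[OF that, of x] by (simp add: add.commute)
    have m: "((\<lambda>h. f (x - h)) has_field_derivative - deriv f x) (at 0)" if "f holomorphic_on UNIV" for f
    proof -
      have "((\<lambda>h. f (x - h)) has_field_derivative deriv f x * (-1)) (at 0)"
        by (rule DERIV_chain2[of f]) (use d[OF that, of x] in \<open>auto intro!: derivative_eq_intros\<close>)
      thus ?thesis by simp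
    qed
    have "((\<lambda>h. X (x + h) * Y (x - h) - Y (x + h) * X (x - h)) has_field_derivative
        (deriv X x * Y (x - 0) + - deriv Y x * X (x + 0)) - (deriv Y x * X (x - 0) + - deriv X x * Y (x + 0))) (at 0)"
      by (intro DERIV_diff DERIV_mult p m hX hY)
    moreover have "((\<lambda>h. t x * t h) has_field_derivative t x * deriv t 0) (at 0)"
      by (intro DERIV_cmult d ht)
    ultimately have "t x * deriv t 0 = (deriv X x * Y (x - 0) + - deriv Y x * X (x + 0)) - (deriv Y x * X (x - 0) + - deriv X x * Y (x + 0))"
      unfolding tt by (rule DERIV_unique[symmetric])
    moreover have "deriv t 0 = 0" using D by (simp add: t_def)
    ultimately have "2 * (deriv Y x * X x) = 2 * (Y x * deriv X x)" by (simp add: algebra_simps)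
    thus ?thesis by simp
  qed
  obtain x1 where x1: "X x1 \<noteq> 0" using theta3_not_zero[OF Im2] by (auto simp: X_def)
  obtain c where c: "\<And>z. Y z = c * X z" using entire_wronskian_zero[OF hY hX wr x1] by blast
  have "t x * t x = 0" for x unfolding tt c by (simp add: algebra_simps)
  thus False using theta1_not_zero by (auto simp: t_def)
qed

lemma theta_zero_iff_H:
  "theta1 (2 * z) \<tau> = 0 \<longleftrightarrow> z \<in> H" "theta2 (2 * z) \<tau> = 0 \<longleftrightarrow> z - 1/4 \<in> H"
  "theta3 (2 * z) \<tau> = 0 \<longleftrightarrow> z - (1 + \<tau>)/4 \<in> H" "theta4 (2 * z) \<tau> = 0 \<longleftrightarrow> z - \<tau>/4 \<in> H"
proof -
  have 1: "theta1 (2 * z) \<tau> = 0 \<longleftrightarrow> z \<in> H" for z by (simp add: theta1_zero_iff H_iff_lattice)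
  thus "theta1 (2 * z) \<tau> = 0 \<longleftrightarrow> z \<in> H" .
  have e: "2 * (z - 1/4) = 2 * z - 1/2" "2 * (z - (1 + \<tau>)/4) = 2 * z - 1/2 - \<tau>/2" "2 * (z - \<tau>/4) = 2 * z - \<tau>/2"
    by (simp_all add: field_simps)
  show "theta2 (2 * z) \<tau> = 0 \<longleftrightarrow> z - 1/4 \<in> H" "theta3 (2 * z) \<tau> = 0 \<longleftrightarrow> z - (1 + \<tau>)/4 \<in> H"
    "theta4 (2 * z) \<tau> = 0 \<longleftrightarrow> z - \<tau>/4 \<in> H"
    unfolding 1[symmetric] e by (simp_all add: theta_shifts_zero)
qed

section \<open>Quadratic identities\<close>

lemma theta_0_nz [simp]: "theta2 0 \<tau> \<noteq> 0" "theta3 0 \<tau> \<noteq> 0" "theta4 0 \<tau> \<noteq> 0"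
  using theta_zero_iff_H(2-4)[of 0] quarter_notin_H H_uminus by (simp_all del: H_uminus minus_add_distrib)

text \<open>At equal arguments each product becomes a linear combination of theta2 and theta3 at
  \<open>2 * z\<close> for \<open>2 * \<tau>\<close>. Any three of the squares are thus linearly
  dependent, which gives the quadratic identities below.\<close>

lemma theta_sq:
  "theta1 z \<tau> ^ 2 = theta3 (2 * z) (2 * \<tau>) * theta2 0 (2 * \<tau>) - theta2 (2 * z) (2 * \<tau>) * theta3 0 (2 * \<tau>)"
  "theta2 z \<tau> ^ 2 = theta2 (2 * z) (2 * \<tau>) * theta3 0 (2 * \<tau>) + theta3 (2 * z) (2 * \<tau>) * theta2 0 (2 * \<tau>)"
  "theta3 z \<tau> ^ 2 = theta3 (2 * z) (2 * \<tau>) * theta3 0 (2 * \<tau>) + theta2 (2 * z) (2 * \<tau>) * theta2 0 (2 * \<tau>)"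
  "theta4 z \<tau> ^ 2 = theta3 (2 * z) (2 * \<tau>) * theta3 0 (2 * \<tau>) - theta2 (2 * z) (2 * \<tau>) * theta2 0 (2 * \<tau>)"
  using theta11[OF Im_pos, of z z] theta22[OF Im_pos, of z z] theta33[OF Im_pos, of z z] theta44[OF Im_pos, of z z]
  by (simp_all add: power2_eq_square)

lemma theta_quadratic:
  "theta3 0 \<tau> ^ 2 * theta4 z \<tau> ^ 2 - theta4 0 \<tau> ^ 2 * theta3 z \<tau> ^ 2 = theta2 0 \<tau> ^ 2 * theta1 z \<tau> ^ 2"
  "theta2 0 \<tau> ^ 2 * theta3 z \<tau> ^ 2 - theta3 0 \<tau> ^ 2 * theta2 z \<tau> ^ 2 = theta4 0 \<tau> ^ 2 * theta1 z \<tau> ^ 2"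
  "theta2 0 \<tau> ^ 2 * theta4 z \<tau> ^ 2 - theta4 0 \<tau> ^ 2 * theta2 z \<tau> ^ 2 = theta3 0 \<tau> ^ 2 * theta1 z \<tau> ^ 2"
  unfolding theta_sq by (simp_all add: algebra_simps)

text \<open>Jacobi's identity. At 0 the squares of theta2, theta3 and theta4 are
  \<open>2 * X * Y\<close>, \<open>X^2 + Y^2\<close> and \<open>X^2 - Y^2\<close>, with
  \<open>X\<close> and \<open>Y\<close> the values of theta3 and theta2 at 0 for
  \<open>2 * \<tau>\<close>.\<close>

lemma theta_quartic: "theta3 0 \<tau> ^ 4 = theta2 0 \<tau> ^ 4 + theta4 0 \<tau> ^ 4"
proof -
  have "x ^ 4 = (x ^ 2) ^ 2" for x :: complex by simp
  thus ?thesis unfolding theta_sq by (simp only: theta_sq) (simp add: power2_eq_square algebra_simps)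
qed

lemma theta_double:
  "2 * theta3 z (2 * \<tau>) ^ 2 = theta3 0 \<tau> * theta3 z \<tau> + theta4 0 \<tau> * theta4 z \<tau>"
  "2 * theta2 z (2 * \<tau>) ^ 2 = theta3 0 \<tau> * theta3 z \<tau> - theta4 0 \<tau> * theta4 z \<tau>"
  "2 * (theta2 z (2 * \<tau>) * theta3 z (2 * \<tau>)) = theta2 0 \<tau> * theta2 z \<tau>"
  using theta33[OF Im_pos, of z 0] theta44[OF Im_pos, of z 0] theta22[OF Im_pos, of z 0]
  by (simp_all add: power2_eq_square algebra_simps)

end

section \<open>The functions \<open>mu\<close>\<close>

text \<open>The signs of \<open>mu \<tau> i\<close> under translation by \<open>1/2\<close> and, for
  \<open>chi2\<close>, by \<open>\<tau>/2\<close>. They are also the eigenvalues on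
  \<open>holod_v i\<close> of the conjugations by the two generators of D_2, and run over the
  nontrivial characters of that group.\<close>

fun chi1 :: "idx \<Rightarrow> complex" where "chi1 I1 = 1" | "chi1 I2 = -1" | "chi1 I3 = -1"
fun chi2 :: "idx \<Rightarrow> complex" where "chi2 I1 = -1" | "chi2 I2 = -1" | "chi2 I3 = 1"

lemma chi_sq [simp]: "chi1 i * chi1 i = 1" "chi2 i * chi2 i = 1" "norm (chi1 i) = 1" "norm (chi2 i) = 1"
  "chi1 i \<noteq> 0" "chi2 i \<noteq> 0"
  by (cases i; simp)+

lemma chi_nontrivial: "chi1 i \<noteq> 1 \<or> chi2 i \<noteq> 1" by (cases i) auto

lemma chi_mult: "(i, j, k) \<in> cyclic_triples \<Longrightarrow> chi1 i * chi1 j = chi1 k \<and> chi2 i * chi2 j = chi2 k"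
  by (auto simp: cyclic_triples_def)

lemma cyclic_rotate: "(i, j, k) \<in> cyclic_triples \<longleftrightarrow> (j, k, i) \<in> cyclic_triples"
  by (auto simp: cyclic_triples_def)

lemma nicely_meromorphic_translate:
  assumes "f nicely_meromorphic_on UNIV"
  shows "(\<lambda>z. f (z + p)) nicely_meromorphic_on UNIV"
proof -
  have fm: "filtermap (\<lambda>z. z + p) (at a) = at (a + p)" for a
    using filtermap_at_shift[of "- p" a] by simp
  have "(\<lambda>z. f (z + p)) meromorphic_on UNIV"
    by (rule meromorphic_on_compose[of f UNIV "\<lambda>z. z + p"])
       (use assms in \<open>auto simp: nicely_meromorphic_on_def intro!: analytic_intros\<close>)
  moreover have "(is_pole (\<lambda>z. f (z + p)) a \<and> f (a + p) = 0) \<or> ((\<lambda>z. f (z + p)) \<longlongrightarrow> f (a + p)) (at a)" for a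
  proof -
    have "(is_pole f (a + p) \<and> f (a + p) = 0) \<or> (f \<longlongrightarrow> f (a + p)) (at (a + p))"
      using assms by (auto simp: nicely_meromorphic_on_def)
    thus ?thesis by (simp add: is_pole_def filterlim_filtermap flip: fm)
  qed
  ultimately show ?thesis by (auto simp: nicely_meromorphic_on_def)
qed

context torus
begin

lemma theta_succ_hol: "(\<lambda>z. theta_succ i z \<tau>) holomorphic_on A"
  by (cases i) (auto intro: theta_hol)

lemma theta_succ_0_nz: "theta_succ i 0 \<tau> \<noteq> 0"
  by (cases i) auto

definition D1 :: complex where "D1 = deriv (\<lambda>z. theta1 z \<tau>) 0"

lemma D1_nz [simp]: "D1 \<noteq> 0" unfolding D1_def by (rule theta1_deriv_nz)

lemma mu_eq: "mu \<tau> i z = D1 / theta_succ i 0 \<tau> * (theta_succ i (2 * z) \<tau> / theta1 (2 * z) \<tau>)"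
  by (simp add: mu_def D1_def)

lemma entire_double: "f holomorphic_on UNIV \<Longrightarrow> (\<lambda>z. f (2 * z :: complex)) holomorphic_on A"
  using holomorphic_on_compose_gen[of "\<lambda>z. 2 * z" A f UNIV]
  by (auto simp: o_def intro!: holomorphic_intros)

lemma mu_ell: "ell H (chi1 i) (chi2 i) (mu \<tau> i)"
proof -
  have h: "(\<lambda>z. theta_succ i (2 * z) \<tau>) holomorphic_on A" "(\<lambda>z. theta1 (2 * z) \<tau>) holomorphic_on A" for A
    by (rule entire_double, rule theta_succ_hol theta_hol)+
  have m: "mu \<tau> i meromorphic_on UNIV" unfolding mu_eq[abs_def]
    by (intro meromorphic_intros analytic_on_imp_meromorphic_on) (use h in \<open>auto simp: analytic_on_open\<close>)
  have hol: "mu \<tau> i holomorphic_on - H" unfolding mu_eq[abs_def]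
    by (intro holomorphic_intros h) (auto simp: theta_zero_iff_H)
  have "2 * (z + 1/2) = 2 * z + 1" "2 * (z + \<tau>/2) = 2 * z + \<tau>" for z by (simp_all add: ring_distribs)
  hence "mu \<tau> i (z + 1/2) = chi1 i * mu \<tau> i z" "mu \<tau> i (z + \<tau>/2) = chi2 i * mu \<tau> i z" for z
    unfolding mu_eq by (cases i; simp add: theta_add_1s theta_add_taus)+
  with m hol show ?thesis by (simp add: ell_def)
qed

lemma mu_odd: "mu \<tau> i (- z) = - mu \<tau> i z"
  unfolding mu_eq by (cases i) (simp_all add: theta_even theta1_odd)

text \<open>The normalising constants make the residue the same for the three indices; the value 1/2
  comes from the argument \<open>2 * z\<close>. Equal residues are what frees differences of such
  functions from poles.\<close>

lemma mu_lim: "((\<lambda>z. z * mu \<tau> i z) \<longlongrightarrow> 1/2) (at 0)"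
proof -
  have "((\<lambda>z. theta1 z \<tau>) has_field_derivative D1) (at (2 * 0))"
    unfolding D1_def using theta_hol(1)[of UNIV] by (auto intro: holomorphic_derivI)
  hence "((\<lambda>z. theta1 (2 * z) \<tau>) has_field_derivative D1 * 2) (at 0)"
    by (rule DERIV_chain2) (auto intro!: derivative_eq_intros)
  hence d: "((\<lambda>z. theta1 (2 * z) \<tau> / z) \<longlongrightarrow> D1 * 2) (at 0)"
    by (simp add: has_field_derivative_iff)
  have "isCont (\<lambda>z. theta_succ i (2 * z) \<tau>) 0"
    using entire_double[OF theta_succ_hol, of i UNIV] holomorphic_on_imp_continuous_on continuous_on_eq_continuous_at by blast
  hence "((\<lambda>z. theta_succ i (2 * z) \<tau>) \<longlongrightarrow> theta_succ i 0 \<tau>) (at 0)" by (simp add: isCont_def)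
  hence "((\<lambda>z. D1 / theta_succ i 0 \<tau> * (theta_succ i (2 * z) \<tau> / (theta1 (2 * z) \<tau> / z)))
      \<longlongrightarrow> D1 / theta_succ i 0 \<tau> * (theta_succ i 0 \<tau> / (D1 * 2))) (at 0)"
    by (intro tendsto_intros d) auto
  moreover have "eventually (\<lambda>z. D1 / theta_succ i 0 \<tau> * (theta_succ i (2 * z) \<tau> / (theta1 (2 * z) \<tau> / z)) = z * mu \<tau> i z) (at 0)"
    using eventually_neq_at_within[of 0 0] by eventually_elim (simp add: mu_eq)
  ultimately have "((\<lambda>z. z * mu \<tau> i z) \<longlongrightarrow> D1 / theta_succ i 0 \<tau> * (theta_succ i 0 \<tau> / (D1 * 2))) (at 0)"
    using tendsto_cong by fast
  thus ?thesis using theta_succ_0_nz[of i] by simp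
qed

text \<open>The quadratic theta identities, divided by the square of theta1, are the equations of
  Holod's curve, with the constants as squares of theta quotients.\<close>

lemma mu_sq_diff:
  assumes "z \<notin> H"
  shows "mu \<tau> I2 z ^ 2 - mu \<tau> I3 z ^ 2 = - ((D1 * theta2 0 \<tau> / (theta3 0 \<tau> * theta4 0 \<tau>)) ^ 2)"
    and "mu \<tau> I1 z ^ 2 - mu \<tau> I2 z ^ 2 = - ((D1 * theta4 0 \<tau> / (theta2 0 \<tau> * theta3 0 \<tau>)) ^ 2)"
proof -
  have t: "theta1 (2 * z) \<tau> \<noteq> 0" using assms by (simp add: theta_zero_iff_H)
  note q = theta_quadratic[of "2 * z"]
  have "mu \<tau> I2 z ^ 2 - mu \<tau> I3 z ^ 2 = - (D1 ^ 2 * (theta3 0 \<tau> ^ 2 * theta4 (2*z) \<tau> ^ 2 - theta4 0 \<tau> ^ 2 * theta3 (2*z) \<tau> ^ 2)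
      / (theta3 0 \<tau> ^ 2 * theta4 0 \<tau> ^ 2 * theta1 (2*z) \<tau> ^ 2))"
    using t by (simp add: mu_eq field_simps)
  also have "\<dots> = - ((D1 * theta2 0 \<tau> / (theta3 0 \<tau> * theta4 0 \<tau>)) ^ 2)"
    unfolding q using t by (simp add: power_mult_distrib power_divide)
  finally show "mu \<tau> I2 z ^ 2 - mu \<tau> I3 z ^ 2 = - ((D1 * theta2 0 \<tau> / (theta3 0 \<tau> * theta4 0 \<tau>)) ^ 2)" .
  have "mu \<tau> I1 z ^ 2 - mu \<tau> I2 z ^ 2 = - (D1 ^ 2 * (theta2 0 \<tau> ^ 2 * theta3 (2*z) \<tau> ^ 2 - theta3 0 \<tau> ^ 2 * theta2 (2*z) \<tau> ^ 2)
      / (theta2 0 \<tau> ^ 2 * theta3 0 \<tau> ^ 2 * theta1 (2*z) \<tau> ^ 2))"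
    using t by (simp add: mu_eq field_simps)
  also have "\<dots> = - ((D1 * theta4 0 \<tau> / (theta2 0 \<tau> * theta3 0 \<tau>)) ^ 2)"
    unfolding q using t by (simp add: power_mult_distrib power_divide)
  finally show "mu \<tau> I1 z ^ 2 - mu \<tau> I2 z ^ 2 = - ((D1 * theta4 0 \<tau> / (theta2 0 \<tau> * theta3 0 \<tau>)) ^ 2)" .
qed

end

section \<open>Traceless matrices\<close>

no_notation fps_nth (infixl \<open>$\<close> 75)

lemma mat2_nth [simp]: "mat2 a b c d $ 1 $ 1 = a" "mat2 a b c d $ 1 $ 2 = b"
  "mat2 a b c d $ 2 $ 1 = c" "mat2 a b c d $ 2 $ 2 = d"
  by (simp_all add: mat2_def vector_2)

lemma cmat_eq_iff: "X = Y \<longleftrightarrow> X $ 1 $ 1 = Y $ 1 $ 1 \<and> X $ 1 $ 2 = Y $ 1 $ 2 \<and> X $ 2 $ 1 = Y $ 2 $ 1 \<and> X $ 2 $ 2 = Y $ 2 $ 2"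
  for X Y :: cmat
  unfolding vec_eq_iff[of X Y] vec_eq_iff[of "X $ _"] forall_2 by blast

lemma smult_mat_nth [simp]: "smult_mat c X $ i $ j = c * X $ i $ j" by (simp add: smult_mat_def)

lemma cmat_mult_nth: "(X ** Y) $ i $ j = X $ i $ 1 * Y $ 1 $ j + X $ i $ 2 * Y $ 2 $ j" for X Y :: cmat
  by (simp add: matrix_matrix_mult_def sum_2)

lemma cmat_one_nth: "(mat 1 :: cmat) $ 1 $ 1 = 1" "(mat 1 :: cmat) $ 1 $ 2 = 0"
  "(mat 1 :: cmat) $ 2 $ 1 = 0" "(mat 1 :: cmat) $ 2 $ 2 = 1"
  by (simp_all add: mat_def)

lemma cmat_trace: "trace X = X $ 1 $ 1 + X $ 2 $ 2" for X :: cmat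
  by (simp add: trace_def sum_2)

lemma matrix_inv_mat2:
  assumes "a * d - b * c \<noteq> 0"
  shows "matrix_inv (mat2 a b c d) = smult_mat (1 / (a * d - b * c)) (mat2 d (- b) (- c) a)" (is "?I = ?J")
proof -
  define \<delta> where "\<delta> = a * d - b * c"
  have \<delta>: "\<delta> \<noteq> 0" "a * d = \<delta> + b * c" using assms by (simp_all add: \<delta>_def)
  have 1: "mat2 a b c d ** ?J = mat 1" "?J ** mat2 a b c d = mat 1"
    unfolding \<delta>_def[symmetric] using \<delta>
    by (simp_all add: cmat_eq_iff cmat_mult_nth cmat_one_nth field_simps)
  hence "\<exists>A'. mat2 a b c d ** A' = mat 1 \<and> A' ** mat2 a b c d = mat 1" by blast
  from someI_ex[OF this] have 2: "?I ** mat2 a b c d = mat 1" unfolding matrix_inv_def by blast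
  have "?I = ?I ** (mat2 a b c d ** ?J)" by (simp add: 1)
  also have "\<dots> = ?J" by (simp add: matrix_mul_assoc 2)
  finally show ?thesis .
qed

definition lie_bracket :: "cmat \<Rightarrow> cmat \<Rightarrow> cmat" where "lie_bracket X Y = X ** Y - Y ** X"

lemma lie_bracket_nth:
  "lie_bracket X Y $ i $ j = X $ i $ 1 * Y $ 1 $ j + X $ i $ 2 * Y $ 2 $ j - (Y $ i $ 1 * X $ 1 $ j + Y $ i $ 2 * X $ 2 $ j)"
  by (simp add: lie_bracket_def cmat_mult_nth)

text \<open>Coordinates with respect to the basis \<open>holod_v\<close>. They are linear
  functionals on all matrices and determine a matrix of trace 0.\<close>

fun coord :: "idx \<Rightarrow> cmat \<Rightarrow> complex" where
  "coord I1 X = - \<i> * (X $ 1 $ 1 - X $ 2 $ 2)"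
| "coord I2 X = X $ 1 $ 2 - X $ 2 $ 1"
| "coord I3 X = - \<i> * (X $ 1 $ 2 + X $ 2 $ 1)"

lemma coord_add: "coord i (X + Y) = coord i X + coord i Y"
  and coord_smult: "coord i (smult_mat c X) = c * coord i X"
  by (cases i; simp add: algebra_simps)+

text \<open>The basis satisfies \<open>[v_i, v_j] = v_k\<close> for cyclic triples, so the bracket
  is the cross product of the coordinate vectors.\<close>

lemma coord_bracket: "(i, j, k) \<in> cyclic_triples \<Longrightarrow>
    coord k (lie_bracket X Y) = coord i X * coord j Y - coord j X * coord i Y"
  by (auto simp: cyclic_triples_def lie_bracket_nth algebra_simps)

lemma trace_bracket: "trace (lie_bracket X Y) = 0"
  by (simp add: cmat_trace lie_bracket_nth algebra_simps)

lemma coord_v: "coord i (holod_v j) = (if i = j then 1 else 0)"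
  by (cases i; cases j) auto

lemma trace_v: "trace (holod_v j) = 0" by (cases j) (auto simp: cmat_trace)

lemma trace_add': "trace (X + Y) = trace X + trace Y" for X Y :: cmat by (simp add: cmat_trace)

lemma trace_smult: "trace (smult_mat c X) = c * trace X" by (simp add: cmat_trace algebra_simps)

lemma entry_coord:
  assumes "trace X = 0"
  shows "X $ 1 $ 1 = \<i> / 2 * coord I1 X" "X $ 2 $ 2 = - (\<i> / 2) * coord I1 X"
    "X $ 1 $ 2 = 1 / 2 * coord I2 X + \<i> / 2 * coord I3 X" "X $ 2 $ 1 = - (1 / 2) * coord I2 X + \<i> / 2 * coord I3 X"
proof -
  have t: "X $ 2 $ 2 = - X $ 1 $ 1" using assms by (simp add: cmat_trace eq_neg_iff_add_eq_0 add.commute)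
  show "X $ 1 $ 1 = \<i> / 2 * coord I1 X" "X $ 2 $ 2 = - (\<i> / 2) * coord I1 X" by (simp_all add: t)
  show "X $ 1 $ 2 = 1 / 2 * coord I2 X + \<i> / 2 * coord I3 X" "X $ 2 $ 1 = - (1 / 2) * coord I2 X + \<i> / 2 * coord I3 X"
    by (simp_all add: field_simps)
qed

lemma cmat_eqI_coord:
  assumes "\<And>i. coord i X = coord i Y" "trace X = 0" "trace Y = 0"
  shows "X = Y"
  unfolding cmat_eq_iff entry_coord[OF assms(2)] entry_coord[OF assms(3)] assms(1) by blast

section \<open>Equivariant matrix functions\<close>

definition nice_mat :: "(complex \<Rightarrow> cmat) \<Rightarrow> bool" where
  "nice_mat X \<longleftrightarrow> (\<forall>i j. (\<lambda>z. X z $ i $ j) nicely_meromorphic_on UNIV)"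

lemma nice_mat_eqI:
  assumes "nice_mat X" "nice_mat Y" "D sparse_in UNIV" "\<And>z. z \<notin> D \<Longrightarrow> X z = Y z"
  shows "X = Y"
proof -
  have "(\<lambda>z. X z $ i $ j) = (\<lambda>z. Y z $ i $ j)" for i j
    using assms by (intro nicely_meromorphic_eqI[OF _ _ assms(3)]) (auto simp: nice_mat_def)
  thus ?thesis by (simp add: fun_eq_iff vec_eq_iff)
qed

context torus
begin

definition equivariant :: "complex set \<Rightarrow> (complex \<Rightarrow> cmat) \<Rightarrow> bool" where
  "equivariant D Y \<longleftrightarrow> (\<forall>i j. (\<lambda>z. Y z $ i $ j) meromorphic_on UNIV \<and> (\<lambda>z. Y z $ i $ j) holomorphic_on - D) \<and>
     (\<forall>z. z \<notin> D \<longrightarrow> trace (Y z) = 0) \<and> (\<forall>i. ell D (chi1 i) (chi2 i) (\<lambda>z. coord i (Y z)))"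

text \<open>Once the trace vanishes, the entries are linear combinations of the coordinates and
  inherit their regularity.\<close>

lemma equivariantI:
  assumes "\<And>i. ell D (chi1 i) (chi2 i) (\<lambda>z. coord i (Y z))" "\<And>z. z \<notin> D \<Longrightarrow> trace (Y z) = 0" "polar_set D"
  shows "equivariant D Y"
proof -
  have c: "(\<lambda>z. c * coord i (Y z)) meromorphic_on UNIV \<and> (\<lambda>z. c * coord i (Y z)) holomorphic_on - D" for c i
    using assms(1)[of i] by (auto simp: ell_def intro!: meromorphic_intros holomorphic_intros)
  have cs: "(\<lambda>z. c * coord i (Y z) + d * coord j (Y z)) meromorphic_on UNIV \<and>
      (\<lambda>z. c * coord i (Y z) + d * coord j (Y z)) holomorphic_on - D" for c d i j
    using c[of c i] c[of d j] by (auto intro!: meromorphic_intros holomorphic_intros)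
  have tr: "g meromorphic_on UNIV \<and> g holomorphic_on - D"
    if "f meromorphic_on UNIV \<and> f holomorphic_on - D" "\<And>z. z \<notin> D \<Longrightarrow> g z = f z" for f g
  proof
    have "eventually (\<lambda>z. f z = g z) (at a)" for a
      using eventually_not_in_sparse[OF polar_sparse[OF assms(3)]] by eventually_elim (simp add: that)
    thus "g meromorphic_on UNIV" using that(1) meromorphic_on_cong[of UNIV f g UNIV] by auto
    show "g holomorphic_on - D" using that holomorphic_cong[of "- D" "- D" f g] by auto
  qed
  have "(\<lambda>z. Y z $ i $ j) meromorphic_on UNIV \<and> (\<lambda>z. Y z $ i $ j) holomorphic_on - D" for i j
  proof -
    have "i = 1 \<or> i = 2" "j = 1 \<or> j = 2" by (rule exhaust_2)+
    thus ?thesis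
      using tr[OF c entry_coord(1)[OF assms(2)]] tr[OF c entry_coord(2)[OF assms(2)]]
        tr[OF cs entry_coord(3)[OF assms(2)]] tr[OF cs entry_coord(4)[OF assms(2)]] by blast
  qed
  thus ?thesis using assms by (simp add: equivariant_def)
qed

lemma equivariant_cong:
  assumes "equivariant D X" "polar_set D" "\<And>z. z \<notin> D \<Longrightarrow> X z = Y z"
  shows "equivariant D Y"
proof (rule equivariantI)
  show "ell D (chi1 i) (chi2 i) (\<lambda>z. coord i (Y z))" for i
    by (rule ell_cong[of _ _ _ "\<lambda>z. coord i (X z)"]) (use assms in \<open>auto simp: equivariant_def\<close>)
qed (use assms in \<open>auto simp: equivariant_def\<close>)

lemma equivariant_coord: "equivariant D X \<Longrightarrow> ell D (chi1 i) (chi2 i) (\<lambda>z. coord i (X z))"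
  and equivariant_trace: "equivariant D X \<Longrightarrow> z \<notin> D \<Longrightarrow> trace (X z) = 0"
  by (auto simp: equivariant_def)

text \<open>The common model: the automorphic algebra, Holod's algebra and the realisation of
  Uglov's algebra are identified with it, each for its own set of punctures.\<close>

definition equi_algebra :: "complex set \<Rightarrow> (complex \<Rightarrow> cmat) set" where
  "equi_algebra D = {X. equivariant D X \<and> nice_mat X}"

lemma remove_sings_mat_off:
  assumes "equivariant D Y" "polar_set D" "z \<notin> D"
  shows "remove_sings_mat Y z = Y z"
proof -
  have "(\<lambda>w. Y w $ i $ j) analytic_on {z}" for i j
    using assms polar_open[OF assms(2)] unfolding equivariant_def
    by (meson ComplI analytic_at)
  thus ?thesis by (simp add: remove_sings_mat_def vec_eq_iff)
qed

lemma remove_sings_mat_in: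
  assumes "equivariant D Y" "polar_set D"
  shows "remove_sings_mat Y \<in> equi_algebra D"
proof -
  have "equivariant D (remove_sings_mat Y)"
    by (rule equivariant_cong[OF assms]) (use remove_sings_mat_off[OF assms] in simp)
  moreover have "nice_mat (remove_sings_mat Y)"
    unfolding nice_mat_def remove_sings_mat_def vec_lambda_beta
    using assms by (auto simp: equivariant_def intro!: remove_sings_nicely_meromorphic)
  ultimately show ?thesis by (simp add: equi_algebra_def)
qed

lemma equi_algebra_eqI:
  "X \<in> equi_algebra D \<Longrightarrow> Y \<in> equi_algebra D \<Longrightarrow> polar_set D \<Longrightarrow> (\<And>z. z \<notin> D \<Longrightarrow> X z = Y z) \<Longrightarrow> X = Y"
  unfolding equi_algebra_def by (rule nice_mat_eqI[OF _ _ polar_sparse]) blast+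

lemma equivariant_zero: "polar_set D \<Longrightarrow> equivariant D (\<lambda>z. 0)"
proof (rule equivariantI)
  show "ell D (chi1 i) (chi2 i) (\<lambda>z. coord i 0)" for i by (cases i) (auto simp: ell_zero)
qed (auto simp: cmat_trace)

lemma equivariant_add:
  assumes "equivariant D X" "equivariant D Y" "polar_set D"
  shows "equivariant D (\<lambda>z. X z + Y z)"
proof (rule equivariantI)
  show "ell D (chi1 i) (chi2 i) (\<lambda>z. coord i (X z + Y z))" for i
    unfolding coord_add by (intro ell_add equivariant_coord assms)
qed (use assms in \<open>auto simp: trace_add' equivariant_trace\<close>)

lemma equivariant_fsmult:
  assumes "equivariant D X" "ell D 1 1 r" "polar_set D"
  shows "equivariant D (\<lambda>z. smult_mat (r z) (X z))"
proof (rule equivariantI)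
  show "ell D (chi1 i) (chi2 i) (\<lambda>z. coord i (smult_mat (r z) (X z)))" for i
    unfolding coord_smult using ell_mult[OF assms(2) equivariant_coord[OF assms(1), of i]] by simp
qed (use assms in \<open>auto simp: trace_smult equivariant_trace\<close>)

lemma equivariant_smult: "equivariant D X \<Longrightarrow> polar_set D \<Longrightarrow> equivariant D (\<lambda>z. smult_mat c (X z))"
  by (rule equivariant_fsmult[OF _ ell_const])

lemma equivariant_bracket:
  assumes "equivariant D X" "equivariant D Y" "polar_set D"
  shows "equivariant D (\<lambda>z. lie_bracket (X z) (Y z))"
proof (rule equivariantI)
  fix k
  obtain i j where ijk: "(i, j, k) \<in> cyclic_triples"
    by (cases k) (auto simp: cyclic_triples_def)
  show "ell D (chi1 k) (chi2 k) (\<lambda>z. coord k (lie_bracket (X z) (Y z)))"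
    unfolding coord_bracket[OF ijk]
    using ell_mult[OF equivariant_coord[OF assms(1), of i] equivariant_coord[OF assms(2), of j]]
      ell_mult[OF equivariant_coord[OF assms(1), of j] equivariant_coord[OF assms(2), of i]]
      chi_mult[OF ijk] by (intro ell_diff) (simp_all add: mult.commute)
qed (use assms in \<open>auto simp: trace_bracket\<close>)

context
  fixes D :: "complex set" assumes D: "polar_set D"
begin

abbreviation "E \<equiv> equi_algebra D"
abbreviation "EL \<equiv> mero_lie (equi_algebra D)"

lemma E_equi: "X \<in> E \<Longrightarrow> equivariant D X" by (simp add: equi_algebra_def)

lemma EL_simps:
  "lie_carrier EL = E" "lie_zero EL = (\<lambda>z. 0)"
  "lie_add EL X Y = remove_sings_mat (\<lambda>z. X z + Y z)"
  "lie_smul EL c X = remove_sings_mat (\<lambda>z. smult_mat c (X z))"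
  "lie_br EL X Y = remove_sings_mat (\<lambda>z. lie_bracket (X z) (Y z))"
  by (simp_all add: mero_lie_def lie_bracket_def)

lemma E_zero: "(\<lambda>z. 0) \<in> E"
  using equivariant_zero[OF D] by (auto simp: equi_algebra_def nice_mat_def)

lemma E_closed:
  assumes "X \<in> E" "Y \<in> E"
  shows "lie_add EL X Y \<in> E" "lie_smul EL c X \<in> E" "lie_br EL X Y \<in> E"
  unfolding EL_simps using assms
  by (simp_all only: remove_sings_mat_in[OF equivariant_add[OF E_equi E_equi D] D]
      remove_sings_mat_in[OF equivariant_smult[OF E_equi D] D]
      remove_sings_mat_in[OF equivariant_bracket[OF E_equi E_equi D] D])

lemma E_off:
  assumes "z \<notin> D"
  shows "X \<in> E \<Longrightarrow> Y \<in> E \<Longrightarrow> lie_add EL X Y z = X z + Y z"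
    "X \<in> E \<Longrightarrow> lie_smul EL c X z = smult_mat c (X z)"
    "X \<in> E \<Longrightarrow> Y \<in> E \<Longrightarrow> lie_br EL X Y z = lie_bracket (X z) (Y z)"
  using remove_sings_mat_off[OF equivariant_add[OF E_equi E_equi D] D assms, of X Y]
    remove_sings_mat_off[OF equivariant_smult[OF E_equi D] D assms, of X c]
    remove_sings_mat_off[OF equivariant_bracket[OF E_equi E_equi D] D assms, of X Y]
  by (simp_all only: EL_simps)

text \<open>Off \<open>D\<close> the operations are pointwise, so the axioms hold there as matrix
  identities; normal forms turn this into equality of functions.\<close>

lemma equi_complex_lie_algebra: "complex_lie_algebra EL"
  unfolding complex_lie_algebra_def EL_simps(1,2)
  by (intro conjI ballI allI;
      (rule equi_algebra_eqI[OF _ _ D])?;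
      (simp add: E_zero E_closed E_off)?;
      (simp add: cmat_eq_iff lie_bracket_nth algebra_simps)?)

lemma ring_smul_in: "ell D 1 1 r \<Longrightarrow> X \<in> E \<Longrightarrow> ring_smul r X \<in> E"
  unfolding ring_smul_def by (rule remove_sings_mat_in[OF equivariant_fsmult[OF E_equi _ D] D])

lemma ring_smul_off: "ell D 1 1 r \<Longrightarrow> X \<in> E \<Longrightarrow> z \<notin> D \<Longrightarrow> ring_smul r X z = smult_mat (r z) (X z)"
  unfolding ring_smul_def by (rule remove_sings_mat_off[OF equivariant_fsmult[OF E_equi _ D] D])

end

end

section \<open>The automorphic Lie algebra\<close>

lemma Ad_diag: "Ad (mat2 1 0 0 (-1)) X = mat2 (X $ 1 $ 1) (- X $ 1 $ 2) (- X $ 2 $ 1) (X $ 2 $ 2)"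
  and Ad_swap: "Ad (mat2 0 1 1 0) X = mat2 (X $ 2 $ 2) (X $ 2 $ 1) (X $ 1 $ 2) (X $ 1 $ 1)"
  by (simp_all add: Ad_def matrix_inv_mat2 cmat_eq_iff cmat_mult_nth)

lemma coord_Ad_diag: "coord i (Ad (mat2 1 0 0 (-1)) X) = chi1 i * coord i X"
  and coord_Ad_swap: "coord i (Ad (mat2 0 1 1 0) X) = chi2 i * coord i X"
  by (cases i; simp add: Ad_diag Ad_swap algebra_simps)+

lemma trace_Ad: "trace (Ad (mat2 1 0 0 (-1)) X) = trace X" "trace (Ad (mat2 0 1 1 0) X) = trace X"
  by (simp_all add: Ad_diag Ad_swap cmat_trace)

lemma nice_mat_translate: "nice_mat X \<Longrightarrow> nice_mat (\<lambda>z. X (z + p))"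
  unfolding nice_mat_def using nicely_meromorphic_translate by blast

lemma nice_matI:
  assumes "(\<lambda>z. X z $ 1 $ 1) nicely_meromorphic_on UNIV" "(\<lambda>z. X z $ 1 $ 2) nicely_meromorphic_on UNIV"
    "(\<lambda>z. X z $ 2 $ 1) nicely_meromorphic_on UNIV" "(\<lambda>z. X z $ 2 $ 2) nicely_meromorphic_on UNIV"
  shows "nice_mat X"
  unfolding nice_mat_def forall_2 using assms by blast

lemma nice_mat_Ad: "nice_mat X \<Longrightarrow> nice_mat (\<lambda>z. Ad (mat2 1 0 0 (-1)) (X z))"
  "nice_mat X \<Longrightarrow> nice_mat (\<lambda>z. Ad (mat2 0 1 1 0) (X z))"
  by (rule nice_matI; auto simp: Ad_diag Ad_swap nice_mat_def intro!: nicely_meromorphic_on_uminus)+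

lemma bit_uminus: "- (b :: bit) = b" by (cases b) auto

context torus
begin

text \<open>Both sides are in normal form, so the equations known off \<open>D\<close> hold at every
  point, as the definition of the automorphic algebra demands.\<close>

lemma equi_algebra_translates:
  assumes X: "X \<in> equi_algebra D" and D: "polar_set D"
  shows "Ad (mat2 1 0 0 (-1)) (X (z + 1/2)) = X z" "Ad (mat2 0 1 1 0) (X (z + \<tau>/2)) = X z"
    "trace (X z) = 0"
proof -
  have nX: "nice_mat X" and eX: "equivariant D X" using X by (auto simp: equi_algebra_def)
  have "(\<lambda>z. Ad (mat2 1 0 0 (-1)) (X (z + 1/2))) = X"
  proof (rule nice_mat_eqI[OF _ nX polar_sparse[OF D]])
    fix z assume z: "z \<notin> D"
    have "z + 1/2 \<notin> D" using z D by simp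
    with z show "Ad (mat2 1 0 0 (-1)) (X (z + 1/2)) = X z"
      by (intro cmat_eqI_coord)
        (auto simp: coord_Ad_diag trace_Ad ell_half[OF equivariant_coord[OF eX] z] equivariant_trace[OF eX] simp flip: mult.assoc)
  qed (intro nice_mat_Ad nice_mat_translate nX)
  from fun_cong[OF this, of z] show "Ad (mat2 1 0 0 (-1)) (X (z + 1/2)) = X z" .
  have "(\<lambda>z. Ad (mat2 0 1 1 0) (X (z + \<tau>/2))) = X"
  proof (rule nice_mat_eqI[OF _ nX polar_sparse[OF D]])
    fix z assume z: "z \<notin> D"
    have "z + \<tau>/2 \<notin> D" using z D by simp
    with z show "Ad (mat2 0 1 1 0) (X (z + \<tau>/2)) = X z"
      by (intro cmat_eqI_coord)
        (auto simp: coord_Ad_swap trace_Ad ell_tau[OF equivariant_coord[OF eX] z] equivariant_trace[OF eX] simp flip: mult.assoc)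
  qed (intro nice_mat_Ad nice_mat_translate nX)
  from fun_cong[OF this, of z] show "Ad (mat2 0 1 1 0) (X (z + \<tau>/2)) = X z" .
  have "(\<lambda>z. X z $ 1 $ 1) = (\<lambda>z. - X z $ 2 $ 2)"
  proof (rule nicely_meromorphic_eqI[OF _ _ polar_sparse[OF D]])
    show "(\<lambda>z. X z $ 1 $ 1) nicely_meromorphic_on UNIV" "(\<lambda>z. - X z $ 2 $ 2) nicely_meromorphic_on UNIV"
      using nX by (auto simp: nice_mat_def intro!: nicely_meromorphic_on_uminus)
    show "X z $ 1 $ 1 = - X z $ 2 $ 2" if "z \<notin> D" for z
      using equivariant_trace[OF eX that] by (simp add: cmat_trace eq_neg_iff_add_eq_0)
  qed
  from fun_cong[OF this, of z] show "trace (X z) = 0" by (simp add: cmat_trace)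
qed

lemma lattice_period:
  assumes "\<And>z. \<phi> (z + 1) = \<phi> z" "\<And>z. \<phi> (z + \<tau>) = \<phi> z" "w \<in> period_lattice \<tau>"
  shows "\<phi> (z + w) = \<phi> z"
proof -
  obtain m n :: int where w: "w = of_int m + of_int n * \<tau>" using assms(3) by (auto simp: period_lattice_def)
  have "\<phi> (z + w) = \<phi> ((z + of_int m * 1) + of_int n * \<tau>)" by (simp add: w add.assoc)
  thus ?thesis using int_period[of \<phi> \<tau> _ n] int_period[of \<phi> 1 _ m] assms(1,2) by simp
qed

text \<open>The generators of D_2 act on coordinates by the signs \<open>chi1\<close> and
  \<open>chi2\<close>, so invariance says that each coordinate has the multipliers of the
  corresponding \<open>mu\<close>. Periodicity under the full lattice follows by translating twice,
  both conjugations being involutions.\<close>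

lemma automorphic_lie_eq:
  assumes "finite S"
  shows "automorphic_lie \<tau> S = mero_lie (equi_algebra (pts S))"
proof -
  define D where "D = pts S"
  have D: "polar_set D" unfolding D_def by (rule polar_pts[OF assms])
  have DS: "D2_orbit \<tau> S = D" by (simp add: D2_orbit_pts D_def)
  let ?A = "{X. (\<forall>z. trace (X z) = 0) \<and>
         (\<forall>i j. (\<lambda>z. X z $ i $ j) \<in> punctured_ring \<tau> S) \<and>
         (\<forall>\<gamma>. (\<lambda>z. rho \<gamma> (X (sigma \<tau> (- \<gamma>) z))) = X)}"
  have "?A = equi_algebra D"
  proof (intro subset_antisym subsetI)
    fix X assume "X \<in> ?A"
    hence tr: "\<And>z. trace (X z) = 0" and en: "\<And>i j. (\<lambda>z. X z $ i $ j) \<in> punctured_ring \<tau> S"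
      and inv: "\<And>\<gamma>. (\<lambda>z. rho \<gamma> (X (sigma \<tau> (- \<gamma>) z))) = X" by auto
    have nice: "(\<lambda>z. X z $ i $ j) nicely_meromorphic_on UNIV" "(\<lambda>z. X z $ i $ j) holomorphic_on - D" for i j
      using en[of i j] by (auto simp: punctured_ring_def torus_meromorphic_def DS)
    have mero: "(\<lambda>z. X z $ i $ j) meromorphic_on UNIV" for i j using nice by (simp add: nicely_meromorphic_on_def)
    have i1: "Ad (mat2 1 0 0 (-1)) (X (z + 1/2)) = X z" for z
      using fun_cong[OF inv[of "(1, 0)"], of z] by (simp add: bit_uminus)
    have i2: "Ad (mat2 0 1 1 0) (X (z + \<tau>/2)) = X z" for z
      using fun_cong[OF inv[of "(0, 1)"], of z] by (simp add: bit_uminus)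
    have "ell D (chi1 i) (chi2 i) (\<lambda>z. coord i (X z))" for i
    proof -
      have "coord i (X (z + 1/2)) = chi1 i * coord i (X z)" "coord i (X (z + \<tau>/2)) = chi2 i * coord i (X z)" for z
        using arg_cong[OF i1[of z], of "coord i"] arg_cong[OF i2[of z], of "coord i"]
        unfolding coord_Ad_diag coord_Ad_swap by (metis chi_sq(1,2) mult.assoc mult_1)+
      moreover have "(\<lambda>z. coord i (X z)) meromorphic_on UNIV \<and> (\<lambda>z. coord i (X z)) holomorphic_on - D"
        by (cases i) (auto intro!: meromorphic_intros holomorphic_intros mero nice)
      ultimately show ?thesis by (simp add: ell_def)
    qed
    hence "equivariant D X" using tr D by (intro equivariantI)
    thus "X \<in> equi_algebra D" using nice by (simp add: equi_algebra_def nice_mat_def)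
  next
    fix X assume X: "X \<in> equi_algebra D"
    note tl = equi_algebra_translates[OF X D]
    have p1: "X (z + 1) = X z" for z
    proof -
      have "X z = Ad (mat2 1 0 0 (-1)) (Ad (mat2 1 0 0 (-1)) (X (z + 1/2 + 1/2)))" by (simp only: tl)
      also have "\<dots> = X (z + 1/2 + 1/2)" by (simp only: Ad_diag cmat_eq_iff mat2_nth minus_minus)
      also have "z + 1/2 + 1/2 = z + 1" by simp
      finally show ?thesis by simp
    qed
    have p2: "X (z + \<tau>) = X z" for z
    proof -
      have "X z = Ad (mat2 0 1 1 0) (Ad (mat2 0 1 1 0) (X (z + \<tau>/2 + \<tau>/2)))" by (simp only: tl)
      also have "\<dots> = X (z + \<tau>/2 + \<tau>/2)" by (simp only: Ad_swap cmat_eq_iff mat2_nth)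
      also have "z + \<tau>/2 + \<tau>/2 = z + \<tau>" by simp
      finally show ?thesis by simp
    qed
    have per: "X (z + w) = X z" if "w \<in> period_lattice \<tau>" for z w
      by (rule lattice_period[of X, OF p1 p2 that])
    have "(\<lambda>z. rho \<gamma> (X (sigma \<tau> (- \<gamma>) z))) = X" for \<gamma>
    proof
      fix z
      obtain a b where ab: "\<gamma> = (a, b)" by (cases \<gamma>)
      have "a = 0 \<or> a = 1" "b = 0 \<or> b = 1" by (cases a; simp) (cases b; simp)
      thus "rho \<gamma> (X (sigma \<tau> (- \<gamma>) z)) = X z"
        using tl(1)[of z] tl(2)[of z] tl(2)[of "z + 1/2"] by (auto simp: ab bit_uminus)
    qed
    moreover have "(\<lambda>z. X z $ i $ j) \<in> punctured_ring \<tau> S" for i j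
      using X per by (auto simp: punctured_ring_def torus_meromorphic_def DS equi_algebra_def nice_mat_def equivariant_def)
    ultimately show "X \<in> ?A" using tl(3) by blast
  qed
  thus ?thesis by (simp add: automorphic_lie_def D_def)
qed

lemma ell_nice_shift:
  assumes "ell D s1 s2 f" "f nicely_meromorphic_on UNIV" "polar_set D" "s1 \<in> {1, -1}" "s2 \<in> {1, -1}"
  shows "f (z + 1/2) = s1 * f z" "f (z + \<tau>/2) = s2 * f z"
proof -
  have n: "(\<lambda>z. s * f z) nicely_meromorphic_on UNIV" for s
    by (intro nicely_meromorphic_on_cmult_left assms)
  have "(\<lambda>z. f (z + 1/2)) = (\<lambda>z. s1 * f z)" "(\<lambda>z. f (z + \<tau>/2)) = (\<lambda>z. s2 * f z)"
    by (rule nicely_meromorphic_eqI[OF nicely_meromorphic_translate[OF assms(2)] n polar_sparse[OF assms(3)]],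
        rule ell_half[OF assms(1)] ell_tau[OF assms(1)], assumption)+
  thus "f (z + 1/2) = s1 * f z" "f (z + \<tau>/2) = s2 * f z" by meson+
qed

lemma invariant_ring_eq:
  assumes "finite S"
  shows "invariant_ring \<tau> S = {f. ell (pts S) 1 1 f \<and> f nicely_meromorphic_on UNIV}"
proof (intro subset_antisym subsetI)
  fix f assume "f \<in> invariant_ring \<tau> S"
  hence f: "f nicely_meromorphic_on UNIV" "f holomorphic_on - pts S" and inv: "\<And>\<gamma>. f \<circ> sigma \<tau> (- \<gamma>) = f"
    by (auto simp: invariant_ring_def punctured_ring_def torus_meromorphic_def D2_orbit_pts)
  have "f (z + 1/2) = f z" "f (z + \<tau>/2) = f z" for z
    using fun_cong[OF inv[of "(1, 0)"], of z] fun_cong[OF inv[of "(0, 1)"], of z] by (simp_all add: bit_uminus)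
  thus "f \<in> {f. ell (pts S) 1 1 f \<and> f nicely_meromorphic_on UNIV}"
    using f by (auto simp: ell_def nicely_meromorphic_on_def)
next
  fix f assume "f \<in> {f. ell (pts S) 1 1 f \<and> f nicely_meromorphic_on UNIV}"
  hence f: "ell (pts S) 1 1 f" "f nicely_meromorphic_on UNIV" by auto
  have s: "f (z + 1/2) = f z" "f (z + \<tau>/2) = f z" for z
    using ell_nice_shift[OF f polar_pts[OF assms]] by auto
  have "f (z + (1/2 + 1/2)) = f z" "f (z + (\<tau>/2 + \<tau>/2)) = f z" for z
    unfolding add.assoc[symmetric] s by simp_all
  hence pr: "f (z + 1) = f z" "f (z + \<tau>) = f z" for z by simp_all
  have "f (z + w) = f z" if "w \<in> period_lattice \<tau>" for z w
    by (rule lattice_period[of f, OF pr that])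
  moreover have "f \<circ> sigma \<tau> (- \<gamma>) = f" for \<gamma>
  proof
    fix z
    obtain a b where ab: "\<gamma> = (a, b)" by (cases \<gamma>)
    show "(f \<circ> sigma \<tau> (- \<gamma>)) z = f z" by (simp add: ab s)
  qed
  ultimately show "f \<in> invariant_ring \<tau> S"
    using f by (auto simp: invariant_ring_def punctured_ring_def torus_meromorphic_def D2_orbit_pts ell_def)
qed

end

section \<open>The invariant ring and Holod's algebra\<close>

fun nx :: "idx \<Rightarrow> idx" where "nx I1 = I2" | "nx I2 = I3" | "nx I3 = I1"

lemma nx_cyclic: "(i, nx i, nx (nx i)) \<in> cyclic_triples"
  by (cases i) (auto simp: cyclic_triples_def)

lemma cyclic_nx: "(i, j, k) \<in> cyclic_triples \<longleftrightarrow> j = nx i \<and> k = nx (nx i)"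
  by (cases i) (auto simp: cyclic_triples_def)

lemma nx3 [simp]: "nx (nx (nx i)) = i" by (cases i) auto

locale holod = torus +
  fixes z0 :: complex
  assumes z0_notin: "z0 \<notin> H" and wp_z0: "wp z0 = 0"
begin

definition DD :: "complex set" where "DD = pts {0, - z0, z0}"

lemma DD_polar [simp]: "polar_set DD" unfolding DD_def by (rule polar_pts) simp

lemma H_DD: "H \<subseteq> DD" by (auto simp: DD_def pts_def)

lemma in_DD: "z \<in> DD \<longleftrightarrow> z \<in> H \<or> z + z0 \<in> H \<or> z - z0 \<in> H"
  by (auto simp: DD_def in_pts)

lemma wp_zero_iff: "z \<notin> H \<Longrightarrow> wp z = 0 \<longleftrightarrow> z + z0 \<in> H \<or> z - z0 \<in> H"
  using wp_eq_iff[of z z0] z0_notin wp_z0 by auto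

lemma wp_nz: "z \<notin> DD \<Longrightarrow> wp z \<noteq> 0"
  using wp_zero_iff by (auto simp: in_DD)

text \<open>As \<open>wp\<close> vanishes at \<open>z0\<close> and \<open>- z0\<close>, each factor
  \<open>wp\<close> lowers a pole order there by at least one, until only the poles in
  \<open>H\<close> remain. Off \<open>DD\<close> the factor can be divided out again.\<close>

lemma clear_poles:
  assumes f: "ell DD s1 s2 f" and s: "s1 \<noteq> 0" "s2 \<noteq> 0"
  shows "\<exists>N g. ell H s1 s2 g \<and> (\<forall>z. z \<notin> DD \<longrightarrow> g z = f z * wp z ^ N)"
proof -
  have clr: "pole_le 0 a (\<lambda>z. f z * wp z ^ n)" if "pole_le n a f" "a = z0 \<or> a = - z0" for a n
  proof -
    have an: "wp analytic_on {a}" "wp a = 0"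
      using that(2) z0_notin wp_z0 by (auto simp: wp_even intro!: ell_analytic[OF wp_ell polar_H])
    have "pole_le (n - k) a (\<lambda>z. f z * wp z ^ k)" if "k \<le> n" for k
      using that
    proof (induction k)
      case (Suc k)
      hence "pole_le (Suc (n - Suc k)) a (\<lambda>z. f z * wp z ^ k)" by (simp add: Suc_diff_Suc)
      from pole_le_mult_zero[OF this an] show ?case by (simp add: mult_ac)
    qed (use \<open>pole_le n a f\<close> in simp)
    from this[of n] show ?thesis by simp
  qed
  obtain n1 where n1: "pole_le n1 z0 f" using meromorphic_pole_le[OF ell_mero[OF f]] .
  obtain n2 where n2: "pole_le n2 (- z0) f" using meromorphic_pole_le[OF ell_mero[OF f]] .
  define N where "N = max n1 n2"
  have p: "pole_le 0 a (\<lambda>z. f z * wp z ^ N)" if "a = z0 \<or> a = - z0" for a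
    using that clr[of N a] pole_le_mono[OF n1, of N] pole_le_mono[OF n2, of N] by (auto simp: N_def)
  have e: "ell DD s1 s2 (\<lambda>z. f z * wp z ^ N)"
    using ell_mult[OF f ell_power[OF ell_mono[OF wp_ell H_DD], of N]] by simp
  have pd: "pole_le 0 a (\<lambda>z. f z * wp z ^ N)" if "a \<in> DD - H" for a
  proof (rule ell_pole_le_pts[OF e DD_polar s, of a "{- z0, z0}"])
    show "a \<in> pts {- z0, z0}" using that by (auto simp: in_DD in_pts)
  qed (use p in auto)
  show ?thesis
    by (intro exI[of _ N] exI[of _ "remove_sings (\<lambda>z. f z * wp z ^ N)"])
       (use ell_extend[OF e DD_polar polar_H H_DD] pd in blast)
qed

section \<open>The invariant ring\<close>

lemma adjoin_ell: "f \<in> adjoin {wp, (\<lambda>z. inverse (wp z)), deriv wp} \<Longrightarrow> ell DD 1 1 f"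
proof (induction rule: adjoin.induct)
  case (gen g)
  thus ?case
    using ell_mono[OF wp_ell H_DD] ell_mono[OF wp_deriv_ell H_DD]
      ell_inverse[OF ell_mono[OF wp_ell H_DD] wp_nz] by auto
next
  case (mult f g)
  thus ?case using ell_mult[of DD 1 1 f 1 1 g] by simp
qed (auto intro: ell_const ell_add)

lemma adjoin_sum: "(\<And>n. n \<in> A \<Longrightarrow> f n \<in> adjoin G) \<Longrightarrow> (\<lambda>z. \<Sum>n\<in>A. f n z) \<in> adjoin G"
  by (induction A rule: infinite_finite_induct) (auto intro: adjoin.const adjoin.add)

lemma adjoin_power: "f \<in> adjoin G \<Longrightarrow> (\<lambda>z. f z ^ n) \<in> adjoin G"
  by (induction n) (auto intro: adjoin.const adjoin.mult)

text \<open>Pole order exactly \<open>n\<close> at 0 for \<open>n > 1\<close>: a factor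
  \<open>wp\<close> contributes 2 to the order and \<open>deriv wp\<close> contributes 3.\<close>

definition wp_monom :: "nat \<Rightarrow> complex \<Rightarrow> complex" where
  "wp_monom n z = (if even n then wp z ^ (n div 2) else wp z ^ ((n - 3) div 2) * deriv wp z)"

lemma wp_monom_ell: "ell H 1 1 (wp_monom n)"
  using ell_power[OF wp_ell, of "n div 2"] ell_mult[OF ell_power[OF wp_ell, of "(n - 3) div 2"] wp_deriv_ell]
  by (cases "even n") (simp_all add: wp_monom_def[abs_def])

lemma wp_monom_lim:
  assumes "1 < n"
  shows "\<exists>d. d \<noteq> 0 \<and> ((\<lambda>z. (z - 0) ^ n * wp_monom n z) \<longlongrightarrow> d) (at 0)"
proof (cases "even n")
  case True
  then obtain m where m: "n = 2 * m" by (auto elim: evenE)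
  have "((\<lambda>z. (z ^ 2 * wp z) ^ m) \<longlongrightarrow> 1 ^ m) (at 0)" by (intro tendsto_intros wp_lim)
  thus ?thesis by (intro exI[of _ 1]) (simp add: m wp_monom_def power_mult_distrib power_mult)
next
  case False
  define m where "m = (n - 3) div 2"
  have n: "n = 2 * m + 3" using False assms unfolding m_def by (auto elim!: oddE)
  have "((\<lambda>z. (z ^ 2 * wp z) ^ m * (z ^ 3 * deriv wp z)) \<longlongrightarrow> 1 ^ m * (- 2)) (at 0)"
    by (intro tendsto_intros wp_lim wp_deriv_lim)
  thus ?thesis
    by (intro exI[of _ "- 2"]) (simp add: n wp_monom_def power_mult_distrib power_add mult_ac flip: power_mult)
qed

text \<open>With the poles off \<open>H\<close> cleared, subtracting multiples of
  \<open>wp_monom n\<close> leaves at most a simple pole at 0, hence a constant; powers of the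
  inverse of \<open>wp\<close> undo the clearing.\<close>

lemma ell_in_adjoin:
  assumes f: "ell DD 1 1 f"
  obtains g where "g \<in> adjoin {wp, (\<lambda>z. inverse (wp z)), deriv wp}" "\<And>z. z \<notin> DD \<Longrightarrow> f z = g z"
proof -
  obtain N g where g: "ell H 1 1 g" "\<And>z. z \<notin> DD \<Longrightarrow> g z = f z * wp z ^ N"
    using clear_poles[OF f] by auto
  obtain m where m: "pole_le m 0 g" using meromorphic_pole_le[OF ell_mero[OF g(1)]] .
  obtain c where c: "pole_le 1 0 (\<lambda>z. g z - (\<Sum>n\<in>{1<..1+m}. c n * wp_monom n z))"
    using pole_reduction[of g 0 1 m wp_monom] ell_mero[OF g(1)] ell_mero[OF wp_monom_ell]
      pole_le_mono[OF m, of "1 + m"] wp_monom_lim by auto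
  have "ell H 1 1 (\<lambda>z. g z - (\<Sum>n\<in>{1<..1+m}. c n * wp_monom n z))"
    by (intro ell_diff g ell_sum ell_cmult wp_monom_ell)
  from ell_simple_pole[OF this c] obtain k where
    k: "\<And>z. z \<notin> H \<Longrightarrow> g z - (\<Sum>n\<in>{1<..1+m}. c n * wp_monom n z) = k" by blast
  define G where "G = {wp, (\<lambda>z. inverse (wp z)), deriv wp}"
  have gen: "wp \<in> adjoin G" "(\<lambda>z. inverse (wp z)) \<in> adjoin G" "deriv wp \<in> adjoin G"
    by (auto simp: G_def intro!: adjoin.gen)
  have mon: "wp_monom n \<in> adjoin G" for n
    using adjoin_power[OF gen(1), of "n div 2"] adjoin.mult[OF adjoin_power[OF gen(1), of "(n - 3) div 2"] gen(3)]
    by (cases "even n") (simp_all add: wp_monom_def[abs_def])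
  define F where "F = (\<lambda>z. (k + (\<Sum>n\<in>{1<..1+m}. c n * wp_monom n z)) * inverse (wp z) ^ N)"
  have "F \<in> adjoin G" unfolding F_def
    by (intro adjoin.mult adjoin.add adjoin.const adjoin_sum mon adjoin_power gen)
  moreover have "f z = F z" if z: "z \<notin> DD" for z
  proof -
    have "g z = k + (\<Sum>n\<in>{1<..1+m}. c n * wp_monom n z)" using k[of z] z H_DD by (auto simp: algebra_simps)
    hence "F z = f z * (wp z ^ N * inverse (wp z) ^ N)" using g(2)[OF z] by (simp add: F_def)
    also have "\<dots> = f z" using wp_nz[OF z] by (simp flip: power_mult_distrib)
    finally show ?thesis by simp
  qed
  ultimately show ?thesis using that by (simp add: G_def)
qed

lemma ell_remove_sings: "ell DD s1 s2 f \<Longrightarrow> ell DD s1 s2 (remove_sings f) \<and> remove_sings f nicely_meromorphic_on UNIV \<and>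
    (\<forall>z. z \<notin> DD \<longrightarrow> remove_sings f z = f z)"
  using ell_extend(1,2)[OF _ DD_polar DD_polar subset_refl, of s1 s2 f] remove_sings_nicely_meromorphic[OF ell_mero] by auto

lemma wp_ring_eq: "wp_ring H = {f. ell DD 1 1 f \<and> f nicely_meromorphic_on UNIV}"
proof (intro subset_antisym subsetI)
  fix f assume "f \<in> wp_ring H"
  thus "f \<in> {f. ell DD 1 1 f \<and> f nicely_meromorphic_on UNIV}"
    unfolding wp_ring_def using adjoin_ell ell_remove_sings by blast
next
  fix f assume "f \<in> {f. ell DD 1 1 f \<and> f nicely_meromorphic_on UNIV}"
  hence f: "ell DD 1 1 f" "f nicely_meromorphic_on UNIV" by auto
  obtain g where g: "g \<in> adjoin {wp, (\<lambda>z. inverse (wp z)), deriv wp}" "\<And>z. z \<notin> DD \<Longrightarrow> f z = g z"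
    using ell_in_adjoin[OF f(1)] by blast
  have "f = remove_sings g"
    using ell_remove_sings[OF adjoin_ell[OF g(1)]] g(2)
    by (intro nicely_meromorphic_eqI[OF f(2) _ polar_sparse[OF DD_polar]]) auto
  thus "f \<in> wp_ring H" unfolding wp_ring_def using g(1) by blast
qed

section \<open>Holod's functions as a family with prescribed pole orders\<close>

definition pp :: "complex \<Rightarrow> complex" where "pp z = weierstrass_p (period_lattice \<tau>) (2 * z)"

lemma pp_eq: "pp z = wp z / 4" by (simp add: pp_def wp_half_lattice)

lemma pp_nz: "z \<notin> DD \<Longrightarrow> pp z \<noteq> 0" using wp_nz by (simp add: pp_eq)

lemma pp_ell: "ell H 1 1 pp" unfolding pp_eq[abs_def] using ell_cmult[OF wp_ell, of "1/4"] by simp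

lemma pp_powi_ell: "ell DD 1 1 (\<lambda>z. pp z powi n)"
proof -
  have p: "ell DD 1 1 pp" using ell_mono[OF pp_ell H_DD] .
  show ?thesis
    using ell_power[OF p, of "nat n"] ell_power[OF ell_inverse[OF p pp_nz], of "nat (- n)"]
    by (cases "n \<ge> 0") (simp_all add: power_int_def)
qed

text \<open>The scalar factor of Holod's basis element of degree \<open>n > 0\<close> and index
  \<open>i\<close>; its pole order at 0 equals the degree.\<close>

definition hfun :: "idx \<Rightarrow> nat \<Rightarrow> complex \<Rightarrow> complex" where
  "hfun i n z = (if odd n then pp z ^ ((n - 1) div 2) * mu \<tau> i z
     else pp z ^ ((n - 2) div 2) * mu \<tau> (nx i) z * mu \<tau> (nx (nx i)) z)"

lemma hfun_ell: "ell H (chi1 i) (chi2 i) (hfun i n)"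
proof -
  have "chi1 (nx i) * chi1 (nx (nx i)) = chi1 i" "chi2 (nx i) * chi2 (nx (nx i)) = chi2 i"
    by (cases i; simp)+
  thus ?thesis
    using ell_mult[OF ell_power[OF pp_ell, of "(n - 1) div 2"] mu_ell[of i]]
      ell_mult[OF ell_mult[OF ell_power[OF pp_ell, of "(n - 2) div 2"] mu_ell[of "nx i"]] mu_ell[of "nx (nx i)"]]
    by (cases "odd n") (simp_all add: hfun_def[abs_def])
qed

lemma hfun_lim:
  assumes "0 < n"
  shows "\<exists>d. d \<noteq> 0 \<and> ((\<lambda>z. (z - 0) ^ n * hfun i n z) \<longlongrightarrow> d) (at 0)"
proof -
  have p: "((\<lambda>z. z ^ 2 * pp z) \<longlongrightarrow> 1/4) (at 0)"
    using tendsto_divide[OF wp_lim tendsto_const[of 4]] by (simp add: pp_eq)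
  show ?thesis
  proof (cases "odd n")
    case True
    then obtain m where m: "n = 2 * m + 1" by (auto elim: oddE)
    have "((\<lambda>z. (z ^ 2 * pp z) ^ m * (z * mu \<tau> i z)) \<longlongrightarrow> (1/4) ^ m * (1/2)) (at 0)"
      by (intro tendsto_intros p mu_lim)
    thus ?thesis
      by (intro exI[of _ "(1/4) ^ m * (1/2)"]) (simp add: m hfun_def power_mult_distrib mult_ac flip: power_mult)
  next
    case False
    define m where "m = (n - 2) div 2"
    have m: "n = 2 * m + 2" using False assms unfolding m_def by (auto elim!: evenE)
    have "((\<lambda>z. (z ^ 2 * pp z) ^ m * (z * mu \<tau> (nx i) z) * (z * mu \<tau> (nx (nx i)) z)) \<longlongrightarrow> (1/4) ^ m * (1/2) * (1/2)) (at 0)"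
      by (intro tendsto_intros p mu_lim)
    thus ?thesis
      by (intro exI[of _ "(1/4) ^ m * (1/2) * (1/2)"])
         (simp add: m hfun_def power_mult_distrib power_mult mult_ac power2_eq_square)
  qed
qed

text \<open>Every pole order from 1 on is realised, so the reduction goes down to order 0, and the
  nontrivial sign forces the rest to vanish.\<close>

lemma ell_hfun_expansion:
  assumes f: "ell DD (chi1 i) (chi2 i) f"
  shows "\<exists>N m c. \<forall>z. z \<notin> DD \<longrightarrow> f z = (\<Sum>n\<in>{0<..m}. c n * hfun i n z) * inverse (pp z) ^ N"
proof -
  obtain N g where g: "ell H (chi1 i) (chi2 i) g" "\<And>z. z \<notin> DD \<Longrightarrow> g z = f z * wp z ^ N"
    using clear_poles[OF f] by auto
  obtain m where m: "pole_le m 0 g" using meromorphic_pole_le[OF ell_mero[OF g(1)]] .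
  obtain c where c: "pole_le 0 0 (\<lambda>z. g z - (\<Sum>n\<in>{0<..m}. c n * hfun i n z))"
    using pole_reduction[of g 0 0 m "hfun i"] ell_mero[OF g(1)] ell_mero[OF hfun_ell] m hfun_lim by auto
  have e: "ell H (chi1 i) (chi2 i) (\<lambda>z. g z - (\<Sum>n\<in>{0<..m}. c n * hfun i n z))"
    by (intro ell_diff g ell_sum ell_cmult hfun_ell)
  have k: "g z - (\<Sum>n\<in>{0<..m}. c n * hfun i n z) = 0" if "z \<notin> H" for z
  proof (rule ell_Liouville_0[OF e polar_H _ _ _ chi_nontrivial that])
    fix a assume "a \<in> H"
    thus "pole_le 0 a (\<lambda>z. g z - (\<Sum>n\<in>{0<..m}. c n * hfun i n z))"
      using c by (intro ell_pole_le_pts[OF e polar_H, of a "{0}"]) (auto simp flip: H_eq_pts)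
  qed auto
  \<comment> \<open>The powers of 4 convert \<open>wp ^ N\<close>, which cleared the poles, to
    \<open>pp ^ N\<close>.\<close>
  have "f z = (\<Sum>n\<in>{0<..m}. (c n / 4 ^ N) * hfun i n z) * inverse (pp z) ^ N" if z: "z \<notin> DD" for z
  proof -
    have "z \<notin> H" using z H_DD by blast
    hence "(\<Sum>n\<in>{0<..m}. (c n / 4 ^ N) * hfun i n z) = g z / 4 ^ N"
      using k[of z] by (simp flip: sum_divide_distrib)
    thus ?thesis using g(2)[OF z] wp_nz[OF z] by (simp add: pp_eq field_simps)
  qed
  hence "\<forall>z. z \<notin> DD \<longrightarrow> f z = (\<Sum>n\<in>{0<..m}. (c n / 4 ^ N) * hfun i n z) * inverse (pp z) ^ N" by simp
  thus ?thesis by (rule_tac x = N in exI, rule_tac x = m in exI, rule_tac x = "\<lambda>n. c n / 4 ^ N" in exI)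
qed

abbreviation hgens :: "(complex \<Rightarrow> cmat) set" where
  "hgens \<equiv> {holod_even \<tau> t n | t n. t \<in> cyclic_triples} \<union> {holod_odd \<tau> i m | i m. True}"

abbreviation hspan :: "(complex \<Rightarrow> cmat) set" where "hspan \<equiv> module.span smult_fun hgens"

lemma equivariant_fun_v: "ell DD (chi1 i) (chi2 i) f \<Longrightarrow> equivariant DD (\<lambda>z. smult_mat (f z) (holod_v i))"
  by (rule equivariantI)
     (auto simp: coord_smult coord_v trace_smult trace_v ell_zero intro: ell_cong[where f = f])

lemma hspan_equivariant: "Y \<in> hspan \<Longrightarrow> equivariant DD Y"
proof -
  interpret F: module smult_fun by (rule module_smult_fun)
  have "F.subspace {Y. equivariant DD Y}"
    using equivariant_zero[OF DD_polar] equivariant_add[OF _ _ DD_polar] equivariant_smult[OF _ DD_polar]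
    by (intro F.subspaceI) (auto simp: smult_fun_def zero_fun_def plus_fun_def)
  moreover have "hgens \<subseteq> {Y. equivariant DD Y}"
  proof (intro Un_least subsetI)
    fix Y assume "Y \<in> {holod_even \<tau> t n | t n. t \<in> cyclic_triples}"
    then obtain i j k n where ijk: "(i, j, k) \<in> cyclic_triples" and Y: "Y = holod_even \<tau> (i, j, k) n" by auto
    have "ell DD (chi1 i) (chi2 i) (\<lambda>z. pp z powi n * mu \<tau> j z * mu \<tau> k z)"
      using ell_mult[OF ell_mult[OF pp_powi_ell ell_mono[OF mu_ell[of j] H_DD]] ell_mono[OF mu_ell[of k] H_DD], of n]
        chi_mult[OF ijk[unfolded cyclic_rotate[of i j k]]] by simp
    from equivariant_fun_v[OF this] show "Y \<in> {Y. equivariant DD Y}"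
      by (simp add: Y pp_def fun_eq_iff[symmetric] holod_even.simps[abs_def])
  next
    fix Y assume "Y \<in> {holod_odd \<tau> i m | i m. True}"
    then obtain i m where Y: "Y = holod_odd \<tau> i m" by auto
    have "ell DD (chi1 i) (chi2 i) (\<lambda>z. pp z powi m * mu \<tau> i z)"
      using ell_mult[OF pp_powi_ell ell_mono[OF mu_ell[of i] H_DD], of m] by simp
    from equivariant_fun_v[OF this] show "Y \<in> {Y. equivariant DD Y}"
      by (simp add: Y pp_def holod_odd_def[abs_def])
  qed
  ultimately show "Y \<in> hspan \<Longrightarrow> equivariant DD Y" using F.span_minimal by blast
qed

text \<open>A factor \<open>inverse (pp z) ^ N\<close> only lowers the exponent of
  \<open>pp\<close>, which ranges over all integers in Holod's basis.\<close>

lemma hspan_hfun: "\<exists>Y\<in>hspan. \<forall>z. z \<notin> DD \<longrightarrow> Y z = smult_mat (hfun i n z * inverse (pp z) ^ N) (holod_v i)" if "n > 0"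
proof -
  interpret F: module smult_fun by (rule module_smult_fun)
  have pw: "pp z powi (int m - int N) = pp z ^ m * inverse (pp z) ^ N" if "z \<notin> DD" for z m
    using pp_nz[OF that] by (simp add: power_int_diff field_simps)
  have odd: "holod_odd \<tau> i l z = smult_mat (pp z powi l * mu \<tau> i z) (holod_v i)" for l z
    by (simp only: holod_odd_def pp_def)
  have even: "holod_even \<tau> (i, j, k) l z = smult_mat (pp z powi l * mu \<tau> j z * mu \<tau> k z) (holod_v i)" for l z j k
    by (simp only: holod_even.simps pp_def)
  show ?thesis
  proof (cases "odd n")
    case True
    have "holod_odd \<tau> i (int ((n - 1) div 2) - int N) \<in> hspan" by (rule F.span_base) blast
    thus ?thesis
      by (rule bexI[rotated]) (auto simp: odd hfun_def True pw mult_ac)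
  next
    case False
    have "holod_even \<tau> (i, nx i, nx (nx i)) (int ((n - 2) div 2) - int N) \<in> hspan"
      by (rule F.span_base) (use nx_cyclic in blast)
    thus ?thesis
      by (rule bexI[rotated]) (use False in \<open>auto simp: even hfun_def pw mult_ac simp del: holod_even.simps\<close>)
  qed
qed

lemma hspan_coord:
  assumes "ell DD (chi1 i) (chi2 i) f"
  shows "\<exists>Y\<in>hspan. \<forall>z. z \<notin> DD \<longrightarrow> Y z = smult_mat (f z) (holod_v i)"
proof -
  interpret F: module smult_fun by (rule module_smult_fun)
  obtain N m c where f: "\<And>z. z \<notin> DD \<Longrightarrow> f z = (\<Sum>n\<in>{0<..m}. c n * hfun i n z) * inverse (pp z) ^ N"
    using ell_hfun_expansion[OF assms] by blast
  define Q where "Q = (\<lambda>n Y. Y \<in> hspan \<and>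
    (\<forall>z. z \<notin> DD \<longrightarrow> Y z = smult_mat (hfun i n z * inverse (pp z) ^ N) (holod_v i)))"
  define Y where "Y = (\<lambda>n. SOME Y. Q n Y)"
  have "Q n (Y n)" if "n \<in> {0<..m}" for n
  proof -
    have "\<exists>Y. Q n Y" using hspan_hfun[of n i N] that unfolding Q_def by auto
    from someI_ex[OF this] show ?thesis by (simp only: Y_def)
  qed
  hence Y: "\<And>n. n \<in> {0<..m} \<Longrightarrow> Y n \<in> hspan"
    "\<And>n z. n \<in> {0<..m} \<Longrightarrow> z \<notin> DD \<Longrightarrow> Y n z = smult_mat (hfun i n z * inverse (pp z) ^ N) (holod_v i)"
    by (simp_all add: Q_def)
  have "(\<Sum>n\<in>{0<..m}. smult_fun (c n) (Y n)) \<in> hspan"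
    by (intro F.span_sum F.span_scale Y)
  moreover have "(\<Sum>n\<in>{0<..m}. smult_fun (c n) (Y n)) z = smult_mat (f z) (holod_v i)" if z: "z \<notin> DD" for z
  proof -
    have ap: "(\<Sum>n\<in>A. smult_fun (c n) (Y n)) z $ a $ b = (\<Sum>n\<in>A. c n * Y n z $ a $ b)" for A a b
      by (induction A rule: infinite_finite_induct) (auto simp: smult_fun_def)
    have "(\<Sum>n\<in>{0<..m}. c n * Y n z $ a $ b) = f z * holod_v i $ a $ b" for a b
    proof -
      have "(\<Sum>n\<in>{0<..m}. c n * Y n z $ a $ b)
          = (\<Sum>n\<in>{0<..m}. c n * hfun i n z * (inverse (pp z) ^ N * holod_v i $ a $ b))"
        by (rule sum.cong) (simp_all add: Y(2)[OF _ z] mult_ac)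
      thus ?thesis by (simp only: f[OF z] sum_distrib_right mult.assoc)
    qed
    thus ?thesis by (simp add: vec_eq_iff ap)
  qed
  ultimately show ?thesis by blast
qed

text \<open>Every element splits into three coordinates, which are expanded separately. The equality
  also shows that the span of Holod's generators, in normal form, is closed under the
  bracket.\<close>

lemma holod_algebra_eq: "holod_algebra \<tau> = mero_lie (equi_algebra DD)"
proof -
  interpret F: module smult_fun by (rule module_smult_fun)
  have "remove_sings_mat ` hspan = equi_algebra DD"
  proof (intro subset_antisym subsetI)
    fix X assume "X \<in> remove_sings_mat ` hspan"
    thus "X \<in> equi_algebra DD" using hspan_equivariant remove_sings_mat_in by auto
  next
    fix X assume X: "X \<in> equi_algebra DD"
    hence eX: "equivariant DD X" by (simp add: equi_algebra_def)
    have "\<forall>i. \<exists>Y. Y \<in> hspan \<and> (\<forall>z. z \<notin> DD \<longrightarrow> Y z = smult_mat (coord i (X z)) (holod_v i))"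
    proof
      fix i
      show "\<exists>Y. Y \<in> hspan \<and> (\<forall>z. z \<notin> DD \<longrightarrow> Y z = smult_mat (coord i (X z)) (holod_v i))"
        using hspan_coord[OF equivariant_coord[OF eX, of i]] by blast
    qed
    from choice[OF this] obtain Y where
      *: "\<forall>i. Y i \<in> hspan \<and> (\<forall>z. z \<notin> DD \<longrightarrow> Y i z = smult_mat (coord i (X z)) (holod_v i))" by (elim exE)
    hence Y: "Y i \<in> hspan" "z \<notin> DD \<Longrightarrow> Y i z = smult_mat (coord i (X z)) (holod_v i)" for i z
      by simp_all
    define W where "W = Y I1 + Y I2 + Y I3"
    have W: "W \<in> hspan" unfolding W_def by (intro F.span_add Y)
    have XW: "X z = W z" if "z \<notin> DD" for z
    proof (rule cmat_eqI_coord)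
      show "coord i (X z) = coord i (W z)" for i
        by (cases i) (simp_all add: W_def Y(2)[OF that] coord_add coord_smult coord_v del: coord.simps holod_v.simps)
      show "trace (X z) = 0" by (rule equivariant_trace[OF eX that])
      show "trace (W z) = 0" by (rule equivariant_trace[OF hspan_equivariant[OF W] that])
    qed
    have "X = remove_sings_mat W"
      using remove_sings_mat_off[OF hspan_equivariant[OF W] DD_polar] XW
      by (intro equi_algebra_eqI[OF X remove_sings_mat_in[OF hspan_equivariant[OF W]]]) auto
    thus "X \<in> remove_sings_mat ` hspan" using W by blast
  qed
  thus ?thesis by (simp add: holod_algebra_def)
qed

text \<open>The value 0, which \<open>wp\<close> takes at \<open>z0\<close>, is taken only at
  \<open>z0\<close> and \<open>- z0\<close> modulo \<open>H\<close>.\<close>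

lemma zero_set:
  "{z. 2 * z \<notin> period_lattice \<tau> \<and> weierstrass_p (period_lattice \<tau>) (2 * z) = 0} = D2_orbit \<tau> {z0, - z0}"
proof -
  have "2 * z \<notin> period_lattice \<tau> \<and> weierstrass_p (period_lattice \<tau>) (2 * z) = 0 \<longleftrightarrow> z - z0 \<in> H \<or> z + z0 \<in> H" for z
  proof -
    have "z \<notin> H" if "z - z0 \<in> H \<or> z + z0 \<in> H"
    proof
      assume "z \<in> H"
      with that have "z0 \<in> H" using H_diff[of z "z - z0"] H_diff[of "z + z0" z] by auto
      thus False using z0_notin by simp
    qed
    moreover have "weierstrass_p (period_lattice \<tau>) (2 * z) = 0 \<longleftrightarrow> wp z = 0" by (simp add: wp_half_lattice)
    ultimately show ?thesis using wp_zero_iff[of z] by (auto simp flip: H_iff_lattice)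
  qed
  moreover have "z \<in> pts {z0, - z0} \<longleftrightarrow> z - z0 \<in> H \<or> z + z0 \<in> H" for z unfolding in_pts by simp
  ultimately show ?thesis unfolding D2_orbit_pts by (intro set_eqI) (simp only: mem_Collect_eq)
qed

end

section \<open>The normal form\<close>

text \<open>A multiple of the Killing form.\<close>

definition kil :: "cmat \<Rightarrow> cmat \<Rightarrow> complex" where
  "kil X Y = coord I1 X * coord I1 Y + coord I2 X * coord I2 Y + coord I3 X * coord I3 Y"

lemma kil_trace: "trace X = 0 \<Longrightarrow> trace Y = 0 \<Longrightarrow> kil X Y = - 2 * trace (X ** Y)"
proof -
  assume X: "trace X = 0" and Y: "trace Y = 0"
  have "X $ 2 $ 2 = - X $ 1 $ 1" "Y $ 2 $ 2 = - Y $ 1 $ 1"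
    using X Y by (simp_all add: cmat_trace eq_neg_iff_add_eq_0 add.commute)
  thus ?thesis by (simp add: kil_def cmat_trace cmat_mult_nth algebra_simps)
qed

lemma kil_add: "kil (X + Y) Z = kil X Z + kil Y Z" and kil_smult: "kil (smult_mat c X) Z = c * kil X Z"
  by (simp_all only: kil_def coord_add coord_smult algebra_simps)

lemma sl2_trace [simp]: "trace sl2_h = 0" "trace sl2_e = 0" "trace sl2_f = 0"
  by (simp_all add: sl2_h_def sl2_e_def sl2_f_def cmat_trace)

lemma kil_sl2: "kil sl2_h sl2_h = -4" "kil sl2_h sl2_e = 0" "kil sl2_h sl2_f = 0"
  "kil sl2_e sl2_h = 0" "kil sl2_e sl2_e = 0" "kil sl2_e sl2_f = -2"
  "kil sl2_f sl2_h = 0" "kil sl2_f sl2_e = -2" "kil sl2_f sl2_f = 0"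
  by (simp_all add: sl2_h_def sl2_e_def sl2_f_def kil_def)

context
  fixes g gi :: cmat
  assumes inv: "g ** gi = mat 1" "gi ** g = mat 1"
begin

abbreviation cj :: "cmat \<Rightarrow> cmat" where "cj X \<equiv> g ** X ** gi"

lemma cj_mult: "cj X ** cj Y = cj (X ** Y)"
proof -
  have "cj X ** cj Y = g ** X ** (gi ** g) ** Y ** gi" by (simp only: matrix_mul_assoc)
  thus ?thesis by (simp add: inv matrix_mul_assoc)
qed

lemma trace_cj: "trace (cj X) = trace X"
proof -
  have "trace (g ** (X ** gi)) = trace ((X ** gi) ** g)" by (rule trace_mul_sym)
  also have "(X ** gi) ** g = X ** (gi ** g)" by (simp only: matrix_mul_assoc)
  finally show ?thesis by (simp add: inv matrix_mul_assoc)
qed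

lemma cj_add: "cj (X + Y) = cj X + cj Y"
  and cj_smult: "cj (smult_mat c X) = smult_mat c (cj X)"
  by (simp_all add: cmat_eq_iff cmat_mult_nth algebra_simps)

lemma cj_bracket: "lie_bracket (cj X) (cj Y) = cj (lie_bracket X Y)"
proof -
  have "cj (X ** Y - Y ** X) = cj (X ** Y) - cj (Y ** X)"
    by (simp add: cmat_eq_iff cmat_mult_nth algebra_simps)
  thus ?thesis by (simp add: lie_bracket_def cj_mult)
qed

lemma kil_cj: "trace X = 0 \<Longrightarrow> trace Y = 0 \<Longrightarrow> kil (cj X) (cj Y) = kil X Y"
  by (simp add: kil_trace trace_cj cj_mult)

text \<open>The form \<open>kil\<close> pairs \<open>sl2_h\<close> with itself to -4 and
  \<open>sl2_e\<close> with \<open>sl2_f\<close> to -2; the other pairs give 0. Coefficients are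
  therefore read off by pairing with the dual basis, where \<open>sl2_e\<close> and
  \<open>sl2_f\<close> change places, and conjugation preserves the form.\<close>

lemma cj_decompose:
  assumes "trace X = 0"
  shows "X = smult_mat (- kil X (cj sl2_h) / 4) (cj sl2_h) + smult_mat (- kil X (cj sl2_f) / 2) (cj sl2_e)
     + smult_mat (- kil X (cj sl2_e) / 2) (cj sl2_f)"
proof -
  define Y where "Y = gi ** X ** g"
  have XY: "X = cj Y"
  proof -
    have "cj Y = (g ** gi) ** X ** (g ** gi)" by (simp only: Y_def matrix_mul_assoc)
    thus ?thesis by (simp add: inv)
  qed
  have tY: "trace Y = 0" using assms trace_cj[of Y] XY by simp
  have "Y = smult_mat (- kil Y sl2_h / 4) sl2_h + smult_mat (- kil Y sl2_f / 2) sl2_e + smult_mat (- kil Y sl2_e / 2) sl2_f"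
  proof -
    have "Y $ 2 $ 2 = - Y $ 1 $ 1" using tY by (simp add: cmat_trace eq_neg_iff_add_eq_0 add.commute)
    thus ?thesis by (simp add: cmat_eq_iff kil_def sl2_h_def sl2_e_def sl2_f_def algebra_simps)
  qed
  hence "cj Y = smult_mat (- kil Y sl2_h / 4) (cj sl2_h) + smult_mat (- kil Y sl2_f / 2) (cj sl2_e)
     + smult_mat (- kil Y sl2_e / 2) (cj sl2_f)"
    by (metis cj_add cj_smult)
  thus ?thesis unfolding XY kil_cj[OF tY sl2_trace(1)] kil_cj[OF tY sl2_trace(2)] kil_cj[OF tY sl2_trace(3)] .
qed

end

lemma lie_bracket_sl2:
  "lie_bracket sl2_h sl2_e = smult_mat 2 sl2_e" "lie_bracket sl2_h sl2_f = smult_mat (-2) sl2_f"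
  "lie_bracket sl2_e sl2_f = sl2_h"
  by (simp_all add: cmat_eq_iff lie_bracket_nth sl2_h_def sl2_e_def sl2_f_def)

lemma Ad_mat2_sl2:
  assumes "p * s - q * r = \<delta>" "\<delta> \<noteq> 0"
  shows "Ad (mat2 p q r s) sl2_h = smult_mat (1 / \<delta>) (mat2 (p * s + q * r) (- 2 * p * q) (2 * r * s) (- (p * s + q * r)))"
    "Ad (mat2 p q r s) sl2_e = smult_mat (1 / \<delta>) (mat2 (- p * r) (p ^ 2) (- (r ^ 2)) (p * r))"
    "Ad (mat2 p q r s) sl2_f = smult_mat (1 / \<delta>) (mat2 (q * s) (- (q ^ 2)) (s ^ 2) (- q * s))"
proof -
  have mi: "matrix_inv (mat2 p q r s) = smult_mat (1 / \<delta>) (mat2 s (- q) (- r) p)"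
    using matrix_inv_mat2[of p s q r] assms by simp
  show "Ad (mat2 p q r s) sl2_h = smult_mat (1 / \<delta>) (mat2 (p * s + q * r) (- 2 * p * q) (2 * r * s) (- (p * s + q * r)))"
    "Ad (mat2 p q r s) sl2_e = smult_mat (1 / \<delta>) (mat2 (- p * r) (p ^ 2) (- (r ^ 2)) (p * r))"
    "Ad (mat2 p q r s) sl2_f = smult_mat (1 / \<delta>) (mat2 (q * s) (- (q ^ 2)) (s ^ 2) (- q * s))"
    using assms(2) unfolding Ad_def mi
    by (simp_all add: cmat_eq_iff cmat_mult_nth sl2_h_def sl2_e_def sl2_f_def power2_eq_square field_simps)
qed

context torus
begin

section \<open>Conjugation by Omega\<close>

abbreviation "ta \<equiv> theta3 0 \<tau>"
abbreviation "tb \<equiv> theta4 0 \<tau>"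
abbreviation "tc \<equiv> theta2 0 \<tau>"

text \<open>Up to constants, \<open>al\<close>, \<open>be\<close> and \<open>ga\<close> are
  \<open>mu\<close> with the indices \<open>I2\<close>, \<open>I3\<close> and
  \<open>I1\<close>.\<close>

definition al :: "complex \<Rightarrow> complex" where "al z = theta3 (2 * z) \<tau> / theta1 (2 * z) \<tau>"
definition be :: "complex \<Rightarrow> complex" where "be z = theta4 (2 * z) \<tau> / theta1 (2 * z) \<tau>"
definition ga :: "complex \<Rightarrow> complex" where "ga z = theta2 (2 * z) \<tau> / theta1 (2 * z) \<tau>"

lemma abg_ell: "ell H (-1) (-1) al" "ell H (-1) 1 be" "ell H 1 (-1) ga"
  using ell_cmult[OF mu_ell[of I2], of "ta / D1"] ell_cmult[OF mu_ell[of I3], of "tb / D1"]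
    ell_cmult[OF mu_ell[of I1], of "tc / D1"]
  by (simp_all add: al_def[abs_def] be_def[abs_def] ga_def[abs_def] mu_eq)

lemma psi_eq: "psi_coeff \<tau> s z = s * (tb ^ 2 / ta) * al z - (ta ^ 2 / tb) * be z"
  by (simp add: psi_coeff_def al_def be_def)

text \<open>The determinant of Omega is \<open>\<delta>\<close>, by the first quadratic identity.
  The entries of Omega are not elliptic, but a conjugated matrix contains the theta functions for
  \<open>2 * \<tau>\<close> only in quadratic products over \<open>\<delta>\<close>, and the
  duplication formulas turn these into quotients of theta functions for
  \<open>\<tau>\<close>.\<close>

lemma Omega_entries:
  assumes z: "z \<notin> H"
  defines "q \<equiv> theta3 (2 * z) (2 * \<tau>)" and "s \<equiv> theta2 (2 * z) (2 * \<tau>)"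
    and "\<delta> \<equiv> tc ^ 2 * theta1 (2 * z) \<tau>"
  shows "psi_coeff \<tau> (-1) z * s * s - q * (psi_coeff \<tau> 1 z * q) = \<delta>" "\<delta> \<noteq> 0"
    "s ^ 2 / \<delta> = (ta * al z - tb * be z) / (2 * tc ^ 2)" "q ^ 2 / \<delta> = (ta * al z + tb * be z) / (2 * tc ^ 2)"
    "s * q / \<delta> = ga z / (2 * tc)"
proof -
  let ?t = "theta1 (2 * z) \<tau>" and ?A = "theta3 (2 * z) \<tau>" and ?B = "theta4 (2 * z) \<tau>" and ?C = "theta2 (2 * z) \<tau>"
  have t: "?t \<noteq> 0" using z by (simp add: theta_zero_iff_H)
  show d: "\<delta> \<noteq> 0" using t by (simp add: \<delta>_def)
  have q2: "q ^ 2 = (ta * ?A + tb * ?B) / 2" and s2: "s ^ 2 = (ta * ?A - tb * ?B) / 2" and sq: "s * q = tc * ?C / 2"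
    using theta_double[of "2 * z"] by (simp_all add: q_def s_def field_simps)
  show "s ^ 2 / \<delta> = (ta * al z - tb * be z) / (2 * tc ^ 2)" "q ^ 2 / \<delta> = (ta * al z + tb * be z) / (2 * tc ^ 2)"
    using t unfolding s2 q2 by (simp_all add: \<delta>_def al_def be_def field_simps)
  show "s * q / \<delta> = ga z / (2 * tc)" using t unfolding sq by (simp add: \<delta>_def ga_def field_simps power2_eq_square)
  have "psi_coeff \<tau> (-1) z * s * s - q * (psi_coeff \<tau> 1 z * q) = psi_coeff \<tau> (-1) z * s ^ 2 - psi_coeff \<tau> 1 z * q ^ 2"
    by (simp add: power2_eq_square)
  also have "\<dots> = (ta ^ 2 * ?B ^ 2 - tb ^ 2 * ?A ^ 2) / ?t"
    using t unfolding s2 q2 psi_eq al_def be_def by (simp add: field_simps power2_eq_square power3_eq_cube)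
  also have "\<dots> = \<delta>" unfolding theta_quadratic(1) using t by (simp add: \<delta>_def power2_eq_square)
  finally show "psi_coeff \<tau> (-1) z * s * s - q * (psi_coeff \<tau> 1 z * q) = \<delta>" .
qed

definition uu :: complex where "uu = tb ^ 2 / ta"
definition vv :: complex where "vv = ta ^ 2 / tb"

text \<open>After the substitution of the quadratic quotients, each coordinate is a polynomial in
  \<open>al\<close>, \<open>be\<close> and \<open>ga\<close> all of whose monomials have the
  multipliers required for its index.\<close>

lemma Omega_coords:
  assumes z: "z \<notin> H"
  shows "coord I1 (Ad (Omega \<tau> z) sl2_f) = (- \<i> / tc) * ga z"
    "coord I2 (Ad (Omega \<tau> z) sl2_f) = (- ta / tc ^ 2) * al z"
    "coord I3 (Ad (Omega \<tau> z) sl2_f) = (\<i> * tb / tc ^ 2) * be z"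
    "coord I1 (Ad (Omega \<tau> z) sl2_h) = (- 2 * \<i> * (uu * tb - vv * ta) / tc ^ 2) * (al z * be z)"
    "coord I2 (Ad (Omega \<tau> z) sl2_h) = (2 * vv / tc) * (be z * ga z)"
    "coord I3 (Ad (Omega \<tau> z) sl2_h) = (- 2 * \<i> * uu / tc) * (al z * ga z)"
    "coord I1 (Ad (Omega \<tau> z) sl2_e) = (\<i> * vv ^ 2 / tc * be z ^ 2 + (- \<i> * uu ^ 2 / tc) * al z ^ 2) * ga z"
    "coord I2 (Ad (Omega \<tau> z) sl2_e) = (ta * uu ^ 2 / tc ^ 2 * al z ^ 2 + (ta * vv ^ 2 - 2 * uu * vv * tb) / tc ^ 2 * be z ^ 2) * al z"
    "coord I3 (Ad (Omega \<tau> z) sl2_e) = (- \<i> * (2 * uu * vv * ta - tb * uu ^ 2) / tc ^ 2 * al z ^ 2 + \<i> * tb * vv ^ 2 / tc ^ 2 * be z ^ 2) * be z"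
proof -
  define q s \<delta> m p where "q = theta3 (2 * z) (2 * \<tau>)" and "s = theta2 (2 * z) (2 * \<tau>)"
    and "\<delta> = tc ^ 2 * theta1 (2 * z) \<tau>" and "m = psi_coeff \<tau> (-1) z" and "p = psi_coeff \<tau> 1 z"
  note O = Omega_entries[OF z, folded q_def s_def \<delta>_def m_def p_def]
  define S Q G where "S = s ^ 2 / \<delta>" and "Q = q ^ 2 / \<delta>" and "G = s * q / \<delta>"
  have S: "S = (ta * al z - tb * be z) / (2 * tc ^ 2)" and Q: "Q = (ta * al z + tb * be z) / (2 * tc ^ 2)"
    and G: "G = ga z / (2 * tc)" unfolding S_def Q_def G_def by (rule O)+
  have m: "m = - uu * al z - vv * be z" and p: "p = uu * al z - vv * be z"
    by (simp_all add: m_def p_def psi_eq uu_def vv_def)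
  have Om: "Omega \<tau> z = mat2 (m * s) q (p * q) s" by (simp add: Omega_def m_def p_def s_def q_def)
  have mul: "1 / \<delta> * (s * q) = G" "1 / \<delta> * s ^ 2 = S" "1 / \<delta> * q ^ 2 = Q" by (simp_all add: S_def Q_def G_def)
  note A = Ad_mat2_sl2[OF O(1,2)]
  have f: "coord I1 (Ad (Omega \<tau> z) sl2_f) = - \<i> * (2 * G)" "coord I2 (Ad (Omega \<tau> z) sl2_f) = - (Q + S)"
    "coord I3 (Ad (Omega \<tau> z) sl2_f) = - \<i> * (S - Q)"
    unfolding Om A G_def S_def Q_def by (simp_all add: field_simps)
  have h: "coord I1 (Ad (Omega \<tau> z) sl2_h) = - \<i> * (2 * (m * S + p * Q))" "coord I2 (Ad (Omega \<tau> z) sl2_h) = - 2 * (m + p) * G"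
    "coord I3 (Ad (Omega \<tau> z) sl2_h) = - \<i> * (2 * (p - m) * G)"
    using O(2) unfolding Om A G_def S_def Q_def by (simp_all add: field_simps power2_eq_square)
  have e: "coord I1 (Ad (Omega \<tau> z) sl2_e) = \<i> * (2 * (m * p * G))" "coord I2 (Ad (Omega \<tau> z) sl2_e) = m ^ 2 * S + p ^ 2 * Q"
    "coord I3 (Ad (Omega \<tau> z) sl2_e) = - \<i> * (m ^ 2 * S - p ^ 2 * Q)"
    using O(2) unfolding Om A G_def S_def Q_def by (simp_all add: field_simps power2_eq_square)
  show "coord I1 (Ad (Omega \<tau> z) sl2_f) = (- \<i> / tc) * ga z"
    "coord I2 (Ad (Omega \<tau> z) sl2_f) = (- ta / tc ^ 2) * al z"
    "coord I3 (Ad (Omega \<tau> z) sl2_f) = (\<i> * tb / tc ^ 2) * be z"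
    unfolding f S Q G by (simp_all add: field_simps)
  show "coord I1 (Ad (Omega \<tau> z) sl2_h) = (- 2 * \<i> * (uu * tb - vv * ta) / tc ^ 2) * (al z * be z)"
    "coord I2 (Ad (Omega \<tau> z) sl2_h) = (2 * vv / tc) * (be z * ga z)"
    "coord I3 (Ad (Omega \<tau> z) sl2_h) = (- 2 * \<i> * uu / tc) * (al z * ga z)"
    unfolding h S Q G m p by (simp_all add: field_simps)
  show "coord I1 (Ad (Omega \<tau> z) sl2_e) = (\<i> * vv ^ 2 / tc * be z ^ 2 + (- \<i> * uu ^ 2 / tc) * al z ^ 2) * ga z"
    "coord I2 (Ad (Omega \<tau> z) sl2_e) = (ta * uu ^ 2 / tc ^ 2 * al z ^ 2 + (ta * vv ^ 2 - 2 * uu * vv * tb) / tc ^ 2 * be z ^ 2) * al z"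
    "coord I3 (Ad (Omega \<tau> z) sl2_e) = (- \<i> * (2 * uu * vv * ta - tb * uu ^ 2) / tc ^ 2 * al z ^ 2 + \<i> * tb * vv ^ 2 / tc ^ 2 * be z ^ 2) * be z"
    unfolding e S Q G m p by (simp_all add: field_simps power2_eq_square power3_eq_cube)
qed

lemma Omega_inverse:
  assumes "z \<notin> H"
  shows "Omega \<tau> z ** matrix_inv (Omega \<tau> z) = mat 1" "matrix_inv (Omega \<tau> z) ** Omega \<tau> z = mat 1"
    "trace X = 0 \<Longrightarrow> trace (Ad (Omega \<tau> z) X) = 0"
proof -
  have d: "psi_coeff \<tau> (-1) z * theta2 (2 * z) (2 * \<tau>) * theta2 (2 * z) (2 * \<tau>)
      - theta3 (2 * z) (2 * \<tau>) * (psi_coeff \<tau> 1 z * theta3 (2 * z) (2 * \<tau>)) \<noteq> 0"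
    using Omega_entries(1,2)[OF assms] by simp
  have "\<And>a b c d :: complex. a * d - b * c \<noteq> 0 \<Longrightarrow>
    mat2 a b c d ** matrix_inv (mat2 a b c d) = mat 1 \<and> matrix_inv (mat2 a b c d) ** mat2 a b c d = mat 1"
  proof -
    fix a b c d :: complex assume n: "a * d - b * c \<noteq> 0"
    define \<delta> where "\<delta> = a * d - b * c"
    have \<delta>: "\<delta> \<noteq> 0" "a * d = \<delta> + b * c" using n by (simp_all add: \<delta>_def)
    show "mat2 a b c d ** matrix_inv (mat2 a b c d) = mat 1 \<and> matrix_inv (mat2 a b c d) ** mat2 a b c d = mat 1"
      unfolding matrix_inv_mat2[OF n] \<delta>_def[symmetric] using \<delta>
      by (simp add: cmat_eq_iff cmat_mult_nth cmat_one_nth field_simps)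
  qed
  from this[OF d] show i: "Omega \<tau> z ** matrix_inv (Omega \<tau> z) = mat 1" "matrix_inv (Omega \<tau> z) ** Omega \<tau> z = mat 1"
    by (simp_all add: Omega_def)
  show "trace X = 0 \<Longrightarrow> trace (Ad (Omega \<tau> z) X) = 0" unfolding Ad_def using trace_cj[OF i] by simp
qed

end

context holod
begin

lemma Ad_Omega_equivariant:
  assumes "X = sl2_h \<or> X = sl2_e \<or> X = sl2_f"
  shows "equivariant DD (\<lambda>z. Ad (Omega \<tau> z) X)"
proof (rule equivariantI)
  have sq: "ell H 1 1 (\<lambda>z. c * al z ^ 2 + d * be z ^ 2)" "ell H 1 1 (\<lambda>z. c * be z ^ 2 + d * al z ^ 2)" for c d
  proof -
    have p: "ell H 1 1 (\<lambda>z. al z ^ 2)" "ell H 1 1 (\<lambda>z. be z ^ 2)"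
      using ell_power[OF abg_ell(1), of 2] ell_power[OF abg_ell(2), of 2] by simp_all
    show "ell H 1 1 (\<lambda>z. c * al z ^ 2 + d * be z ^ 2)" "ell H 1 1 (\<lambda>z. c * be z ^ 2 + d * al z ^ 2)"
      by (intro ell_add ell_cmult p)+
  qed
  have O: "ell H s1 s2 (\<lambda>z. coord i (Ad (Omega \<tau> z) Y))"
    if "ell H s1 s2 f" "\<And>z. z \<notin> H \<Longrightarrow> coord i (Ad (Omega \<tau> z) Y) = f z" for s1 s2 i Y f
    by (rule ell_cong[OF that(1) polar_H]) (rule that(2)[symmetric])
  have m: "ell H 1 (-1) (\<lambda>z. al z * be z)" "ell H (-1) (-1) (\<lambda>z. be z * ga z)" "ell H (-1) 1 (\<lambda>z. al z * ga z)"
    "ell H 1 (-1) (\<lambda>z. (c * be z ^ 2 + d * al z ^ 2) * ga z)" "ell H (-1) (-1) (\<lambda>z. (c * al z ^ 2 + d * be z ^ 2) * al z)"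
    "ell H (-1) 1 (\<lambda>z. (c * al z ^ 2 + d * be z ^ 2) * be z)" for c d
    using ell_mult[OF abg_ell(1,2)] ell_mult[OF abg_ell(2,3)] ell_mult[OF abg_ell(1,3)]
      ell_mult[OF sq(2) abg_ell(3), of c d] ell_mult[OF sq(1) abg_ell(1), of c d] ell_mult[OF sq(1) abg_ell(2), of c d]
    by simp_all
  have f1: "ell H 1 (-1) (\<lambda>z. coord I1 (Ad (Omega \<tau> z) sl2_f))"
    by (rule O[OF ell_cmult[OF abg_ell(3)] Omega_coords(1)])
  have f2: "ell H (-1) (-1) (\<lambda>z. coord I2 (Ad (Omega \<tau> z) sl2_f))"
    by (rule O[OF ell_cmult[OF abg_ell(1)] Omega_coords(2)])
  have f3: "ell H (-1) 1 (\<lambda>z. coord I3 (Ad (Omega \<tau> z) sl2_f))"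
    by (rule O[OF ell_cmult[OF abg_ell(2)] Omega_coords(3)])
  have h1: "ell H 1 (-1) (\<lambda>z. coord I1 (Ad (Omega \<tau> z) sl2_h))"
    by (rule O[OF ell_cmult[OF m(1)] Omega_coords(4)])
  have h2: "ell H (-1) (-1) (\<lambda>z. coord I2 (Ad (Omega \<tau> z) sl2_h))"
    by (rule O[OF ell_cmult[OF m(2)] Omega_coords(5)])
  have h3: "ell H (-1) 1 (\<lambda>z. coord I3 (Ad (Omega \<tau> z) sl2_h))"
    by (rule O[OF ell_cmult[OF m(3)] Omega_coords(6)])
  have e1: "ell H 1 (-1) (\<lambda>z. coord I1 (Ad (Omega \<tau> z) sl2_e))"
    by (rule O[OF m(4) Omega_coords(7)])
  have e2: "ell H (-1) (-1) (\<lambda>z. coord I2 (Ad (Omega \<tau> z) sl2_e))"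
    by (rule O[OF m(5) Omega_coords(8)])
  have e3: "ell H (-1) 1 (\<lambda>z. coord I3 (Ad (Omega \<tau> z) sl2_e))"
    by (rule O[OF m(6) Omega_coords(9)])
  have tr: "trace X = 0" using assms by auto
  show "trace (Ad (Omega \<tau> z) X) = 0" if "z \<notin> DD" for z
    using Omega_inverse(3)[OF _ tr] that H_DD by blast
  show "ell DD (chi1 i) (chi2 i) (\<lambda>z. coord i (Ad (Omega \<tau> z) X))" for i
  proof (rule ell_mono[OF _ H_DD])
    show "ell H (chi1 i) (chi2 i) (\<lambda>z. coord i (Ad (Omega \<tau> z) X))"
      using assms
      by (elim disjE; cases i; simp only: chi1.simps chi2.simps f1 f2 f3 h1 h2 h3 e1 e2 e3)
  qed
qed simp

lemma Ad_Omega_in: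
  assumes "X = sl2_h \<or> X = sl2_e \<or> X = sl2_f"
  shows "Ad_Omega \<tau> X \<in> equi_algebra DD" "\<And>z. z \<notin> DD \<Longrightarrow> Ad_Omega \<tau> X z = Ad (Omega \<tau> z) X"
  unfolding Ad_Omega_def using Ad_Omega_equivariant[OF assms] remove_sings_mat_in remove_sings_mat_off by auto

lemma kil_ell:
  assumes "equivariant DD X" "equivariant DD Y"
  shows "ell DD 1 1 (\<lambda>z. kil (X z) (Y z))"
proof -
  have "ell DD 1 1 (\<lambda>z. coord i (X z) * coord i (Y z))" for i
    using ell_mult[OF equivariant_coord[OF assms(1), of i] equivariant_coord[OF assms(2), of i]] by simp
  thus ?thesis unfolding kil_def by (intro ell_add)
qed

lemma holod_normal_form:
  "normal_form (wp_ring H) (holod_algebra \<tau>) (Ad_Omega \<tau> sl2_h) (Ad_Omega \<tau> sl2_e) (Ad_Omega \<tau> sl2_f)"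
proof -
  define Hh Ee Ff where "Hh = Ad_Omega \<tau> sl2_h" and "Ee = Ad_Omega \<tau> sl2_e" and "Ff = Ad_Omega \<tau> sl2_f"
  have inE: "Hh \<in> equi_algebra DD" "Ee \<in> equi_algebra DD" "Ff \<in> equi_algebra DD"
    unfolding Hh_def Ee_def Ff_def by (rule Ad_Omega_in; simp)+
  have off: "Hh z = Ad (Omega \<tau> z) sl2_h" "Ee z = Ad (Omega \<tau> z) sl2_e" "Ff z = Ad (Omega \<tau> z) sl2_f" if "z \<notin> DD" for z
    unfolding Hh_def Ee_def Ff_def by (rule Ad_Omega_in(2)[OF _ that]; simp)+
  have R: "r \<in> wp_ring H \<Longrightarrow> ell DD 1 1 r" for r by (simp add: wp_ring_eq)
  let ?L = "mero_lie (equi_algebra DD)"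
  note P = DD_polar
  note cl = E_closed(1,3)[OF P] E_closed(2)[OF P _ inE(1)] ring_smul_in[OF P] inE R
  note offs = E_off[OF P] ring_smul_off[OF P]
  have iO: "Omega \<tau> z ** matrix_inv (Omega \<tau> z) = mat 1" "matrix_inv (Omega \<tau> z) ** Omega \<tau> z = mat 1" if "z \<notin> DD" for z
    using Omega_inverse(1,2)[of z] that H_DD by blast+
  have kl: "kil (Hh z) (Hh z) = -4" "kil (Hh z) (Ee z) = 0" "kil (Hh z) (Ff z) = 0"
    "kil (Ee z) (Hh z) = 0" "kil (Ee z) (Ee z) = 0" "kil (Ee z) (Ff z) = -2"
    "kil (Ff z) (Hh z) = 0" "kil (Ff z) (Ee z) = -2" "kil (Ff z) (Ff z) = 0" if "z \<notin> DD" for z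
    unfolding off[OF that] Ad_def by (simp_all add: kil_cj[OF iO[OF that]] kil_sl2)
  have comb: "lie_add ?L (lie_add ?L (ring_smul a Hh) (ring_smul b Ee)) (ring_smul c Ff) z
     = smult_mat (a z) (Hh z) + smult_mat (b z) (Ee z) + smult_mat (c z) (Ff z)"
    "lie_add ?L (lie_add ?L (ring_smul a Hh) (ring_smul b Ee)) (ring_smul c Ff) \<in> equi_algebra DD"
    if "a \<in> wp_ring H" "b \<in> wp_ring H" "c \<in> wp_ring H" "z \<notin> DD" for a b c z
    using that by (simp_all add: cl offs)
  have un: "\<exists>!t. t \<in> wp_ring H \<times> wp_ring H \<times> wp_ring H \<and>
        (case t of (a, b, c) \<Rightarrow> X = lie_add ?L (lie_add ?L (ring_smul a Hh) (ring_smul b Ee)) (ring_smul c Ff))"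
    if X: "X \<in> equi_algebra DD" for X
  proof -
    have eX: "equivariant DD X" and eq: "equivariant DD Hh" "equivariant DD Ee" "equivariant DD Ff"
      using X inE by (simp_all add: equi_algebra_def)
    \<comment> \<open>The factors -1/4 and -1/2, and the exchange of \<open>Ee\<close> and
      \<open>Ff\<close>, come from the dual basis with respect to \<open>kil\<close>.\<close>
    define a b c where "a = remove_sings (\<lambda>z. (- 1 / 4) * kil (X z) (Hh z))"
      and "b = remove_sings (\<lambda>z. (- 1 / 2) * kil (X z) (Ff z))" and "c = remove_sings (\<lambda>z. (- 1 / 2) * kil (X z) (Ee z))"
    note k = ell_remove_sings[OF ell_cmult[OF kil_ell[OF eX eq(1)]]] ell_remove_sings[OF ell_cmult[OF kil_ell[OF eX eq(3)]]]
      ell_remove_sings[OF ell_cmult[OF kil_ell[OF eX eq(2)]]]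
    have abc: "a \<in> wp_ring H" "b \<in> wp_ring H" "c \<in> wp_ring H"
      unfolding wp_ring_eq a_def b_def c_def using k by blast+
    have abz: "a z = (- 1 / 4) * kil (X z) (Hh z)" "b z = (- 1 / 2) * kil (X z) (Ff z)" "c z = (- 1 / 2) * kil (X z) (Ee z)"
      if "z \<notin> DD" for z
      unfolding a_def b_def c_def using k that by blast+
    have ex: "X = lie_add ?L (lie_add ?L (ring_smul a Hh) (ring_smul b Ee)) (ring_smul c Ff)"
    proof (rule equi_algebra_eqI[OF X _ P])
      show "lie_add ?L (lie_add ?L (ring_smul a Hh) (ring_smul b Ee)) (ring_smul c Ff) \<in> equi_algebra DD"
        using abc by (simp add: cl)
      fix z assume z: "z \<notin> DD"
      have "X z = smult_mat (- kil (X z) (Hh z) / 4) (Hh z) + smult_mat (- kil (X z) (Ff z) / 2) (Ee z)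
         + smult_mat (- kil (X z) (Ee z) / 2) (Ff z)"
        unfolding off[OF z] Ad_def by (rule cj_decompose[OF iO[OF z] equivariant_trace[OF eX z]])
      thus "X z = lie_add ?L (lie_add ?L (ring_smul a Hh) (ring_smul b Ee)) (ring_smul c Ff) z"
        unfolding comb(1)[OF abc z] abz[OF z] by simp
    qed
    \<comment> \<open>Pairing any expansion with the dual basis returns its coefficients, off
      \<open>DD\<close> at first and then everywhere by normal form.\<close>
    have uniq: "a' = a \<and> b' = b \<and> c' = c"
      if abc': "a' \<in> wp_ring H" "b' \<in> wp_ring H" "c' \<in> wp_ring H"
        and X': "X = lie_add ?L (lie_add ?L (ring_smul a' Hh) (ring_smul b' Ee)) (ring_smul c' Ff)" for a' b' c'
    proof -
      have "a' z = a z" "b' z = b z" "c' z = c z" if z: "z \<notin> DD" for z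
      proof -
        have Xz: "X z = smult_mat (a' z) (Hh z) + smult_mat (b' z) (Ee z) + smult_mat (c' z) (Ff z)"
          using comb(1)[OF abc' z] X' by metis
        show "a' z = a z" "b' z = b z" "c' z = c z"
          unfolding abz[OF z] Xz kil_add kil_smult by (simp_all add: kl[OF z])
      qed
      thus ?thesis using abc abc' nicely_meromorphic_eqI[OF _ _ polar_sparse[OF P]]
        unfolding wp_ring_eq by simp
    qed
    show ?thesis
    proof (rule ex1I[of _ "(a, b, c)"])
      show "(a, b, c) \<in> wp_ring H \<times> wp_ring H \<times> wp_ring H \<and> (case (a, b, c) of (a, b, c) \<Rightarrow>
          X = lie_add ?L (lie_add ?L (ring_smul a Hh) (ring_smul b Ee)) (ring_smul c Ff))"
        unfolding prod.case mem_Sigma_iff using abc ex by blast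
    next
      fix t assume t: "t \<in> wp_ring H \<times> wp_ring H \<times> wp_ring H \<and> (case t of (a, b, c) \<Rightarrow>
          X = lie_add ?L (lie_add ?L (ring_smul a Hh) (ring_smul b Ee)) (ring_smul c Ff))"
      obtain a' b' c' where tt: "t = (a', b', c')" by (cases t)
      show "t = (a, b, c)"
        using t uniq[of a' b' c'] unfolding tt prod.case mem_Sigma_iff by blast
    qed
  qed
  have br: "lie_br ?L Hh Ee = lie_smul ?L 2 Ee" "lie_br ?L Hh Ff = lie_smul ?L (-2) Ff" "lie_br ?L Ee Ff = Hh"
  proof -
    have *: "lie_bracket (Hh z) (Ee z) = smult_mat 2 (Ee z)" "lie_bracket (Hh z) (Ff z) = smult_mat (-2) (Ff z)"
      "lie_bracket (Ee z) (Ff z) = Hh z" if "z \<notin> DD" for z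
      unfolding off[OF that] Ad_def cj_bracket[OF iO[OF that]] lie_bracket_sl2 cj_smult[OF iO[OF that]] by simp_all
    show "lie_br ?L Hh Ee = lie_smul ?L 2 Ee" "lie_br ?L Hh Ff = lie_smul ?L (-2) Ff" "lie_br ?L Ee Ff = Hh"
      by (rule equi_algebra_eqI[OF _ _ P]; simp add: cl offs *)+
  qed
  have bil: "lie_br ?L (ring_smul r X) Y = ring_smul r (lie_br ?L X Y) \<and> lie_br ?L X (ring_smul r Y) = ring_smul r (lie_br ?L X Y)"
    if "r \<in> wp_ring H" "X \<in> equi_algebra DD" "Y \<in> equi_algebra DD" for r X Y
    by (intro conjI; rule equi_algebra_eqI[OF _ _ P];
        use that in \<open>simp add: cl offs; simp add: cmat_eq_iff lie_bracket_nth algebra_simps\<close>)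
  show ?thesis
    unfolding normal_form_def holod_algebra_eq EL_simps(1)[OF P] Hh_def[symmetric] Ee_def[symmetric] Ff_def[symmetric]
    using equi_complex_lie_algebra[OF P] bil un br inE cl by simp
qed

end

section \<open>Lie algebras generated by elliptic triples\<close>

lemma nx_cases: "j = i \<or> j = nx i \<or> j = nx (nx i)" by (cases i; cases j) auto

locale clie = vector_space sc for sc :: "complex \<Rightarrow> 'a::ab_group_add \<Rightarrow> 'a" +
  fixes br :: "'a \<Rightarrow> 'a \<Rightarrow> 'a"
  assumes br_add_left: "br (x + y) z = br x z + br y z"
    and br_add_right: "br x (y + z) = br x y + br x z"
    and br_sc_left: "br (sc a x) y = sc a (br x y)"
    and br_sc_right: "br x (sc a y) = sc a (br x y)"
    and br_self: "br x x = 0"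
    and br_jacobi: "br x (br y z) + br y (br z x) + br z (br x y) = 0"
begin

lemma br_zero [simp]: "br 0 x = 0" "br x 0 = 0"
  using br_add_left[of 0 0 x] br_add_right[of x 0 0] by auto

lemma br_anti: "br x y = - br y x"
proof -
  have "br x y + br y x = br (x + y) (x + y)" by (simp add: br_add_left br_add_right br_self[of x] br_self[of y])
  hence "br x y + br y x = 0" by (simp only: br_self)
  thus ?thesis by (simp only: eq_neg_iff_add_eq_0)
qed

lemma br_minus_left: "br (- x) y = - br x y"
  using br_add_left[of "- x" x y] by (simp add: eq_neg_iff_add_eq_0)

lemma br_minus_right: "br x (- y) = - br x y"
  using br_add_right[of x "- y" y] by (simp add: eq_neg_iff_add_eq_0)

lemma br_diff_left: "br (x - y) z = br x z - br y z"
  using br_add_left[of x "- y" z] by (simp add: br_minus_left)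

lemma br_diff_right: "br x (y - z) = br x y - br x z"
  using br_add_right[of x y "- z"] by (simp add: br_minus_right)

lemma br_ad: "br (br x y) z = br x (br y z) - br y (br x z)"
proof -
  have "br x (br y z) + br y (- br x z) + - br (br x y) z = 0"
    using br_jacobi[of x y z] br_anti[of z x] br_anti[of z "br x y"] by simp
  thus ?thesis by (simp add: br_minus_right algebra_simps)
qed

lemma br_span_right:
  assumes "y \<in> span S" "subspace W" "\<And>s. s \<in> S \<Longrightarrow> br x s \<in> W"
  shows "br x y \<in> W"
  using assms(1)
proof (induction rule: span_induct_alt)
  case base
  thus ?case using assms(2) by (simp add: subspace_0)
next
  case (step c s y)
  thus ?case using assms by (simp add: br_add_right br_sc_right subspace_add subspace_scale)
qed

lemma br_span_left:
  assumes "y \<in> span S" "subspace W" "\<And>s. s \<in> S \<Longrightarrow> br s x \<in> W"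
  shows "br y x \<in> W"
proof -
  have "br x y \<in> W"
  proof (rule br_span_right[OF assms(1,2)])
    fix s assume "s \<in> S"
    thus "br x s \<in> W" using assms(2,3) br_anti[of x s] by (simp add: subspace_neg)
  qed
  thus ?thesis using assms(2) br_anti[of y x] by (simp add: subspace_neg)
qed

text \<open>In the realisation these brackets become products of \<open>n + 1\<close> elliptic
  functions with a simple pole, hence of pole order \<open>n + 1\<close>.\<close>

primrec ebr :: "(idx \<Rightarrow> 'a) \<Rightarrow> nat \<Rightarrow> idx \<Rightarrow> 'a" where
  "ebr x 0 i = x i"
| "ebr x (Suc n) i = br (x (nx i)) (ebr x n (nx (nx i)))"

end

locale elliptic_triple = clie sc br for sc :: "complex \<Rightarrow> 'a::ab_group_add \<Rightarrow> 'a" and br +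
  fixes x :: "idx \<Rightarrow> 'a" and J :: "idx \<Rightarrow> complex"
  assumes rel1: "br (x i) (br (x (nx i)) (x (nx (nx i)))) = 0"
    and rel2: "br (x i) (br (x i) (x (nx (nx i)))) - br (x (nx i)) (br (x (nx i)) (x (nx (nx i)))) = sc (J i) (x (nx (nx i)))"
begin

section \<open>The filtration by bracket length\<close>

abbreviation e :: "nat \<Rightarrow> idx \<Rightarrow> 'a" where "e \<equiv> ebr x"

definition F :: "nat \<Rightarrow> 'a set" where "F n = span {e m i | m i. m \<le> n}"

lemma F_sub: "subspace (F n)" by (simp add: F_def)

lemma F_e: "m \<le> n \<Longrightarrow> e m i \<in> F n" unfolding F_def by (rule span_base) blast

lemma F_mono: "m \<le> n \<Longrightarrow> F m \<subseteq> F n" unfolding F_def by (rule span_mono) auto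

lemma F_ops: "a \<in> F n \<Longrightarrow> b \<in> F n \<Longrightarrow> a + b \<in> F n" "a \<in> F n \<Longrightarrow> b \<in> F n \<Longrightarrow> a - b \<in> F n"
  "a \<in> F n \<Longrightarrow> - a \<in> F n" "a \<in> F n \<Longrightarrow> sc c a \<in> F n" "0 \<in> F n"
  using F_sub[of n] by (auto intro: subspace_add subspace_diff subspace_neg subspace_scale subspace_0)

text \<open>Modulo shorter brackets, \<open>e p i\<close> is to behave like the power
  \<open>p + 1\<close> of a variable times the unit vector of index \<open>i\<close>, with the cross
  product as bracket. This is the leading behaviour of the realising functions at a pole.\<close>

definition good :: "nat \<Rightarrow> bool" where
  "good N \<longleftrightarrow> (\<forall>p q i. p + q = N \<longrightarrow> br (e p i) (e q i) \<in> F N \<and>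
     br (e p i) (e q (nx i)) - e (Suc N) (nx (nx i)) \<in> F N)"

lemma good_eq: "good (p + q) \<Longrightarrow> br (e p i) (e q i) \<in> F (p + q)"
  and good_nx: "good (p + q) \<Longrightarrow> br (e p i) (e q (nx i)) - e (Suc (p + q)) (nx (nx i)) \<in> F (p + q)"
  by (auto simp: good_def)

lemma good_nxx:
  assumes "good (p + q)"
  shows "br (e p i) (e q (nx (nx i))) + e (Suc (p + q)) (nx i) \<in> F (p + q)"
proof -
  have "br (e q (nx (nx i))) (e p i) - e (Suc (p + q)) (nx i) \<in> F (p + q)"
    using good_nx[of q p "nx (nx i)"] assms by (simp add: add.commute)
  hence "- (br (e q (nx (nx i))) (e p i) - e (Suc (p + q)) (nx i)) \<in> F (p + q)" by (rule F_ops)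
  thus ?thesis using br_anti[of "e p i" "e q (nx (nx i))"] by simp
qed

lemma good_in: "good (p + q) \<Longrightarrow> br (e p i) (e q j) \<in> F (Suc (p + q))"
proof -
  assume g: "good (p + q)"
  note m = F_mono[of "p + q" "Suc (p + q)"]
  have e: "e (Suc (p + q)) k \<in> F (Suc (p + q))" for k by (rule F_e) simp
  consider "j = i" | "j = nx i" | "j = nx (nx i)" using nx_cases by blast
  thus ?thesis
  proof cases
    case 1
    thus ?thesis using good_eq[OF g] m by auto
  next
    case 2
    have "(br (e p i) (e q j) - e (Suc (p + q)) (nx (nx i))) + e (Suc (p + q)) (nx (nx i)) \<in> F (Suc (p + q))"
      using good_nx[OF g, of i] m e 2 by (intro F_ops(1)) (auto simp del: ebr.simps)
    thus ?thesis by (simp only: diff_add_cancel)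
  next
    case 3
    have "(br (e p i) (e q j) + e (Suc (p + q)) (nx i)) - e (Suc (p + q)) (nx i) \<in> F (Suc (p + q))"
      using good_nxx[OF g, of i] m e 3 by (intro F_ops(2)) (auto simp del: ebr.simps)
    thus ?thesis by (simp only: add_diff_cancel)
  qed
qed

lemma br_F_right:
  assumes "\<forall>n<N. good n" "p + q < N" "y \<in> F q"
  shows "br (e p i) y \<in> F (Suc (p + q))"
proof (rule br_span_right[OF _ F_sub])
  show "y \<in> span {e m i | m i. m \<le> q}" using assms(3) by (simp add: F_def)
  fix s assume "s \<in> {e m i | m i. m \<le> q}"
  then obtain m j where s: "s = e m j" "m \<le> q" by blast
  have "br (e p i) (e m j) \<in> F (Suc (p + m))" using assms s by (intro good_in) auto
  thus "br (e p i) s \<in> F (Suc (p + q))" using F_mono[of "Suc (p + m)" "Suc (p + q)"] s by auto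
qed

lemma br_F_left:
  assumes "\<forall>n<N. good n" "p + q < N" "y \<in> F p"
  shows "br y (e q i) \<in> F (Suc (p + q))"
  using br_F_right[where p=q and q=p and N=N and y=y and i=i] assms br_anti[of y "e q i"] F_ops(3)[of "br (e q i) y" "Suc (p + q)"]
  by (simp add: add.commute)

text \<open>Expanding \<open>e (Suc p) i\<close> in the two ways \<open>[x j, e p k]\<close> and \<open>[e p j, x k]\<close>, for \<open>j = nx i\<close> and
  \<open>k = nx (nx i)\<close>, expresses \<open>[e (Suc p) i, e q l]\<close> modulo \<open>F N\<close> in two ways by brackets with smaller \<open>p\<close>.\<close>

lemma bracket_recursion:
  assumes G: "\<forall>n<N. good n" and pq: "Suc (p + q) = N"
  defines "B \<equiv> \<lambda>i j. br (x i) (e N j)"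
  shows "br (e (Suc p) i) (e q i) - (B (nx i) (nx i) + br (e p (nx (nx i))) (e (Suc q) (nx (nx i)))) \<in> F N"
    and "br (e (Suc p) i) (e q i) - (B (nx (nx i)) (nx (nx i)) + br (e p (nx i)) (e (Suc q) (nx i))) \<in> F N"
    and "br (e (Suc p) i) (e q (nx i)) + B (nx i) i \<in> F N"
    and "br (e (Suc p) i) (e q (nx i)) + br (e p (nx i)) (e (Suc q) i) \<in> F N"
    and "br (e (Suc p) i) (e q (nx (nx i))) + br (e p (nx (nx i))) (e (Suc q) i) \<in> F N"
    and "br (e (Suc p) i) (e q (nx (nx i))) + B (nx (nx i)) i \<in> F N"
proof -
  define j k where "j = nx i" and "k = nx (nx i)"
  have n: "nx i = j" "nx j = k" "nx k = i" by (simp_all add: j_def k_def)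
  have gp: "good p" "good q" "good (p + q)" using G pq by auto
  have g0: "good (0 + q)" "good (p + 0)" using gp by auto
  have xF: "br (x l) y \<in> F N" if "y \<in> F (p + q)" for y l
    using br_F_right[where p=0 and q="p + q" and N=N and y=y and i=l] G that pq by simp
  have eF: "br (e p l) y \<in> F N" if "y \<in> F q" for y l
    using br_F_right[where p=p and q=q and N=N and y=y and i=l] G that pq by simp
  have Fe: "br y (e q l) \<in> F N" if "y \<in> F p" for y l
    using br_F_left[where p=p and q=q and N=N and y=y and i=l] G that pq by simp
  have I: "br (e (Suc p) i) y = br (x j) (br (e p k) y) - br (e p k) (br (x j) y)" for y
    by (simp add: br_ad n)
  have II: "br (e (Suc p) i) (e q l) - (br (e p j) (br (x k) (e q l)) - br (x k) (br (e p j) (e q l))) \<in> F N" for l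
  proof -
    have "br (e p j) (x k) - e (Suc p) i \<in> F p" using good_nx[OF g0(2), of j] by (simp add: n)
    from Fe[OF this, of l] have "br (br (e p j) (x k)) (e q l) - br (e (Suc p) i) (e q l) \<in> F N" by (simp add: br_diff_left)
    from F_ops(3)[OF this] show ?thesis by (simp add: br_ad)
  qed
  have a1: "br (e p k) (e q i) - e N j \<in> F (p + q)" using good_nx[OF gp(3), of k] pq by (simp add: n)
  have a2: "br (x j) (e q i) + e (Suc q) k \<in> F q" using good_nxx[OF g0(1), of j] by (simp add: n)
  have a3: "br (e p k) (e q j) + e N i \<in> F (p + q)" using good_nxx[OF gp(3), of k] pq by (simp add: n)
  have a4: "br (x j) (e q j) \<in> F q" using good_eq[OF g0(1), of j] by simp
  have a5: "br (e p k) (e q k) \<in> F (p + q)" using good_eq[OF gp(3), of k] by simp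
  have a6: "br (x j) (e q k) - e (Suc q) i \<in> F q" using good_nx[OF g0(1), of j] by (simp add: n)
  have b1: "br (x k) (e q i) - e (Suc q) j \<in> F q" using good_nx[OF g0(1), of k] by (simp add: n)
  have b2: "br (e p j) (e q i) + e N k \<in> F (p + q)" using good_nxx[OF gp(3), of j] pq by (simp add: n)
  have b3: "br (x k) (e q j) + e (Suc q) i \<in> F q" using good_nxx[OF g0(1), of k] by (simp add: n)
  have b4: "br (e p j) (e q j) \<in> F (p + q)" using good_eq[OF gp(3), of j] by simp
  have b5: "br (x k) (e q k) \<in> F q" using good_eq[OF g0(1), of k] by simp
  have b6: "br (e p j) (e q k) - e N i \<in> F (p + q)" using good_nx[OF gp(3), of j] pq by (simp add: n)
  have "br (e (Suc p) i) (e q i) - (B j j + br (e p k) (e (Suc q) k)) \<in> F N"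
  proof -
    have "br (e (Suc p) i) (e q i) - (B j j + br (e p k) (e (Suc q) k))
       = br (x j) (br (e p k) (e q i) - e N j) - br (e p k) (br (x j) (e q i) + e (Suc q) k)"
      unfolding I B_def by (simp only: br_diff_right br_add_right) (simp add: algebra_simps)
    thus ?thesis using F_ops(2)[OF xF[OF a1] eF[OF a2]] by (simp only:)
  qed
  moreover have "br (e (Suc p) i) (e q i) - (B k k + br (e p j) (e (Suc q) j)) \<in> F N"
  proof -
    have "br (e (Suc p) i) (e q i) - (B k k + br (e p j) (e (Suc q) j))
       = (br (e (Suc p) i) (e q i) - (br (e p j) (br (x k) (e q i)) - br (x k) (br (e p j) (e q i))))
         + (br (e p j) (br (x k) (e q i) - e (Suc q) j) - br (x k) (br (e p j) (e q i) + e N k))"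
      unfolding B_def by (simp only: br_diff_right br_add_right) (simp add: algebra_simps)
    thus ?thesis using F_ops(1)[OF II[of i] F_ops(2)[OF eF[OF b1] xF[OF b2]]] by (simp only:)
  qed
  moreover have "br (e (Suc p) i) (e q j) + B j i \<in> F N"
  proof -
    have "br (e (Suc p) i) (e q j) + B j i
       = br (x j) (br (e p k) (e q j) + e N i) - br (e p k) (br (x j) (e q j))"
      unfolding I B_def by (simp only: br_diff_right br_add_right) (simp add: algebra_simps)
    thus ?thesis using F_ops(2)[OF xF[OF a3] eF[OF a4]] by (simp only:)
  qed
  moreover have "br (e (Suc p) i) (e q j) + br (e p j) (e (Suc q) i) \<in> F N"
  proof -
    have "br (e (Suc p) i) (e q j) + br (e p j) (e (Suc q) i)
       = (br (e (Suc p) i) (e q j) - (br (e p j) (br (x k) (e q j)) - br (x k) (br (e p j) (e q j))))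
         + (br (e p j) (br (x k) (e q j) + e (Suc q) i) - br (x k) (br (e p j) (e q j)))"
      by (simp only: br_diff_right br_add_right) (simp add: algebra_simps)
    thus ?thesis using F_ops(1)[OF II[of j] F_ops(2)[OF eF[OF b3] xF[OF b4]]] by (simp only:)
  qed
  moreover have "br (e (Suc p) i) (e q k) + br (e p k) (e (Suc q) i) \<in> F N"
  proof -
    have "br (e (Suc p) i) (e q k) + br (e p k) (e (Suc q) i)
       = br (x j) (br (e p k) (e q k)) - br (e p k) (br (x j) (e q k) - e (Suc q) i)"
      unfolding I by (simp only: br_diff_right br_add_right) (simp add: algebra_simps)
    thus ?thesis using F_ops(2)[OF xF[OF a5] eF[OF a6]] by (simp only:)
  qed
  moreover have "br (e (Suc p) i) (e q k) + B k i \<in> F N"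
  proof -
    have "br (e (Suc p) i) (e q k) + B k i
       = (br (e (Suc p) i) (e q k) - (br (e p j) (br (x k) (e q k)) - br (x k) (br (e p j) (e q k))))
         + (br (e p j) (br (x k) (e q k)) - br (x k) (br (e p j) (e q k) - e N i))"
      unfolding B_def by (simp only: br_diff_right br_add_right) (simp add: algebra_simps)
    thus ?thesis using F_ops(1)[OF II[of k] F_ops(2)[OF eF[OF b5] xF[OF b6]]] by (simp only:)
  qed
  ultimately show "br (e (Suc p) i) (e q i) - (B (nx i) (nx i) + br (e p (nx (nx i))) (e (Suc q) (nx (nx i)))) \<in> F N"
    and "br (e (Suc p) i) (e q i) - (B (nx (nx i)) (nx (nx i)) + br (e p (nx i)) (e (Suc q) (nx i))) \<in> F N"
    and "br (e (Suc p) i) (e q (nx i)) + B (nx i) i \<in> F N"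
    and "br (e (Suc p) i) (e q (nx i)) + br (e p (nx i)) (e (Suc q) i) \<in> F N"
    and "br (e (Suc p) i) (e q (nx (nx i))) + br (e p (nx (nx i))) (e (Suc q) i) \<in> F N"
    and "br (e (Suc p) i) (e q (nx (nx i))) + B (nx (nx i)) i \<in> F N"
    by (simp_all only: j_def k_def)
qed

lemma good_0: "good 0"
  unfolding good_def by (auto simp: br_self F_ops)

text \<open>The two triple relations are the statement for total index one: the first makes brackets
  vanish, the second puts the difference of two double brackets into the span of the
  generators.\<close>

lemma good_1: "good 1"
proof -
  have "br (e p i) (e q i) \<in> F 1 \<and> br (e p i) (e q (nx i)) - e (Suc 1) (nx (nx i)) \<in> F 1" if pq: "p + q = 1" for p q i
  proof -
    consider "p = 0" "q = 1" | "p = 1" "q = 0" using pq by linarith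
    thus ?thesis
    proof cases
      case 1
      thus ?thesis using rel1[of i] by (simp add: F_ops)
    next
      case 2
      define j k where "j = nx i" and "k = nx (nx i)"
      have n: "nx i = j" "nx j = k" "nx k = i" by (simp_all add: j_def k_def)
      have "br (br (x j) (x k)) (x i) = 0" using rel1[of i] br_anti[of "br (x j) (x k)" "x i"] by (simp add: n)
      moreover have "br (br (x j) (x k)) (x j) - br (x i) (br (x k) (x i)) = sc (J i) (x k)"
        using rel2[of i] br_anti[of "br (x j) (x k)" "x j"] br_anti[of "x k" "x i"]
        by (simp add: n br_minus_right algebra_simps)
      moreover have "sc (J i) (x k) \<in> F 1" using F_e[of 0 1 k] by (intro F_ops) simp
      ultimately show ?thesis using 2 by (simp add: n F_ops)
    qed
  qed
  thus ?thesis by (simp add: good_def)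
qed

text \<open>Modulo \<open>F N\<close>, the bracket \<open>[e p i, e (N - p) i]\<close> is \<open>p + 1\<close> times an element \<open>b\<close> that does not depend on
  \<open>i\<close>; antisymmetry for \<open>p = N\<close> gives \<open>(N + 2) b = 0\<close>.\<close>

lemma good_step:
  assumes G: "\<forall>n<N. good n" and N: "N \<ge> 2"
  shows "good N"
proof -
  define B where "B = (\<lambda>i j. br (x i) (e N j))"
  define b where "b = (\<lambda>i. B i i)"
  define T where "T = (\<lambda>p i l. br (e p i) (e (N - p) l))"
  have T0: "T 0 = B" by (simp add: T_def B_def fun_eq_iff)
  have rec: "T (Suc p) i i - (b (nx i) + T p (nx (nx i)) (nx (nx i))) \<in> F N"
    "T (Suc p) i i - (b (nx (nx i)) + T p (nx i) (nx i)) \<in> F N"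
    "T (Suc p) i (nx i) + B (nx i) i \<in> F N" "T (Suc p) i (nx i) + T p (nx i) i \<in> F N"
    "T (Suc p) i (nx (nx i)) + T p (nx (nx i)) i \<in> F N" "T (Suc p) i (nx (nx i)) + B (nx (nx i)) i \<in> F N"
    if "Suc p \<le> N" for p i
  proof -
    have q: "Suc (p + (N - Suc p)) = N" "Suc (N - Suc p) = N - p" using that by simp_all
    show "T (Suc p) i i - (b (nx i) + T p (nx (nx i)) (nx (nx i))) \<in> F N"
    "T (Suc p) i i - (b (nx (nx i)) + T p (nx i) (nx i)) \<in> F N"
    "T (Suc p) i (nx i) + B (nx i) i \<in> F N" "T (Suc p) i (nx i) + T p (nx i) i \<in> F N"
    "T (Suc p) i (nx (nx i)) + T p (nx (nx i)) i \<in> F N" "T (Suc p) i (nx (nx i)) + B (nx (nx i)) i \<in> F N"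
      using bracket_recursion[OF G q(1), of i] unfolding T_def B_def b_def q(2) by simp_all
  qed
  have N1: "Suc 0 \<le> N" "Suc (Suc 0) \<le> N" using N by auto
  \<comment> \<open>The bracket \<open>T 2 i j\<close>, with \<open>j\<close> the successor of
    \<open>i\<close>, is expressed in two ways; this takes two steps of the recursion and hence
    \<open>N\<close> at least 2.\<close>
  have anti: "B (nx i) i + B i (nx i) \<in> F N" for i
  proof -
    define j where "j = nx i"
    have ij: "i = nx (nx j)" by (simp add: j_def)
    have 1: "T (Suc 0) j i + B i j \<in> F N" using rec(6)[OF N1(1), of j] ij by simp
    have 2: "T (Suc (Suc 0)) i j + B j i \<in> F N" "T (Suc (Suc 0)) i j + T (Suc 0) j i \<in> F N"
      using rec(3,4)[OF N1(2), of i] by (simp_all add: j_def)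
    have "(T (Suc (Suc 0)) i j + B j i) - (T (Suc (Suc 0)) i j + T (Suc 0) j i) + (T (Suc 0) j i + B i j) \<in> F N"
      by (rule F_ops(1)[OF F_ops(2)[OF 2] 1])
    thus ?thesis by (simp add: j_def algebra_simps)
  qed
  have half: "a \<in> F N" if "sc c a \<in> F N" "c \<noteq> 0" for a c
    using F_ops(4)[OF that(1), of "inverse c"] that(2) by simp
  have two: "sc 2 a = a + a" for a using scale_left_distrib[of 1 1 a] by simp
  have bb: "b (nx i) - b (nx (nx i)) \<in> F N" for i
  proof -
    define j k where "j = nx i" and "k = nx (nx i)"
    have n: "nx i = j" "nx j = k" "nx k = i" by (simp_all add: j_def k_def)
    have 1: "T (Suc 0) k k - (b i + b j) \<in> F N" "T (Suc 0) j j - (b k + b i) \<in> F N"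
      using rec(1)[OF N1(1), of k] rec(1)[OF N1(1), of j] by (simp_all add: n T0 b_def)
    have 2: "T (Suc (Suc 0)) i i - (b j + T (Suc 0) k k) \<in> F N" "T (Suc (Suc 0)) i i - (b k + T (Suc 0) j j) \<in> F N"
      using rec(1,2)[OF N1(2), of i] by (simp_all add: n)
    have "(T (Suc (Suc 0)) i i - (b k + T (Suc 0) j j)) - (T (Suc (Suc 0)) i i - (b j + T (Suc 0) k k))
        - (T (Suc 0) k k - (b i + b j)) + (T (Suc 0) j j - (b k + b i)) \<in> F N"
      by (rule F_ops(1)[OF F_ops(2)[OF F_ops(2)[OF 2(2,1)] 1(1)] 1(2)])
    also have "(T (Suc (Suc 0)) i i - (b k + T (Suc 0) j j)) - (T (Suc (Suc 0)) i i - (b j + T (Suc 0) k k))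
        - (T (Suc 0) k k - (b i + b j)) + (T (Suc 0) j j - (b k + b i)) = (b j - b k) + (b j - b k)"
      by (simp add: algebra_simps)
    finally show ?thesis using half[of 2 "b j - b k"] by (simp add: two n)
  qed
  have ball: "b i - b I1 \<in> F N" for i
    using bb[of I3] bb[of I2] F_ops(3)[OF bb[of I3]] by (cases i) (auto simp: F_ops)
  have Tp: "T p i i - sc (of_nat (Suc p)) (b I1) \<in> F N" if "p \<le> N" for p i
    using that
  proof (induction p arbitrary: i)
    case 0
    thus ?case using ball[of i] by (simp add: T0 b_def)
  next
    case (Suc p)
    have "(T (Suc p) i i - (b (nx i) + T p (nx (nx i)) (nx (nx i)))) + (b (nx i) - b I1)
        + (T p (nx (nx i)) (nx (nx i)) - sc (of_nat (Suc p)) (b I1)) \<in> F N"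
      by (rule F_ops(1)[OF F_ops(1)[OF rec(1)[OF Suc.prems, of i] ball] Suc.IH]) (use Suc.prems in simp)
    thus ?case by (simp add: scale_left_distrib two algebra_simps)
  qed
  have b0: "b I1 \<in> F N"
  proof -
    have "T N I1 I1 = - b I1" using br_anti[of "e N I1" "x I1"] by (simp add: T_def b_def B_def)
    hence "- (T N I1 I1 - sc (of_nat (Suc N)) (b I1)) = sc (of_nat (Suc (Suc N))) (b I1)"
      by (simp add: scale_left_distrib two algebra_simps)
    hence "sc (of_nat (Suc (Suc N))) (b I1) \<in> F N" using F_ops(3)[OF Tp[of N I1]] by simp
    thus ?thesis by (rule half) (use of_nat_eq_0_iff[of "Suc (Suc N)"] in blast)
  qed
  show ?thesis
    unfolding good_def
  proof (intro allI impI)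
    fix p q i assume pq: "p + q = N"
    have q: "q = N - p" "p \<le> N" using pq by auto
    have "(T p i i - sc (of_nat (Suc p)) (b I1)) + sc (of_nat (Suc p)) (b I1) \<in> F N"
      by (rule F_ops(1)[OF Tp[OF q(2)] F_ops(4)[OF b0]])
    moreover have "T p i (nx i) - e (Suc N) (nx (nx i)) \<in> F N"
    proof -
      have eN: "e (Suc N) (nx (nx i)) = B i (nx i)" by (simp add: B_def)
      show ?thesis
      proof (cases p)
        case 0
        thus ?thesis by (simp add: T0 B_def F_ops)
      next
        case (Suc p')
        have "(T (Suc p') i (nx i) + B (nx i) i) - (B (nx i) i + B i (nx i)) \<in> F N"
          by (rule F_ops(2)[OF rec(3) anti]) (use Suc q in simp)
        thus ?thesis unfolding eN Suc by (simp add: algebra_simps)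
      qed
    qed
    ultimately show "br (e p i) (e q i) \<in> F N \<and> br (e p i) (e q (nx i)) - e (Suc N) (nx (nx i)) \<in> F N"
      by (simp add: T_def q)
  qed
qed

lemma good_all: "good N"
proof (induction N rule: less_induct)
  case (less N)
  consider "N = 0" | "N = 1" | "N \<ge> 2" by linarith
  thus ?case using good_0 good_1 good_step[of N] less.IH by cases auto
qed

lemma ad_x_span: "br (x i) (e n j) \<in> span {e m k | m k. True}"
proof -
  have "br (e 0 i) (e n j) \<in> F (Suc (0 + n))" by (rule good_in[OF good_all])
  moreover have "F (Suc n) \<subseteq> span {e m k | m k. True}" unfolding F_def by (rule span_mono) blast
  ultimately show ?thesis by auto
qed

end

section \<open>Two triples with linear cross relations\<close>

locale elliptic_pair = clie sc br for sc :: "complex \<Rightarrow> 'a::ab_group_add \<Rightarrow> 'a" and br +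
  fixes x :: "pm \<Rightarrow> idx \<Rightarrow> 'a" and J :: "idx \<Rightarrow> complex"
  assumes triple: "elliptic_triple sc br (x s) J"
    and cross: "br (x s i) (x (opp s) j) \<in> span {x s k | s k. True}"
begin

lemma opp_opp [simp]: "opp (opp s) = s" by (cases s) auto

definition U :: "'a set" where "U = span {ebr (x s) n i | s n i. True}"

lemma U_sub: "subspace U" by (simp add: U_def)

text \<open>The span of the brackets of sign \<open>s\<close> is enlarged by the opposite generators
  because the cross relations produce them. The enlarged space is stable under bracketing with
  \<open>x s i\<close>, and the claim follows by induction on the length with the Jacobi
  identity.\<close>

lemma br_x_e_opp: "br (x (opp s) i) (ebr (x s) n j) \<in> span ({ebr (x s) n j | n j. True} \<union> {x (opp s) j | j. True})"
proof -
  define M where "M = span ({ebr (x s) n j | n j. True} \<union> {x (opp s) j | j. True})"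
  have M: "subspace M" by (simp add: M_def)
  have Mx: "x s k \<in> M" "x (opp s) k \<in> M" for k
  proof -
    have "x s k = ebr (x s) 0 k" by simp
    thus "x s k \<in> M" "x (opp s) k \<in> M" unfolding M_def by (auto intro!: span_base simp del: ebr.simps)
  qed
  have Me: "br (x s i) (ebr (x s) n j) \<in> M" for i n j
    using elliptic_triple.ad_x_span[OF triple, of s i n j] span_mono[of "{ebr (x s) n j | n j. True}"]
    unfolding M_def by blast
  have sp: "span {x s k | s k. True} \<subseteq> M"
  proof (rule span_minimal[OF _ M])
    show "{x s k | s k. True} \<subseteq> M" using Mx by (auto) (metis opp.simps pm.exhaust opp_opp)
  qed
  have x1: "br (x s i) (x (opp s) j) \<in> M" for i j using cross[of s i j] sp by blast
  have x2: "br (x (opp s) i) (x s j) \<in> M" for i j using cross[of "opp s" i j] sp by auto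
  have xM: "br (x s i) y \<in> M" if "y \<in> M" for i y
    using that unfolding M_def[of] by (rule br_span_right[OF _ M[unfolded M_def]]) (use Me x1 in \<open>auto simp: M_def\<close>)
  have "br (x (opp s) i) (ebr (x s) n j) \<in> M" for i j
  proof (induction n arbitrary: i j)
    case 0
    thus ?case using x2 by simp
  next
    case (Suc n)
    define a b where "a = nx j" and "b = nx (nx j)"
    have "br (x (opp s) i) (br (x s a) (ebr (x s) n b))
        = br (br (x (opp s) i) (x s a)) (ebr (x s) n b) + br (x s a) (br (x (opp s) i) (ebr (x s) n b))"
      by (simp add: br_ad)
    moreover have "br (br (x (opp s) i) (x s a)) (ebr (x s) n b) \<in> M"
    proof (rule br_span_left[OF _ M])
      show "br (x (opp s) i) (x s a) \<in> span {x s k | s k. True}" using cross[of "opp s" i a] by simp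
      fix y assume "y \<in> {x s k | s k. True}"
      then obtain r k where "y = x r k" by blast
      moreover have "r = s \<or> r = opp s" by (cases r; cases s) auto
      ultimately show "br y (ebr (x s) n b) \<in> M" using Me Suc.IH by auto
    qed
    moreover have "br (x s a) (br (x (opp s) i) (ebr (x s) n b)) \<in> M" by (intro xM Suc.IH)
    ultimately show ?case using M by (simp add: a_def b_def subspace_add)
  qed
  thus ?thesis by (simp add: M_def)
qed

lemma br_x_U: "y \<in> U \<Longrightarrow> br (x s i) y \<in> U"
  unfolding U_def
proof (erule br_span_right)
  show "subspace (span {ebr (x s) n i | s n i. True})" by simp
  fix y assume "y \<in> {ebr (x s) n i | s n i. True}"
  then obtain r n j where y: "y = ebr (x r) n j" by blast
  have "r = s \<or> s = opp r" by (cases r; cases s) auto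
  thus "br (x s i) y \<in> span {ebr (x s) n i | s n i. True}"
  proof
    assume "r = s"
    thus ?thesis using elliptic_triple.ad_x_span[OF triple, of s i n j]
        span_mono[of "{ebr (x s) n j | n j. True}" "{ebr (x s) n i | s n i. True}"] y by blast
  next
    assume s: "s = opp r"
    have "x q k \<in> {ebr (x s) n i | s n i. True}" for q k
      using ebr.simps(1)[of "x q" k] by (metis (mono_tags, lifting) mem_Collect_eq)
    hence "{ebr (x r) n j | n j. True} \<union> {x (opp r) j | j. True} \<subseteq> {ebr (x s) n i | s n i. True}" by blast
    from span_mono[OF this] show ?thesis using br_x_e_opp[of r i n j] y s by blast
  qed
qed

text \<open>By the Jacobi identity, bracketing with a nested bracket reduces to bracketing with
  generators, under which \<open>U\<close> is stable.\<close>

lemma br_e_U: "y \<in> U \<Longrightarrow> br (ebr (x s) n i) y \<in> U"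
proof (induction n arbitrary: i y)
  case 0
  thus ?case using br_x_U by simp
next
  case (Suc n)
  thus ?case using U_sub br_x_U by (simp add: br_ad subspace_diff)
qed

lemma br_U: "a \<in> U \<Longrightarrow> b \<in> U \<Longrightarrow> br a b \<in> U"
  by (rule br_span_left[OF _ U_sub, of a "{ebr (x s) n i | s n i. True}"]) (use br_e_U in \<open>auto simp: U_def\<close>)

lemma x_U: "x s i \<in> U"
  unfolding U_def using ebr.simps(1)[of "x s" i] by (metis (mono_tags, lifting) mem_Collect_eq span_base)

end

section \<open>Uglov's generators as elliptic functions\<close>

text \<open>The functions \<open>1/sn\<close>, \<open>dn/sn\<close> and \<open>cn/sn\<close> are
  multiples of theta4, theta3 and theta2 over theta1, that is, of \<open>mu\<close> with indices 3,
  2 and 1: Uglov's numbering reverses Holod's.\<close>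

fun dual :: "idx \<Rightarrow> idx" where "dual I1 = I3" | "dual I2 = I2" | "dual I3 = I1"

lemma dual_dual [simp]: "dual (dual i) = i" by (cases i) auto

lemma dual_eq_iff [simp]: "dual i = dual j \<longleftrightarrow> i = j" by (cases i; cases j) auto

lemma chi_dual: "chi1 (dual i) * chi1 (dual (nx i)) = chi1 (dual (nx (nx i)))"
  "chi2 (dual i) * chi2 (dual (nx i)) = chi2 (dual (nx (nx i)))"
  by (cases i; simp)+

text \<open>Reversing the numbering changes the orientation of the basis; the sign -1 restores
  \<open>[u_1, u_2] = u_3\<close> and its cyclic versions.\<close>

definition uvec :: "idx \<Rightarrow> cmat" where "uvec i = smult_mat (- 1) (holod_v (dual i))"

lemma coord_uvec: "coord (dual i) (uvec j) = (if i = j then - 1 else 0)"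
  by (simp add: uvec_def coord_smult coord_v)

lemma trace_uvec: "trace (uvec j) = 0"
  by (simp add: uvec_def trace_smult trace_v)

lemma uvec_bracket: "lie_bracket (uvec i) (uvec (nx i)) = uvec (nx (nx i))"
  by (cases i) (simp_all add: cmat_eq_iff lie_bracket_nth uvec_def)

lemma lie_bracket_smult: "lie_bracket (smult_mat a X) (smult_mat b Y) = smult_mat (a * b) (lie_bracket X Y)"
  by (simp add: vec_eq_iff lie_bracket_nth algebra_simps)

lemma lie_bracket_swap: "lie_bracket Y X = smult_mat (- 1) (lie_bracket X Y)"
  by (simp add: vec_eq_iff lie_bracket_nth algebra_simps)

lemma lie_bracket_self: "lie_bracket X X = 0"
  by (simp add: lie_bracket_def)

lemma smult_smult: "smult_mat a (smult_mat b X) = smult_mat (a * b) X"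
  and smult_add: "smult_mat a X + smult_mat b X = smult_mat (a + b) X"
  and smult_zero: "smult_mat 0 X = 0" "smult_mat a 0 = 0"
  by (simp_all add: vec_eq_iff algebra_simps)

lemma uvec_brackets:
  "lie_bracket (uvec i) (uvec i) = 0"
  "lie_bracket (uvec (nx i)) (uvec (nx (nx i))) = uvec i"
  "lie_bracket (uvec i) (uvec (nx (nx i))) = smult_mat (- 1) (uvec (nx i))"
  "lie_bracket (uvec (nx i)) (uvec i) = smult_mat (- 1) (uvec (nx (nx i)))"
  using uvec_bracket[of i] uvec_bracket[of "nx i"] uvec_bracket[of "nx (nx i)"]
    lie_bracket_swap[of "uvec i" "uvec (nx (nx i))"] lie_bracket_swap[of "uvec (nx i)" "uvec i"]
  by (simp_all add: lie_bracket_self)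

primrec ev :: "('g \<Rightarrow> cmat) \<Rightarrow> 'g lie_term \<Rightarrow> cmat" where
  "ev G (Gen g) = G g"
| "ev G TZero = 0"
| "ev G (TAdd s t) = ev G s + ev G t"
| "ev G (TSmul a t) = smult_mat a (ev G t)"
| "ev G (TBr s t) = lie_bracket (ev G s) (ev G t)"

lemma ev_cong:
  assumes "lie_cong R s t" "\<And>s t. (s, t) \<in> R \<Longrightarrow> ev G s = ev G t"
  shows "ev G s = ev G t"
  using assms(1)
  by (induction rule: lie_cong.induct)
     (auto simp: assms(2) vec_eq_iff lie_bracket_nth algebra_simps)

context torus
begin

text \<open>Chosen such that \<open>kap * mu \<tau> (dual i)\<close> is the function
  \<open>w_i\<close> formed from the Jacobi functions.\<close>

definition kap :: complex where "kap = theta4 0 \<tau> * theta2 0 \<tau> / (theta3 0 \<tau> * D1)"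

text \<open>The factor \<open>\<i>\<close> accounts for the imaginary unit in Uglov's cross relation
  and for the signs of the \<open>J\<close> in the differences of squares.\<close>

definition ff :: "idx \<Rightarrow> complex \<Rightarrow> complex" where "ff i z = \<i> * kap * mu \<tau> (dual i) z"

lemma kap_nz [simp]: "kap \<noteq> 0" by (simp add: kap_def)

lemma ff_ell: "ell H (chi1 (dual i)) (chi2 (dual i)) (ff i)"
  unfolding ff_def[abs_def] by (rule ell_cmult[OF mu_ell])

lemma ff_lim: "((\<lambda>z. z * ff i z) \<longlongrightarrow> \<i> * kap / 2) (at 0)"
  using tendsto_mult[OF tendsto_const[of "\<i> * kap"] mu_lim[of "dual i"]]
  by (simp add: ff_def algebra_simps)

text \<open>These are the classical relations between the squares of \<open>1/sn\<close>,
  \<open>dn/sn\<close> and \<open>cn/sn\<close>; the quartic theta identity turns the quotient of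
  the fourth powers of theta4 and theta3 at 0 into \<open>1 - k^2\<close>.\<close>

lemma ff_sq:
  assumes "z \<notin> H"
  shows "ff (nx i) z ^ 2 - ff i z ^ 2 = uglov_J (jacobi_modulus \<tau>) i (nx i)"
proof -
  define a b c where "a = theta3 0 \<tau>" and "b = theta4 0 \<tau>" and "c = theta2 0 \<tau>"
  have nz: "a \<noteq> 0" "b \<noteq> 0" "c \<noteq> 0" by (simp_all add: a_def b_def c_def)
  have q: "a ^ 4 = c ^ 4 + b ^ 4" using theta_quartic by (simp add: a_def b_def c_def)
  define X where "X = (\<lambda>i. mu \<tau> i z ^ 2)"
  have X: "X I2 - X I3 = - ((D1 * c / (a * b)) ^ 2)" "X I1 - X I2 = - ((D1 * b / (c * a)) ^ 2)"
    using mu_sq_diff[OF assms] by (simp_all add: X_def a_def b_def c_def)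
  have f: "ff j z ^ 2 = - (kap ^ 2) * X (dual j)" for j by (simp add: ff_def X_def power_mult_distrib)
  have k: "jacobi_modulus \<tau> ^ 2 = c ^ 4 / a ^ 4"
    by (simp add: jacobi_modulus_def a_def c_def power_divide flip: power_mult)
  have 1: "kap ^ 2 * ((D1 * c / (a * b)) ^ 2) = c ^ 4 / a ^ 4" "kap ^ 2 * ((D1 * b / (c * a)) ^ 2) = b ^ 4 / a ^ 4"
    using nz by (simp_all add: kap_def flip: a_def b_def c_def) (simp_all add: field_simps power_numeral_reduce)
  have e1: "ff I2 z ^ 2 - ff I1 z ^ 2 = c ^ 4 / a ^ 4"
    unfolding f 1(1)[symmetric] using X(1) by (simp flip: right_diff_distrib) (simp add: algebra_simps)
  have e2: "ff I3 z ^ 2 - ff I2 z ^ 2 = b ^ 4 / a ^ 4"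
    unfolding f 1(2)[symmetric] using X(2) by (simp flip: right_diff_distrib) (simp add: algebra_simps)
  have e3: "b ^ 4 / a ^ 4 = 1 - c ^ 4 / a ^ 4" 
  proof -
    have "b ^ 4 = a ^ 4 - c ^ 4" using q by simp
    thus ?thesis using nz by (simp add: diff_divide_distrib)
  qed
  have "ff I1 z ^ 2 - ff I3 z ^ 2 = - 1" using e1 e2 e3 by (simp add: algebra_simps)
  thus ?thesis using e1 e2 e3 by (cases i) (simp_all add: k)
qed

lemma mu_cont: "a \<notin> H \<Longrightarrow> (mu \<tau> i \<longlongrightarrow> mu \<tau> i a) (at a)"
  using analytic_at_imp_isCont[OF ell_analytic[OF mu_ell polar_H]] by (simp add: isCont_def)

lemma mu_cont_shift: "a - d \<notin> H \<Longrightarrow> ((\<lambda>z. mu \<tau> i (z - d)) \<longlongrightarrow> mu \<tau> i (a - d)) (at a)"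
proof -
  assume "a - d \<notin> H"
  hence "isCont (mu \<tau> i) (a - d)" using ell_analytic[OF mu_ell polar_H] analytic_at_imp_isCont by blast
  hence "isCont (\<lambda>z. mu \<tau> i (z - d)) a" using isCont_o2[of a "\<lambda>z. z - d" "mu \<tau> i"] by simp
  thus ?thesis by (simp add: isCont_def)
qed

lemma lim_shift: "((\<lambda>z. \<phi> (z - a)) \<longlongrightarrow> l) (at a) \<longleftrightarrow> (\<phi> \<longlongrightarrow> l) (at 0)" for \<phi> :: "complex \<Rightarrow> complex"
  using filterlim_at_to_0[of "\<lambda>z. \<phi> (z - a)" "nhds l" a] by simp

text \<open>Both sides have the multipliers of \<open>mu \<tau> r\<close> and the same principal parts at \<open>0\<close> and \<open>\<delta>\<close>.\<close>

lemma mu_cross: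
  assumes chi: "chi1 p * chi1 q = chi1 r" "chi2 p * chi2 q = chi2 r"
    and d: "\<delta> \<notin> H" and z: "z \<notin> H" "z - \<delta> \<notin> H"
  shows "mu \<tau> p z * mu \<tau> q (z - \<delta>) = mu \<tau> p \<delta> * mu \<tau> r (z - \<delta>) - mu \<tau> q \<delta> * mu \<tau> r z"
proof -
  define D where "D = pts {0, \<delta>}"
  have D: "polar_set D" unfolding D_def by (rule polar_pts) simp
  have in_D: "z \<in> D \<longleftrightarrow> z \<in> H \<or> z - \<delta> \<in> H" for z by (auto simp: D_def in_pts)
  define g where "g = (\<lambda>z. mu \<tau> p z * mu \<tau> q (z - \<delta>) - (mu \<tau> p \<delta> * mu \<tau> r (z - \<delta>) - mu \<tau> q \<delta> * mu \<tau> r z))"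
  have m1: "ell D (chi1 i) (chi2 i) (mu \<tau> i)" for i
    by (rule ell_mono[OF mu_ell]) (auto simp: in_D)
  have m2: "ell D (chi1 i) (chi2 i) (\<lambda>z. mu \<tau> i (z - \<delta>))" for i
    by (rule ell_mono[OF ell_translate[OF mu_ell, of "- \<delta>" i, simplified]]) (auto simp: in_D)
  have g: "ell D (chi1 r) (chi2 r) g"
    unfolding g_def using ell_mult[OF m1[of p] m2[of q]] chi
    by (intro ell_diff ell_cmult m1 m2) simp
  have l0: "((\<lambda>z. (z - 0) ^ Suc 0 * g z) \<longlongrightarrow> 0) (at 0)"
  proof -
    have "((\<lambda>z. (z * mu \<tau> p z) * mu \<tau> q (z - \<delta>) - (mu \<tau> p \<delta> * (z * mu \<tau> r (z - \<delta>)) - mu \<tau> q \<delta> * (z * mu \<tau> r z)))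
      \<longlongrightarrow> 1/2 * mu \<tau> q (0 - \<delta>) - (mu \<tau> p \<delta> * (0 * mu \<tau> r (0 - \<delta>)) - mu \<tau> q \<delta> * (1/2))) (at 0)"
      by (intro tendsto_intros mu_lim mu_cont_shift) (use d in auto)
    thus ?thesis by (simp add: mu_odd g_def algebra_simps)
  qed
  have l1: "((\<lambda>z. (z - \<delta>) ^ Suc 0 * g z) \<longlongrightarrow> 0) (at \<delta>)"
  proof -
    have m: "((\<lambda>z. (z - \<delta>) * mu \<tau> i (z - \<delta>)) \<longlongrightarrow> 1/2) (at \<delta>)" for i
      using mu_lim[of i] unfolding lim_shift[of "\<lambda>z. z * mu \<tau> i z"] .
    have "((\<lambda>z. mu \<tau> p z * ((z - \<delta>) * mu \<tau> q (z - \<delta>)) - (mu \<tau> p \<delta> * ((z - \<delta>) * mu \<tau> r (z - \<delta>)) - mu \<tau> q \<delta> * ((z - \<delta>) * mu \<tau> r z)))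
      \<longlongrightarrow> mu \<tau> p \<delta> * (1/2) - (mu \<tau> p \<delta> * (1/2) - mu \<tau> q \<delta> * ((\<delta> - \<delta>) * mu \<tau> r \<delta>))) (at \<delta>)"
      by (intro tendsto_intros m mu_cont d)
    thus ?thesis by (simp add: g_def algebra_simps)
  qed
  have p: "pole_le 0 a g" if "a \<in> {0, \<delta>}" for a
    using that pole_le_reduce[OF ell_mero[OF g] l0] pole_le_reduce[OF ell_mero[OF g] l1] by auto
  have "g z = 0"
  proof (rule ell_Liouville_0[OF g D])
    show "pole_le 0 a g" if "a \<in> D" for a
      by (rule ell_pole_le_pts[OF g D _ _ _ p]) (use that in \<open>auto simp: D_def\<close>)
  qed (use z chi_nontrivial[of r] in \<open>auto simp: in_D\<close>)
  thus ?thesis by (simp add: g_def)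
qed

text \<open>The common denominator theta4 of sn, cn and dn cancels in the quotients. At its zeros
  the formulas divide by 0, and \<open>remove_sings\<close> supplies the value.\<close>

lemma uglov_w_eq:
  assumes "\<delta> \<notin> H"
  shows "uglov_w \<tau> i \<delta> = kap * mu \<tau> (dual i) \<delta>"
proof -
  define a b c where "a = theta3 0 \<tau>" and "b = theta4 0 \<tau>" and "c = theta2 0 \<tau>"
  have nz: "a \<noteq> 0" "b \<noteq> 0" "c \<noteq> 0" by (simp_all add: a_def b_def c_def)
  have arg: "theta_arg \<tau> (jacobi_arg \<tau> z) = 2 * z" for z
    by (simp add: theta_arg_def jacobi_arg_def)
  have an: "(\<lambda>z. kap * mu \<tau> (dual i) z) analytic_on {\<delta>}"
    by (rule ell_analytic[OF ell_cmult[OF mu_ell] polar_H assms])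
  have ev: "eventually (\<lambda>z. theta4 (2 * z) \<tau> \<noteq> 0 \<and> theta1 (2 * z) \<tau> \<noteq> 0) (at \<delta>)"
    using eventually_not_in_sparse[OF sparse_translate[of "\<tau>/4"]] eventually_not_in_sparse[OF H_sparse]
    by eventually_elim (simp add: theta_zero_iff_H)
  have R: "remove_sings \<phi> \<delta> = kap * mu \<tau> (dual i) \<delta>"
    if "\<And>z. theta4 (2 * z) \<tau> \<noteq> 0 \<Longrightarrow> theta1 (2 * z) \<tau> \<noteq> 0 \<Longrightarrow> \<phi> z = kap * mu \<tau> (dual i) z" for \<phi>
  proof -
    have "remove_sings \<phi> \<delta> = remove_sings (\<lambda>z. kap * mu \<tau> (dual i) z) \<delta>"
      by (rule remove_sings_cong[OF _ HOL.refl]) (use ev in eventually_elim, use that in blast)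
    thus ?thesis using an by simp
  qed
  note defs = jacobi_sn_def jacobi_cn_def jacobi_dn_def arg mu_eq kap_def
  show ?thesis
  proof (cases i)
    case I1
    show ?thesis unfolding I1 uglov_w.simps
      by (rule R[unfolded I1]) (use nz in \<open>simp add: defs flip: a_def b_def c_def\<close>)
  next
    case I2
    show ?thesis unfolding I2 uglov_w.simps
      by (rule R[unfolded I2]) (use nz in \<open>simp add: defs power2_eq_square flip: a_def b_def c_def\<close>)
  next
    case I3
    show ?thesis unfolding I3 uglov_w.simps
      by (rule R[unfolded I3]) (use nz in \<open>simp add: defs flip: a_def b_def c_def\<close>)
  qed
qed

text \<open>The scalar factor of the image of an iterated bracket, the matrix factor being
  \<open>uvec i\<close>.\<close>

primrec gf :: "nat \<Rightarrow> idx \<Rightarrow> complex \<Rightarrow> complex" where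
  "gf 0 i = ff i"
| "gf (Suc n) i = (\<lambda>z. ff (nx i) z * gf n (nx (nx i)) z)"

lemma gf_ell: "ell H (chi1 (dual i)) (chi2 (dual i)) (gf n i)"
proof (induction n arbitrary: i)
  case (Suc n)
  thus ?case using ell_mult[OF ff_ell[of "nx i"] Suc.IH[of "nx (nx i)"]] chi_dual[of "nx i"] by simp
qed (simp add: ff_ell)

lemma gf_lim: "((\<lambda>z. z ^ Suc n * gf n i z) \<longlongrightarrow> (\<i> * kap / 2) ^ Suc n) (at 0)"
proof (induction n arbitrary: i)
  case (Suc n)
  show ?case using tendsto_mult[OF ff_lim[of "nx i"] Suc.IH[of "nx (nx i)"]] by (simp add: mult_ac)
qed (use ff_lim in simp)

end

section \<open>Presented Lie algebras\<close>

lemma lie_class_eq_iff: "lie_class R s = lie_class R t \<longleftrightarrow> lie_cong R s t"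
proof
  assume "lie_class R s = lie_class R t"
  hence "t \<in> lie_class R s" by (simp add: lie_class_def lie_cong.refl)
  thus "lie_cong R s t" by (simp add: lie_class_def)
next
  assume "lie_cong R s t"
  thus "lie_class R s = lie_class R t"
    unfolding lie_class_def by (blast intro: lie_cong.trans lie_cong.sym)
qed

text \<open>The operations are unions over all representatives; by the congruence rules all sets in
  such a union are the same class.\<close>

lemma presented_lie_simps:
  "lie_carrier (presented_lie R) = range (lie_class R)"
  "lie_zero (presented_lie R) = lie_class R TZero"
  "lie_add (presented_lie R) (lie_class R s) (lie_class R t) = lie_class R (TAdd s t)"
  "lie_smul (presented_lie R) a (lie_class R s) = lie_class R (TSmul a s)"
  "lie_br (presented_lie R) (lie_class R s) (lie_class R t) = lie_class R (TBr s t)"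
proof -
  have mem: "u \<in> lie_class R s \<longleftrightarrow> lie_cong R s u" for u s by (simp add: lie_class_def)
  have eq: "lie_cong R s u \<Longrightarrow> lie_class R u = lie_class R s" for s u
    using lie_class_eq_iff lie_cong.sym by metis
  have ne: "lie_class R u \<noteq> {}" for u using mem[of u u] lie_cong.refl[of R u] by blast
  have union: "(\<Union>u\<in>A. X u) = C" if "A \<noteq> {}" "\<And>u. u \<in> A \<Longrightarrow> X u = C" for A and X :: "'a lie_term \<Rightarrow> 'a lie_term set" and C
    using that by blast
  have "(\<Union>u\<in>lie_class R s. \<Union>v\<in>lie_class R t. lie_class R (TAdd u v)) = lie_class R (TAdd s t)"
    by (rule union[OF ne], rule union[OF ne], rule eq, rule lie_cong.cong_add) (simp_all add: mem)
  moreover have "(\<Union>u\<in>lie_class R s. \<Union>v\<in>lie_class R t. lie_class R (TBr u v)) = lie_class R (TBr s t)"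
    by (rule union[OF ne], rule union[OF ne], rule eq, rule lie_cong.cong_br) (simp_all add: mem)
  moreover have "(\<Union>u\<in>lie_class R s. lie_class R (TSmul a u)) = lie_class R (TSmul a s)"
    by (rule union[OF ne], rule eq, rule lie_cong.cong_smul) (simp add: mem)
  ultimately show "lie_carrier (presented_lie R) = range (lie_class R)"
    "lie_zero (presented_lie R) = lie_class R TZero"
    "lie_add (presented_lie R) (lie_class R s) (lie_class R t) = lie_class R (TAdd s t)"
    "lie_smul (presented_lie R) a (lie_class R s) = lie_class R (TSmul a s)"
    "lie_br (presented_lie R) (lie_class R s) (lie_class R t) = lie_class R (TBr s t)"
    by (simp_all add: presented_lie_def)
qed

lemma presented_lie_algebra: "complex_lie_algebra (presented_lie R)"
  unfolding complex_lie_algebra_def presented_lie_simps ball_simps(9)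
  by (auto simp: presented_lie_simps lie_class_eq_iff lie_cong.add_assoc lie_cong.add_commute lie_cong.add_zero
      lie_cong.add_inverse lie_cong.smul_add lie_cong.add_smul lie_cong.smul_smul lie_cong.one_smul
      lie_cong.br_add_left lie_cong.br_add_right lie_cong.br_smul_left lie_cong.br_smul_right lie_cong.br_self
      lie_cong.jacobi)

text \<open>The homomorphism theorem for the algebra of terms: an evaluation \<open>E\<close> onto
  \<open>L\<close> that identifies exactly the congruent terms induces the isomorphism, with
  \<open>inv E\<close> choosing representatives.\<close>

lemma lie_isomorphic_presentedI:
  assumes L: "complex_lie_algebra L" and E: "range E = lie_carrier L"
    and eq: "\<And>s t. E s = E t \<longleftrightarrow> lie_cong R s t"
    and ops: "\<And>s t. E (TAdd s t) = lie_add L (E s) (E t)" "\<And>a s. E (TSmul a s) = lie_smul L a (E s)"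
      "\<And>s t. E (TBr s t) = lie_br L (E s) (E t)"
  shows "lie_isomorphic L (presented_lie R)"
proof -
  define \<phi> where "\<phi> = (\<lambda>x. lie_class R (inv E x))"
  have \<phi>: "\<phi> (E s) = lie_class R s" for s
    by (simp add: \<phi>_def lie_class_eq_iff flip: eq) (simp add: f_inv_into_f)
  have "bij_betw \<phi> (lie_carrier L) (range (lie_class R))"
    unfolding bij_betw_def inj_on_def E[symmetric] by (auto simp: \<phi> lie_class_eq_iff eq image_image)
  moreover have "\<phi> (lie_add L (E s) (E t)) = lie_add (presented_lie R) (\<phi> (E s)) (\<phi> (E t))"
    "\<phi> (lie_smul L a (E s)) = lie_smul (presented_lie R) a (\<phi> (E s))"
    "\<phi> (lie_br L (E s) (E t)) = lie_br (presented_lie R) (\<phi> (E s)) (\<phi> (E t))" for s t a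
    by (simp_all add: \<phi> presented_lie_simps flip: ops)
  ultimately show ?thesis
    unfolding lie_isomorphic_def presented_lie_simps(1) E[symmetric]
    using L presented_lie_algebra by (intro conjI exI[of _ \<phi>]) auto
qed

lemma lie_cong_smul_0: "lie_cong R (TSmul 0 s) TZero"
proof -
  have "lie_cong R (TSmul 0 s) (TAdd (TSmul 1 s) (TSmul (- 1) s))" using lie_cong.add_smul[of R 1 "- 1" s] by simp
  moreover have "lie_cong R (TAdd (TSmul 1 s) (TSmul (- 1) s)) (TAdd s (TSmul (- 1) s))"
    by (intro lie_cong.cong_add lie_cong.one_smul lie_cong.refl)
  ultimately show ?thesis using lie_cong.add_inverse lie_cong.trans by metis
qed

lemma lie_cong_diff_0:
  assumes "lie_cong R (TDiff s t) TZero"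
  shows "lie_cong R s t"
proof -
  have n: "lie_cong R (TAdd u TZero) u" for u
    using lie_cong.add_commute lie_cong.add_zero lie_cong.trans by metis
  have "lie_cong R (TAdd (TSmul (- 1) t) t) TZero"
    using lie_cong.add_commute lie_cong.add_inverse lie_cong.trans by metis
  hence "lie_cong R (TAdd s (TAdd (TSmul (- 1) t) t)) s"
    using n lie_cong.cong_add[OF lie_cong.refl] lie_cong.trans by metis
  moreover have "lie_cong R (TAdd (TDiff s t) t) t"
    using lie_cong.cong_add[OF assms lie_cong.refl, of t] lie_cong.add_zero lie_cong.trans by metis
  ultimately show ?thesis using lie_cong.add_assoc lie_cong.sym lie_cong.trans by metis
qed

section \<open>Realisation of Uglov's algebra\<close>

primrec eterm :: "pm \<Rightarrow> nat \<Rightarrow> idx \<Rightarrow> (pm \<times> idx) lie_term" where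
  "eterm s 0 i = Gen (s, i)"
| "eterm s (Suc n) i = TBr (Gen (s, nx i)) (eterm s n (nx (nx i)))"

primrec lin_term :: "('k \<Rightarrow> complex) \<Rightarrow> ('k \<Rightarrow> 'g lie_term) \<Rightarrow> 'k list \<Rightarrow> 'g lie_term" where
  "lin_term c e [] = TZero"
| "lin_term c e (k # ks) = TAdd (TSmul (c k) (e k)) (lin_term c e ks)"

lemma ev_lin_term: "ev G (lin_term c e ks) = (\<Sum>k\<leftarrow>ks. smult_mat (c k) (ev G (e k)))"
  by (induction ks) simp_all

lemma lin_term_0: "(\<And>k. k \<in> set ks \<Longrightarrow> c k = 0) \<Longrightarrow> lie_cong R (lin_term c e ks) TZero"
proof (induction ks)
  case (Cons k ks)
  have "lie_cong R (lin_term c e (k # ks)) (TAdd TZero TZero)"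
    using Cons lie_cong.cong_add[OF lie_cong_smul_0] by simp
  thus ?case using lie_cong.add_zero lie_cong.trans by metis
qed (simp add: lie_cong.refl)

lemma coord_sum_list: "coord i (\<Sum>k\<leftarrow>ks. X k) = (\<Sum>k\<leftarrow>ks. coord i (X k))"
  by (induction ks) (simp_all add: coord_add, cases i, simp_all)

lemma pm_cases: "s = r \<or> s = opp r" by (cases s; cases r) auto

text \<open>The hypothesis on \<open>\<nu>\<close> separates the two orbits of poles: a function
  with poles on one of them is analytic on the other.\<close>

locale uglov = torus +
  fixes \<nu> :: "pm \<Rightarrow> complex"
  assumes nu: "\<nu> Plus - \<nu> Minus \<notin> H"
begin

definition DU :: "complex set" where "DU = pts {\<nu> Plus, \<nu> Minus}"

abbreviation "rels \<equiv> uglov_rels \<tau> \<nu>"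

lemma DU_polar [simp]: "polar_set DU" unfolding DU_def by (rule polar_pts) simp

lemma DU_off: "z \<notin> DU \<Longrightarrow> z - \<nu> s \<notin> H"
  by (cases s) (auto simp: DU_def in_pts)

lemma nu_in_DU: "z - \<nu> s \<in> H \<Longrightarrow> z \<in> DU"
  using DU_off by blast

lemma nu_opp: "\<nu> (opp s) - \<nu> s \<notin> H"
  using nu H_diff_commute by (cases s) auto

definition gen :: "complex \<Rightarrow> pm \<times> idx \<Rightarrow> cmat" where
  "gen z si = smult_mat (ff (snd si) (z - \<nu> (fst si))) (uvec (snd si))"

text \<open>A rescaled form of the addition theorem for \<open>mu\<close>, to be used with
  \<open>y = z - \<nu> s\<close> and \<open>\<delta> = \<nu> (opp s) - \<nu> s\<close>.\<close>

lemma ff_cross: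
  assumes "\<delta> \<notin> H" "y \<notin> H" "y - \<delta> \<notin> H"
  shows "ff i y * ff (nx i) (y - \<delta>) =
    \<i> * (uglov_w \<tau> i \<delta> * ff (nx (nx i)) (y - \<delta>) - uglov_w \<tau> (nx i) \<delta> * ff (nx (nx i)) y)"
proof -
  note m = mu_cross[OF chi_dual[of i] assms]
  have "ff i y * ff (nx i) (y - \<delta>) = - (kap ^ 2) * (mu \<tau> (dual i) y * mu \<tau> (dual (nx i)) (y - \<delta>))"
  proof -
    have "(\<i> * k * a) * (\<i> * k * b) = (\<i> * \<i>) * (k ^ 2 * (a * b))" for k a b :: complex
      by (simp only: mult_ac power2_eq_square)
    thus ?thesis by (simp add: ff_def)
  qed
  also have "\<dots> = \<i> * (uglov_w \<tau> i \<delta> * ff (nx (nx i)) (y - \<delta>) - uglov_w \<tau> (nx i) \<delta> * ff (nx (nx i)) y)"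
    unfolding m uglov_w_eq[OF assms(1)] ff_def by (simp add: power2_eq_square algebra_simps)
  finally show ?thesis .
qed

text \<open>In the first and third relation a multiple of \<open>uvec i\<close> is bracketed with
  another one; the second is \<open>ff_sq\<close> and the fourth \<open>ff_cross\<close>.\<close>

lemma gen_rels:
  assumes "(t, u) \<in> rels" "z \<notin> DU"
  shows "ev (gen z) t = ev (gen z) u"
proof -
  note simps = gen_def lie_bracket_smult uvec_brackets uvec_bracket smult_smult smult_add smult_zero
  note off = DU_off[OF assms(2)]
  consider s i where "t = TBr (uglov_x s i) (TBr (uglov_x s (nx i)) (uglov_x s (nx (nx i))))" "u = TZero"
    | s i where "t = TDiff (TBr (uglov_x s i) (TBr (uglov_x s i) (uglov_x s (nx (nx i)))))
             (TBr (uglov_x s (nx i)) (TBr (uglov_x s (nx i)) (uglov_x s (nx (nx i)))))"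
       "u = TSmul (uglov_J (jacobi_modulus \<tau>) i (nx i)) (uglov_x s (nx (nx i)))"
    | i where "t = TBr (uglov_x Plus i) (uglov_x Minus i)" "u = TZero"
    | s i where "t = TBr (uglov_x s i) (uglov_x (opp s) (nx i))"
       "u = TSmul \<i> (TDiff (TSmul (uglov_w \<tau> i (\<nu> (opp s) - \<nu> s)) (uglov_x (opp s) (nx (nx i))))
                      (TSmul (uglov_w \<tau> (nx i) (\<nu> (opp s) - \<nu> s)) (uglov_x s (nx (nx i)))))"
    using assms(1) unfolding uglov_rels_def cyclic_nx by blast
  thus ?thesis
  proof cases
    case (1 s i)
    thus ?thesis by (simp add: simps)
  next
    case (2 s i)
    show ?thesis unfolding 2 
      by (simp add: simps flip: ff_sq[OF off[of s]]) (rule arg_cong[of _ _ "\<lambda>c. smult_mat c _"], simp add: power2_eq_square algebra_simps)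
  next
    case (3 i)
    thus ?thesis by (simp add: simps)
  next
    case (4 s i)
    have "ff i (z - \<nu> s) * ff (nx i) (z - \<nu> (opp s)) =
      \<i> * (uglov_w \<tau> i (\<nu> (opp s) - \<nu> s) * ff (nx (nx i)) (z - \<nu> (opp s)) - uglov_w \<tau> (nx i) (\<nu> (opp s) - \<nu> s) * ff (nx (nx i)) (z - \<nu> s))"
      using ff_cross[OF nu_opp[of s] off[of s], of i] off[of "opp s"] by simp
    thus ?thesis unfolding 4
      by (simp add: simps right_diff_distrib mult.assoc)
  qed
qed

lemma ev_eterm: "ev (gen z) (eterm s n i) = smult_mat (gf n i (z - \<nu> s)) (uvec i)"
  by (induction n arbitrary: i) (simp_all add: gen_def lie_bracket_smult uvec_brackets)

lemma gf_ell_shift: "ell DU (chi1 (dual i)) (chi2 (dual i)) (\<lambda>z. gf n i (z - \<nu> s))"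
  by (rule ell_mono[OF ell_translate[OF gf_ell, of "- \<nu> s", simplified]]) (use nu_in_DU in auto)

lemma gf_lim_shift: "((\<lambda>z. (z - \<nu> s) ^ Suc n * gf n i (z - \<nu> s)) \<longlongrightarrow> (\<i> * kap / 2) ^ Suc n) (at (\<nu> s))"
  using gf_lim[of n i] unfolding lim_shift[of "\<lambda>z. z ^ Suc n * gf n i z"] .

lemma gf_analytic_opp: "(\<lambda>z. gf n i (z - \<nu> (opp s))) analytic_on {\<nu> s}"
proof -
  have P: "polar_set {z. z - \<nu> (opp s) \<in> H}" using polar_pts[of "{\<nu> (opp s)}"] by (simp add: pts_def)
  show ?thesis
    by (rule ell_analytic[OF ell_translate[OF gf_ell, of "- \<nu> (opp s)", simplified] P])
       (use nu_opp[of s] H_diff_commute in auto)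
qed

lemma ev_gen_equivariant: "equivariant DU (\<lambda>z. ev (gen z) t)"
proof (induction t)
  case (Gen si)
  obtain s i where si: "si = (s, i)" by (cases si)
  show ?case
  proof (rule equivariantI)
    fix j
    have "coord j (ev (gen z) (Gen si)) = (if dual i = j then - 1 else 0) * ff i (z - \<nu> s)" for z
      using coord_uvec[of "dual j" i] by (auto simp: si gen_def coord_smult)
    thus "ell DU (chi1 j) (chi2 j) (\<lambda>z. coord j (ev (gen z) (Gen si)))"
      using ell_cmult[OF gf_ell_shift[of i 0 s], of "- 1"] by (cases "dual i = j") (auto simp: ell_zero)
  qed (simp_all add: si gen_def trace_smult trace_uvec)
qed (simp_all add: equivariant_zero equivariant_add equivariant_smult equivariant_bracket)

section \<open>The realisation map: injectivity on combinations, and surjectivity\<close>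

definition Ev :: "(pm \<times> idx) lie_term \<Rightarrow> complex \<Rightarrow> cmat" where
  "Ev t = remove_sings_mat (\<lambda>z. ev (gen z) t)"

lemma Ev_in: "Ev t \<in> equi_algebra DU"
  unfolding Ev_def by (rule remove_sings_mat_in[OF ev_gen_equivariant DU_polar])

lemma Ev_off: "z \<notin> DU \<Longrightarrow> Ev t z = ev (gen z) t"
  unfolding Ev_def by (rule remove_sings_mat_off[OF ev_gen_equivariant DU_polar])

abbreviation "et \<equiv> \<lambda>(s, n, i). eterm s n i"

text \<open>Among the terms with the given sign and index and nonzero coefficient, take the largest
  number \<open>M\<close>. Multiplying the coordinate by \<open>(z - \<nu> s) ^ Suc M\<close> and
  letting \<open>z\<close> tend to \<open>\<nu> s\<close> isolates its coefficient: smaller numbers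
  have smaller pole order, other indices have coordinate 0, and terms of the opposite sign are
  analytic there.\<close>

lemma lin_term_independent:
  assumes "distinct ks" and z: "\<And>z. z \<notin> DU \<Longrightarrow> ev (gen z) (lin_term c et ks) = 0" and "k \<in> set ks"
  shows "c k = 0"
proof (rule ccontr)
  assume nz: "c k \<noteq> 0"
  obtain s n i where k: "k = (s, n, i)" by (cases k)
  define M where "M = Max {m. (s, m, i) \<in> set ks \<and> c (s, m, i) \<noteq> 0}"
  have fin: "finite {m. (s, m, i) \<in> set ks \<and> c (s, m, i) \<noteq> 0}"
    by (rule finite_subset[of _ "(\<lambda>(s, m, i). m) ` set ks"]) (auto intro: rev_image_eqI)
  have "M \<in> {m. (s, m, i) \<in> set ks \<and> c (s, m, i) \<noteq> 0}"
    unfolding M_def by (rule Max_in[OF fin]) (use assms(3) nz k in auto)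
  hence M: "(s, M, i) \<in> set ks" "c (s, M, i) \<noteq> 0" by auto
  have Mmax: "m \<le> M" if "(s, m, i) \<in> set ks" "c (s, m, i) \<noteq> 0" for m
    unfolding M_def using that by (intro Max_ge[OF fin]) auto
  define a where "a = (\<lambda>k z. (z - \<nu> s) ^ Suc M * (c k * coord (dual i) (ev (gen z) (et k))))"
  define L where "L = (\<lambda>k. if k = (s, M, i) then - (c k * (\<i> * kap / 2) ^ Suc M) else 0)"
  have lim: "(a k \<longlongrightarrow> L k) (at (\<nu> s))" if k: "k \<in> set ks" for k
  proof -
    obtain r m j where kr: "k = (r, m, j)" by (cases k)
    have a: "a k z = (if i = j then - 1 else 0) * c k * ((z - \<nu> s) ^ Suc M * gf m j (z - \<nu> r))" for z
      by (simp add: a_def kr ev_eterm coord_smult coord_uvec)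
    have p: "((\<lambda>z. (z - \<nu> s) ^ Suc q) \<longlongrightarrow> 0) (at (\<nu> s))" for q
    proof -
      have "((\<lambda>z. (z - \<nu> s) ^ Suc q) \<longlongrightarrow> (\<nu> s - \<nu> s) ^ Suc q) (at (\<nu> s))" by (intro tendsto_intros)
      thus ?thesis by simp
    qed
    consider "i \<noteq> j \<or> c k = 0" | "i = j" "r = s" "m = M" | "i = j" "r = s" "m < M" | "i = j" "r = opp s"
      using Mmax[of m] kr k pm_cases[of r s] by (cases "c k = 0"; cases "i = j"; force)
    thus ?thesis
    proof cases
      case 1
      thus ?thesis using M(2) unfolding a L_def by (auto simp: kr)
    next
      case 2
      show ?thesis using tendsto_mult[OF tendsto_const[of "- c k"] gf_lim_shift[of s M i]] 2
        unfolding a L_def by (simp add: kr)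
    next
      case 3
      define d where "d = M - Suc m"
      have M': "Suc M = Suc d + Suc m" using 3 by (simp add: d_def)
      have "((\<lambda>z. - c k * ((z - \<nu> s) ^ Suc d * ((z - \<nu> s) ^ Suc m * gf m i (z - \<nu> s)))) \<longlongrightarrow> - c k * (0 * (\<i> * kap / 2) ^ Suc m)) (at (\<nu> s))"
        by (intro tendsto_mult tendsto_const p gf_lim_shift)
      moreover have "a k = (\<lambda>z. - c k * ((z - \<nu> s) ^ Suc d * ((z - \<nu> s) ^ Suc m * gf m i (z - \<nu> s))))"
        unfolding a[abs_def] M' power_add using 3 by (simp add: mult_ac)
      ultimately show ?thesis using 3 by (simp add: L_def kr)
    next
      case 4
      have "isCont (\<lambda>z. gf m j (z - \<nu> (opp s))) (\<nu> s)" by (rule analytic_at_imp_isCont[OF gf_analytic_opp])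
      hence g: "((\<lambda>z. gf m j (z - \<nu> (opp s))) \<longlongrightarrow> gf m j (\<nu> s - \<nu> (opp s))) (at (\<nu> s))" by (simp add: isCont_def)
      have "((\<lambda>z. - c k * ((z - \<nu> s) ^ Suc M * gf m j (z - \<nu> (opp s)))) \<longlongrightarrow> - c k * (0 * gf m j (\<nu> s - \<nu> (opp s)))) (at (\<nu> s))"
        by (intro tendsto_mult tendsto_const p g)
      moreover have "opp s \<noteq> s" by (cases s) auto
      ultimately show ?thesis using 4 unfolding a L_def by (simp add: kr)
    qed
  qed
  have "((\<lambda>z. \<Sum>k\<in>set ks. a k z) \<longlongrightarrow> (\<Sum>k\<in>set ks. L k)) (at (\<nu> s))" by (intro tendsto_sum lim)
  moreover have "eventually (\<lambda>z. (\<Sum>k\<in>set ks. a k z) = 0) (at (\<nu> s))"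
    using eventually_not_in_sparse[OF polar_sparse[OF DU_polar]]
  proof eventually_elim
    case (elim z)
    have "(\<Sum>k\<in>set ks. a k z) = (z - \<nu> s) ^ Suc M * (\<Sum>k\<leftarrow>ks. c k * coord (dual i) (ev (gen z) (et k)))"
      by (simp add: a_def sum_list_distinct_conv_sum_set[OF assms(1)] sum_distrib_left del: power_Suc)
    also have "(\<Sum>k\<leftarrow>ks. c k * coord (dual i) (ev (gen z) (et k))) = coord (dual i) (ev (gen z) (lin_term c et ks))"
      by (simp add: ev_lin_term coord_sum_list coord_smult)
    also have "\<dots> = 0" using z[OF elim] by (cases "dual i") simp_all
    finally show ?case by simp
  qed
  ultimately have "((\<lambda>z. 0) \<longlongrightarrow> (\<Sum>k\<in>set ks. L k)) (at (\<nu> s))" using tendsto_cong by fastforce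
  hence "(\<Sum>k\<in>set ks. L k) = 0" using tendsto_unique[OF _ _ tendsto_const] by force
  moreover have "(\<Sum>k\<in>set ks. L k) = - (c (s, M, i) * (\<i> * kap / 2) ^ Suc M)"
    unfolding L_def using M(1) by (simp add: sum.delta)
  ultimately show False using M(2) by simp
qed

text \<open>The pole at \<open>\<nu> Plus\<close> is removed, then the one at
  \<open>\<nu> Minus\<close>; the second correction is analytic at \<open>\<nu> Plus\<close> and
  does not restore the pole. The remainder vanishes by its nontrivial sign.\<close>

lemma ell_expansion:
  assumes h: "ell DU (chi1 (dual i)) (chi2 (dual i)) h"
  shows "\<exists>t. \<forall>z. z \<notin> DU \<longrightarrow> ev (gen z) t = smult_mat (h z) (uvec i)"
proof -
  \<comment> \<open>The index is shifted to agree with the pole order.\<close>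
  define g where "g = (\<lambda>s n z. gf (n - 1) i (z - \<nu> s))"
  have g_ell: "ell DU (chi1 (dual i)) (chi2 (dual i)) (g s n)" for s n
    unfolding g_def by (rule gf_ell_shift)
  have g_lim: "\<exists>d. d \<noteq> 0 \<and> ((\<lambda>z. (z - \<nu> s) ^ n * g s n z) \<longlongrightarrow> d) (at (\<nu> s))" if "0 < n" for s n
    using gf_lim_shift[of s "n - 1" i] that by (intro exI[of _ "(\<i> * kap / 2) ^ n"]) (simp add: g_def)
  have red: "\<exists>m c. pole_le 0 (\<nu> s) (\<lambda>z. f z - (\<Sum>n\<in>{0<..m}. c n * g s n z))"
    if f: "ell DU (chi1 (dual i)) (chi2 (dual i)) f" for f s
  proof -
    obtain m where m: "pole_le m (\<nu> s) f" using meromorphic_pole_le[OF ell_mero[OF f]] .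
    show ?thesis
      using pole_reduction[of f "\<nu> s" 0 m "g s", OF ell_mero[OF f] _ ell_mero[OF g_ell] g_lim] m by auto
  qed
  have S: "ell DU (chi1 (dual i)) (chi2 (dual i)) (\<lambda>z. \<Sum>n\<in>{0<..m}. c n * g s n z)" for m c s
    by (intro ell_sum ell_cmult g_ell)
  obtain m1 c1 where 1: "pole_le 0 (\<nu> Plus) (\<lambda>z. h z - (\<Sum>n\<in>{0<..m1}. c1 n * g Plus n z))" using red[OF h] by blast
  define h1 where "h1 = (\<lambda>z. h z - (\<Sum>n\<in>{0<..m1}. c1 n * g Plus n z))"
  have h1: "ell DU (chi1 (dual i)) (chi2 (dual i)) h1" unfolding h1_def by (intro ell_diff h S)
  obtain m2 c2 where 2: "pole_le 0 (\<nu> Minus) (\<lambda>z. h1 z - (\<Sum>n\<in>{0<..m2}. c2 n * g Minus n z))" using red[OF h1] by blast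
  define r where "r = (\<lambda>z. h1 z - (\<Sum>n\<in>{0<..m2}. c2 n * g Minus n z))"
  have r: "ell DU (chi1 (dual i)) (chi2 (dual i)) r" unfolding r_def by (intro ell_diff h1 S)
  have "pole_le 0 (\<nu> Plus) (\<lambda>z. \<Sum>n\<in>{0<..m2}. c2 n * g Minus n z)"
    using gf_analytic_opp[of _ i Plus]
    by (intro pole_le_sum pole_le_cmult pole_le_analytic) (simp add: g_def)
  hence p: "pole_le 0 a r" if "a \<in> {\<nu> Plus, \<nu> Minus}" for a
    using that 1 2 pole_le_diff[of 0 "\<nu> Plus" h1] by (auto simp: r_def h1_def)
  have r0: "r z = 0" if "z \<notin> DU" for z
  proof (rule ell_Liouville_0[OF r DU_polar _ _ _ chi_nontrivial that])
    show "pole_le 0 a r" if "a \<in> DU" for a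
      by (rule ell_pole_le_pts[OF r DU_polar _ _ _ p]) (use that in \<open>auto simp: DU_def\<close>)
  qed simp_all
  define T where "T = (\<lambda>s m c. lin_term (\<lambda>n. c n) (\<lambda>n. eterm s (n - 1) i) [1..<Suc m])"
  have T: "ev (gen z) (T s m c) = smult_mat (\<Sum>n\<in>{0<..m}. c n * g s n z) (uvec i)" for s m c z
  proof -
    have upt: "set [1..<Suc m] = {0<..m}" by auto
    have "(\<Sum>k\<leftarrow>ks. smult_mat (a k) (uvec i)) = smult_mat (\<Sum>k\<leftarrow>ks. a k) (uvec i)" for a and ks :: "nat list"
      by (induction ks) (simp_all add: smult_zero smult_add)
    thus ?thesis
      using sum_list_distinct_conv_sum_set[of "[1..<Suc m]" "\<lambda>n. c n * g s n z"] upt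
      by (simp add: T_def ev_lin_term ev_eterm smult_smult g_def del: upt_Suc set_upt)
  qed
  have "ev (gen z) (TAdd (T Plus m1 c1) (T Minus m2 c2)) = smult_mat (h z) (uvec i)" if "z \<notin> DU" for z
    using r0[OF that] by (simp add: T smult_add r_def h1_def algebra_simps)
  thus ?thesis by blast
qed

lemma Ev_surj:
  assumes X: "X \<in> equi_algebra DU"
  shows "\<exists>t. Ev t = X"
proof -
  have e: "equivariant DU X" using X by (simp add: equi_algebra_def)
  \<comment> \<open>The factor -1 compensates the sign in \<open>uvec\<close>.\<close>
  have "\<exists>t. \<forall>z. z \<notin> DU \<longrightarrow> ev (gen z) t = smult_mat (- 1 * coord (dual i) (X z)) (uvec i)" for i
    by (rule ell_expansion, rule ell_cmult, rule equivariant_coord[OF e])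
  then obtain t where t: "\<And>i z. z \<notin> DU \<Longrightarrow> ev (gen z) (t i) = smult_mat (- 1 * coord (dual i) (X z)) (uvec i)"
    by metis
  define u where "u = TAdd (t I1) (TAdd (t I2) (t I3))"
  have "ev (gen z) u = X z" if z: "z \<notin> DU" for z
  proof (rule cmat_eqI_coord)
    fix j
    obtain i where j: "j = dual i" using dual_dual[of j] by metis
    show "coord j (ev (gen z) u) = coord j (X z)"
      unfolding j by (cases i) (simp_all only: u_def ev.simps coord_add t[OF z] coord_smult coord_uvec, simp_all)
  next
    show "trace (X z) = 0" by (rule equivariant_trace[OF e z])
    show "trace (ev (gen z) u) = 0" by (rule equivariant_trace[OF ev_gen_equivariant z])
  qed
  hence "Ev u = X" by (intro equi_algebra_eqI[OF Ev_in X DU_polar]) (simp add: Ev_off)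
  thus ?thesis by blast
qed

text \<open>By \<open>nf\<close> the difference of two terms with equal image is congruent to a
  combination of iterated brackets. Their images are independent, so all coefficients vanish and the
  terms are congruent.\<close>

theorem uglov_realisation:
  assumes nf: "\<And>t. \<exists>c ks. distinct ks \<and> lie_cong rels t (lin_term c et ks)"
  shows "lie_isomorphic (mero_lie (equi_algebra DU)) (presented_lie rels)"
proof (rule lie_isomorphic_presentedI[OF equi_complex_lie_algebra[OF DU_polar]])
  have in_L: "lie_carrier (mero_lie (equi_algebra DU)) = equi_algebra DU" by (simp add: EL_simps)
  show "range Ev = lie_carrier (mero_lie (equi_algebra DU))"
    unfolding in_L using Ev_in Ev_surj by (auto simp: image_iff) metis
  have ev_eq: "ev (gen z) s = ev (gen z) t" if "lie_cong rels s t" "z \<notin> DU" for s t z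
    by (rule ev_cong[OF that(1)]) (rule gen_rels[OF _ that(2)])
  show "Ev s = Ev t \<longleftrightarrow> lie_cong rels s t" for s t
  proof
    assume "lie_cong rels s t"
    thus "Ev s = Ev t" by (intro equi_algebra_eqI[OF Ev_in Ev_in DU_polar]) (simp add: Ev_off ev_eq)
  next
    assume st: "Ev s = Ev t"
    obtain c ks where ck: "distinct ks" "lie_cong rels (TDiff s t) (lin_term c et ks)" using nf by blast
    have "ev (gen z) (lin_term c et ks) = 0" if "z \<notin> DU" for z
    proof -
      have "ev (gen z) s = ev (gen z) t" using st Ev_off[OF that] by metis
      hence "ev (gen z) (TDiff s t) = 0" by (simp add: vec_eq_iff)
      thus ?thesis using ev_eq[OF ck(2) that] by simp
    qed
    hence "lie_cong rels (lin_term c et ks) TZero"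
      by (intro lin_term_0 lin_term_independent[OF ck(1)]) auto
    thus "lie_cong rels s t" using lie_cong_diff_0 lie_cong.trans[OF ck(2)] by blast
  qed
  note eqI = equi_algebra_eqI[OF Ev_in _ DU_polar]
  show "Ev (TAdd s t) = lie_add (mero_lie (equi_algebra DU)) (Ev s) (Ev t)" for s t
    by (rule eqI[OF E_closed(1)[OF DU_polar Ev_in Ev_in]]) (simp add: E_off(1)[OF DU_polar _ Ev_in Ev_in] Ev_off)
  show "Ev (TSmul a s) = lie_smul (mero_lie (equi_algebra DU)) a (Ev s)" for a s
    by (rule eqI[OF E_closed(2)[OF DU_polar Ev_in Ev_in]]) (simp add: E_off(2)[OF DU_polar _ Ev_in] Ev_off)
  show "Ev (TBr s t) = lie_br (mero_lie (equi_algebra DU)) (Ev s) (Ev t)" for s t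
    by (rule eqI[OF E_closed(3)[OF DU_polar Ev_in Ev_in]]) (simp add: E_off(3)[OF DU_polar _ Ev_in Ev_in] Ev_off)
qed

end

section \<open>The square torus\<close>

context torus
begin

context
  assumes tau_i: "\<tau> = \<i>"
begin

lemma H_i: "\<i> * z \<in> H \<longleftrightarrow> z \<in> H"
proof -
  have 1: "\<i> * z \<in> H" if zH: "z \<in> H" for z
  proof -
    obtain m n :: int where "z = (of_int m + of_int n * \<tau>) / 2" using zH unfolding H_iff by blast
    hence "\<i> * z = (of_int (- n) + of_int m * \<tau>) / 2" by (simp add: tau_i algebra_simps)
    thus ?thesis unfolding H_iff by blast
  qed
  show ?thesis using 1[of z] 1[of "\<i> * z"] H_uminus[of z] by auto
qed

text \<open>Multiplication by \<open>\<i>\<close> permutes the lattice and turns each square in the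
  series into its negative.\<close>

lemma wp_i: "wp (\<i> * z) = - wp z"
proof -
  have b: "bij_betw (\<lambda>w. \<i> * w) (H - {0}) (H - {0})"
  proof (rule bij_betwI[where g = "\<lambda>w. - \<i> * w"])
    show "(\<lambda>w. - \<i> * w) \<in> H - {0} \<rightarrow> H - {0}"
      using H_i[of "- \<i> * _"] by (auto simp: H_i)
  qed (auto simp: H_i)
  have "(\<Sum>\<^sub>\<infinity>w\<in>H - {0}. 1 / (\<i> * z - w) ^ 2 - 1 / w ^ 2) = (\<Sum>\<^sub>\<infinity>w\<in>H - {0}. 1 / (\<i> * z - \<i> * w) ^ 2 - 1 / (\<i> * w) ^ 2)"
    using infsum_reindex_bij_betw[OF b, of "\<lambda>w. 1 / (\<i> * z - w) ^ 2 - 1 / w ^ 2"] by simp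
  also have "\<dots> = (\<Sum>\<^sub>\<infinity>w\<in>H - {0}. - (1 / (z - w) ^ 2 - 1 / w ^ 2))"
    by (simp add: power_mult_distrib flip: right_diff_distrib)
  also have "\<dots> = - (\<Sum>\<^sub>\<infinity>w\<in>H - {0}. 1 / (z - w) ^ 2 - 1 / w ^ 2)" by (rule infsum_uminus)
  finally show ?thesis by (simp add: weierstrass_p_def power_mult_distrib)
qed

text \<open>Multiplication by \<open>\<i>\<close> moves the point by \<open>- 1/2\<close>, a period
  of \<open>wp\<close>, and so its value equals its own negative.\<close>

lemma wp_quarter: "wp ((1 + \<i>) / 4) = 0"
proof -
  define q where "q = (1 + \<i>) / 4"
  have "\<i> * q = q + (- (1/2))" by (simp add: q_def field_simps)
  hence "- wp q = wp (q + (- (1/2)))" using wp_i[of q] by simp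
  also have "\<dots> = wp q" using half_H H_uminus by (intro wp_period) blast
  finally show ?thesis by (simp add: q_def)
qed

text \<open>Multiplication by \<open>\<i>\<close> exchanges the translations by \<open>1/2\<close>
  and \<open>\<tau>/2\<close>, hence the two signs, and the outer factor \<open>\<i>\<close>
  restores the residue 1/2. The sides then differ by a function without poles and with a nontrivial
  sign.\<close>

lemma mu_i:
  assumes chi: "chi1 k = chi2 j" "chi2 k = chi1 j" and z: "z \<notin> H"
  shows "\<i> * mu \<tau> j (\<i> * z) = mu \<tau> k z"
proof -
  define g where "g = (\<lambda>z. \<i> * mu \<tau> j (\<i> * z) - mu \<tau> k z)"
  have "ell H (chi1 k) (chi2 k) (\<lambda>z. mu \<tau> j (\<i> * z))"
    unfolding ell_def
  proof (intro conjI allI impI)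
    show "(\<lambda>z. mu \<tau> j (\<i> * z)) meromorphic_on UNIV"
      by (rule meromorphic_on_compose[of "mu \<tau> j" UNIV "\<lambda>z. \<i> * z"]) (auto intro!: analytic_intros ell_mero[OF mu_ell])
    have img: "(\<lambda>z. \<i> * z) ` (- H) \<subseteq> - H" by (auto simp: H_i)
    have "mu \<tau> j holomorphic_on - H" using mu_ell by (simp add: ell_def)
    thus "(\<lambda>z. mu \<tau> j (\<i> * z)) holomorphic_on - H"
      using holomorphic_on_compose_gen[of "\<lambda>z. \<i> * z" "- H" "mu \<tau> j" "- H"] img
      by (auto simp: o_def intro!: holomorphic_intros)
    fix z assume z: "z \<notin> H"
    show "mu \<tau> j (\<i> * (z + 1/2)) = chi1 k * mu \<tau> j (\<i> * z)"
    proof -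
      have "\<i> * (z + 1/2) = \<i> * z + \<tau>/2" by (simp add: tau_i algebra_simps)
      moreover have "\<i> * z \<notin> H" using z H_i[of z] by blast
      ultimately show ?thesis using ell_tau[OF mu_ell, of "\<i> * z" j] by (simp add: chi)
    qed
    have w: "\<i> * (z + \<tau>/2) + 1/2 = \<i> * z" by (simp add: tau_i algebra_simps)
    have "\<i> * (z + \<tau>/2) \<notin> H" using z H_add_iff[OF tau_H] by (simp add: H_i)
    from ell_half[OF mu_ell this, of j] have "mu \<tau> j (\<i> * z) = chi1 j * mu \<tau> j (\<i> * (z + \<tau>/2))" unfolding w .
    thus "mu \<tau> j (\<i> * (z + \<tau>/2)) = chi2 k * mu \<tau> j (\<i> * z)"
      using chi_sq(1)[of j] by (simp add: chi flip: mult.assoc)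
  qed
  hence g: "ell H (chi1 k) (chi2 k) g" unfolding g_def by (intro ell_diff ell_cmult mu_ell)
  have "((\<lambda>w. (\<i> * w) * mu \<tau> j (\<i> * w)) \<longlongrightarrow> 1/2) (at 0)"
  proof (rule filterlim_compose[OF mu_lim[of j]])
    show "filterlim (\<lambda>w. \<i> * w) (at 0) (at 0)"
    proof (rule filterlim_atI)
      have "((\<lambda>w. \<i> * w) \<longlongrightarrow> \<i> * 0) (at 0)" by (intro tendsto_intros)
      thus "((\<lambda>w. \<i> * w) \<longlongrightarrow> 0) (at 0)" by simp
    qed (auto simp: eventually_at_filter)
  qed
  from tendsto_diff[OF this mu_lim[of k]] have "((\<lambda>z. (z - 0) ^ Suc 0 * g z) \<longlongrightarrow> 0) (at 0)"
    by (simp add: g_def algebra_simps)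
  hence p: "pole_le 0 0 g" by (rule pole_le_reduce[OF ell_mero[OF g]])
  have "g z = 0"
  proof (rule ell_Liouville_0[OF g polar_H _ _ _ chi_nontrivial z])
    show "pole_le 0 a g" if "a \<in> H" for a
      by (rule ell_pole_le_pts[OF g polar_H, of a "{0}"]) (use that p in \<open>auto simp flip: H_eq_pts\<close>)
  qed simp_all
  thus ?thesis by (simp add: g_def)
qed

text \<open>Comparing the curve equations at \<open>w\<close> and \<open>\<i> * w\<close> gives
  equal fourth powers of theta2 and theta4 at 0, and the quartic identity then gives
  \<open>k^2 = 1/2\<close>. The root is the positive one because theta2 and theta3 at 0 are real for
  \<open>\<tau> = \<i>\<close>, so that \<open>k\<close> is a quotient of squares of reals.\<close>

lemma modulus_i: "jacobi_modulus \<tau> = 1 / of_real (sqrt 2)"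
proof -
  define a b c where "a = theta3 0 \<tau>" and "b = theta4 0 \<tau>" and "c = theta2 0 \<tau>"
  have nz: "a \<noteq> 0" "b \<noteq> 0" "c \<noteq> 0" by (simp_all add: a_def b_def c_def)
  define w :: complex where "w = 1/4"
  have w: "w \<notin> H" "\<i> * w \<notin> H" using quarter_notin_H(1) H_i[of w] unfolding w_def by blast+
  have "mu \<tau> I3 w ^ 2 = - (mu \<tau> I1 (\<i> * w) ^ 2)" "mu \<tau> I2 w ^ 2 = - (mu \<tau> I2 (\<i> * w) ^ 2)"
    using mu_i[of I3 I1 w, symmetric] mu_i[of I2 I2 w, symmetric] w by (simp_all add: power_mult_distrib)
  hence "(D1 * c / (a * b)) ^ 2 = (D1 * b / (c * a)) ^ 2"
    using mu_sq_diff(1)[OF w(1)] mu_sq_diff(2)[OF w(2)] unfolding a_def b_def c_def by simp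
  hence bc: "b ^ 4 = c ^ 4"
    using nz by (simp add: power_divide power_mult_distrib field_simps)
  have "a ^ 4 = 2 * c ^ 4" using theta_quartic bc by (simp add: a_def b_def c_def)
  have k2: "jacobi_modulus \<tau> ^ 2 = 1 / 2"
    using nz \<open>a ^ 4 = 2 * c ^ 4\<close> by (simp add: jacobi_modulus_def power_divide flip: power_mult a_def c_def)
  have real: "cnj (theta t 0 0 \<tau>) = theta t 0 0 \<tau>" for t
    unfolding theta_def infsum_cnj[symmetric]
    by (intro infsum_cong) (simp add: tau_i exp_cnj)
  have "a \<in> \<real>" "c \<in> \<real>"
    using real[of 0] real[of "1/2"] by (simp_all add: a_def c_def theta3_def theta2_def Reals_cnj_iff)
  then obtain x y where xy: "a = of_real x" "c = of_real y" by (auto elim!: Reals_cases)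
  define r where "r = y ^ 2 / x ^ 2"
  have k: "jacobi_modulus \<tau> = of_real r" by (simp add: jacobi_modulus_def r_def xy flip: a_def c_def)
  have "complex_of_real (r ^ 2) = of_real (1 / 2)" using k2 unfolding k by simp
  hence "r ^ 2 = 1 / 2" unfolding of_real_eq_iff .
  moreover have "r \<ge> 0" by (simp add: r_def)
  ultimately have "r = sqrt (1 / 2)" by (metis real_sqrt_unique)
  thus ?thesis by (simp add: k real_sqrt_divide)
qed

end

end

section \<open>Normal forms of Lie terms\<close>

definition square_nu :: "pm \<Rightarrow> complex" where
  "square_nu s = (case s of Plus \<Rightarrow> 0 | Minus \<Rightarrow> (1 + \<i>) / 4)"

abbreviation "square_rels \<equiv> uglov_rels \<i> square_nu"

\<comment> \<open>Classes of terms as a type, so that spans and the results on elliptic pairs apply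
  to them. A type cannot depend on \<open>\<tau>\<close> and \<open>\<nu>\<close>, so both are fixed
  here.\<close>
quotient_type uq = "(pm \<times> idx) lie_term" / "lie_cong square_rels"
  by (rule equivpI)
     (auto simp: reflp_def symp_def transp_def intro: lie_cong.refl lie_cong.sym lie_cong.trans)

instantiation uq :: ab_group_add
begin

lift_definition zero_uq :: uq is TZero .
lift_definition plus_uq :: "uq \<Rightarrow> uq \<Rightarrow> uq" is TAdd by (rule lie_cong.cong_add)
lift_definition uminus_uq :: "uq \<Rightarrow> uq" is "TSmul (- 1)" by (rule lie_cong.cong_smul)
definition minus_uq :: "uq \<Rightarrow> uq \<Rightarrow> uq" where "minus_uq x y = x + - y"

instance
proof
  show "a + b + c = a + (b + c)" for a b c :: uq by transfer (rule lie_cong.add_assoc)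
  show comm: "a + b = b + a" for a b :: uq by transfer (rule lie_cong.add_commute)
  show "0 + a = a" for a :: uq by transfer (rule lie_cong.add_zero)
  have "a + - a = 0" for a :: uq by transfer (rule lie_cong.add_inverse)
  thus "- a + a = 0" for a :: uq using comm[of a "- a"] by simp
qed (simp add: minus_uq_def)

end

lift_definition sc_uq :: "complex \<Rightarrow> uq \<Rightarrow> uq" is TSmul by (rule lie_cong.cong_smul)
lift_definition br_uq :: "uq \<Rightarrow> uq \<Rightarrow> uq" is TBr by (rule lie_cong.cong_br)

interpretation uq: clie sc_uq br_uq
proof
  show "sc_uq a (x + y) = sc_uq a x + sc_uq a y" for a x y by transfer (rule lie_cong.smul_add)
  show "sc_uq (a + b) x = sc_uq a x + sc_uq b x" for a b x by transfer (rule lie_cong.add_smul)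
  show "sc_uq a (sc_uq b x) = sc_uq (a * b) x" for a b x by transfer (rule lie_cong.sym[OF lie_cong.smul_smul])
  show "sc_uq 1 x = x" for x by transfer (rule lie_cong.one_smul)
  show "br_uq (x + y) z = br_uq x z + br_uq y z" for x y z by transfer (rule lie_cong.br_add_left)
  show "br_uq x (y + z) = br_uq x y + br_uq x z" for x y z by transfer (rule lie_cong.br_add_right)
  show "br_uq (sc_uq a x) y = sc_uq a (br_uq x y)" for a x y by transfer (rule lie_cong.br_smul_left)
  show "br_uq x (sc_uq a y) = sc_uq a (br_uq x y)" for a x y by transfer (rule lie_cong.br_smul_right)
  show "br_uq x x = 0" for x by transfer (rule lie_cong.br_self)
  show "br_uq x (br_uq y z) + br_uq y (br_uq z x) + br_uq z (br_uq x y) = 0" for x y z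
    by transfer (rule lie_cong.jacobi)
qed

lemmas abs_uq_simps = zero_uq.abs_eq[symmetric] plus_uq.abs_eq[symmetric] sc_uq.abs_eq[symmetric] br_uq.abs_eq[symmetric]

lemma sc_uq_minus: "sc_uq (- 1) x = - x" by transfer (rule lie_cong.refl)

definition xq :: "pm \<Rightarrow> idx \<Rightarrow> uq" where "xq s i = abs_uq (Gen (s, i))"

lemma abs_uq_rel: "(s, t) \<in> square_rels \<Longrightarrow> abs_uq s = abs_uq t"
  by (simp add: uq.abs_eq_iff lie_cong.rel)

lemma xq_rels:
  "br_uq (xq s i) (br_uq (xq s (nx i)) (xq s (nx (nx i)))) = 0"
  "br_uq (xq s i) (br_uq (xq s i) (xq s (nx (nx i)))) - br_uq (xq s (nx i)) (br_uq (xq s (nx i)) (xq s (nx (nx i))))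
     = sc_uq (uglov_J (jacobi_modulus \<i>) i (nx i)) (xq s (nx (nx i)))"
  "br_uq (xq Plus i) (xq Minus i) = 0"
  "br_uq (xq s i) (xq (opp s) (nx i)) = sc_uq \<i> (sc_uq (uglov_w \<i> i (square_nu (opp s) - square_nu s)) (xq (opp s) (nx (nx i)))
     - sc_uq (uglov_w \<i> (nx i) (square_nu (opp s) - square_nu s)) (xq s (nx (nx i))))"
proof -
  note simps = xq_def abs_uq_simps sc_uq_minus
  have "abs_uq (TBr (uglov_x s i) (TBr (uglov_x s (nx i)) (uglov_x s (nx (nx i))))) = abs_uq TZero"
    by (rule abs_uq_rel) (unfold uglov_rels_def cyclic_nx, blast)
  thus "br_uq (xq s i) (br_uq (xq s (nx i)) (xq s (nx (nx i)))) = 0" by (simp add: simps)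
  have "abs_uq (TDiff (TBr (uglov_x s i) (TBr (uglov_x s i) (uglov_x s (nx (nx i)))))
             (TBr (uglov_x s (nx i)) (TBr (uglov_x s (nx i)) (uglov_x s (nx (nx i)))))) =
      abs_uq (TSmul (uglov_J (jacobi_modulus \<i>) i (nx i)) (uglov_x s (nx (nx i))))"
    by (rule abs_uq_rel) (unfold uglov_rels_def cyclic_nx, blast)
  thus "br_uq (xq s i) (br_uq (xq s i) (xq s (nx (nx i)))) - br_uq (xq s (nx i)) (br_uq (xq s (nx i)) (xq s (nx (nx i))))
     = sc_uq (uglov_J (jacobi_modulus \<i>) i (nx i)) (xq s (nx (nx i)))" by (simp add: simps)
  have "abs_uq (TBr (uglov_x Plus i) (uglov_x Minus i)) = abs_uq TZero"
    by (rule abs_uq_rel) (unfold uglov_rels_def cyclic_nx, blast)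
  thus "br_uq (xq Plus i) (xq Minus i) = 0" by (simp add: simps)
  have "abs_uq (TBr (uglov_x s i) (uglov_x (opp s) (nx i))) =
      abs_uq (TSmul \<i> (TDiff (TSmul (uglov_w \<i> i (square_nu (opp s) - square_nu s)) (uglov_x (opp s) (nx (nx i))))
                      (TSmul (uglov_w \<i> (nx i) (square_nu (opp s) - square_nu s)) (uglov_x s (nx (nx i))))))"
    by (rule abs_uq_rel) (unfold uglov_rels_def cyclic_nx, blast)
  thus "br_uq (xq s i) (xq (opp s) (nx i)) = sc_uq \<i> (sc_uq (uglov_w \<i> i (square_nu (opp s) - square_nu s)) (xq (opp s) (nx (nx i)))
     - sc_uq (uglov_w \<i> (nx i) (square_nu (opp s) - square_nu s)) (xq s (nx (nx i))))" by (simp add: simps)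
qed

interpretation uq: elliptic_pair sc_uq br_uq xq "\<lambda>i. uglov_J (jacobi_modulus \<i>) i (nx i)"
proof (rule elliptic_pair.intro[OF uq.clie_axioms elliptic_pair_axioms.intro])
  fix s
  show "elliptic_triple sc_uq br_uq (xq s) (\<lambda>i. uglov_J (jacobi_modulus \<i>) i (nx i))"
    by unfold_locales (rule xq_rels)+
next
  fix s i j
  let ?V = "uq.span {xq s k | s k. True}"
  have x: "xq r k \<in> ?V" for r k by (rule uq.span_base) blast
  have c: "br_uq (xq r k) (xq (opp r) (nx k)) \<in> ?V" for r k
    unfolding xq_rels by (intro uq.span_scale uq.span_diff x)
  consider "j = i" | "j = nx i" | "j = nx (nx i)" using nx_cases by blast
  thus "br_uq (xq s i) (xq (opp s) j) \<in> ?V"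
  proof cases
    case 1
    have "br_uq (xq s i) (xq (opp s) i) = 0"
      using xq_rels(3)[of i] uq.br_anti[of "xq Minus i" "xq Plus i"] by (cases s) simp_all
    thus ?thesis using 1 by (simp add: uq.span_zero)
  next
    \<comment> \<open>Here \<open>i\<close> is the successor of \<open>j\<close>, so the cross
      relation applies with the signs exchanged.\<close>
    case 3
    have "opp (opp s) = s" by (cases s) auto
    hence "br_uq (xq (opp s) j) (xq s i) \<in> ?V" using c[of "opp s" j] 3 by simp
    thus ?thesis using uq.br_anti[of "xq s i"] uq.span_neg by metis
  qed (use c in simp)
qed

text \<open>\<open>U\<close> contains the generators and is a subalgebra, so it is everything: this
  is the spanning half of the basis statement.\<close>

lemma abs_uq_U: "abs_uq t \<in> uq.U"
proof (induction t)
  case (Gen si)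
  have "abs_uq (Gen si) = xq (fst si) (snd si)" by (simp add: xq_def)
  thus ?case using uq.x_U by simp
qed (simp_all add: abs_uq_simps uq.br_U uq.subspace_0[OF uq.U_sub] uq.subspace_add[OF uq.U_sub] uq.subspace_scale[OF uq.U_sub])

lemma (in vector_space) span_range:
  assumes "y \<in> span (range e)"
  shows "\<exists>c ks. distinct ks \<and> y = (\<Sum>k\<leftarrow>ks. scale (c k) (e k))"
  using assms
proof (induction rule: span_induct_alt)
  case base
  show ?case by (intro exI[of _ "[]"] exI) simp
next
  case (step a s y)
  then obtain c ks k where ks: "distinct ks" "y = (\<Sum>k\<leftarrow>ks. scale (c k) (e k))" and k: "s = e k" by blast
  \<comment> \<open>The index \<open>k\<close> may already occur in \<open>ks\<close>; its
    coefficient is then increased, so that the list stays distinct.\<close>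
  define c' where "c' = (\<lambda>j. (if j \<in> set ks then c j else 0) + (if j = k then a else 0))"
  define ls where "ls = (if k \<in> set ks then ks else k # ks)"
  have ls: "distinct ls" "set ls = insert k (set ks)" using ks(1) by (auto simp: ls_def)
  have "(\<Sum>j\<leftarrow>ls. scale (c' j) (e j)) = (\<Sum>j\<in>insert k (set ks). scale (c' j) (e j))"
    using ls by (simp add: sum_list_distinct_conv_sum_set)
  also have "\<dots> = (\<Sum>j\<in>insert k (set ks). scale (if j \<in> set ks then c j else 0) (e j)) + (\<Sum>j\<in>insert k (set ks). if j = k then scale a (e k) else 0)"
    unfolding sum.distrib[symmetric] by (intro sum.cong) (auto simp: c'_def scale_left_distrib)
  also have "(\<Sum>j\<in>insert k (set ks). if j = k then scale a (e k) else 0) = scale a s" by (simp add: k)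
  also have "(\<Sum>j\<in>insert k (set ks). scale (if j \<in> set ks then c j else 0) (e j)) = (\<Sum>j\<in>set ks. scale (c j) (e j))"
    by (rule sum.mono_neutral_cong_right) auto
  also have "\<dots> = y" using ks by (simp add: sum_list_distinct_conv_sum_set)
  finally show ?case using ls(1) by (metis add.commute)
qed

lemma uq_normal_form:
  "\<exists>c ks. distinct ks \<and> lie_cong square_rels t (lin_term c (\<lambda>(s, n, i). eterm s n i) ks)"
proof -
  let ?e = "\<lambda>(s, n, i). uq.ebr (xq s) n i"
  have e: "abs_uq ((\<lambda>(s, n, i). eterm s n i) k) = ?e k" for k
  proof -
    have "abs_uq (eterm s n i) = uq.ebr (xq s) n i" for s n i
      by (induction n arbitrary: i) (simp_all add: abs_uq_simps xq_def)
    thus ?thesis by (cases k) simp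
  qed
  have "{uq.ebr (xq s) n i | s n i. True} = range ?e" by (auto simp: image_iff; blast)
  hence "abs_uq t \<in> uq.span (range ?e)" using abs_uq_U[of t] by (simp add: uq.U_def)
  then obtain c ks where "distinct ks" "abs_uq t = (\<Sum>k\<leftarrow>ks. sc_uq (c k) (?e k))"
    using uq.span_range by blast
  moreover have "abs_uq (lin_term c (\<lambda>(s, n, i). eterm s n i) ks) = (\<Sum>k\<leftarrow>ks. sc_uq (c k) (?e k))" for c ks
    by (induction ks) (simp_all add: abs_uq_simps e)
  ultimately show ?thesis by (metis uq.abs_eq_iff)
qed

lemma holod_uglov_isomorphic: "lie_isomorphic (holod_algebra \<i>) (uglov_algebra \<i> 0 ((1 + \<i>) / 4))"
proof -
  interpret torus \<i> by unfold_locales simp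
  have z0: "(1 + \<i>) / 4 \<notin> H" using quarter_notin_H by simp
  interpret holod \<i> "(1 + \<i>) / 4" by unfold_locales (simp_all add: z0 wp_quarter)
  interpret uglov \<i> square_nu
    by unfold_locales (simp add: square_nu_def z0 del: minus_divide_left)
  \<comment> \<open>The points \<open>z0\<close> and \<open>- z0\<close> differ by
    \<open>(1 + \<i>)/2\<close>, an element of \<open>H\<close>.\<close>
  have "DD = DU"
  proof -
    have h: "(1 + \<i>) / 2 \<in> H" using H_add[OF half_H tau_H] by (simp add: add_divide_distrib)
    have "z + (1 + \<i>) / 4 \<in> H \<longleftrightarrow> z - (1 + \<i>) / 4 \<in> H" for z
      using H_add_iff[OF h, of "z - (1 + \<i>) / 4"] by (simp add: algebra_simps)
    thus ?thesis by (auto simp: in_DD DU_def in_pts square_nu_def)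
  qed
  thus ?thesis
    using uglov_realisation[OF uq_normal_form] unfolding holod_algebra_eq uglov_algebra_def square_nu_def by simp
qed

text \<open>The zero \<open>z0\<close> is arbitrary; by the first conjunct the set of punctures is
  determined by \<open>\<tau>\<close>. The third conjunct identifies the coefficient ring of the
  normal form with the ring of invariant functions.\<close>

theorem theorem3p7:
  fixes \<tau> z0 :: complex
  assumes "Im \<tau> > 0"
    and "2 * z0 \<notin> period_lattice \<tau>" and "weierstrass_p (period_lattice \<tau>) (2 * z0) = 0"
  shows
    "{z. 2 * z \<notin> period_lattice \<tau> \<and> weierstrass_p (period_lattice \<tau>) (2 * z) = 0}
       = D2_orbit \<tau> {z0, - z0} \<and>
     holod_algebra \<tau> = automorphic_lie \<tau> {0, - z0, z0} \<and>
     invariant_ring \<tau> {0, - z0, z0} = wp_ring (half_lattice \<tau>) \<and>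
     normal_form (wp_ring (half_lattice \<tau>)) (holod_algebra \<tau>)
       (Ad_Omega \<tau> sl2_h) (Ad_Omega \<tau> sl2_e) (Ad_Omega \<tau> sl2_f) \<and>
     jacobi_modulus \<i> = 1 / of_real (sqrt 2) \<and>
     lie_isomorphic (holod_algebra \<i>) (uglov_algebra \<i> 0 ((1 + \<i>) / 4))"
proof -
  interpret torus \<tau> by unfold_locales (rule assms(1))
  interpret holod \<tau> z0
    by unfold_locales (use assms(2,3) in \<open>simp_all add: H_iff_lattice wp_half_lattice\<close>)
  interpret sq: torus \<i> by unfold_locales simp
  show ?thesis
    using zero_set holod_normal_form sq.modulus_i holod_uglov_isomorphic
    by (simp add: holod_algebra_eq automorphic_lie_eq invariant_ring_eq wp_ring_eq flip: DD_def)
qed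

end
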